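(* Let $k\in\mathbb C$, $k\ne-3$, $k\notin\mathbb Z_{\ge0}$, and let $a,b\in\mathbb Z_{\ge0}$. Put $$x=\frac{b-a}{3},\qquad y=\frac{(b-a)^2-3(a+b)(2(k+1)-a-b)}{12(k+3)}-\frac{b-a}{6},\qquad m_1=\frac{a+2b}{3}.$$ Then: (1) $L_k^{\mathfrak{sl}_3}(a\omega_1+b\omega_2)= V^k(\mathfrak{sl}_3).\big(v[x,y]\otimes e^{m_1c_2}\big)\subset L[x,y]\otimes\mathcal S_0(m_1)$, i.e. the $V^k(\mathfrak{sl}_3)$-submodule generated by $v[x,y]\otimes e^{m_1c_2}$ is isomorphic to $L_k^{\mathfrak{sl}_3}(a\omega_1+b\omega_2)$. (2) $L_k^{\mathfrak{sl}_3}(a\omega_1+b\omega_2)=\big(L[x,y]\otimes\mathcal S\otimes\Pi(0)^{1/3}\big)^{\mathrm{int}_{\mathfrak{sl}_3}}$.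
   Context: $V^k(\mathfrak{sl}_3)$ is the universal affine vertex algebra of level $k$; $\omega_1,\omega_2$ are the fundamental weights of $\mathfrak{sl}_3$; $L_k^{\mathfrak{sl}_3}(\lambda)$ is the irreducible highest weight $\widehat{\mathfrak{sl}}_3$-module of level $k$ whose top component is the irreducible $\mathfrak{sl}_3$-module of highest weight $\lambda$. Notation: $e_1=e_{1,2}$, $e_2=e_{2,3}$, $e_3=e_{1,3}$, $h_1=e_{1,1}-e_{2,2}$, $h_2=e_{2,2}-e_{3,3}$, $f_1=e_{2,1}$, $f_2=e_{3,2}$, $f_3=e_{3,1}=[f_2,f_1]$. The universal Bershadsky-Polyakov algebra $\mathcal W^k$ ($k\neq-3$) is the vertex algebra freely and strongly generated by $J,G^\pm,L^{\rm BP}$ where $L^{\rm BP}$ is a Virasoro field of central charge $-\frac{(2k+3)(3k+1)}{k+3}$; $J$, $G^\pm$ are primary of weights $1$, $\frac32$; $J(z)J(w)\sim\frac{2k+3}{3(z-w)^2}$; $J(z)G^\pm(w)\sim\frac{\pm G^\pm(w)}{z-w}$; $G^\pm(z)G^\pm(w)\sim0$; and $$G^+(z)G^-(w)\sim\frac{(k+1)(2k+3)}{(z-w)^3}+\frac{3(k+1)J(w)}{(z-w)^2}+\frac{1}{z-w}\Big(3{:}J(w)^2{:}+\tfrac{3(k+1)}2\partial J(w)-(k+3)L^{\rm BP}(w)\Big).$$ Put $\widetilde L=L^{\rm BP}+\frac12\partial J$ and write $J(z)=\sum J(n)z^{-n-1}$, $\widetilde L(z)=\sum\widetilde L(n)z^{-n-2}$,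 $G^+(z)=\sum G^+(n)z^{-n-1}$, $G^-(z)=\sum G^-(n)z^{-n-2}$. $L[x,y]$ is the irreducible highest weight $\mathcal W^k$-module with highest weight vector $v[x,y]$: $J(0)v=xv$, $\widetilde L(0)v=yv$, $G^+(n+1)v=G^-(n)v=J(n+1)v=\widetilde L(n+1)v=0$ for $n\ge0$. $\mathcal S$ is the $\beta\gamma$ vertex algebra, $\beta(z)\gamma(w)\sim\frac1{z-w}$. $\Pi(0)=M(1)\otimes\mathbb C[\mathbb Zc_2]$ is generated by Heisenberg fields $c_2,d_2$ with $c_2(z)d_2(w)\sim\frac2{(z-w)^2}$, $c_2c_2\sim0\sim d_2d_2$, and $e^{\pm c_2}$. $\mathcal S_0(\lambda)=\mathcal S\otimes\Pi(0).e^{\lambda c_2}$ and $\Pi(0)^{1/3}=\Pi(0)\oplus\Pi(0).e^{c_2/3}\oplus\Pi(0).e^{2c_2/3}$. $V^k(\mathfrak{sl}_3)$ acts on $\mathcal W^k\otimes\mathcal S\otimes\Pi(0)$-modules via the embedding $V^k(\mathfrak{sl}_3)\hookrightarrow\mathcal W^k\otimes\mathcal S\otimes\Pi(0)$ (with $c=c_2,d=d_2$): $e_1\mapsto-\gamma e^{c}$, $e_2\mapsto\beta$, $e_3\mapsto e^c$, $h_1\mapsto-2J+{:}\gamma\beta{:}-\frac{2k+9}6c+\frac12d$, $h_2\mapsto J-2{:}\gamma\beta{:}+\frac{4k+9}6c+\frac12d$, $f_1\mapsto G^+-{:}(2J+\frac{8k+9}6c-\frac12d)\beta e^{-c}{:}+(k+1)(\partial\beta)e^{-c}$,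 $f_2\mapsto G^-e^{-c}+(J+\frac{4k+9}6c+\frac12d)\gamma+k\,\partial\gamma-{:}\gamma^2\beta{:}$, with $f_3$ determined by $f_3=[f_2,f_1]$. For a $V^k(\mathfrak{sl}_3)$-module $M$, $M^{\mathrm{int}_{\mathfrak{sl}_3}}$ denotes its $\mathfrak{sl}_3$-integrable part: the submodule of vectors $w$ such that $U(\mathfrak{sl}_3)w$ is finite-dimensional, $\mathfrak{sl}_3$ acting by zero modes. In $L[x,y]\otimes\mathcal S_0(m_1)$, $v[x,y]\otimes e^{m_1c_2}$ means $v[x,y]\otimes\mathbf 1\otimes e^{m_1c_2}$. *)

theory Defs
  imports "HOL-Analysis.Analysis" "HOL-Library.Poly_Mapping" "HOL-Library.Groups_Big_Fun"
begin

section \<open>Complex vector spaces\<close>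

class cvec = ab_group_add +
  fixes cscale :: "complex \<Rightarrow> 'a \<Rightarrow> 'a"  (infixr \<open>*\<^sub>C\<close> 75)
  assumes cscale_right_distrib: "z *\<^sub>C (u + w) = z *\<^sub>C u + z *\<^sub>C w"
    and cscale_left_distrib: "(z + z') *\<^sub>C u = z *\<^sub>C u + z' *\<^sub>C u"
    and cscale_cscale: "z *\<^sub>C (z' *\<^sub>C u) = (z * z') *\<^sub>C u"
    and cscale_one: "1 *\<^sub>C u = u"

global_interpretation cvec: vector_space "cscale :: complex \<Rightarrow> 'a \<Rightarrow> 'a::cvec"
  by unfold_locales
    (simp_all add: cscale_right_distrib cscale_left_distrib cscale_cscale cscale_one)

instantiation complex :: cvec
begin
definition cscale_complex :: "complex \<Rightarrow> complex \<Rightarrow> complex" where "cscale_complex z u = z * u"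
instance by standard (simp_all add: cscale_complex_def algebra_simps)
end

instantiation vec :: (cvec, finite) cvec
begin
definition cscale_vec :: "complex \<Rightarrow> ('a, 'b) vec \<Rightarrow> ('a, 'b) vec"
  where "cscale_vec z u = (\<chi> i. z *\<^sub>C (u $ i))"
instance
  by standard (simp_all add: cscale_vec_def vec_eq_iff cscale_right_distrib
      cscale_left_distrib cscale_cscale cscale_one)
end

instantiation poly_mapping :: (type, cvec) cvec
begin
definition cscale_poly_mapping :: "complex \<Rightarrow> ('a \<Rightarrow>\<^sub>0 'b) \<Rightarrow> ('a \<Rightarrow>\<^sub>0 'b)"
  where "cscale_poly_mapping z p = Poly_Mapping.map (cscale z) p"
lemma lookup_cscale: "Poly_Mapping.lookup (z *\<^sub>C (p :: 'a \<Rightarrow>\<^sub>0 'b)) i = z *\<^sub>C Poly_Mapping.lookup p i"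
  by (simp add: cscale_poly_mapping_def Poly_Mapping.map.rep_eq when_def)
instance
  by standard (rule poly_mapping_eqI, simp add: lookup_cscale lookup_add cscale_right_distrib
      cscale_left_distrib cscale_cscale cscale_one)+
end

definition clinear :: "('a::cvec \<Rightarrow> 'b::cvec) \<Rightarrow> bool"
  where "clinear f \<longleftrightarrow> Vector_Spaces.linear cscale cscale f"

definition cbilinear :: "('a::cvec \<Rightarrow> 'b::cvec \<Rightarrow> 'c::cvec) \<Rightarrow> bool"
  where "cbilinear f \<longleftrightarrow> (\<forall>u. clinear (f u)) \<and> (\<forall>w. clinear (\<lambda>u. f u w))"

lemma clinear_iff:
  "clinear f \<longleftrightarrow> (\<forall>u w. f (u + w) = f u + f w) \<and> (\<forall>z u. f (z *\<^sub>C u) = z *\<^sub>C f u)"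
  unfolding clinear_def Vector_Spaces.linear_iff
  by (simp only: cvec.vector_space_axioms simp_thms)


section \<open>Tensor products\<close>

text \<open>The quotient of the free complex vector space on the set of pairs by the bilinearity relations.\<close>

abbreviation free_pair :: "'a \<Rightarrow> 'b \<Rightarrow> ('a \<times> 'b \<Rightarrow>\<^sub>0 complex)"
  where "free_pair u w \<equiv> Poly_Mapping.single (u, w) 1"

definition tensor_relators :: "('a::cvec \<times> 'b::cvec \<Rightarrow>\<^sub>0 complex) set" where
  "tensor_relators =
     {free_pair (u + u') w - free_pair u w - free_pair u' w | u u' w. True} \<union>
     {free_pair u (w + w') - free_pair u w - free_pair u w' | u w w'. True} \<union>
     {free_pair (z *\<^sub>C u) w - z *\<^sub>C free_pair u w | z u w. True} \<union>
     {free_pair u (z *\<^sub>C w) - z *\<^sub>C free_pair u w | z u w. True}"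

definition tensor_rel :: "('a::cvec \<times> 'b::cvec \<Rightarrow>\<^sub>0 complex) \<Rightarrow> ('a \<times> 'b \<Rightarrow>\<^sub>0 complex) \<Rightarrow> bool"
  where "tensor_rel p q \<longleftrightarrow> p - q \<in> cvec.span tensor_relators"

lemma tensor_rel_equivp:
  "equivp (tensor_rel :: ('a::cvec \<times> 'b::cvec \<Rightarrow>\<^sub>0 complex) \<Rightarrow> _)" (is "equivp ?R")
proof (rule equivpI)
  show "reflp ?R" by (auto simp: reflp_def tensor_rel_def cvec.span_zero)
  show "symp ?R"
    by (rule sympI) (metis tensor_rel_def cvec.span_neg minus_diff_eq)
  show "transp ?R"
  proof (rule transpI)
    fix p q r :: "'a \<times> 'b \<Rightarrow>\<^sub>0 complex"
    assume "tensor_rel p q" "tensor_rel q r"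
    then have "(p - q) + (q - r) \<in> cvec.span tensor_relators"
      unfolding tensor_rel_def by (rule cvec.span_add)
    then show "tensor_rel p r" by (simp add: tensor_rel_def)
  qed
qed

quotient_type (overloaded) ('a, 'b) ctensor = "'a::cvec \<times> 'b::cvec \<Rightarrow>\<^sub>0 complex" / tensor_rel
  by (rule tensor_rel_equivp)

instantiation ctensor :: (cvec, cvec) cvec
begin
lift_definition zero_ctensor :: "('a, 'b) ctensor" is 0 .
lift_definition plus_ctensor :: "('a, 'b) ctensor \<Rightarrow> ('a, 'b) ctensor \<Rightarrow> ('a, 'b) ctensor" is "(+)"
  unfolding tensor_rel_def by (subst add_diff_add) (rule cvec.span_add)
lift_definition uminus_ctensor :: "('a, 'b) ctensor \<Rightarrow> ('a, 'b) ctensor" is uminus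
proof -
  fix p q :: "'a \<times> 'b \<Rightarrow>\<^sub>0 complex"
  assume "tensor_rel p q"
  then have "- (p - q) \<in> cvec.span tensor_relators"
    unfolding tensor_rel_def by (rule cvec.span_neg)
  then show "tensor_rel (- p) (- q)" by (simp add: tensor_rel_def)
qed
lift_definition minus_ctensor :: "('a, 'b) ctensor \<Rightarrow> ('a, 'b) ctensor \<Rightarrow> ('a, 'b) ctensor" is "(-)"
proof -
  fix p q r s :: "'a \<times> 'b \<Rightarrow>\<^sub>0 complex"
  assume "tensor_rel p q" "tensor_rel r s"
  then have "(p - q) - (r - s) \<in> cvec.span tensor_relators"
    unfolding tensor_rel_def by (rule cvec.span_diff)
  then show "tensor_rel (p - r) (q - s)" by (simp add: tensor_rel_def algebra_simps)
qed
lift_definition cscale_ctensor :: "complex \<Rightarrow> ('a, 'b) ctensor \<Rightarrow> ('a, 'b) ctensor" is cscale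
  unfolding tensor_rel_def cvec.scale_right_diff_distrib[symmetric] by (rule cvec.span_scale)
instance
proof
  fix p q r :: "('a, 'b) ctensor" and z z' :: complex
  have refl: "tensor_rel s t" if "s = t" for s t :: "'a \<times> 'b \<Rightarrow>\<^sub>0 complex"
    using that equivp_reflp[OF tensor_rel_equivp] by simp
  show "p + q + r = p + (q + r)" by transfer (rule refl, simp add: algebra_simps)
  show "p + q = q + p" by transfer (rule refl, simp add: algebra_simps)
  show "0 + p = p" by transfer (rule refl, simp)
  show "- p + p = 0" by transfer (rule refl, simp)
  show "p - q = p + - q" by transfer (rule refl, simp)
  show "z *\<^sub>C (p + q) = z *\<^sub>C p + z *\<^sub>C q" by transfer (rule refl, rule cscale_right_distrib)
  show "(z + z') *\<^sub>C p = z *\<^sub>C p + z' *\<^sub>C p" by transfer (rule refl, rule cscale_left_distrib)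
  show "z *\<^sub>C (z' *\<^sub>C p) = (z * z') *\<^sub>C p" by transfer (rule refl, rule cscale_cscale)
  show "1 *\<^sub>C p = p" by transfer (rule refl, rule cscale_one)
qed
end

lift_definition tensor :: "'a::cvec \<Rightarrow> 'b::cvec \<Rightarrow> ('a, 'b) ctensor"  (infixr \<open>\<otimes>\<^sub>C\<close> 72)
  is free_pair .

lemma cbilinear_tensor: "cbilinear (\<otimes>\<^sub>C)"
proof -
  have 1: "(u + u') \<otimes>\<^sub>C w = u \<otimes>\<^sub>C w + u' \<otimes>\<^sub>C w" for u u' :: 'a and w :: 'b
    unfolding tensor.abs_eq plus_ctensor.abs_eq ctensor.abs_eq_iff tensor_rel_def diff_diff_eq[symmetric]
    by (rule cvec.span_base) (unfold tensor_relators_def, blast)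
  have 2: "u \<otimes>\<^sub>C (w + w') = u \<otimes>\<^sub>C w + u \<otimes>\<^sub>C w'" for u :: 'a and w w' :: 'b
    unfolding tensor.abs_eq plus_ctensor.abs_eq ctensor.abs_eq_iff tensor_rel_def diff_diff_eq[symmetric]
    by (rule cvec.span_base) (unfold tensor_relators_def, blast)
  have 3: "(z *\<^sub>C u) \<otimes>\<^sub>C w = z *\<^sub>C (u \<otimes>\<^sub>C w)" for z and u :: 'a and w :: 'b
    unfolding tensor.abs_eq cscale_ctensor.abs_eq ctensor.abs_eq_iff tensor_rel_def
    by (rule cvec.span_base) (unfold tensor_relators_def, blast)
  have 4: "u \<otimes>\<^sub>C (z *\<^sub>C w) = z *\<^sub>C (u \<otimes>\<^sub>C w)" for z and u :: 'a and w :: 'b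
    unfolding tensor.abs_eq cscale_ctensor.abs_eq ctensor.abs_eq_iff tensor_rel_def
    by (rule cvec.span_base) (unfold tensor_relators_def, blast)
  show ?thesis unfolding cbilinear_def clinear_iff by (simp only: 1 2 3 4 simp_thms)
qed

text \<open>The linear map out of the tensor product induced by \<open>f\<close>; it is well defined, i.e.
  independent of the representative, when \<open>f\<close> is bilinear.\<close>

definition free_lift :: "('a \<Rightarrow> 'b \<Rightarrow> 'c::cvec) \<Rightarrow> ('a \<times> 'b \<Rightarrow>\<^sub>0 complex) \<Rightarrow> 'c" where
  "free_lift f p = (\<Sum>x\<in>Poly_Mapping.keys p. Poly_Mapping.lookup p x *\<^sub>C f (fst x) (snd x))"

definition tensor_lift :: "('a::cvec \<Rightarrow> 'b::cvec \<Rightarrow> 'c::cvec) \<Rightarrow> ('a, 'b) ctensor \<Rightarrow> 'c"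
  where "tensor_lift f t = free_lift f (rep_ctensor t)"

lemma free_lift_superset:
  assumes "finite A" "Poly_Mapping.keys p \<subseteq> A"
  shows "free_lift f p = (\<Sum>x\<in>A. Poly_Mapping.lookup p x *\<^sub>C f (fst x) (snd x))"
  unfolding free_lift_def using assms
  by (intro sum.mono_neutral_left) (auto simp: in_keys_iff)

lemma clinear_free_lift: "clinear (free_lift f)"
  unfolding clinear_iff
proof (intro conjI allI)
  fix p q :: "'a \<times> 'b \<Rightarrow>\<^sub>0 complex" and z :: complex
  let ?A = "Poly_Mapping.keys p \<union> Poly_Mapping.keys q"
  have sub: "Poly_Mapping.keys (p + q) \<subseteq> ?A" "Poly_Mapping.keys p \<subseteq> ?A"
    "Poly_Mapping.keys q \<subseteq> ?A" by (rule Poly_Mapping.keys_add, blast, blast)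
  have fin: "finite ?A" by simp
  show "free_lift f (p + q) = free_lift f p + free_lift f q"
    unfolding sub[THEN free_lift_superset[OF fin]]
    by (simp only: lookup_add cscale_left_distrib sum.distrib)
  have "Poly_Mapping.keys (z *\<^sub>C p) \<subseteq> Poly_Mapping.keys p"
    by (auto simp: in_keys_iff lookup_cscale)
  then have "free_lift f (z *\<^sub>C p) =
      (\<Sum>x\<in>Poly_Mapping.keys p. (z * Poly_Mapping.lookup p x) *\<^sub>C f (fst x) (snd x))"
    by (subst free_lift_superset[OF finite_keys]) (simp_all only: lookup_cscale cscale_complex_def)
  also have "\<dots> = z *\<^sub>C free_lift f p"
    unfolding free_lift_def cvec.scale_sum_right cscale_cscale ..
  finally show "free_lift f (z *\<^sub>C p) = z *\<^sub>C free_lift f p" .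
qed

lemma clinear_add: "clinear f \<Longrightarrow> f (u + w) = f u + f w"
  by (simp only: clinear_iff)

lemma clinear_scale: "clinear f \<Longrightarrow> f (z *\<^sub>C u) = z *\<^sub>C f u"
  by (simp only: clinear_iff)

lemma clinear_compose: "clinear h \<Longrightarrow> clinear f \<Longrightarrow> clinear (\<lambda>u. h (f u))"
  by (simp only: clinear_iff simp_thms)

lemma clinear_diff:
  assumes f: "clinear f" shows "f (u - w) = f u - f w"
proof -
  have "f (u - w + w) = f (u - w) + f w"
    by (rule f[unfolded clinear_iff, THEN conjunct1, rule_format])
  then show ?thesis by (simp add: eq_diff_eq)
qed

lemma clinear_0: "clinear f \<Longrightarrow> f 0 = 0"
  using clinear_diff[of f 0 0] by simp

lemma free_lift_pair [simp]: "free_lift f (free_pair u w) = f u w"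
  by (simp add: free_lift_def cscale_one)

lemma free_lift_rel:
  assumes f: "cbilinear f" and "tensor_rel p q"
  shows "free_lift f p = free_lift f q"
proof -
  note L = clinear_free_lift[of f]
  have "free_lift f r = 0" if "r \<in> cvec.span tensor_relators" for r
    using that
  proof (induction rule: cvec.span_induct_alt)
    case base show ?case by (rule clinear_0[OF L])
  next
    case (step z r s)
    have "free_lift f r = 0"
      using step(1) f L unfolding tensor_relators_def cbilinear_def clinear_iff
      by (elim UnE CollectE exE conjE) (simp_all add: clinear_diff[OF L])
    then show ?case using step L by (simp add: clinear_iff)
  qed
  then show ?thesis using assms(2) clinear_diff[OF L, of p q] by (simp add: tensor_rel_def)
qed

lemma tensor_lift_abs:
  assumes "cbilinear f"
  shows "tensor_lift f (abs_ctensor p) = free_lift f p"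
  unfolding tensor_lift_def
  by (rule free_lift_rel[OF assms], rule Quotient3_rep_abs[OF Quotient3_ctensor])
    (rule equivp_reflp[OF tensor_rel_equivp])

lemma tensor_lift_tensor:
  assumes "cbilinear f" shows "tensor_lift f (u \<otimes>\<^sub>C w) = f u w"
  unfolding tensor.abs_eq by (simp add: tensor_lift_abs[OF assms])

lemma clinear_tensor_lift:
  assumes "cbilinear f" shows "clinear (tensor_lift f)"
  unfolding clinear_iff
proof (intro conjI allI)
  fix s t :: "('a, 'b) ctensor" and z
  obtain p where p: "s = abs_ctensor p" by (rule that, rule Quotient3_abs_rep[OF Quotient3_ctensor, symmetric])
  obtain q where q: "t = abs_ctensor q" by (rule that, rule Quotient3_abs_rep[OF Quotient3_ctensor, symmetric])
  show "tensor_lift f (s + t) = tensor_lift f s + tensor_lift f t"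
    using clinear_free_lift[of f]
    by (simp add: p q plus_ctensor.abs_eq tensor_lift_abs[OF assms] clinear_iff)
  show "tensor_lift f (z *\<^sub>C s) = z *\<^sub>C tensor_lift f s"
    using clinear_free_lift[of f]
    by (simp add: p cscale_ctensor.abs_eq tensor_lift_abs[OF assms] clinear_iff)
qed


section \<open>Vertex algebras and modules\<close>

text \<open>\<open>Y a n b\<close> is the product \<open>a\<^sub>(\<^sub>n\<^sub>)b\<close>, i.e. \<open>Y(a,z) = \<Sum>n. a\<^sub>(\<^sub>n\<^sub>) z\<^sup>-\<^sup>n\<^sup>-\<^sup>1\<close>. The
  sums in the Borcherds identity have finite support by the truncation axiom.\<close>

definition vertex_module ::
  "'v::cvec \<Rightarrow> ('v \<Rightarrow> int \<Rightarrow> 'v \<Rightarrow> 'v) \<Rightarrow> ('v \<Rightarrow> int \<Rightarrow> 'm::cvec \<Rightarrow> 'm) \<Rightarrow> bool" where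
  "vertex_module vac Y act \<longleftrightarrow>
     (\<forall>n. cbilinear (\<lambda>a. act a n)) \<and>
     (\<forall>a u. \<exists>N. \<forall>n\<ge>N. act a n u = 0) \<and>
     (\<forall>n u. act vac n u = (if n = -1 then u else 0)) \<and>
     (\<forall>a b u m n p.
        Sum_any (\<lambda>j::nat. ((of_int m :: complex) gchoose j) *\<^sub>C
            act (Y a (n + int j) b) (m + p - int j) u) =
        Sum_any (\<lambda>j::nat. ((- 1) ^ j * ((of_int n :: complex) gchoose j)) *\<^sub>C
            (act a (m + n - int j) (act b (p + int j) u)
             - ((- 1) powi n) *\<^sub>C act b (n + p - int j) (act a (m + int j) u))))"

definition vertex_algebra :: "'v::cvec \<Rightarrow> ('v \<Rightarrow> int \<Rightarrow> 'v \<Rightarrow> 'v) \<Rightarrow> bool" where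
  "vertex_algebra vac Y \<longleftrightarrow> vertex_module vac Y Y \<and>
     (\<forall>a. Y a (-1) vac = a \<and> (\<forall>n\<ge>0. Y a n vac = 0))"

definition translation :: "'v \<Rightarrow> ('v \<Rightarrow> int \<Rightarrow> 'v \<Rightarrow> 'v) \<Rightarrow> 'v \<Rightarrow> 'v"
  where "translation vac Y a = Y a (-2) vac"

text \<open>\<open>ope Y a b [c\<^sub>0, \<dots>, c\<^sub>r]\<close>: \<open>a(z)b(w) \<sim> c\<^sub>0(w)/(z-w) + \<dots> + c\<^sub>r(w)/(z-w)\<^sup>r\<^sup>+\<^sup>1\<close>.\<close>

definition ope :: "('v \<Rightarrow> int \<Rightarrow> 'v \<Rightarrow> 'v::zero) \<Rightarrow> 'v \<Rightarrow> 'v \<Rightarrow> 'v list \<Rightarrow> bool" where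
  "ope Y a b cs \<longleftrightarrow> (\<forall>n. Y a (int n) b = (if n < length cs then cs ! n else 0))"

definition vertex_embedding ::
  "'v::cvec \<Rightarrow> ('v \<Rightarrow> int \<Rightarrow> 'v \<Rightarrow> 'v) \<Rightarrow> 't::cvec \<Rightarrow> ('t \<Rightarrow> int \<Rightarrow> 't \<Rightarrow> 't) \<Rightarrow> ('v \<Rightarrow> 't) \<Rightarrow> bool" where
  "vertex_embedding vac Y vac' Y' \<phi> \<longleftrightarrow>
     clinear \<phi> \<and> inj \<phi> \<and> \<phi> vac = vac' \<and> (\<forall>a n b. \<phi> (Y a n b) = Y' (\<phi> a) n (\<phi> b))"

definition submodule :: "('v \<Rightarrow> int \<Rightarrow> 'm \<Rightarrow> 'm::cvec) \<Rightarrow> 'm set \<Rightarrow> bool" where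
  "submodule act N \<longleftrightarrow> cvec.subspace N \<and> (\<forall>a n. \<forall>u\<in>N. act a n u \<in> N)"

definition generated_submodule :: "('v \<Rightarrow> int \<Rightarrow> 'm \<Rightarrow> 'm::cvec) \<Rightarrow> 'm \<Rightarrow> 'm set" where
  "generated_submodule act u = \<Inter>{N. submodule act N \<and> u \<in> N}"

definition irreducible_module :: "('v \<Rightarrow> int \<Rightarrow> 'm \<Rightarrow> 'm::cvec) \<Rightarrow> bool" where
  "irreducible_module act \<longleftrightarrow> (\<exists>u::'m. u \<noteq> 0) \<and> (\<forall>N. submodule act N \<longrightarrow> N = {0} \<or> N = UNIV)"

text \<open>Action of \<open>V \<otimes> V'\<close> on \<open>M \<otimes> M'\<close> by \<open>Y(a \<otimes> b, z) = Y(a, z) \<otimes> Y(b, z)\<close>.\<close>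

definition tensor_action ::
  "('v::cvec \<Rightarrow> int \<Rightarrow> 'm::cvec \<Rightarrow> 'm) \<Rightarrow> ('w::cvec \<Rightarrow> int \<Rightarrow> 'n::cvec \<Rightarrow> 'n) \<Rightarrow>
    ('v, 'w) ctensor \<Rightarrow> int \<Rightarrow> ('m, 'n) ctensor \<Rightarrow> ('m, 'n) ctensor" where
  "tensor_action A B s n t =
     tensor_lift (\<lambda>a b. tensor_lift (\<lambda>u w.
       Sum_any (\<lambda>i::int. A a i u \<otimes>\<^sub>C B b (n - 1 - i) w)) t) s"

lemma clinear_Sum_any:
  assumes lin: "\<And>i. clinear (g i)" and fin: "\<And>u. finite {i. g i u \<noteq> 0}"
  shows "clinear (\<lambda>u. Sum_any (\<lambda>i. g i u))"
  unfolding clinear_iff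
proof (intro conjI allI)
  show "Sum_any (\<lambda>i. g i (u + w)) = Sum_any (\<lambda>i. g i u) + Sum_any (\<lambda>i. g i w)" for u w
    unfolding clinear_add[OF lin] by (rule Sum_any.distrib[OF fin fin])
  show "Sum_any (\<lambda>i. g i (z *\<^sub>C u)) = z *\<^sub>C Sum_any (\<lambda>i. g i u)" for z u
  proof -
    have "Sum_any (\<lambda>i. z *\<^sub>C g i u) = (\<Sum>i | g i u \<noteq> 0. z *\<^sub>C g i u)"
      by (rule Sum_any.expand_superset[OF fin]) auto
    then show ?thesis
      unfolding clinear_scale[OF lin] by (simp only: Sum_any.expand_set cvec.scale_sum_right)
  qed
qed

lemma clinear_tensor_lift_param:
  assumes G: "\<And>u w. clinear (\<lambda>a. G a u w)"
  shows "clinear (\<lambda>a. tensor_lift (G a) t)"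
  unfolding clinear_iff tensor_lift_def free_lift_def
  by (simp only: clinear_add[OF G] clinear_scale[OF G] cscale_right_distrib sum.distrib
      cvec.scale_sum_right cvec.scale_left_commute simp_thms)

lemma tensor_action_tensor:
  assumes A: "\<And>n. cbilinear (\<lambda>a. A a n)" "\<And>a u. \<exists>N. \<forall>n\<ge>N. A a n u = 0"
    and B: "\<And>n. cbilinear (\<lambda>b. B b n)" "\<And>b w. \<exists>N. \<forall>n\<ge>N. B b n w = 0"
  shows "tensor_action A B (a \<otimes>\<^sub>C b) n (u \<otimes>\<^sub>C w) =
           Sum_any (\<lambda>i::int. A a i u \<otimes>\<^sub>C B b (n - 1 - i) w)"
    and "cbilinear (\<lambda>s. tensor_action A B s n)"
proof -
  define g where "g = (\<lambda>a b u w (i::int). A a i u \<otimes>\<^sub>C B b (n - 1 - i) w)"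
  note T = cbilinear_tensor[unfolded cbilinear_def]
  have z: "0 \<otimes>\<^sub>C t = 0" "s \<otimes>\<^sub>C 0 = 0" for s :: 'b and t :: 'd
    using clinear_0[OF T[THEN conjunct2, rule_format]] clinear_0[OF T[THEN conjunct1, rule_format]] .
  have fin: "finite {i. g a b u w i \<noteq> 0}" for a b u w
  proof -
    obtain N where N: "\<And>i. i \<ge> N \<Longrightarrow> A a i u = 0" using A(2) by blast
    obtain M where M: "\<And>i. i \<ge> M \<Longrightarrow> B b i w = 0" using B(2) by blast
    have "{i. g a b u w i \<noteq> 0} \<subseteq> {n - M..N}"
    proof
      fix i assume i: "i \<in> {i. g a b u w i \<noteq> 0}"
      then have "A a i u \<noteq> 0" "B b (n - 1 - i) w \<noteq> 0" by (auto simp: g_def z)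
      then have "\<not> i \<ge> N" "\<not> n - 1 - i \<ge> M" using N M by blast+
      then show "i \<in> {n - M..N}" by auto
    qed
    then show ?thesis by (rule finite_subset) simp
  qed
  have Tl: "clinear (\<lambda>s. s \<otimes>\<^sub>C t)" and Tr: "clinear (\<lambda>t. s \<otimes>\<^sub>C t)" for s :: 'b and t :: 'd
    using T by blast+
  have A1: "clinear (\<lambda>a. A a i u)" "clinear (A a i)" for a i u
    using A(1) by (simp_all add: cbilinear_def)
  have B1: "clinear (\<lambda>b. B b i w)" "clinear (B b i)" for b i w
    using B(1) by (simp_all add: cbilinear_def)
  have l1: "clinear (\<lambda>a. g a b u w i)" for b u w i
    unfolding g_def by (rule clinear_compose[OF Tl A1(1)])
  have l2: "clinear (\<lambda>b. g a b u w i)" for a u w i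
    unfolding g_def by (rule clinear_compose[OF Tr B1(1)])
  have l3: "clinear (\<lambda>u. g a b u w i)" for a b w i
    unfolding g_def by (rule clinear_compose[OF Tl A1(2)])
  have l4: "clinear (\<lambda>w. g a b u w i)" for a b u i
    unfolding g_def by (rule clinear_compose[OF Tr B1(2)])
  define S where "S = (\<lambda>a b u w. Sum_any (g a b u w))"
  have S1: "clinear (\<lambda>a. S a b u w)" for b u w unfolding S_def by (rule clinear_Sum_any[OF l1 fin])
  have S2: "clinear (\<lambda>b. S a b u w)" for a u w unfolding S_def by (rule clinear_Sum_any[OF l2 fin])
  have S3: "clinear (\<lambda>u. S a b u w)" for a b w unfolding S_def by (rule clinear_Sum_any[OF l3 fin])
  have S4: "clinear (\<lambda>w. S a b u w)" for a b u unfolding S_def by (rule clinear_Sum_any[OF l4 fin])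
  have bl: "cbilinear (S a b)" for a b using S3 S4 by (simp add: cbilinear_def)
  have bl': "cbilinear (\<lambda>a b. tensor_lift (S a b) t)" for t
    unfolding cbilinear_def by (intro conjI allI clinear_tensor_lift_param S1 S2)
  have eq: "tensor_action A B s n t = tensor_lift (\<lambda>a b. tensor_lift (S a b) t) s" for s t
    by (simp add: tensor_action_def S_def g_def)
  show "tensor_action A B (a \<otimes>\<^sub>C b) n (u \<otimes>\<^sub>C w) =
           Sum_any (\<lambda>i::int. A a i u \<otimes>\<^sub>C B b (n - 1 - i) w)"
    unfolding eq tensor_lift_tensor[OF bl']
    unfolding tensor_lift_tensor[OF bl] by (simp only: S_def g_def)
  show "cbilinear (\<lambda>s. tensor_action A B s n)"
    unfolding cbilinear_def
  proof (intro conjI allI)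
    show "clinear (tensor_action A B s n)" for s
      unfolding eq[abs_def] by (intro clinear_tensor_lift_param clinear_tensor_lift[OF bl])
    show "clinear (\<lambda>s. tensor_action A B s n t)" for t
      unfolding eq by (rule clinear_tensor_lift[OF bl'])
  qed
qed

text \<open>\<open>pbw_basis act [g\<^sub>0, \<dots>, g\<^sub>r\<^sub>-\<^sub>1] I u\<close>: the ordered monomials in the modes
  \<open>(g\<^sub>i)\<^sub>(\<^sub>-\<^sub>n\<^sub>-\<^sub>1\<^sub>)\<close>, \<open>n \<ge> 0\<close>, applied to the vectors \<open>u \<lambda>\<close>, \<open>\<lambda> \<in> I\<close>, are pairwise distinct
  and form a basis of the whole space. A monomial is encoded as a list of pairs \<open>(i, n)\<close>.\<close>

definition pbw_words :: "nat \<Rightarrow> (nat \<times> nat) list set" where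
  "pbw_words r = {ws. (\<forall>(i, n)\<in>set ws. i < r) \<and>
     sorted_wrt (\<lambda>(i, m) (j, n). i < j \<or> (i = j \<and> n \<le> m)) ws}"

definition pbw_monomial ::
  "('v \<Rightarrow> int \<Rightarrow> 'm \<Rightarrow> 'm) \<Rightarrow> 'v list \<Rightarrow> (nat \<times> nat) list \<Rightarrow> 'm \<Rightarrow> 'm" where
  "pbw_monomial act gs ws u = foldr (\<lambda>(i, n). act (gs ! i) (- int n - 1)) ws u"

definition pbw_basis ::
  "('v \<Rightarrow> int \<Rightarrow> 'm \<Rightarrow> 'm::cvec) \<Rightarrow> 'v list \<Rightarrow> 'i set \<Rightarrow> ('i \<Rightarrow> 'm) \<Rightarrow> bool" where
  "pbw_basis act gs I u \<longleftrightarrow>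
     (let B = pbw_words (length gs) \<times> I; F = (\<lambda>(ws, l). pbw_monomial act gs ws (u l))
      in inj_on F B \<and> \<not> cvec.dependent (F ` B) \<and> cvec.span (F ` B) = UNIV)"

definition freely_strongly_generated ::
  "'v::cvec \<Rightarrow> ('v \<Rightarrow> int \<Rightarrow> 'v \<Rightarrow> 'v) \<Rightarrow> 'v list \<Rightarrow> bool" where
  "freely_strongly_generated vac Y gs \<longleftrightarrow> pbw_basis Y gs {()} (\<lambda>_. vac)"


section \<open>The Bershadsky-Polyakov algebra and its highest weight modules\<close>

definition primary_field ::
  "'v::cvec \<Rightarrow> ('v \<Rightarrow> int \<Rightarrow> 'v \<Rightarrow> 'v) \<Rightarrow> 'v \<Rightarrow> complex \<Rightarrow> 'v \<Rightarrow> bool" where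
  "primary_field vac Y L h a \<longleftrightarrow> ope Y L a [translation vac Y a, h *\<^sub>C a]"

definition universal_BP ::
  "complex \<Rightarrow> 'v::cvec \<Rightarrow> ('v \<Rightarrow> int \<Rightarrow> 'v \<Rightarrow> 'v) \<Rightarrow> 'v \<Rightarrow> 'v \<Rightarrow> 'v \<Rightarrow> 'v \<Rightarrow> bool" where
  "universal_BP k vac Y J Gp Gm L \<longleftrightarrow>
     vertex_algebra vac Y \<and>
     freely_strongly_generated vac Y [J, Gp, Gm, L] \<and>
     ope Y L L [translation vac Y L, 2 *\<^sub>C L, 0,
       ((- ((2 * k + 3) * (3 * k + 1) / (k + 3))) / 2) *\<^sub>C vac] \<and>
     primary_field vac Y L 1 J \<and>
     primary_field vac Y L (3/2) Gp \<and>
     primary_field vac Y L (3/2) Gm \<and>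
     ope Y J J [0, ((2 * k + 3) / 3) *\<^sub>C vac] \<and>
     ope Y J Gp [Gp] \<and>
     ope Y J Gm [- Gm] \<and>
     ope Y Gp Gp [] \<and>
     ope Y Gm Gm [] \<and>
     ope Y Gp Gm
       [3 *\<^sub>C Y J (-1) J + (3 * (k + 1) / 2) *\<^sub>C translation vac Y J - (k + 3) *\<^sub>C L,
        (3 * (k + 1)) *\<^sub>C J,
        ((k + 1) * (2 * k + 3)) *\<^sub>C vac]"

text \<open>The irreducible highest weight module \<open>L[x,y]\<close>. In terms of \<open>n\<close>-th products, the modes of
  \<open>J\<close> and \<open>G\<^sup>+\<close> are \<open>J(n) = J\<^sub>(\<^sub>n\<^sub>)\<close>, \<open>G\<^sup>+(n) = G\<^sup>+\<^sub>(\<^sub>n\<^sub>)\<close>, those of \<open>G\<^sup>-\<close> and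
  \<open>L + \<partial>J/2\<close> are shifted by one.\<close>

definition BP_irreducible_hw_module ::
  "'v::cvec \<Rightarrow> ('v \<Rightarrow> int \<Rightarrow> 'v \<Rightarrow> 'v) \<Rightarrow> 'v \<Rightarrow> 'v \<Rightarrow> 'v \<Rightarrow> 'v \<Rightarrow>
    ('v \<Rightarrow> int \<Rightarrow> 'l::cvec \<Rightarrow> 'l) \<Rightarrow> 'l \<Rightarrow> complex \<Rightarrow> complex \<Rightarrow> bool" where
  "BP_irreducible_hw_module vac Y J Gp Gm L act v x y \<longleftrightarrow>
     (let Jm = act J; Gpm = act Gp; Gmm = (\<lambda>n. act Gm (n + 1));
          Lm = (\<lambda>n. act (L + (1/2) *\<^sub>C translation vac Y J) (n + 1))
      in vertex_module vac Y act \<and> irreducible_module act \<and> v \<noteq> 0 \<and>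
         Jm 0 v = x *\<^sub>C v \<and> Lm 0 v = y *\<^sub>C v \<and>
         (\<forall>n\<ge>0. Gpm (n + 1) v = 0 \<and> Gmm n v = 0 \<and> Jm (n + 1) v = 0 \<and> Lm (n + 1) v = 0))"


section \<open>The vertex algebras \<open>S\<close> and \<open>\<Pi>(0)\<close>\<close>

definition beta_gamma_algebra ::
  "'s::cvec \<Rightarrow> ('s \<Rightarrow> int \<Rightarrow> 's \<Rightarrow> 's) \<Rightarrow> 's \<Rightarrow> 's \<Rightarrow> bool" where
  "beta_gamma_algebra vac Y \<beta> \<gamma> \<longleftrightarrow>
     vertex_algebra vac Y \<and> freely_strongly_generated vac Y [\<beta>, \<gamma>] \<and>
     ope Y \<beta> \<gamma> [vac] \<and> ope Y \<beta> \<beta> [] \<and> ope Y \<gamma> \<gamma> []"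

text \<open>\<open>e m\<close> stands for \<open>e\<^sup>m\<^sup>c\<close> in the half-lattice vertex algebra \<open>M(1) \<otimes> \<complex>[\<int>c]\<close>, where
  \<open>\<langle>c, d\<rangle> = 2\<close> and \<open>\<langle>c, c\<rangle> = \<langle>d, d\<rangle> = 0\<close>. Since \<open>c\<close> is isotropic, the fields \<open>e\<^sup>m\<^sup>c(z)\<close> have regular
  operator products with each other; \<open>\<partial>e\<^sup>m\<^sup>c = m :c e\<^sup>m\<^sup>c:\<close>.\<close>

definition Pi0_algebra ::
  "'p::cvec \<Rightarrow> ('p \<Rightarrow> int \<Rightarrow> 'p \<Rightarrow> 'p) \<Rightarrow> 'p \<Rightarrow> 'p \<Rightarrow> (int \<Rightarrow> 'p) \<Rightarrow> bool" where
  "Pi0_algebra vac Y c d e \<longleftrightarrow>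
     vertex_algebra vac Y \<and>
     pbw_basis Y [c, d] UNIV e \<and>
     ope Y c d [0, 2 *\<^sub>C vac] \<and> ope Y c c [] \<and> ope Y d d [] \<and>
     e 0 = vac \<and>
     (\<forall>m. ope Y c (e m) [] \<and> ope Y d (e m) [(2 * of_int m) *\<^sub>C e m]) \<and>
     (\<forall>m. translation vac Y (e m) = of_int m *\<^sub>C Y c (-1) (e m)) \<and>
     (\<forall>m m'. ope Y (e m) (e m') [] \<and> Y (e m) (-1) (e m') = e (m + m'))"

text \<open>The \<open>\<Pi>(0)\<close>-module \<open>M(1) \<otimes> \<complex>[\<Lambda>c]\<close> for a union \<open>\<Lambda>\<close> of cosets of \<open>\<int>\<close> in \<open>\<complex>\<close>, i.e. the
  direct sum of the modules \<open>\<Pi>(0).e\<^sup>\<lambda>\<^sup>c\<close>, one for each coset; \<open>E \<lambda>\<close> stands for \<open>e\<^sup>\<lambda>\<^sup>c\<close>.\<close>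

definition Pi0_lattice_module ::
  "'p::cvec \<Rightarrow> ('p \<Rightarrow> int \<Rightarrow> 'p \<Rightarrow> 'p) \<Rightarrow> 'p \<Rightarrow> 'p \<Rightarrow> (int \<Rightarrow> 'p) \<Rightarrow>
    complex set \<Rightarrow> ('p \<Rightarrow> int \<Rightarrow> 'q::cvec \<Rightarrow> 'q) \<Rightarrow> (complex \<Rightarrow> 'q) \<Rightarrow> bool" where
  "Pi0_lattice_module vac Y c d e \<Lambda> act E \<longleftrightarrow>
     vertex_module vac Y act \<and>
     pbw_basis act [c, d] \<Lambda> E \<and>
     (\<forall>l\<in>\<Lambda>. \<forall>n\<ge>0. act c n (E l) = 0) \<and>
     (\<forall>l\<in>\<Lambda>. \<forall>n\<ge>0. act d n (E l) = (if n = 0 then (2 * l) *\<^sub>C E l else 0)) \<and>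
     (\<forall>l\<in>\<Lambda>. \<forall>m. (\<forall>n\<ge>0. act (e m) n (E l) = 0) \<and> act (e m) (-1) (E l) = E (l + of_int m))"

text \<open>\<open>\<Pi>(0)\<^sup>1\<^sup>/\<^sup>3 = \<Pi>(0) \<oplus> \<Pi>(0).e\<^sup>c\<^sup>/\<^sup>3 \<oplus> \<Pi>(0).e\<^sup>2\<^sup>c\<^sup>/\<^sup>3\<close>\<close>

definition Pi0_third ::
  "'p::cvec \<Rightarrow> ('p \<Rightarrow> int \<Rightarrow> 'p \<Rightarrow> 'p) \<Rightarrow> 'p \<Rightarrow> 'p \<Rightarrow> (int \<Rightarrow> 'p) \<Rightarrow>
    ('p \<Rightarrow> int \<Rightarrow> 'q::cvec \<Rightarrow> 'q) \<Rightarrow> (complex \<Rightarrow> 'q) \<Rightarrow> bool" where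
  "Pi0_third vac Y c d e act E \<longleftrightarrow>
     Pi0_lattice_module vac Y c d e {of_nat i / 3 + of_int j | i j. i < 3} act E"


section \<open>Affine \<open>sl\<^sub>3\<close>\<close>

definition sl3 :: "(complex^3^3) set" where "sl3 = {A. trace A = 0}"

definition mat_unit :: "3 \<Rightarrow> 3 \<Rightarrow> complex^3^3" where
  "mat_unit i j = (\<chi> p q. if p = i \<and> q = j then 1 else 0)"

definition commutator :: "complex^3^3 \<Rightarrow> complex^3^3 \<Rightarrow> complex^3^3" where
  "commutator A B = A ** B - B ** A"

definition "e1 = mat_unit 1 2"
definition "e2 = mat_unit 2 3"
definition "e3 = mat_unit 1 3"
definition "h1 = mat_unit 1 1 - mat_unit 2 2"
definition "h2 = mat_unit 2 2 - mat_unit 3 3"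
definition "f1 = mat_unit 2 1"
definition "f2 = mat_unit 3 2"
definition "f3 = mat_unit 3 1"

definition linear_on :: "'a::cvec set \<Rightarrow> ('a \<Rightarrow> 'b::cvec) \<Rightarrow> bool" where
  "linear_on S f \<longleftrightarrow> (\<forall>u\<in>S. \<forall>w\<in>S. f (u + w) = f u + f w) \<and> (\<forall>z. \<forall>u\<in>S. f (z *\<^sub>C u) = z *\<^sub>C f u)"

text \<open>\<open>V\<^sup>k(sl\<^sub>3)\<close>, with respect to the trace form; \<open>\<iota> A\<close> is \<open>A\<^sub>(\<^sub>-\<^sub>1\<^sub>)1\<close>. Only the values of \<open>\<iota>\<close>
  on \<open>sl3\<close> matter.\<close>

definition universal_affine_sl3 ::
  "complex \<Rightarrow> 'v::cvec \<Rightarrow> ('v \<Rightarrow> int \<Rightarrow> 'v \<Rightarrow> 'v) \<Rightarrow> (complex^3^3 \<Rightarrow> 'v) \<Rightarrow> bool" where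
  "universal_affine_sl3 k vac Y \<iota> \<longleftrightarrow>
     vertex_algebra vac Y \<and> linear_on sl3 \<iota> \<and>
     freely_strongly_generated vac Y (map \<iota> [e1, e2, e3, h1, h2, f1, f2, f3]) \<and>
     (\<forall>A\<in>sl3. \<forall>B\<in>sl3. ope Y (\<iota> A) (\<iota> B) [\<iota> (commutator A B), (k * trace (A ** B)) *\<^sub>C vac])"

text \<open>A level \<open>k\<close> module of affine \<open>sl\<^sub>3\<close>; \<open>X A n\<close> is the action of \<open>A \<otimes> t\<^sup>n\<close>.\<close>

definition affine_sl3_module :: "complex \<Rightarrow> (complex^3^3 \<Rightarrow> int \<Rightarrow> 'm::cvec \<Rightarrow> 'm) \<Rightarrow> bool" where
  "affine_sl3_module k X \<longleftrightarrow>
     (\<forall>A\<in>sl3. \<forall>n. clinear (X A n)) \<and>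
     (\<forall>n u. linear_on sl3 (\<lambda>A. X A n u)) \<and>
     (\<forall>A\<in>sl3. \<forall>B\<in>sl3. \<forall>m n u.
        X A m (X B n u) - X B n (X A m u) =
          X (commutator A B) (m + n) u +
          (if m + n = 0 then (of_int m * k * trace (A ** B)) *\<^sub>C u else 0))"

definition affine_invariant :: "(complex^3^3 \<Rightarrow> int \<Rightarrow> 'm::cvec \<Rightarrow> 'm) \<Rightarrow> 'm set \<Rightarrow> bool" where
  "affine_invariant X N \<longleftrightarrow> cvec.subspace N \<and> (\<forall>A\<in>sl3. \<forall>n. \<forall>u\<in>N. X A n u \<in> N)"

definition sl3_invariant :: "(complex^3^3 \<Rightarrow> int \<Rightarrow> 'm::cvec \<Rightarrow> 'm) \<Rightarrow> 'm set \<Rightarrow> bool" where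
  "sl3_invariant X U \<longleftrightarrow> cvec.subspace U \<and> (\<forall>A\<in>sl3. \<forall>u\<in>U. X A 0 u \<in> U)"

definition top_component :: "(complex^3^3 \<Rightarrow> int \<Rightarrow> 'm::cvec \<Rightarrow> 'm) \<Rightarrow> 'm set" where
  "top_component X = {u. \<forall>A\<in>sl3. \<forall>n\<ge>1. X A n u = 0}"

text \<open>\<open>U\<close> is, under the zero modes, the irreducible \<open>sl\<^sub>3\<close>-module of highest weight
  \<open>a\<omega>\<^sub>1 + b\<omega>\<^sub>2\<close>.\<close>

definition sl3_irreducible_hw ::
  "(complex^3^3 \<Rightarrow> int \<Rightarrow> 'm::cvec \<Rightarrow> 'm) \<Rightarrow> 'm set \<Rightarrow> complex \<Rightarrow> complex \<Rightarrow> bool" where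
  "sl3_irreducible_hw X U a b \<longleftrightarrow>
     sl3_invariant X U \<and>
     (\<forall>U'. U' \<subseteq> U \<and> sl3_invariant X U' \<longrightarrow> U' = {0} \<or> U' = U) \<and>
     (\<exists>v\<in>U. v \<noteq> 0 \<and> X e1 0 v = 0 \<and> X e2 0 v = 0 \<and> X e3 0 v = 0 \<and>
        X h1 0 v = a *\<^sub>C v \<and> X h2 0 v = b *\<^sub>C v)"

definition is_Lk_sl3 ::
  "complex \<Rightarrow> complex \<Rightarrow> complex \<Rightarrow> (complex^3^3 \<Rightarrow> int \<Rightarrow> 'm::cvec \<Rightarrow> 'm) \<Rightarrow> bool" where
  "is_Lk_sl3 k a b X \<longleftrightarrow>
     affine_sl3_module k X \<and>
     (\<forall>N. affine_invariant X N \<longrightarrow> N = {0} \<or> N = UNIV) \<and>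
     sl3_irreducible_hw X (top_component X) a b"

text \<open>\<open>N\<close> is invariant under the affine action \<open>X\<close>, and isomorphic to the module given by \<open>X'\<close>.\<close>

definition affine_sl3_iso ::
  "(complex^3^3 \<Rightarrow> int \<Rightarrow> 'n::cvec \<Rightarrow> 'n) \<Rightarrow> 'n set \<Rightarrow> (complex^3^3 \<Rightarrow> int \<Rightarrow> 'm::cvec \<Rightarrow> 'm) \<Rightarrow> bool" where
  "affine_sl3_iso X N X' \<longleftrightarrow>
     affine_invariant X N \<and>
     (\<exists>f. linear_on N f \<and> bij_betw f N UNIV \<and>
        (\<forall>A\<in>sl3. \<forall>n. \<forall>u\<in>N. f (X A n u) = X' A n (f u)))"

definition sl3_orbit :: "(complex^3^3 \<Rightarrow> int \<Rightarrow> 'm::cvec \<Rightarrow> 'm) \<Rightarrow> 'm \<Rightarrow> 'm set" where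
  "sl3_orbit X w = \<Inter>{U. sl3_invariant X U \<and> w \<in> U}"

definition integrable_part :: "(complex^3^3 \<Rightarrow> int \<Rightarrow> 'm::cvec \<Rightarrow> 'm) \<Rightarrow> 'm set" where
  "integrable_part X = {w. \<exists>B. finite B \<and> sl3_orbit X w \<subseteq> cvec.span B}"


section \<open>The embedding of \<open>V\<^sup>k(sl\<^sub>3)\<close> into \<open>W\<^sup>k \<otimes> S \<otimes> \<Pi>(0)\<close>\<close>

text \<open>Iterated normally ordered products are nested to the right; \<open>NO A B\<close> is \<open>:AB:\<close>.
  The values on the listed elements determine the embedding, \<open>f\<^sub>3 = [f\<^sub>2, f\<^sub>1]\<close>.\<close>

definition BP_affine_embedding ::
  "complex \<Rightarrow> 'w::cvec \<Rightarrow> ('w \<Rightarrow> int \<Rightarrow> 'w \<Rightarrow> 'w) \<Rightarrow> 'w \<Rightarrow> 'w \<Rightarrow> 'w \<Rightarrow>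
    's::cvec \<Rightarrow> ('s \<Rightarrow> int \<Rightarrow> 's \<Rightarrow> 's) \<Rightarrow> 's \<Rightarrow> 's \<Rightarrow>
    'p::cvec \<Rightarrow> ('p \<Rightarrow> int \<Rightarrow> 'p \<Rightarrow> 'p) \<Rightarrow> 'p \<Rightarrow> 'p \<Rightarrow> (int \<Rightarrow> 'p) \<Rightarrow>
    'v::cvec \<Rightarrow> ('v \<Rightarrow> int \<Rightarrow> 'v \<Rightarrow> 'v) \<Rightarrow> (complex^3^3 \<Rightarrow> 'v) \<Rightarrow>
    ('v \<Rightarrow> ('w, ('s, 'p) ctensor) ctensor) \<Rightarrow> bool" where
  "BP_affine_embedding k vacW YW JW GpW GmW vacS YS \<beta>S \<gamma>S vacP YP cP dP eP vacV YV \<iota> \<phi> \<longleftrightarrow>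
    (let
       vac = vacW \<otimes>\<^sub>C vacS \<otimes>\<^sub>C vacP;
       Y = tensor_action YW (tensor_action YS YP);
       NO = (\<lambda>A B. Y A (-1) B);
       D = translation vac Y;
       J = JW \<otimes>\<^sub>C vacS \<otimes>\<^sub>C vacP;
       Gp = GpW \<otimes>\<^sub>C vacS \<otimes>\<^sub>C vacP;
       Gm = GmW \<otimes>\<^sub>C vacS \<otimes>\<^sub>C vacP;
       \<beta> = vacW \<otimes>\<^sub>C \<beta>S \<otimes>\<^sub>C vacP;
       \<gamma> = vacW \<otimes>\<^sub>C \<gamma>S \<otimes>\<^sub>C vacP;
       c = vacW \<otimes>\<^sub>C vacS \<otimes>\<^sub>C cP;
       d = vacW \<otimes>\<^sub>C vacS \<otimes>\<^sub>C dP;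
       ec = vacW \<otimes>\<^sub>C vacS \<otimes>\<^sub>C eP 1;
       ec' = vacW \<otimes>\<^sub>C vacS \<otimes>\<^sub>C eP (-1)
     in
       vertex_embedding vacV YV vac Y \<phi> \<and>
       \<phi> (\<iota> e1) = - NO \<gamma> ec \<and>
       \<phi> (\<iota> e2) = \<beta> \<and>
       \<phi> (\<iota> e3) = ec \<and>
       \<phi> (\<iota> h1) = - (2 *\<^sub>C J) + NO \<gamma> \<beta> - ((2 * k + 9) / 6) *\<^sub>C c + (1/2) *\<^sub>C d \<and>
       \<phi> (\<iota> h2) = J - 2 *\<^sub>C NO \<gamma> \<beta> + ((4 * k + 9) / 6) *\<^sub>C c + (1/2) *\<^sub>C d \<and>
       \<phi> (\<iota> f1) = Gp - NO (2 *\<^sub>C J + ((8 * k + 9) / 6) *\<^sub>C c - (1/2) *\<^sub>C d) (NO \<beta> ec')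
                  + (k + 1) *\<^sub>C NO (D \<beta>) ec' \<and>
       \<phi> (\<iota> f2) = NO Gm ec' + NO (J + ((4 * k + 9) / 6) *\<^sub>C c + (1/2) *\<^sub>C d) \<gamma>
                  + k *\<^sub>C D \<gamma> - NO \<gamma> (NO \<gamma> \<beta>))"

end

theory Submission
  imports Defs
begin

text \<open>The vector \<open>w\<^sub>0 = v[x,y] \<otimes> 1 \<otimes> e\<^sup>m\<^sup>1\<^sup>c\<close> has weight \<open>a\<omega>\<^sub>1 + b\<omega>\<^sub>2\<close>, and the value of \<open>y\<close> is exactly what
  makes \<open>f\<^sub>3(1)\<close> kill it. The operator \<open>e\<^sub>3(-1)\<close> is the injective lattice operator \<open>e\<^sup>c\<close>, and it is
  ad-nilpotent on the affine Lie algebra, so the vectors that some power of it maps into an affine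
  submodule \<open>N\<close> form an affine submodule \<open>N'\<close>. On \<open>N'\<close> one can also apply \<open>e\<^sup>-\<^sup>c\<close>, and then the currents
  of \<open>sl\<^sub>3\<close> can be solved for the fields of the three tensor factors, so \<open>N'\<close> is stable under all of them.
  A Fock space argument and the irreducibility of \<open>L[x,y]\<close> show that if \<open>N\<close> meets the coset of \<open>w\<^sub>0\<close>, then \<open>N'\<close>
  contains it. Thus every nonzero submodule of \<open>\<langle>w\<^sub>0\<rangle>\<close> contains some \<open>e\<^sub>3(-1)\<^sup>n w\<^sub>0\<close>; as \<open>k\<close> is not a natural
  number, \<open>f\<^sub>3(1)\<close> leads back to \<open>w\<^sub>0\<close>, and \<open>\<langle>w\<^sub>0\<rangle>\<close> is irreducible. The same \<open>sl\<^sub>2\<close>-triple shows that the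
  integrable part is not larger. The Sugawara operator shows that an irreducible module with a singular vector
  is determined by its weight, without any complete reducibility.\<close>

subsection \<open>Linear algebra\<close>

text \<open>Two obstacles shape the proof. The action on the triple tensor product is given by
  convolution sums, so its mode algebra has to be established, and only the commutator formula is
  proved for it. This makes it an affine module, but stability of the affine submodule of
  \<open>w0\<close> under the modes of every element of \<open>V\<^sup>k\<close> does not follow
  from iterates. It is obtained indirectly: every vector of \<open>V\<^sup>k\<close> is integrable,
  the commutator formula then makes the integrable part stable under all modes, and the integrable
  part turns out to be the affine submodule of \<open>w0\<close>.

  The second obstacle is a bound on degrees that survives the inversion of
  \<open>e\<^sub>3(-1)\<close>. The grading by powers of \<open>t\<close> is shifted by
  \<open>e\<^sub>3(-1)\<close>. Giving \<open>A t\<^sup>n\<close> the degree \<open>2n + i\<close>,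
  where \<open>i\<close> is the eigenvalue of \<open>ad(h\<^sub>1 + h\<^sub>2)\<close> on
  \<open>A\<close>, puts \<open>e\<^sub>3(-1)\<close> and \<open>f\<^sub>3(1)\<close> in degree 0,
  so their \<open>sl\<^sub>2\<close>-triple, the only place where the size of \<open>k\<close>
  matters, acts inside a fixed step of the filtration.

  The values of \<open>x\<close> and \<open>m\<^sub>1\<close> solve
  \<open>a = m\<^sub>1 - 2x\<close> and \<open>b = m\<^sub>1 + x\<close>, the weight equations for
  \<open>w0\<close>.\<close>

lemma clinear_sum: "clinear f \<Longrightarrow> f (\<Sum>i\<in>A. g i) = (\<Sum>i\<in>A. f (g i))"
  by (induction A rule: infinite_finite_induct) (simp_all add: clinear_0 clinear_add)

lemma clinear_minus: "clinear f \<Longrightarrow> f (- u) = - f u"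
  using clinear_diff[of f 0 u] by (simp add: clinear_0)

lemmas clinear_simps = clinear_0 clinear_add clinear_diff clinear_minus clinear_scale

lemma clinear_id [intro]: "clinear (\<lambda>u. u)"
  by (simp add: clinear_iff)

lemma clinear_const_scale [intro]: "clinear f \<Longrightarrow> clinear (\<lambda>u. z *\<^sub>C f u)"
  by (simp add: clinear_iff cscale_right_distrib cvec.scale_left_commute)

lemma clinear_plus [intro]: "clinear f \<Longrightarrow> clinear g \<Longrightarrow> clinear (\<lambda>u. f u + g u)"
  by (simp add: clinear_iff cscale_right_distrib)

lemma clinear_minus_fun [intro]: "clinear f \<Longrightarrow> clinear g \<Longrightarrow> clinear (\<lambda>u. f u - g u)"
  by (simp add: clinear_iff cvec.scale_right_diff_distrib)

lemma clinear_neg_fun [intro]: "clinear f \<Longrightarrow> clinear (\<lambda>u. - f u)"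
  by (simp add: clinear_iff cvec.scale_minus_right)

lemma cbilinearD: "cbilinear f \<Longrightarrow> clinear (f u)" "cbilinear f \<Longrightarrow> clinear (\<lambda>u. f u w)"
  by (simp_all add: cbilinear_def)

lemma Sum_any_clinear:
  assumes f: "clinear f" and fin: "finite {i. g i \<noteq> 0}"
  shows "f (Sum_any g) = Sum_any (\<lambda>i. f (g i))"
proof -
  have "Sum_any (\<lambda>i. f (g i)) = (\<Sum>i | g i \<noteq> 0. f (g i))"
    by (rule Sum_any.expand_superset[OF fin]) (auto simp: clinear_0[OF f])
  then show ?thesis by (simp add: Sum_any.expand_set clinear_sum[OF f])
qed

lemma Sum_any_in_subspace:
  assumes "cvec.subspace N" "\<And>i. g i \<in> N"
  shows "Sum_any g \<in> N"
  unfolding Sum_any.expand_set using assms by (intro cvec.subspace_sum)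

lemma Sum_any_single:
  assumes "\<And>j. j \<noteq> i \<Longrightarrow> g j = 0" shows "Sum_any g = g i"
proof -
  have "Sum_any g = sum g {i}" by (rule Sum_any.expand_superset) (use assms in auto)
  then show ?thesis by simp
qed

lemma clinear_eq_on_span:
  assumes "clinear f" "clinear g" "\<And>u. u \<in> B \<Longrightarrow> f u = g u" "w \<in> cvec.span B"
  shows "f w = g w"
  using assms(4)
proof (induction rule: cvec.span_induct_alt)
  case base then show ?case using assms by (simp add: clinear_0)
next
  case (step z u w) then show ?case using assms by (simp add: clinear_add clinear_scale)
qed

lemma clinear_maps_span:
  assumes "clinear f" "cvec.subspace N" "\<And>u. u \<in> B \<Longrightarrow> f u \<in> N" "w \<in> cvec.span B"
  shows "f w \<in> N"
  using assms(4)
proof (induction rule: cvec.span_induct_alt)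
  case base then show ?case using assms by (simp add: clinear_0 cvec.subspace_0)
next
  case (step z u w)
  then show ?case using assms by (simp add: clinear_add clinear_scale cvec.subspace_add cvec.subspace_scale)
qed

lemma subspace_vimage: "clinear f \<Longrightarrow> cvec.subspace N \<Longrightarrow> cvec.subspace {u. f u \<in> N}"
  by (simp add: cvec.subspace_def clinear_0 clinear_add clinear_scale)

lemma subspace_image_clinear: "clinear f \<Longrightarrow> cvec.subspace N \<Longrightarrow> cvec.subspace (f ` N)"
  unfolding cvec.subspace_def
  by (auto simp: image_iff) (metis clinear_simps(1,2,5))+

lemma clinear_funpow: "clinear f \<Longrightarrow> clinear (f ^^ n)" for f :: "'a::cvec \<Rightarrow> 'a"
  by (induction n) (simp_all add: clinear_iff)

section \<open>Tensor products of vector spaces\<close>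

lemma tensor_simps [simp]:
  "(u + u') \<otimes>\<^sub>C w = u \<otimes>\<^sub>C w + u' \<otimes>\<^sub>C w" "u \<otimes>\<^sub>C (w + w') = u \<otimes>\<^sub>C w + u \<otimes>\<^sub>C w'"
  "(u - u') \<otimes>\<^sub>C w = u \<otimes>\<^sub>C w - u' \<otimes>\<^sub>C w" "u \<otimes>\<^sub>C (w - w') = u \<otimes>\<^sub>C w - u \<otimes>\<^sub>C w'"
  "(- u) \<otimes>\<^sub>C w = - (u \<otimes>\<^sub>C w)" "u \<otimes>\<^sub>C (- w) = - (u \<otimes>\<^sub>C w)"
  "(z *\<^sub>C u) \<otimes>\<^sub>C w = z *\<^sub>C (u \<otimes>\<^sub>C w)" "u \<otimes>\<^sub>C (z *\<^sub>C w) = z *\<^sub>C (u \<otimes>\<^sub>C w)"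
  "0 \<otimes>\<^sub>C w = 0" "u \<otimes>\<^sub>C 0 = 0"
  by (simp_all only: clinear_simps[OF cbilinearD(1)[OF cbilinear_tensor]]
      clinear_simps[OF cbilinearD(2)[OF cbilinear_tensor]])

lemma clinear_tensor_left [intro]: "clinear f \<Longrightarrow> clinear (\<lambda>u. f u \<otimes>\<^sub>C w)"
  by (simp add: clinear_iff)

lemma clinear_tensor_right [intro]: "clinear f \<Longrightarrow> clinear (\<lambda>u. w \<otimes>\<^sub>C f u)"
  by (simp add: clinear_iff)

lemma tensor_span: "t \<in> cvec.span {u \<otimes>\<^sub>C w | u w. True}"
proof -
  obtain p where t: "t = abs_ctensor p"
    by (rule that, rule Quotient3_abs_rep[OF Quotient3_ctensor, symmetric])
  have "p = (\<Sum>x\<in>Poly_Mapping.keys p. Poly_Mapping.lookup p x *\<^sub>C free_pair (fst x) (snd x))"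
    (is "_ = sum ?g _")
  proof (rule poly_mapping_eqI)
    fix y
    have "Poly_Mapping.lookup (sum ?g (Poly_Mapping.keys p)) y = (\<Sum>x\<in>Poly_Mapping.keys p. if x = y then Poly_Mapping.lookup p x else 0)"
      unfolding lookup_sum by (rule sum.cong) (auto simp: lookup_cscale lookup_single when_def cscale_complex_def)
    then show "Poly_Mapping.lookup p y = Poly_Mapping.lookup (sum ?g (Poly_Mapping.keys p)) y"
      by (simp add: in_keys_iff)
  qed
  moreover have "abs_ctensor (\<Sum>x\<in>A. z x *\<^sub>C free_pair (fst x) (snd x)) = (\<Sum>x\<in>A. z x *\<^sub>C (fst x \<otimes>\<^sub>C snd x))"
    if "finite A" for A and z :: "'a \<times> 'b \<Rightarrow> complex"
    using that
  proof induction
    case empty show ?case by (simp add: zero_ctensor_def)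
  next
    case (insert x F)
    have "abs_ctensor (z x *\<^sub>C free_pair (fst x) (snd x) + (\<Sum>x\<in>F. z x *\<^sub>C free_pair (fst x) (snd x)))
      = z x *\<^sub>C (fst x \<otimes>\<^sub>C snd x) + (\<Sum>x\<in>F. z x *\<^sub>C (fst x \<otimes>\<^sub>C snd x))"
      unfolding plus_ctensor.abs_eq[symmetric] insert.IH cscale_ctensor.abs_eq[symmetric]
      by (simp only: tensor.abs_eq)
    then show ?case by (simp only: sum.insert[OF insert.hyps])
  qed
  note this[of "Poly_Mapping.keys p" "Poly_Mapping.lookup p", OF finite_keys]
  ultimately have "t = (\<Sum>x\<in>Poly_Mapping.keys p. Poly_Mapping.lookup p x *\<^sub>C (fst x \<otimes>\<^sub>C snd x))"
    unfolding t by (rule arg_cong[THEN trans])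
  then show ?thesis
    by (simp only:) (rule cvec.span_sum, rule cvec.span_scale, rule cvec.span_base, blast)
qed

text \<open>Scalars are absorbed into the left factor, so sums of pure tensors need no
  coefficients.\<close>

lemma tensor_induct [case_names zero step]:
  assumes "P 0" "\<And>u w t. P t \<Longrightarrow> P (u \<otimes>\<^sub>C w + t)"
  shows "P t"
  using tensor_span[of t]
proof (induction rule: cvec.span_induct_alt)
  case base show ?case by (rule assms(1))
next
  case (step z s t)
  then obtain u w where "s = u \<otimes>\<^sub>C w" by auto
  then show ?case using assms(2)[OF step(2), of "z *\<^sub>C u" w] by simp
qed

lemma functional_exists:
  fixes u :: "'a::cvec"
  assumes "u \<noteq> 0"
  obtains f :: "'a \<Rightarrow> complex" where "clinear f" "f u = 1"
proof -
  interpret p: vector_space_pair "cscale :: complex \<Rightarrow> 'a \<Rightarrow> 'a" "cscale :: complex \<Rightarrow> complex \<Rightarrow> complex" ..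
  have i: "\<not> cvec.dependent {u}" using assms by simp
  obtain g where "Vector_Spaces.linear cscale cscale g" "\<forall>w\<in>{u}. g w = (1::complex)"
    using p.linear_independent_extend[OF i, of "\<lambda>_. 1"] by auto
  then show ?thesis by (intro that[of g]) (auto simp: clinear_def)
qed

text \<open>Functionals equal to 1 on \<open>u\<close> and on \<open>w\<close> multiply to a
  bilinear form whose lift takes the value 1 on the pure tensor.\<close>

lemma tensor_nonzero:
  assumes "u \<noteq> 0" "w \<noteq> 0" shows "u \<otimes>\<^sub>C w \<noteq> 0"
proof
  obtain f where f: "clinear f" "f u = (1::complex)" using functional_exists[OF assms(1)] .
  obtain g where g: "clinear g" "g w = (1::complex)" using functional_exists[OF assms(2)] .
  have b: "cbilinear (\<lambda>u w. f u * g w)"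
    using f g by (auto simp: cbilinear_def clinear_iff cscale_complex_def algebra_simps)
  assume "u \<otimes>\<^sub>C w = 0"
  then have "tensor_lift (\<lambda>u w. f u * g w) (u \<otimes>\<^sub>C w) = 0"
    using clinear_0[OF clinear_tensor_lift[OF b]] by simp
  then show False by (simp add: tensor_lift_tensor[OF b] f g)
qed

definition tmap :: "('a::cvec \<Rightarrow> 'c::cvec) \<Rightarrow> ('b::cvec \<Rightarrow> 'd::cvec) \<Rightarrow> ('a, 'b) ctensor \<Rightarrow> ('c, 'd) ctensor"
  where "tmap f g = tensor_lift (\<lambda>u w. f u \<otimes>\<^sub>C g w)"

lemma
  assumes "clinear f" "clinear g"
  shows clinear_tmap: "clinear (tmap f g)"
    and tmap_tensor: "tmap f g (u \<otimes>\<^sub>C w) = f u \<otimes>\<^sub>C g w"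
proof -
  have b: "cbilinear (\<lambda>u w. f u \<otimes>\<^sub>C g w)"
    unfolding cbilinear_def using assms by (auto intro: clinear_tensor_left clinear_tensor_right)
  show "clinear (tmap f g)" unfolding tmap_def by (rule clinear_tensor_lift[OF b])
  show "tmap f g (u \<otimes>\<^sub>C w) = f u \<otimes>\<^sub>C g w" unfolding tmap_def by (rule tensor_lift_tensor[OF b])
qed

text \<open>Lagrange interpolation: in a space spanned by eigenvectors, the eigencomponents of a vector
  stay in every invariant subspace containing it.\<close>

lemma eigen_components_aux:
  assumes T: "clinear T" and "finite \<Lambda>"
    and ev: "\<And>l. l \<in> \<Lambda> \<Longrightarrow> T (f l) = l *\<^sub>C f l"
    and U: "cvec.subspace U" "\<And>w. w \<in> U \<Longrightarrow> T w \<in> U"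
    and "(\<Sum>l\<in>\<Lambda>. f l) \<in> U" "\<mu> \<in> \<Lambda>"
  shows "f \<mu> \<in> U"
  using assms(2-)
proof (induction "card \<Lambda>" arbitrary: \<Lambda> f rule: less_induct)
  case less
  show ?case
  proof (cases "\<Lambda> = {\<mu>}")
    case True then show ?thesis using less.prems(5) by simp
  next
    case False
    then obtain \<nu> where \<nu>: "\<nu> \<in> \<Lambda>" "\<nu> \<noteq> \<mu>" using less.prems(6) by blast
    \<comment> \<open>\<open>T - \<nu>\<close> kills the component at \<nu> and rescales the others,
      so the induction hypothesis applies to one eigenvalue less.\<close>
    define g where "g l = (l - \<nu>) *\<^sub>C f l" for l
    have "T (\<Sum>l\<in>\<Lambda>. f l) - \<nu> *\<^sub>C (\<Sum>l\<in>\<Lambda>. f l) = (\<Sum>l\<in>\<Lambda>. T (f l) - \<nu> *\<^sub>C f l)"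
      by (simp only: clinear_sum[OF T] cvec.scale_sum_right sum_subtractf)
    also have "\<dots> = (\<Sum>l\<in>\<Lambda>. g l)"
      by (rule sum.cong) (simp_all only: less.prems(2) g_def cvec.scale_left_diff_distrib)
    also have "\<dots> = (\<Sum>l\<in>\<Lambda> - {\<nu>}. g l)"
      using \<nu> less.prems(1) by (simp add: sum.remove[of \<Lambda> \<nu>] g_def)
    finally have "(\<Sum>l\<in>\<Lambda> - {\<nu>}. g l) \<in> U"
      using cvec.subspace_diff[OF less.prems(3) less.prems(4)[OF less.prems(5)]
          cvec.subspace_scale[OF less.prems(3) less.prems(5), of \<nu>]] by simp
    have c: "card (\<Lambda> - {\<nu>}) < card \<Lambda>"
      using \<nu>(1) less.prems(1) by (rule card_Diff1_less[rotated])
    have m: "finite (\<Lambda> - {\<nu>})" "\<mu> \<in> \<Lambda> - {\<nu>}" using less.prems(1,6) \<nu>(2) by auto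
    have e: "T (g l) = l *\<^sub>C g l" if "l \<in> \<Lambda> - {\<nu>}" for l
      using less.prems(2)[of l] that by (simp add: g_def clinear_scale[OF T] cscale_cscale mult.commute)
    have "g \<mu> \<in> U"
      by (rule less.hyps[OF c m(1) e less.prems(3,4) \<open>(\<Sum>l\<in>\<Lambda> - {\<nu>}. g l) \<in> U\<close> m(2)])
    then have "inverse (\<mu> - \<nu>) *\<^sub>C g \<mu> \<in> U" using less.prems(3) by (simp add: cvec.subspace_scale)
    then show ?thesis using \<nu> by (simp add: g_def cscale_cscale cscale_one)
  qed
qed

text \<open>The last conclusion ranges over all invariant subspaces, so that one decomposition can
  be tested against several of them at once, such as the integrable part and a step of a
  filtration.\<close>

lemma eigen_decomposition:
  assumes T: "clinear T" and S: "\<And>s. s \<in> S \<Longrightarrow> T s = ev s *\<^sub>C s"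
    and u: "u \<in> cvec.span S"
  obtains \<Lambda> f where "finite \<Lambda>" "u = (\<Sum>l\<in>\<Lambda>. f l)" "\<And>l. T (f l) = l *\<^sub>C f l"
    "\<And>l. f l \<in> cvec.span {s \<in> S. ev s = l}" "\<And>l. l \<notin> \<Lambda> \<Longrightarrow> f l = 0"
    "\<And>U l. cvec.subspace U \<Longrightarrow> T ` U \<subseteq> U \<Longrightarrow> u \<in> U \<Longrightarrow> f l \<in> U"
proof -
  have "\<exists>\<Lambda> f. finite \<Lambda> \<and> u = (\<Sum>l\<in>\<Lambda>. f l) \<and> (\<forall>l. f l \<in> cvec.span {s \<in> S. ev s = l})
     \<and> (\<forall>l. l \<notin> \<Lambda> \<longrightarrow> f l = 0)"
    using u
  proof (induction rule: cvec.span_induct_alt)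
    case base
    show ?case by (intro exI[of _ "{}"] exI[of _ "\<lambda>_. 0"]) (simp add: cvec.span_zero)
  next
    case (step z s w)
    then obtain \<Lambda> f where f: "finite \<Lambda>" "w = (\<Sum>l\<in>\<Lambda>. f l)"
      "\<And>l. f l \<in> cvec.span {s \<in> S. ev s = l}" "\<And>l. l \<notin> \<Lambda> \<Longrightarrow> f l = 0" by auto
    define g where "g l = (if l = ev s then z *\<^sub>C s + f l else f l)" for l
    have w: "w = (\<Sum>l\<in>insert (ev s) \<Lambda>. f l)"
      unfolding f(2) by (rule sum.mono_neutral_left) (use f(1,4) in auto)
    have "(\<Sum>l\<in>insert (ev s) \<Lambda>. g l) = z *\<^sub>C s + w"
    proof -
      have r: "(\<Sum>l\<in>insert (ev s) \<Lambda>. h l) = h (ev s) + (\<Sum>l\<in>\<Lambda> - {ev s}. h l)" for h :: "complex \<Rightarrow> 'a"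
        using f(1) by (rule sum.insert_remove)
      have "(\<Sum>l\<in>\<Lambda> - {ev s}. g l) = (\<Sum>l\<in>\<Lambda> - {ev s}. f l)"
        by (rule sum.cong) (auto simp: g_def)
      then show ?thesis unfolding w r by (simp add: g_def add.assoc)
    qed
    moreover have "g l \<in> cvec.span {s \<in> S. ev s = l}" for l
    proof (cases "l = ev s")
      case True
      have "z *\<^sub>C s \<in> cvec.span {s \<in> S. ev s = l}"
        using step(1) True by (intro cvec.span_scale cvec.span_base) simp
      then show ?thesis using cvec.span_add[OF _ f(3)] True by (simp add: g_def)
    next
      case False then show ?thesis using f(3) by (simp add: g_def)
    qed
    ultimately show ?case using f(1,4)
      by (intro exI[of _ "insert (ev s) \<Lambda>"] exI[of _ g]) (auto simp: g_def)
  qed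
  then obtain \<Lambda> f where f: "finite \<Lambda>" "u = (\<Sum>l\<in>\<Lambda>. f l)"
    "\<And>l. f l \<in> cvec.span {s \<in> S. ev s = l}" "\<And>l. l \<notin> \<Lambda> \<Longrightarrow> f l = 0" by auto
  have ev: "T (f l) = l *\<^sub>C f l" for l
    by (rule clinear_eq_on_span[OF T _ _ f(3)]) (auto simp: S)
  show ?thesis
  proof (rule that[OF f(1,2) ev f(3,4)])
    fix U l assume U: "cvec.subspace U" "T ` U \<subseteq> U" "u \<in> U"
    show "f l \<in> U"
    proof (cases "l \<in> \<Lambda>")
      case True
      show ?thesis
        by (rule eigen_components_aux[OF T f(1) ev U(1) _ _ True]) (use U(2,3) f(2) in auto)
    next
      case False then show ?thesis using f(4) cvec.subspace_0[OF U(1)] by simp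
    qed
  qed
qed

text \<open>Taking the \<mu>-eigenspace as the invariant subspace of the decomposition gives each
  component two eigenvalues, so only the component at \<mu> survives.\<close>

lemma eigenvector_in_span:
  assumes T: "clinear T" and S: "\<And>s. s \<in> S \<Longrightarrow> T s = ev s *\<^sub>C s"
    and u: "u \<in> cvec.span S" "T u = \<mu> *\<^sub>C u"
  shows "u \<in> cvec.span {s \<in> S. ev s = \<mu>}"
proof -
  obtain \<Lambda> f where f: "finite \<Lambda>" "u = (\<Sum>l\<in>\<Lambda>. f l)" "\<And>l. T (f l) = l *\<^sub>C f l"
    "\<And>l. f l \<in> cvec.span {s \<in> S. ev s = l}" "\<And>l. l \<notin> \<Lambda> \<Longrightarrow> f l = 0"
    "\<And>U l. cvec.subspace U \<Longrightarrow> T ` U \<subseteq> U \<Longrightarrow> u \<in> U \<Longrightarrow> f l \<in> U"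
    by (rule eigen_decomposition[OF T _ u(1)]) (use S in blast)+
  define E where "E = {w. T w = \<mu> *\<^sub>C w}"
  have "cvec.subspace E" "T ` E \<subseteq> E" "u \<in> E"
    using u(2) by (auto simp: E_def cvec.subspace_def clinear_simps[OF T] cscale_right_distrib cvec.scale_left_commute)
  then have "f l \<in> E" for l by (rule f(6))
  then have "(l - \<mu>) *\<^sub>C f l = 0" for l
    unfolding cvec.scale_left_diff_distrib by (metis (mono_tags, lifting) E_def f(3) mem_Collect_eq right_minus_eq)
  then have "f l = 0" if "l \<noteq> \<mu>" for l
    using that cvec.scale_eq_0_iff[of "l - \<mu>" "f l"] by auto
  then have z: "sum f (\<Lambda> - {\<mu>}) = 0" by (intro sum.neutral) auto
  have "u = f \<mu>"
  proof (cases "\<mu> \<in> \<Lambda>")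
    case True then show ?thesis using sum.remove[OF f(1) True, of f] z f(2) by simp
  next
    case False then show ?thesis using z f(2) f(5)[OF False] by simp
  qed
  then show ?thesis using f(4) by simp
qed

definition fin_dim :: "'a::cvec set \<Rightarrow> bool"
  where "fin_dim U \<longleftrightarrow> (\<exists>B. finite B \<and> U \<subseteq> cvec.span B)"

text \<open>If \<open>g n\<close> depended on the other vectors, \<open>eigenvector_in_span\<close>
  would put it into the span of those among them with eigenvalue \<open>\<mu> n\<close>, and there
  are none.\<close>

lemma eigenvectors_independent:
  assumes T: "clinear T" and ev: "\<And>n::nat. T (g n) = \<mu> n *\<^sub>C g n" and inj: "inj \<mu>"
    and nz: "\<And>n. g n \<noteq> 0" and U: "fin_dim U" "\<And>n. g n \<in> U"
  shows False
proof -
  have injg: "inj g"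
  proof (rule injI)
    fix m n assume e: "g m = g n"
    then have "(\<mu> m - \<mu> n) *\<^sub>C g n = 0" using ev[of m] ev[of n] unfolding e cvec.scale_left_diff_distrib by (metis
        right_minus_eq)
    then show "m = n" using nz[of n] inj by (auto simp: inj_eq)
  qed
  have ind: "\<not> cvec.dependent (range g)"
  proof
    assume "cvec.dependent (range g)"
    then obtain n where n: "g n \<in> cvec.span (range g - {g n})" unfolding cvec.dependent_def by auto
    define ev' where "ev' s = \<mu> (inv g s)" for s
    have "g n \<in> cvec.span {s \<in> range g - {g n}. ev' s = \<mu> n}"
      by (rule eigenvector_in_span[OF T _ n ev]) (auto simp: ev'_def injg ev)
    also have "{s \<in> range g - {g n}. ev' s = \<mu> n} = {}"
      using inj by (auto simp: ev'_def injg inj_eq)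
    finally show False using nz by simp
  qed
  obtain B where B: "finite B" "U \<subseteq> cvec.span B" using U(1) by (auto simp: fin_dim_def)
  then have "range g \<subseteq> cvec.span B" using U(2) by auto
  then have "finite (range g)" using cvec.independent_span_bound[OF B(1) ind] by simp
  then show False using injg finite_imageD[of g UNIV] by simp
qed

subsection \<open>Tensor products of modules\<close>

text \<open>For mutually local fields, \<open>(z - w)\<^sup>N a(z)b(w)u\<close> is a two-variable Laurent series
  \<open>\<Sum> p(m,n) z\<^sup>-\<^sup>m\<^sup>-\<^sup>1 w\<^sup>-\<^sup>n\<^sup>-\<^sup>1\<close>. The three expansions of \<open>p/(z - w)\<^sup>N\<close> are \<open>a(z)b(w)u\<close>, \<open>b(w)a(z)u\<close> and
  the iterate \<open>Y(Y(a,z-w)b,w)u\<close>; since they only involve antidiagonals of \<open>p\<close>, they multiply well under tensor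
  products by Vandermonde's identity.\<close>

definition gb :: "complex \<Rightarrow> int \<Rightarrow> complex"
  where "gb a s = (if s < 0 then 0 else a gchoose nat s)"

lemma gb_neg [simp]: "s < 0 \<Longrightarrow> gb a s = 0" and gb_nat [simp]: "gb a (int n) = a gchoose n"
  by (simp_all add: gb_def)

lemma gb_zero: "gb 0 s = (if s = 0 then 1 else 0)"
  by (auto simp: gb_def gbinomial_0_left)

lemma Sum_any_bij:
  assumes "bij h" shows "Sum_any g = Sum_any (\<lambda>x. g (h x))"
  by (rule Sum_any.reindex_cong[OF assms]) (simp add: comp_def)

lemma bij_int_shift: "bij (\<lambda>i::int. i + c)" "bij (\<lambda>i::int. c + i)" "bij (\<lambda>i::int. c - i)" "bij (\<lambda>i::int. i - c)"
  using bij_betw_byWitness[of UNIV "\<lambda>i. i - c" "\<lambda>i. i + c" UNIV]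
    bij_betw_byWitness[of UNIV "\<lambda>i. i - c" "\<lambda>i. c + i" UNIV]
    bij_betw_byWitness[of UNIV "\<lambda>i. c - i" "\<lambda>i. c - i" UNIV]
    bij_betw_byWitness[of UNIV "\<lambda>i. i + c" "\<lambda>i. i - c" UNIV]
  by (simp_all only: diff_add_cancel add_diff_cancel add_diff_cancel_left' diff_diff_eq2 subset_UNIV simp_thms ball_UNIV)
    simp_all

lemma Sum_any_pair:
  assumes fin: "finite {(i, j). g i j \<noteq> 0}"
  shows "Sum_any (\<lambda>i. Sum_any (g i)) = Sum_any (\<lambda>(i, j). g i j)"
    and "Sum_any (\<lambda>j. Sum_any (\<lambda>i. g i j)) = Sum_any (\<lambda>(i, j). g i j)"
proof -
  let ?F = "{(i, j). g i j \<noteq> 0}"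
  let ?C = "(fst ` ?F) \<times> (snd ` ?F)"
  have C: "finite ?C" using fin by blast
  have sub: "{a. \<exists>b. g a b \<noteq> 0} \<times> {b. \<exists>a. g a b \<noteq> 0} \<subseteq> ?C" by (force simp: image_iff)
  show 1: "Sum_any (\<lambda>i. Sum_any (g i)) = Sum_any (\<lambda>(i, j). g i j)"
    by (rule Sum_any.cartesian_product[OF C sub])
  show "Sum_any (\<lambda>j. Sum_any (\<lambda>i. g i j)) = Sum_any (\<lambda>(i, j). g i j)"
    using Sum_any.swap[OF C sub] 1 by simp
qed

text \<open>Vandermonde's identity. Extending the binomial coefficients by 0 to negative lower
  indices turns it into a convolution over all integers with arbitrary shifts.\<close>

lemma gb_conv:
  "finite {i. gb a (i - \<alpha>) * gb b (\<beta> - i) \<noteq> 0}"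
  "Sum_any (\<lambda>i. gb a (i - \<alpha>) * gb b (\<beta> - i)) = gb (a + b) (\<beta> - \<alpha>)"
proof -
  have sub: "{i. gb a (i - \<alpha>) * gb b (\<beta> - i) \<noteq> 0} \<subseteq> {\<alpha>..\<beta>}" by (auto simp: gb_def split: if_splits)
  then show "finite {i. gb a (i - \<alpha>) * gb b (\<beta> - i) \<noteq> 0}" by (rule finite_subset) simp
  have eq: "Sum_any (\<lambda>i. gb a (i - \<alpha>) * gb b (\<beta> - i)) = (\<Sum>i\<in>{\<alpha>..\<beta>}. gb a (i - \<alpha>) * gb b (\<beta> - i))"
    by (rule Sum_any.expand_superset[OF _ sub]) simp
  show "Sum_any (\<lambda>i. gb a (i - \<alpha>) * gb b (\<beta> - i)) = gb (a + b) (\<beta> - \<alpha>)"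
  proof (cases "\<alpha> \<le> \<beta>")
    case False then show ?thesis unfolding eq by simp
  next
    case True
    define n where "n = nat (\<beta> - \<alpha>)"
    have n: "\<beta> = \<alpha> + int n" using True by (simp add: n_def)
    have nn: "nat (\<alpha> + int n - i) = n - nat (i - \<alpha>)" if "\<alpha> \<le> i" for i
      using that by arith
    have "(\<Sum>i\<in>{\<alpha>..\<beta>}. gb a (i - \<alpha>) * gb b (\<beta> - i)) = (\<Sum>k=0..n. (a gchoose k) * (b gchoose (n - k)))"
      by (rule sum.reindex_bij_witness[of _ "\<lambda>k. \<alpha> + int k" "\<lambda>i. nat (i - \<alpha>)"])
        (auto simp: n gb_def nn)
    also have "\<dots> = (a + b) gchoose n" by (rule gbinomial_Vandermonde)
    finally show ?thesis unfolding eq by (simp add: n)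
  qed
qed

definition sgn1 :: "int \<Rightarrow> complex" where "sgn1 s = (if even s then 1 else - 1)"

lemma sgn1_add: "sgn1 (s + t) = sgn1 s * sgn1 t" and sgn1_diff: "sgn1 (s - t) = sgn1 s * sgn1 t"
  and sgn1_neg [simp]: "sgn1 (- s) = sgn1 s" and sgn1_sq [simp]: "sgn1 s * sgn1 s = 1"
  by (auto simp: sgn1_def)

lemma sgn1_nat: "sgn1 (int n) = (- 1) ^ n" and sgn1_powi: "(- 1) powi s = sgn1 s"
  by (auto simp: sgn1_def power_int_minus_left)

text \<open>\<open>cb N\<close> gives the coefficients of \<open>(z - w)\<^sup>-\<^sup>N\<close> for \<open>|z| > |w|\<close>.\<close>

definition cb :: "nat \<Rightarrow> int \<Rightarrow> complex"
  where "cb N s = sgn1 s * gb (- of_nat N) s"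

lemma cb_neg [simp]: "s < 0 \<Longrightarrow> cb N s = 0" by (simp add: cb_def)

text \<open>Coefficients of \<open>(z - w)^(-N) (z - w)^(-M) = (z - w)^(-N-M)\<close>; the sign
  depends only on the total index and factors out.\<close>

lemma cb_conv:
  "finite {i. cb N (i - \<alpha>) * cb M (\<beta> - i) \<noteq> 0}"
  "Sum_any (\<lambda>i. cb N (i - \<alpha>) * cb M (\<beta> - i)) = cb (N + M) (\<beta> - \<alpha>)"
proof -
  have e: "cb N (i - \<alpha>) * cb M (\<beta> - i) = sgn1 (\<beta> - \<alpha>) * (gb (- of_nat N) (i - \<alpha>) * gb (- of_nat M) (\<beta> - i))" for i
    by (simp add: cb_def sgn1_diff algebra_simps)
  show "finite {i. cb N (i - \<alpha>) * cb M (\<beta> - i) \<noteq> 0}"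
    unfolding e by (rule finite_subset[OF _ gb_conv(1)]) auto
  show "Sum_any (\<lambda>i. cb N (i - \<alpha>) * cb M (\<beta> - i)) = cb (N + M) (\<beta> - \<alpha>)"
    unfolding e by (subst Sum_any_right_distrib[symmetric, OF gb_conv(1)]) (simp add: gb_conv(2) cb_def)
qed

section \<open>Weighted sums along antidiagonals and the three expansions\<close>

definition dsum :: "(int \<Rightarrow> complex) \<Rightarrow> int \<Rightarrow> (int \<Rightarrow> int \<Rightarrow> 'm::cvec) \<Rightarrow> 'm"
  where "dsum \<kappa> D p = Sum_any (\<lambda>\<mu>. \<kappa> \<mu> *\<^sub>C p \<mu> (D - \<mu>))"

definition bdd_series :: "(int \<Rightarrow> int \<Rightarrow> 'm::cvec) \<Rightarrow> bool"
  where "bdd_series p \<longleftrightarrow> (\<exists>K. \<forall>m n. m \<ge> K \<or> n \<ge> K \<longrightarrow> p m n = 0)"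

lemma bdd_series_finite:
  assumes "bdd_series p" shows "finite {\<mu>. p \<mu> (D - \<mu>) \<noteq> 0}"
proof -
  obtain K where K: "\<And>m n. m \<ge> K \<or> n \<ge> K \<Longrightarrow> p m n = 0" using assms by (auto simp: bdd_series_def)
  have "{\<mu>. p \<mu> (D - \<mu>) \<noteq> 0} \<subseteq> {D - K..K}"
  proof
    fix \<mu> assume "\<mu> \<in> {\<mu>. p \<mu> (D - \<mu>) \<noteq> 0}"
    then have "\<not> (\<mu> \<ge> K \<or> D - \<mu> \<ge> K)" using K by blast
    then show "\<mu> \<in> {D - K..K}" by auto
  qed
  then show ?thesis by (rule finite_subset) simp
qed

lemma dsum_finite:
  assumes "bdd_series p" shows "finite {\<mu>. \<kappa> \<mu> *\<^sub>C p \<mu> (D - \<mu>) \<noteq> 0}"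
  by (rule finite_subset[OF _ bdd_series_finite[OF assms, of D]]) auto

lemma dsum_add:
  assumes "bdd_series p" shows "dsum (\<lambda>\<mu>. \<kappa> \<mu> + \<kappa>' \<mu>) D p = dsum \<kappa> D p + dsum \<kappa>' D p"
  unfolding dsum_def cscale_left_distrib
  by (rule Sum_any.distrib) (rule dsum_finite[OF assms])+

lemma dsum_scale:
  assumes "bdd_series p" shows "dsum (\<lambda>\<mu>. z * \<kappa> \<mu>) D p = z *\<^sub>C dsum \<kappa> D p"
  unfolding dsum_def
  by (subst Sum_any_clinear[of "\<lambda>u. z *\<^sub>C u"])
    (auto simp: cscale_cscale intro: finite_subset[OF _ bdd_series_finite[OF assms]])

lemma dsum_diff:
  assumes "bdd_series p" shows "dsum (\<lambda>\<mu>. \<kappa> \<mu> - \<kappa>' \<mu>) D p = dsum \<kappa> D p - dsum \<kappa>' D p"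
  using dsum_add[OF assms, of \<kappa> "\<lambda>\<mu>. (-1) * \<kappa>' \<mu>" D] unfolding dsum_scale[OF assms]
  by (simp add: cvec.scale_minus_left cscale_one)

lemma dsum_sum:
  assumes "bdd_series p" shows "dsum (\<lambda>\<mu>. \<Sum>i\<in>A. \<kappa> i \<mu>) D p = (\<Sum>i\<in>A. dsum (\<kappa> i) D p)"
proof (induction A rule: infinite_finite_induct)
  case (insert x F) then show ?case by (simp add: dsum_add[OF assms])
qed (simp_all add: dsum_def)

lemma dsum_cong:
  assumes "\<And>\<mu>. p \<mu> (D - \<mu>) \<noteq> 0 \<Longrightarrow> \<kappa> \<mu> = \<kappa>' \<mu>"
  shows "dsum \<kappa> D p = dsum \<kappa>' D p"
  unfolding dsum_def by (rule Sum_any.cong) (metis assms cvec.scale_zero_right)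

text \<open>Expanding \<open>z^(-\<mu>-1)\<close> in powers of \<open>z - w\<close> and dividing by
  \<open>(z - w)^N\<close>, this is the coefficient at \<open>(z - w)^(-t-1)\<close>.\<close>

definition kap3 :: "nat \<Rightarrow> int \<Rightarrow> int \<Rightarrow> complex"
  where "kap3 N t \<mu> = gb (of_int (- \<mu> - 1)) (int N - 1 - t)"

text \<open>The three equations are the expansions of \<open>p/(z - w)^N\<close> for |z| > |w|, for
  |w| > |z| and for |w| > |z - w|. As all are read off the same \<open>p\<close>, a tensor product
  of fields only has to multiply the series.\<close>

definition vrep ::
  "('v \<Rightarrow> int \<Rightarrow> 'v \<Rightarrow> 'v) \<Rightarrow> ('v \<Rightarrow> int \<Rightarrow> 'm \<Rightarrow> 'm) \<Rightarrow> 'v \<Rightarrow> 'v \<Rightarrow> 'm::cvec \<Rightarrow> nat \<Rightarrow> (int \<Rightarrow> int \<Rightarrow> 'm) \<Rightarrow> bool"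
  where "vrep Y act a b u N p \<longleftrightarrow> bdd_series p \<and>
    (\<forall>m n. act a m (act b n u) = dsum (\<lambda>\<mu>. cb N (m - int N - \<mu>)) (m + n - int N) p) \<and>
    (\<forall>m n. act b n (act a m u) = dsum (\<lambda>\<mu>. sgn1 (int N) * cb N (\<mu> - m)) (m + n - int N) p) \<and>
    (\<forall>t q. act (Y a t b) q u = dsum (kap3 N t) (q + t - int N) p)"

text \<open>The left side is the coefficient of \<open>z^\<mu> w^(r-\<mu>)\<close> in
  \<open>(z - w)^r\<close> expanded for |z| > |w|, minus that for |w| > |z|. For
  \<open>r \<ge> 0\<close> both are the same polynomial and the lower index on the right is
  negative; for \<open>r < 0\<close> the difference is a derivative of the delta function. The three
  ranges of \<mu> are those where only the second expansion, neither, or only the first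
  contributes.\<close>

lemma kap_identity:
  "gb (of_int r) (r - \<mu>) * sgn1 (r - \<mu>) - gb (of_int r) \<mu> * sgn1 (r - \<mu>) = gb (of_int (- \<mu> - 1)) (- 1 - r)"
proof (cases "r \<ge> 0")
  case True
  have "gb (of_int r) (r - \<mu>) = gb (of_int r) \<mu>"
  proof (cases "0 \<le> \<mu> \<and> \<mu> \<le> r")
    case m: True
    then have "nat \<mu> \<le> nat r" by linarith
    from gbinomial_of_nat_symmetric[OF this, where 'a = complex] m True
    have "complex_of_int r gchoose nat (r - \<mu>) = complex_of_int r gchoose nat \<mu>"
      by (simp add: nat_diff_distrib')
    then show ?thesis using m by (simp add: gb_def)
  next
    case False
    have "complex_of_int r gchoose nat s = 0" if "s > r" for s
      using binomial_gbinomial[of "nat r" "nat s", where 'a = complex] True that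
      by (simp add: binomial_eq_0)
    then show ?thesis using False True by (auto simp: gb_def)
  qed
  then show ?thesis using True by simp
next
  case False
  define R where "R = nat (- 1 - r)"
  have r: "r = - 1 - int R" using False by (simp add: R_def)
  have iR: "- 1 - r = int R" by (simp add: r)
  have neg: "gb (of_int r) (int s) = (- 1) ^ s * of_nat ((R + s) choose R)" for s
  proof -
    have "complex_of_int r gchoose s = (- 1) ^ s * ((of_nat s - of_int r - 1) gchoose s)"
      by (rule gbinomial_negated_upper)
    also have "of_nat s - of_int r - 1 = (of_nat (R + s) :: complex)" by (simp add: r)
    also have "(of_nat (R + s) gchoose s :: complex) = of_nat ((R + s) choose s)"
      by (simp only: binomial_gbinomial)
    also have "(R + s) choose s = (R + s) choose R" using binomial_symmetric[of R "R + s"] by simp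
    finally show ?thesis by simp
  qed
  consider "\<mu> \<ge> 0" | "\<mu> < 0" "r < \<mu>" | "\<mu> \<le> r" by linarith
  then show ?thesis
  proof cases
    case 1
    define s where "s = nat \<mu>"
    have \<mu>: "\<mu> = int s" using 1 by (simp add: s_def)
    have "complex_of_int (- \<mu> - 1) gchoose R = (- 1) ^ R * ((of_nat R - of_int (- \<mu> - 1) - 1) gchoose R)"
      by (rule gbinomial_negated_upper)
    also have "of_nat R - of_int (- \<mu> - 1) - 1 = (of_nat (R + s) :: complex)" by (simp add: \<mu>)
    also have "(of_nat (R + s) gchoose R :: complex) = of_nat ((R + s) choose R)"
      by (simp only: binomial_gbinomial)
    finally have "gb (of_int (- \<mu> - 1)) (- 1 - r) = (- 1) ^ R * of_nat ((R + s) choose R)"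
      by (simp only: iR gb_nat)
    moreover have "gb (of_int r) (r - \<mu>) = 0" using 1 False by simp
    moreover have "sgn1 (r - \<mu>) * (- 1) ^ s = - ((- 1) ^ R)"
      by (auto simp: sgn1_def r \<mu> minus_one_power_iff)
    moreover have "gb (of_int r) \<mu> * sgn1 (r - \<mu>) = (sgn1 (r - \<mu>) * (- 1) ^ s) * of_nat ((R + s) choose R)"
      unfolding \<mu> neg by (simp only: ac_simps)
    ultimately show ?thesis by simp
  next
    case 2
    have "complex_of_int (- \<mu> - 1) gchoose R = 0"
      using binomial_gbinomial[of "nat (- \<mu> - 1)" R, where 'a = complex] 2 r
      by (simp add: binomial_eq_0)
    then have "gb (of_int (- \<mu> - 1)) (- 1 - r) = 0" by (simp only: iR gb_nat)
    then show ?thesis using 2 by simp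
  next
    case 3
    define s where "s = nat (r - \<mu>)"
    have s: "r - \<mu> = int s" using 3 by (simp add: s_def)
    have "- \<mu> - 1 = int (R + s)" using s r by simp
    then have "gb (of_int (- \<mu> - 1)) (- 1 - r) = of_nat ((R + s) choose R)"
      by (simp add: r gb_def binomial_gbinomial)
    moreover have "gb (of_int r) \<mu> = 0" using 3 False by simp
    ultimately show ?thesis using neg[of s] by (simp add: s sgn1_nat)
  qed
qed

text \<open>The difference of the two expansions of \<open>(z - w)^(-N)\<close> is one binomial
  coefficient with upper index \<open>r - 1\<close>; splitting this as
  \<open>m + (r - m - 1)\<close> in Vandermonde's identity produces the right side of the commutator
  formula.\<close>

lemma cb_minus_cb:
  "cb N (r - int N) - sgn1 (int N) * cb N (- r) = (\<Sum>j<N. (of_int m gchoose j) * gb (of_int (r - m - 1)) (int N - 1 - int j))"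
proof -
  have e: "cb N (r - int N) - sgn1 (int N) * cb N (- r) = gb (of_int (r - 1)) (int N - 1)"
    using kap_identity[of "- int N" "- r"]
    by (simp add: cb_def sgn1_diff algebra_simps)
  show ?thesis
  proof (cases N)
    case 0 then show ?thesis unfolding e by simp
  next
    case (Suc M)
    have "(\<Sum>j<N. (of_int m gchoose j) * gb (of_int (r - m - 1)) (int N - 1 - int j))
       = (\<Sum>i\<in>{0..int M}. gb (of_int m) (i - 0) * gb (of_int (r - m - 1)) (int M - i))"
      by (rule sum.reindex_bij_witness[of _ nat int]) (auto simp: Suc)
    also have "\<dots> = Sum_any (\<lambda>i. gb (of_int m) (i - 0) * gb (of_int (r - m - 1)) (int M - i))"
      by (rule Sum_any.expand_superset[symmetric]) (auto simp: gb_def split: if_splits)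
    also have "\<dots> = gb (of_int m + of_int (r - m - 1)) (int M - 0)" by (rule gb_conv)
    finally show ?thesis unfolding e by (simp add: Suc)
  qed
qed

lemma vrep_commutator:
  assumes "vrep Y act a b u N p"
  shows "act a m (act b n u) - act b n (act a m u) =
      (\<Sum>j<N. (of_int m gchoose j) *\<^sub>C act (Y a (int j) b) (m + n - int j) u)"
    and "t \<ge> int N \<Longrightarrow> act (Y a t b) q u = 0"
proof -
  have p: "bdd_series p" using assms by (simp add: vrep_def)
  have "act a m (act b n u) - act b n (act a m u)
     = dsum (\<lambda>\<mu>. cb N (m - \<mu> - int N) - sgn1 (int N) * cb N (- (m - \<mu>))) (m + n - int N) p"
    using assms unfolding dsum_diff[OF p] by (simp add: vrep_def algebra_simps)
  also have "\<dots> = dsum (\<lambda>\<mu>. \<Sum>j<N. (of_int m gchoose j) * kap3 N (int j) \<mu>) (m + n - int N) p"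
    unfolding cb_minus_cb[of N _ m] by (rule dsum_cong) (simp add: kap3_def)
  also have "\<dots> = (\<Sum>j<N. (of_int m gchoose j) *\<^sub>C act (Y a (int j) b) (m + n - int j) u)"
    unfolding dsum_sum[OF p] dsum_scale[OF p] using assms by (simp add: vrep_def)
  finally show "act a m (act b n u) - act b n (act a m u) =
      (\<Sum>j<N. (of_int m gchoose j) *\<^sub>C act (Y a (int j) b) (m + n - int j) u)" .
  show "t \<ge> int N \<Longrightarrow> act (Y a t b) q u = 0"
    using assms by (simp add: vrep_def kap3_def dsum_def)
qed

text \<open>Multiplication by \<open>(z - w)^N\<close> followed by the expansion of
  \<open>(z - w)^(-N)\<close> is the identity. The vanishing of \<open>g\<close> beyond
  \<open>K\<close> makes the double sum finite.\<close>

lemma cb_inverse: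
  fixes g :: "int \<Rightarrow> 'm::cvec"
  assumes g: "\<And>r. r \<ge> K \<Longrightarrow> g r = 0"
  shows "Sum_any (\<lambda>s. cb N s *\<^sub>C (\<Sum>i\<le>N. ((- 1) ^ i * of_nat (N choose i)) *\<^sub>C g (s + int i))) = g 0"
proof -
  define c where "c i = sgn1 i * gb (of_nat N) i" for i
  have c: "c (int i) = (- 1) ^ i * of_nat (N choose i)" for i
    by (simp add: c_def sgn1_nat binomial_gbinomial)
  have c0: "c i = 0" if "i < 0 \<or> i > int N" for i
    using that binomial_gbinomial[of N "nat i", where 'a = complex]
    by (auto simp: c_def gb_def binomial_eq_0)
  have inner: "(\<Sum>i\<le>N. ((- 1) ^ i * of_nat (N choose i)) *\<^sub>C g (s + int i)) = Sum_any (\<lambda>r. c (r - s) *\<^sub>C g r)" for s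
  proof -
    have "Sum_any (\<lambda>r. c (r - s) *\<^sub>C g r) = (\<Sum>r\<in>{s..s + int N}. c (r - s) *\<^sub>C g r)"
    proof (rule Sum_any.expand_superset)
      show "{r. c (r - s) *\<^sub>C g r \<noteq> 0} \<subseteq> {s..s + int N}"
      proof
        fix r assume "r \<in> {r. c (r - s) *\<^sub>C g r \<noteq> 0}"
        then have "c (r - s) \<noteq> 0" by auto
        then show "r \<in> {s..s + int N}" using c0[of "r - s"] by force
      qed
    qed simp
    also have "\<dots> = (\<Sum>i\<le>N. c (int i) *\<^sub>C g (s + int i))"
      by (rule sum.reindex_bij_witness[of _ "\<lambda>i. s + int i" "\<lambda>r. nat (r - s)"]) auto
    finally show ?thesis by (simp add: c)
  qed
  have conv: "Sum_any (\<lambda>s. cb N (s - 0) * c (r - s)) = (if r = 0 then 1 else 0)"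
    "finite {s. cb N (s - 0) * c (r - s) \<noteq> 0}" for r
  proof -
    have e: "cb N (s - 0) * c (r - s) = sgn1 r * (gb (- of_nat N) (s - 0) * gb (of_nat N) (r - s))" for s
      by (simp add: cb_def c_def sgn1_diff)
    show "Sum_any (\<lambda>s. cb N (s - 0) * c (r - s)) = (if r = 0 then 1 else 0)"
      unfolding e by (subst Sum_any_right_distrib[symmetric, OF gb_conv(1)])
        (use gb_conv(2)[of "- of_nat N" 0 "of_nat N" r] in \<open>simp add: gb_zero sgn1_def\<close>)
    show "finite {s. cb N (s - 0) * c (r - s) \<noteq> 0}"
      unfolding e by (rule finite_subset[OF _ gb_conv(1)[of "- of_nat N" 0 "of_nat N" r]]) auto
  qed
  have fin: "finite {(s, r). (cb N s * c (r - s)) *\<^sub>C g r \<noteq> 0}"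
  proof (rule finite_subset)
    show "{(s, r). (cb N s * c (r - s)) *\<^sub>C g r \<noteq> 0} \<subseteq> {0..K} \<times> {0..K}"
    proof clarify
      fix s r assume "(cb N s * c (r - s)) *\<^sub>C g r \<noteq> 0"
      then have "cb N s \<noteq> 0" "c (r - s) \<noteq> 0" "g r \<noteq> 0" by auto
      then have "s \<ge> 0" "r \<ge> s" "r < K" using cb_neg[of s N] c0[of "r - s"] g[of r] by force+
      then show "s \<in> {0..K} \<and> r \<in> {0..K}" by auto
    qed
  qed simp
  have finr: "finite {r. c (r - s) *\<^sub>C g r \<noteq> 0}" for s
  proof (rule finite_subset)
    show "{r. c (r - s) *\<^sub>C g r \<noteq> 0} \<subseteq> {s..K}"
    proof
      fix r assume "r \<in> {r. c (r - s) *\<^sub>C g r \<noteq> 0}"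
      then have "c (r - s) \<noteq> 0" "g r \<noteq> 0" by auto
      then show "r \<in> {s..K}" using c0[of "r - s"] g[of r] by force
    qed
  qed simp
  have "Sum_any (\<lambda>s. cb N s *\<^sub>C Sum_any (\<lambda>r. c (r - s) *\<^sub>C g r)) =
      Sum_any (\<lambda>s. Sum_any (\<lambda>r. (cb N s * c (r - s)) *\<^sub>C g r))"
    by (subst Sum_any_clinear[OF clinear_const_scale[OF clinear_id] finr]) (simp add: cscale_cscale)
  also have "\<dots> = Sum_any (\<lambda>r. Sum_any (\<lambda>s. (cb N s * c (r - s)) *\<^sub>C g r))"
    using Sum_any_pair[OF fin] by simp
  also have "\<dots> = Sum_any (\<lambda>r. (if r = 0 then 1 else 0) *\<^sub>C g r)"
  proof (rule Sum_any.cong)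
    fix r
    have "clinear (\<lambda>z. z *\<^sub>C g r)" by (simp add: clinear_iff cscale_left_distrib cscale_complex_def cscale_cscale)
    from Sum_any_clinear[OF this conv(2)[of r]] conv(1)[of r]
    show "Sum_any (\<lambda>s. (cb N s * c (r - s)) *\<^sub>C g r) = (if r = 0 then 1 else 0) *\<^sub>C g r" by simp
  qed
  also have "\<dots> = g 0"
    by (subst Sum_any_single[of 0]) (auto simp: cscale_one)
  finally show ?thesis unfolding inner .
qed

lemma vertex_moduleD:
  assumes "vertex_module vac Y act"
  shows "cbilinear (\<lambda>a. act a n)" "clinear (act a n)" "clinear (\<lambda>a. act a n u)"
    "\<exists>N. \<forall>n\<ge>N. act a n u = 0" "act vac n u = (if n = -1 then u else 0)"
  using assms unfolding vertex_module_def cbilinear_def by blast+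

lemma borcherds:
  assumes "vertex_module vac Y act"
  shows "Sum_any (\<lambda>j::nat. ((of_int m :: complex) gchoose j) *\<^sub>C
            act (Y a (n + int j) b) (m + p - int j) u) =
        Sum_any (\<lambda>j::nat. ((- 1) ^ j * ((of_int n :: complex) gchoose j)) *\<^sub>C
            (act a (m + n - int j) (act b (p + int j) u)
             - ((- 1) powi n) *\<^sub>C act b (n + p - int j) (act a (m + int j) u)))"
  using assms unfolding vertex_module_def by blast

text \<open>\<open>N\<close> bounds the pole order of \<open>a(z) b(w)\<close>, and \<open>p\<close>
  is the series of \<open>(z - w)^N a(z) b(w) u\<close>. The first two expansions invert this
  multiplication, the third follows from the Borcherds identity and
  \<open>kap_identity\<close>.\<close>

lemma vrep_exists:
  assumes act: "vertex_module vac Y act" and Y: "\<exists>N. \<forall>n\<ge>N. Y a n b = 0"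
  obtains N p where "vrep Y act a b u N p"
proof -
  note lin = vertex_moduleD(2)[OF act] and lin1 = vertex_moduleD(3)[OF act]
  obtain N0 where N0: "\<And>n. n \<ge> N0 \<Longrightarrow> Y a n b = 0" using Y by auto
  define N where "N = nat N0"
  have N: "Y a n b = 0" if "n \<ge> int N" for n using that by (intro N0) (simp add: N_def split: if_splits)
  obtain Ka where Ka: "\<And>n. n \<ge> Ka \<Longrightarrow> act a n u = 0" using vertex_moduleD(4)[OF act] by meson
  obtain Kb where Kb: "\<And>n. n \<ge> Kb \<Longrightarrow> act b n u = 0" using vertex_moduleD(4)[OF act] by meson
  define K where "K = max Ka Kb"
  have K: "act a n u = 0" "act b n u = 0" if "n \<ge> K" for n using that Ka Kb by (auto simp: K_def)
  define C where "C i = (- 1) ^ i * complex_of_nat (N choose i)" for i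
  define p where "p m n = (\<Sum>i\<le>N. C i *\<^sub>C act a (m + int N - int i) (act b (n + int i) u))" for m n
  \<comment> \<open>With \<open>n = N\<close> the left side of the Borcherds identity vanishes. This
    is locality: it expresses \<open>p\<close> a second time with the fields exchanged. The first
    form vanishes for large \<open>n\<close>, the second for large \<open>m\<close>.\<close>
  have p2: "p m n = sgn1 (int N) *\<^sub>C (\<Sum>i\<le>N. C i *\<^sub>C act b (n + int N - int i) (act a (m + int i) u))" for m n
  proof -
    have "Sum_any (\<lambda>j::nat. ((of_int m :: complex) gchoose j) *\<^sub>C act (Y a (int N + int j) b) (m + n - int j) u) = 0"
      by (simp add: N clinear_0[OF lin1])
    then have "0 = Sum_any (\<lambda>j::nat. ((- 1) ^ j * ((of_int (int N) :: complex) gchoose j)) *\<^sub>C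
            (act a (m + int N - int j) (act b (n + int j) u)
             - ((- 1) powi (int N)) *\<^sub>C act b (int N + n - int j) (act a (m + int j) u)))"
      by (subst (asm) borcherds[OF act]) (rule sym)
    also have "\<dots> = Sum_any (\<lambda>j. C j *\<^sub>C
            (act a (m + int N - int j) (act b (n + int j) u)
             - sgn1 (int N) *\<^sub>C act b (n + int N - int j) (act a (m + int j) u)))"
      by (rule Sum_any.cong) (simp only: C_def sgn1_powi of_int_of_nat_eq binomial_gbinomial add.commute[of "int N" n])
    also have "\<dots> = (\<Sum>j\<le>N. C j *\<^sub>C
            (act a (m + int N - int j) (act b (n + int j) u)
             - sgn1 (int N) *\<^sub>C act b (n + int N - int j) (act a (m + int j) u)))"
      by (rule Sum_any.expand_superset) (auto simp: C_def not_less[symmetric] intro: ccontr)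
    also have "\<dots> = p m n - (\<Sum>j\<le>N. C j *\<^sub>C sgn1 (int N) *\<^sub>C act b (n + int N - int j) (act a (m + int j) u))"
      unfolding p_def by (simp only: cvec.scale_right_diff_distrib sum_subtractf)
    finally show ?thesis
      by (simp add: cvec.scale_sum_right mult.commute)
  qed
  have bd: "bdd_series p"
    unfolding bdd_series_def
  proof (intro exI[of _ K] allI impI)
    fix m n assume mn: "m \<ge> K \<or> n \<ge> K"
    show "p m n = 0"
    proof (cases "n \<ge> K")
      case True then show ?thesis by (simp add: p_def K clinear_0[OF lin])
    next
      case False
      then have "m \<ge> K" using mn by simp
      then show ?thesis unfolding p2 by (simp add: K clinear_0[OF lin])
    qed
  qed
  have R1: "act a m (act b n u) = dsum (\<lambda>\<mu>. cb N (m - int N - \<mu>)) (m + n - int N) p" for m n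
  proof -
    have "dsum (\<lambda>\<mu>. cb N (m - int N - \<mu>)) (m + n - int N) p
       = Sum_any (\<lambda>s. cb N s *\<^sub>C p (m - int N - s) (n + s))"
      unfolding dsum_def by (subst Sum_any_bij[OF bij_int_shift(3)[of "m - int N"]]) (simp add: algebra_simps)
    also have "\<dots> = Sum_any (\<lambda>s. cb N s *\<^sub>C (\<Sum>i\<le>N. ((- 1) ^ i * of_nat (N choose i)) *\<^sub>C
        (\<lambda>r. act a (m - r) (act b (n + r) u)) (s + int i)))"
      by (simp add: p_def C_def algebra_simps)
    also have "\<dots> = act a m (act b n u)"
      by (subst cb_inverse[of "K - n"]) (auto simp: K clinear_0[OF lin])
    finally show ?thesis ..
  qed
  have R2: "act b n (act a m u) = dsum (\<lambda>\<mu>. sgn1 (int N) * cb N (\<mu> - m)) (m + n - int N) p" for m n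
  proof -
    have "dsum (\<lambda>\<mu>. sgn1 (int N) * cb N (\<mu> - m)) (m + n - int N) p
       = Sum_any (\<lambda>s. cb N s *\<^sub>C sgn1 (int N) *\<^sub>C p (m + s) (n - int N - s))"
      unfolding dsum_def by (subst Sum_any_bij[OF bij_int_shift(2)[of m]]) (simp add: algebra_simps cscale_cscale)
    also have "\<dots> = Sum_any (\<lambda>s. cb N s *\<^sub>C (\<Sum>i\<le>N. ((- 1) ^ i * of_nat (N choose i)) *\<^sub>C
        (\<lambda>r. act b (n - r) (act a (m + r) u)) (s + int i)))"
      unfolding p2 cscale_cscale by (simp add: C_def algebra_simps cscale_one)
    also have "\<dots> = act b n (act a m u)"
      by (subst cb_inverse[of "K - m"]) (auto simp: K clinear_0[OF lin])
    finally show ?thesis ..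
  qed
  have R3: "act (Y a t b) q u = dsum (kap3 N t) (q + t - int N) p" for t q
  proof -
    let ?D = "q + t - int N"
    obtain M where M: "\<And>\<mu>. p \<mu> (?D - \<mu>) \<noteq> 0 \<Longrightarrow> \<bar>\<mu>\<bar> \<le> M"
    proof -
      have "bdd_above (abs ` {\<mu>. p \<mu> (?D - \<mu>) \<noteq> 0})"
        using bdd_series_finite[OF bd, of ?D] by simp
      then show ?thesis using that by (auto simp: bdd_above_def)
    qed
    \<comment> \<open>Large enough that the sums below \<open>J\<close> contain all nonzero terms of
      the Borcherds sum and, for every \<mu> in the support of \<open>p\<close>, all terms of the
      two Vandermonde convolutions, at \<open>t - N - \<mu>\<close> and at
      \<open>\<mu>\<close>.\<close>
    define J where "J = nat (\<bar>M\<bar> + \<bar>t\<bar> + \<bar>q\<bar> + int N + \<bar>K\<bar> + 1)"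
    define B where "B j = (- 1) ^ j * ((of_int t :: complex) gchoose j)" for j
    have "act (Y a t b) q u = Sum_any (\<lambda>j::nat. ((of_int 0 :: complex) gchoose j) *\<^sub>C
            act (Y a (t + int j) b) (0 + q - int j) u)"
      by (subst Sum_any_single[of 0]) (auto simp: cscale_one gbinomial_0_left)
    also have "\<dots> = Sum_any (\<lambda>j::nat. B j *\<^sub>C (act a (t - int j) (act b (q + int j) u)
             - sgn1 t *\<^sub>C act b (t + q - int j) (act a (int j) u)))"
      unfolding borcherds[OF act] by (simp add: B_def sgn1_powi)
    also have "\<dots> = (\<Sum>j<J. B j *\<^sub>C (act a (t - int j) (act b (q + int j) u)
             - sgn1 t *\<^sub>C act b (t + q - int j) (act a (int j) u)))"
    proof (rule Sum_any.expand_superset)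
      show "{j. B j *\<^sub>C (act a (t - int j) (act b (q + int j) u)
             - sgn1 t *\<^sub>C act b (t + q - int j) (act a (int j) u)) \<noteq> 0} \<subseteq> {..<J}"
      proof
        fix j assume j: "j \<in> {j. B j *\<^sub>C (act a (t - int j) (act b (q + int j) u)
             - sgn1 t *\<^sub>C act b (t + q - int j) (act a (int j) u)) \<noteq> 0}"
        show "j \<in> {..<J}"
        proof (rule ccontr)
          assume "j \<notin> {..<J}"
          then have "q + int j \<ge> K" "int j \<ge> K" by (auto simp: J_def)
          then show False using j by (simp add: K clinear_0[OF lin])
        qed
      qed
    qed simp
    also have "\<dots> = (\<Sum>j<J. B j *\<^sub>C (dsum (\<lambda>\<mu>. cb N (t - int j - int N - \<mu>)) ?D p
             - sgn1 t *\<^sub>C dsum (\<lambda>\<mu>. sgn1 (int N) * cb N (\<mu> - int j)) ?D p))"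
      unfolding R1 R2 by (simp add: algebra_simps)
    also have "\<dots> = dsum (\<lambda>\<mu>. \<Sum>j<J. B j * (cb N (t - int j - int N - \<mu>) - sgn1 t * (sgn1 (int N) * cb N (\<mu> - int j)))) ?D p"
      by (simp only: dsum_sum[OF bd] dsum_scale[OF bd] dsum_diff[OF bd])
    also have "\<dots> = dsum (kap3 N t) ?D p"
    proof (rule dsum_cong)
      fix \<mu> assume "p \<mu> (?D - \<mu>) \<noteq> 0"
      then have \<mu>: "\<bar>\<mu>\<bar> \<le> M" by (rule M)
      have s: "(\<Sum>j<J. B j * cb N (\<beta> - int j)) = sgn1 \<beta> * gb (of_int (t - int N)) \<beta>" if "\<beta> < int J" for \<beta>
      proof -
        have "(\<Sum>j<J. B j * cb N (\<beta> - int j)) = (\<Sum>j<J. sgn1 \<beta> * (gb (of_int t) (int j - 0) * gb (- of_nat N) (\<beta> - int j)))"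
          by (rule sum.cong) (simp_all add: B_def cb_def sgn1_diff sgn1_nat)
        also have "\<dots> = sgn1 \<beta> * (\<Sum>j<J. gb (of_int t) (int j - 0) * gb (- of_nat N) (\<beta> - int j))"
          by (simp only: sum_distrib_left)
        also have "(\<Sum>j<J. gb (of_int t) (int j - 0) * gb (- of_nat N) (\<beta> - int j))
           = (\<Sum>i\<in>{0..<int J}. gb (of_int t) (i - 0) * gb (- of_nat N) (\<beta> - i))"
          by (rule sum.reindex_bij_witness[of _ nat int]) auto
        also have "\<dots> = Sum_any (\<lambda>i. gb (of_int t) (i - 0) * gb (- of_nat N) (\<beta> - i))"
          by (rule Sum_any.expand_superset[symmetric]) (use that in \<open>auto simp: gb_def split: if_splits\<close>)
        also have "\<dots> = gb (of_int t + - of_nat N) (\<beta> - 0)" by (rule gb_conv)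
        finally show ?thesis by simp
      qed
      have "(\<Sum>j<J. B j * (cb N (t - int j - int N - \<mu>) - sgn1 t * (sgn1 (int N) * cb N (\<mu> - int j))))
        = (\<Sum>j<J. B j * cb N ((t - int N - \<mu>) - int j)) - sgn1 t * sgn1 (int N) * (\<Sum>j<J. B j * cb N (\<mu> - int j))"
        by (simp add: algebra_simps sum_subtractf sum_distrib_left)
      also have "\<dots> = sgn1 (t - int N - \<mu>) * gb (of_int (t - int N)) (t - int N - \<mu>)
          - sgn1 t * sgn1 (int N) * (sgn1 \<mu> * gb (of_int (t - int N)) \<mu>)"
        using \<mu> by (subst (1 2) s) (auto simp: J_def)
      also have "\<dots> = kap3 N t \<mu>"
        using kap_identity[of "t - int N" \<mu>] by (simp add: kap3_def sgn1_diff sgn1_add algebra_simps)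
      finally show "(\<Sum>j<J. B j * (cb N (t - int j - int N - \<mu>) - sgn1 t * (sgn1 (int N) * cb N (\<mu> - int j)))) = kap3 N t \<mu>" .
    qed
    finally show ?thesis .
  qed
  show ?thesis by (rule that[of N p]) (simp add: vrep_def bd flip: R1 R2 R3)
qed

text \<open>\<open>p\<close> is the product of the two Laurent series; as \<mu> labels the power
  \<open>z^(-\<mu>-1)\<close>, the labels combine to \<open>\<mu>1 + \<mu>2 + 1\<close>. On a fixed
  antidiagonal of the first factor the summation over \<open>i\<close> meets only the weights, so it
  can be carried out before the sums over \<open>\<mu>1\<close> and \<open>\<mu>2\<close>.\<close>

lemma dsum_tensor:
  fixes p1 :: "int \<Rightarrow> int \<Rightarrow> 'm::cvec" and p2 :: "int \<Rightarrow> int \<Rightarrow> 'n::cvec"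
  assumes bd: "bdd_series p1" "bdd_series p2"
  defines "p \<equiv> (\<lambda>\<mu> \<nu>. Sum_any (\<lambda>(\<mu>1, \<nu>1). p1 \<mu>1 \<nu>1 \<otimes>\<^sub>C p2 (\<mu> - 1 - \<mu>1) (\<nu> - 1 - \<nu>1)))"
  shows "bdd_series p"
    and "\<lbrakk>\<And>\<mu>1 \<mu>2. finite {i. k1 i \<mu>1 * k2 i \<mu>2 \<noteq> 0};
      \<And>\<mu>1 \<mu>2. Sum_any (\<lambda>i. k1 i \<mu>1 * k2 i \<mu>2) = \<kappa> (\<mu>1 + \<mu>2 + 1)\<rbrakk> \<Longrightarrow>
      finite {(i, j). dsum (k1 i) (i + j - c) p1 \<otimes>\<^sub>C dsum (k2 i) (D - 2 - (i + j - c)) p2 \<noteq> 0} \<and>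
      Sum_any (\<lambda>(i, j). dsum (k1 i) (i + j - c) p1 \<otimes>\<^sub>C dsum (k2 i) (D - 2 - (i + j - c)) p2) = dsum \<kappa> D p"
proof -
  obtain K1 where K1: "\<And>m n. m \<ge> K1 \<or> n \<ge> K1 \<Longrightarrow> p1 m n = 0" using bd(1) by (auto simp: bdd_series_def)
  obtain K2 where K2: "\<And>m n. m \<ge> K2 \<or> n \<ge> K2 \<Longrightarrow> p2 m n = 0" using bd(2) by (auto simp: bdd_series_def)
  define K where "K = \<bar>K1\<bar> + \<bar>K2\<bar>"
  have K: "p1 m n \<noteq> 0 \<Longrightarrow> m < K \<and> n < K" "p2 m n \<noteq> 0 \<Longrightarrow> m < K \<and> n < K" for m n
  proof -
    show "p1 m n \<noteq> 0 \<Longrightarrow> m < K \<and> n < K" using K1[of m n] unfolding K_def by linarith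
    show "p2 m n \<noteq> 0 \<Longrightarrow> m < K \<and> n < K" using K2[of m n] unfolding K_def by linarith
  qed
  show "bdd_series p"
    unfolding bdd_series_def
  proof (intro exI[of _ "2 * K"] allI impI)
    fix m n assume mn: "m \<ge> 2 * K \<or> n \<ge> 2 * K"
    have "p1 \<mu>1 \<nu>1 \<otimes>\<^sub>C p2 (m - 1 - \<mu>1) (n - 1 - \<nu>1) = 0" for \<mu>1 \<nu>1
    proof (rule ccontr)
      assume "p1 \<mu>1 \<nu>1 \<otimes>\<^sub>C p2 (m - 1 - \<mu>1) (n - 1 - \<nu>1) \<noteq> 0"
      then have "p1 \<mu>1 \<nu>1 \<noteq> 0" "p2 (m - 1 - \<mu>1) (n - 1 - \<nu>1) \<noteq> 0" by (metis tensor_simps(9), metis tensor_simps(10))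
      then show False using K(1)[of \<mu>1 \<nu>1] K(2)[of "m - 1 - \<mu>1" "n - 1 - \<nu>1"] mn by linarith
    qed
    then show "p m n = 0" by (simp add: p_def)
  qed
  assume k: "\<And>\<mu>1 \<mu>2. finite {i. k1 i \<mu>1 * k2 i \<mu>2 \<noteq> 0}"
      "\<And>\<mu>1 \<mu>2. Sum_any (\<lambda>i. k1 i \<mu>1 * k2 i \<mu>2) = \<kappa> (\<mu>1 + \<mu>2 + 1)"
  \<comment> \<open>\<open>G\<close> lists the pure tensors by the antidiagonal of the first factor
    and the positions on both antidiagonals. Boundedness confines its support to the box
    \<open>A\<close>, which makes all rearrangements finite.\<close>
  define G where "G = (\<lambda>(d, \<mu>1, \<mu>2). p1 \<mu>1 (d - \<mu>1) \<otimes>\<^sub>C p2 \<mu>2 (D - 2 - d - \<mu>2))"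
  define H where "H = \<bar>D\<bar> + 4 * \<bar>K\<bar> + 5"
  define A where "A = {- H..H} \<times> {- H..H} \<times> {- H..H}"
  have finA: "finite A" by (simp add: A_def)
  have GA: "x \<in> A" if "G x \<noteq> 0" for x
  proof -
    obtain d \<mu>1 \<mu>2 where x: "x = (d, \<mu>1, \<mu>2)" by (cases x)
    have "p1 \<mu>1 (d - \<mu>1) \<noteq> 0" "p2 \<mu>2 (D - 2 - d - \<mu>2) \<noteq> 0"
      using that unfolding G_def x by (auto simp del: )
    then show ?thesis
      using K(1)[of \<mu>1 "d - \<mu>1"] K(2)[of \<mu>2 "D - 2 - d - \<mu>2"] by (auto simp: A_def H_def x)
  qed
  define I where "I = (\<Union>x\<in>A. {i. k1 i (fst (snd x)) * k2 i (snd (snd x)) \<noteq> 0})"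
  have finI: "finite I" using finA k(1) by (simp add: I_def)
  have rhs: "dsum \<kappa> D p = (\<Sum>x\<in>A. \<kappa> (fst (snd x) + snd (snd x) + 1) *\<^sub>C G x)"
  proof -
    define F where "F = (\<lambda>\<mu> (\<mu>1, \<nu>1). \<kappa> \<mu> *\<^sub>C (p1 \<mu>1 \<nu>1 \<otimes>\<^sub>C p2 (\<mu> - 1 - \<mu>1) (D - \<mu> - 1 - \<nu>1)))"
    define h :: "int \<times> int \<times> int \<Rightarrow> int \<times> int \<times> int" where "h = (\<lambda>(d, \<mu>1, \<mu>2). (\<mu>1 + \<mu>2 + 1, \<mu>1, d - \<mu>1))"
    have bij: "bij h"
      by (rule bij_betw_byWitness[where f' = "\<lambda>(\<mu>, \<mu>1, \<nu>1). (\<mu>1 + \<nu>1, \<mu>1, \<mu> - 1 - \<mu>1)"]) (auto simp: h_def)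
    have Fh: "(case h x of (\<mu>, y) \<Rightarrow> F \<mu> y) = \<kappa> (fst (snd x) + snd (snd x) + 1) *\<^sub>C G x" for x
      by (auto simp: F_def h_def G_def split: prod.splits simp: algebra_simps)
    have finF: "finite {(\<mu>, y). F \<mu> y \<noteq> 0}"
    proof (rule finite_subset)
      show "{(\<mu>, y). F \<mu> y \<noteq> 0} \<subseteq> h ` A"
      proof clarify
        fix \<mu> \<mu>1 \<nu>1 assume n: "F \<mu> (\<mu>1, \<nu>1) \<noteq> 0"
        obtain x where x: "(\<mu>, \<mu>1, \<nu>1) = h x" using bij by (metis bij_pointE)
        then have "F \<mu> (\<mu>1, \<nu>1) = \<kappa> (fst (snd x) + snd (snd x) + 1) *\<^sub>C G x" using Fh[of x] by (simp flip: x)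
        then have "G x \<noteq> 0" using n by auto
        then show "(\<mu>, \<mu>1, \<nu>1) \<in> h ` A" using GA x by auto
      qed
    qed (use finA in simp)
    have finp: "finite {y. (case y of (\<mu>1, \<nu>1) \<Rightarrow> p1 \<mu>1 \<nu>1 \<otimes>\<^sub>C p2 (\<mu> - 1 - \<mu>1) (D - \<mu> - 1 - \<nu>1)) \<noteq> 0}" for \<mu>
    proof (rule finite_subset)
      show "{y. (case y of (\<mu>1, \<nu>1) \<Rightarrow> p1 \<mu>1 \<nu>1 \<otimes>\<^sub>C p2 (\<mu> - 1 - \<mu>1) (D - \<mu> - 1 - \<nu>1)) \<noteq> 0} \<subseteq> (snd \<circ> h) ` A"
      proof clarify
        fix \<mu>1 \<nu>1 assume n: "p1 \<mu>1 \<nu>1 \<otimes>\<^sub>C p2 (\<mu> - 1 - \<mu>1) (D - \<mu> - 1 - \<nu>1) \<noteq> 0"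
        have "G (\<mu>1 + \<nu>1, \<mu>1, \<mu> - 1 - \<mu>1) \<noteq> 0" using n by (simp add: G_def algebra_simps)
        then have "(\<mu>1 + \<nu>1, \<mu>1, \<mu> - 1 - \<mu>1) \<in> A" by (rule GA)
        then show "(\<mu>1, \<nu>1) \<in> (snd \<circ> h) ` A" by (rule rev_image_eqI) (simp add: h_def)
      qed
    qed (use finA in simp)
    have "dsum \<kappa> D p = Sum_any (\<lambda>\<mu>. Sum_any (F \<mu>))"
      unfolding dsum_def p_def
    proof (rule Sum_any.cong)
      fix \<mu>
      show "\<kappa> \<mu> *\<^sub>C Sum_any (\<lambda>(\<mu>1, \<nu>1). p1 \<mu>1 \<nu>1 \<otimes>\<^sub>C p2 (\<mu> - 1 - \<mu>1) (D - \<mu> - 1 - \<nu>1)) = Sum_any (F \<mu>)"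
        by (subst Sum_any_clinear[OF clinear_const_scale[OF clinear_id] finp])
          (auto simp: F_def split_def)
    qed
    also have "\<dots> = Sum_any (\<lambda>(\<mu>, y). F \<mu> y)" by (rule Sum_any_pair(1)[OF finF])
    also have "\<dots> = Sum_any (\<lambda>x. \<kappa> (fst (snd x) + snd (snd x) + 1) *\<^sub>C G x)"
      by (subst Sum_any_bij[OF bij]) (simp only: Fh)
    also have "\<dots> = (\<Sum>x\<in>A. \<kappa> (fst (snd x) + snd (snd x) + 1) *\<^sub>C G x)"
      by (rule Sum_any.expand_superset[OF finA]) (use GA in auto)
    finally show ?thesis .
  qed
  define f where "f i d = dsum (k1 i) d p1 \<otimes>\<^sub>C dsum (k2 i) (D - 2 - d) p2" for i d
  have fsum: "f i d = (\<Sum>\<mu>1\<in>{- H..H}. \<Sum>\<mu>2\<in>{- H..H}. (k1 i \<mu>1 * k2 i \<mu>2) *\<^sub>C G (d, \<mu>1, \<mu>2))" if d: "d \<in> {- H..H}" for i d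
  proof -
    have "f i d = Sum_any (\<lambda>\<mu>1. Sum_any (\<lambda>\<mu>2. (k1 i \<mu>1 * k2 i \<mu>2) *\<^sub>C G (d, \<mu>1, \<mu>2)))"
      unfolding f_def dsum_def[of "k1 i"] dsum_def[of "k2 i"]
      apply (subst Sum_any_clinear[OF clinear_tensor_left[OF clinear_id] dsum_finite[OF bd(1)]])
      apply (subst Sum_any_clinear[OF clinear_tensor_right[OF clinear_id] dsum_finite[OF bd(2)]])
      by (simp add: G_def cscale_cscale mult.commute)
    also have "\<dots> = Sum_any (\<lambda>\<mu>1. \<Sum>\<mu>2\<in>{- H..H}. (k1 i \<mu>1 * k2 i \<mu>2) *\<^sub>C G (d, \<mu>1, \<mu>2))"
    proof (rule Sum_any.cong, rule Sum_any.expand_superset)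
      fix \<mu>1 show "{\<mu>2. (k1 i \<mu>1 * k2 i \<mu>2) *\<^sub>C G (d, \<mu>1, \<mu>2) \<noteq> 0} \<subseteq> {- H..H}"
        using GA by (auto simp: A_def)
    qed simp
    also have "\<dots> = (\<Sum>\<mu>1\<in>{- H..H}. \<Sum>\<mu>2\<in>{- H..H}. (k1 i \<mu>1 * k2 i \<mu>2) *\<^sub>C G (d, \<mu>1, \<mu>2))"
    proof (rule Sum_any.expand_superset)
      show "{\<mu>1. (\<Sum>\<mu>2\<in>{- H..H}. (k1 i \<mu>1 * k2 i \<mu>2) *\<^sub>C G (d, \<mu>1, \<mu>2)) \<noteq> 0} \<subseteq> {- H..H}"
      proof
        fix \<mu>1 assume "\<mu>1 \<in> {\<mu>1. (\<Sum>\<mu>2\<in>{- H..H}. (k1 i \<mu>1 * k2 i \<mu>2) *\<^sub>C G (d, \<mu>1, \<mu>2)) \<noteq> 0}"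
        then obtain \<mu>2 where "(k1 i \<mu>1 * k2 i \<mu>2) *\<^sub>C G (d, \<mu>1, \<mu>2) \<noteq> 0"
          by (metis (mono_tags, lifting) mem_Collect_eq sum.neutral)
        then show "\<mu>1 \<in> {- H..H}" using GA[of "(d, \<mu>1, \<mu>2)"] by (auto simp: A_def)
      qed
    qed simp
    finally show ?thesis .
  qed
  have f0: "f i d = 0" if "d \<notin> {- H..H}" for i d
  proof -
    have "(\<forall>\<mu>1. p1 \<mu>1 (d - \<mu>1) = 0) \<or> (\<forall>\<mu>2. p2 \<mu>2 (D - 2 - d - \<mu>2) = 0)"
    proof (rule ccontr)
      assume "\<not> ?thesis"
      then obtain \<mu>1 \<mu>2 where "p1 \<mu>1 (d - \<mu>1) \<noteq> 0" "p2 \<mu>2 (D - 2 - d - \<mu>2) \<noteq> 0" by auto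
      then have "G (d, \<mu>1, \<mu>2) \<noteq> 0" by (simp add: G_def tensor_nonzero)
      then show False using GA that by (auto simp: A_def)
    qed
    then show ?thesis by (auto simp: f_def dsum_def)
  qed
  have fI: "i \<in> I" if "f i d \<noteq> 0" for i d
  proof -
    have d: "d \<in> {- H..H}" using f0 that by blast
    then have "(\<Sum>\<mu>1\<in>{- H..H}. \<Sum>\<mu>2\<in>{- H..H}. (k1 i \<mu>1 * k2 i \<mu>2) *\<^sub>C G (d, \<mu>1, \<mu>2)) \<noteq> 0" using that fsum by simp
    then obtain \<mu>1 \<mu>2 where "\<mu>1 \<in> {- H..H}" "\<mu>2 \<in> {- H..H}" "(k1 i \<mu>1 * k2 i \<mu>2) *\<^sub>C G (d, \<mu>1, \<mu>2) \<noteq> 0"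
      by (meson sum.neutral)
    then show ?thesis using d unfolding I_def A_def by force
  qed
  have finf: "finite {(i, j). f i (i + j - c) \<noteq> 0}"
  proof (rule finite_subset)
    show "{(i, j). f i (i + j - c) \<noteq> 0} \<subseteq> (\<lambda>(i, d). (i, d - i + c)) ` (I \<times> {- H..H})"
    proof clarify
      fix i j assume n: "f i (i + j - c) \<noteq> 0"
      then have "i + j - c \<in> {- H..H}" using f0 by blast
      moreover have "i \<in> I" using fI n by blast
      moreover have "(i, j) = (\<lambda>(i, d). (i, d - i + c)) (i, i + j - c)" by simp
      ultimately show "(i, j) \<in> (\<lambda>(i, d). (i, d - i + c)) ` (I \<times> {- H..H})" by blast
    qed
  qed (use finI in simp)
  have "Sum_any (\<lambda>(i, j). f i (i + j - c)) = Sum_any (\<lambda>(i, d). f i d)"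
  proof -
    have "bij (\<lambda>(i, j). (i, i + j - c))"
      by (rule bij_betw_byWitness[where f' = "\<lambda>(i, d). (i, d - i + c)"]) auto
    from Sum_any_bij[OF this, of "\<lambda>(i, d). f i d"] show ?thesis by (simp add: split_def)
  qed
  also have "\<dots> = (\<Sum>(i, d)\<in>I \<times> {- H..H}. f i d)"
  proof (rule Sum_any.expand_superset)
    show "{a. (case a of (i, d) \<Rightarrow> f i d) \<noteq> 0} \<subseteq> I \<times> {- H..H}"
      using fI f0 by (force simp del: atLeastAtMost_iff)
  qed (use finI in simp)
  also have "\<dots> = (\<Sum>d\<in>{- H..H}. \<Sum>i\<in>I. f i d)"
    by (simp add: sum.cartesian_product[symmetric] sum.swap[of _ _ I])
  also have "\<dots> = (\<Sum>d\<in>{- H..H}. \<Sum>\<mu>1\<in>{- H..H}. \<Sum>\<mu>2\<in>{- H..H}. \<kappa> (\<mu>1 + \<mu>2 + 1) *\<^sub>C G (d, \<mu>1, \<mu>2))"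
  proof (rule sum.cong[OF refl])
    fix d assume d: "d \<in> {- H..H}"
    have "(\<Sum>i\<in>I. f i d) = (\<Sum>\<mu>1\<in>{- H..H}. \<Sum>\<mu>2\<in>{- H..H}. \<Sum>i\<in>I. (k1 i \<mu>1 * k2 i \<mu>2) *\<^sub>C G (d, \<mu>1, \<mu>2))"
      by (simp only: fsum[OF d] sum.swap[of _ _ I])
    also have "\<dots> = (\<Sum>\<mu>1\<in>{- H..H}. \<Sum>\<mu>2\<in>{- H..H}. \<kappa> (\<mu>1 + \<mu>2 + 1) *\<^sub>C G (d, \<mu>1, \<mu>2))"
    proof (intro sum.cong refl)
      fix \<mu>1 \<mu>2 assume m: "\<mu>1 \<in> {- H..H}" "\<mu>2 \<in> {- H..H}"
      have "{i. k1 i \<mu>1 * k2 i \<mu>2 \<noteq> 0} \<subseteq> I" using m d unfolding I_def A_def by force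
      then have "Sum_any (\<lambda>i. k1 i \<mu>1 * k2 i \<mu>2) = (\<Sum>i\<in>I. k1 i \<mu>1 * k2 i \<mu>2)"
        by (rule Sum_any.expand_superset[OF finI])
      then show "(\<Sum>i\<in>I. (k1 i \<mu>1 * k2 i \<mu>2) *\<^sub>C G (d, \<mu>1, \<mu>2)) = \<kappa> (\<mu>1 + \<mu>2 + 1) *\<^sub>C G (d, \<mu>1, \<mu>2)"
        by (simp only: cvec.scale_sum_left[symmetric] k(2))
    qed
    finally show "(\<Sum>i\<in>I. f i d) = (\<Sum>\<mu>1\<in>{- H..H}. \<Sum>\<mu>2\<in>{- H..H}. \<kappa> (\<mu>1 + \<mu>2 + 1) *\<^sub>C G (d, \<mu>1, \<mu>2))" .
  qed
  also have "\<dots> = dsum \<kappa> D p"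
    unfolding rhs A_def by (simp add: sum.cartesian_product split_def)
  finally have "Sum_any (\<lambda>(i, j). f i (i + j - c)) = dsum \<kappa> D p" .
  then show "finite {(i, j). dsum (k1 i) (i + j - c) p1 \<otimes>\<^sub>C dsum (k2 i) (D - 2 - (i + j - c)) p2 \<noteq> 0} \<and>
      Sum_any (\<lambda>(i, j). dsum (k1 i) (i + j - c) p1 \<otimes>\<^sub>C dsum (k2 i) (D - 2 - (i + j - c)) p2) = dsum \<kappa> D p"
    using finf unfolding f_def by blast
qed

lemma tensor_action_lift:
  assumes A: "\<And>n. cbilinear (\<lambda>a. A a n)" "\<And>a u. \<exists>N. \<forall>n\<ge>N. A a n u = 0"
    and B: "\<And>n. cbilinear (\<lambda>b. B b n)" "\<And>b w. \<exists>N. \<forall>n\<ge>N. B b n w = 0"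
  shows "\<exists>N. \<forall>n\<ge>N. tensor_action A B s n t = 0"
    and "finite {i. A a i u \<otimes>\<^sub>C B b (n - 1 - i) w \<noteq> 0}"
proof -
  have pure: "\<exists>K. \<forall>n i. n \<ge> K \<longrightarrow> A a i u \<otimes>\<^sub>C B b (n - 1 - i) w = 0" for a b u w
  proof -
    obtain N where N: "\<And>i. i \<ge> N \<Longrightarrow> A a i u = 0" using A(2) by blast
    obtain M where M: "\<And>i. i \<ge> M \<Longrightarrow> B b i w = 0" using B(2) by blast
    have "A a i u \<otimes>\<^sub>C B b (n - 1 - i) w = 0" if "n \<ge> N + M" for n i
      using N[of i] M[of "n - 1 - i"] that by (cases "i \<ge> N") auto
    then show ?thesis by blast
  qed
  note T = tensor_action_tensor[of A B, OF A B]
  show "\<exists>N. \<forall>n\<ge>N. tensor_action A B s n t = 0"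
  proof (induction s rule: tensor_induct)
    case zero show ?case using clinear_0[OF cbilinearD(2)[OF T(2)]] by auto
  next
    case (step a b s)
    then obtain N where N: "\<And>n. n \<ge> N \<Longrightarrow> tensor_action A B s n t = 0" by auto
    have "\<exists>N. \<forall>n\<ge>N. tensor_action A B (a \<otimes>\<^sub>C b) n t = 0"
    proof (induction t rule: tensor_induct)
      case zero show ?case using clinear_0[OF cbilinearD(1)[OF T(2)]] by auto
    next
      case (step u w t)
      then obtain M where M: "\<And>n. n \<ge> M \<Longrightarrow> tensor_action A B (a \<otimes>\<^sub>C b) n t = 0" by auto
      obtain K where K: "\<And>n i. n \<ge> K \<Longrightarrow> A a i u \<otimes>\<^sub>C B b (n - 1 - i) w = 0" using pure by meson
      show ?case
        by (intro exI[of _ "max M K"]) (simp add: clinear_add[OF cbilinearD(1)[OF T(2)]] T(1) M K)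
    qed
    then obtain M where M: "\<And>n. n \<ge> M \<Longrightarrow> tensor_action A B (a \<otimes>\<^sub>C b) n t = 0" by auto
    show ?case
      by (intro exI[of _ "max N M"]) (simp add: clinear_add[OF cbilinearD(2)[OF T(2)]] N M)
  qed
  obtain N where N: "\<And>i. i \<ge> N \<Longrightarrow> A a i u = 0" using A(2) by blast
  obtain M where M: "\<And>i. i \<ge> M \<Longrightarrow> B b i w = 0" using B(2) by blast
  have "{i. A a i u \<otimes>\<^sub>C B b (n - 1 - i) w \<noteq> 0} \<subseteq> {n - M..N}"
  proof
    fix i assume i: "i \<in> {i. A a i u \<otimes>\<^sub>C B b (n - 1 - i) w \<noteq> 0}"
    then have "A a i u \<noteq> 0" "B b (n - 1 - i) w \<noteq> 0" by auto
    then have "\<not> i \<ge> N" "\<not> n - 1 - i \<ge> M" using N M by blast+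
    then show "i \<in> {n - M..N}" by auto
  qed
  then show "finite {i. A a i u \<otimes>\<^sub>C B b (n - 1 - i) w \<noteq> 0}" by (rule finite_subset) simp
qed

text \<open>\<open>(z - w)^(N1+N2)\<close> clears the poles of both factors. In each of the three
  domains the expansion of \<open>(z - w)^(-N1-N2)\<close> is the product of the expansions for
  \<open>N1\<close> and \<open>N2\<close>, which is the convolution identity for \<open>cb\<close>
  or \<open>gb\<close>.\<close>

lemma vrep_tensor:
  assumes act1: "\<And>n. cbilinear (\<lambda>a. act1 a n)" "\<And>a u. \<exists>N. \<forall>n\<ge>N. act1 a n u = 0"
    and act2: "\<And>n. cbilinear (\<lambda>a. act2 a n)" "\<And>a u. \<exists>N. \<forall>n\<ge>N. act2 a n u = 0"
    and Y1: "\<And>n. cbilinear (\<lambda>a. Y1 a n)" "\<And>a u. \<exists>N. \<forall>n\<ge>N. Y1 a n u = 0"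
    and Y2: "\<And>n. cbilinear (\<lambda>a. Y2 a n)" "\<And>a u. \<exists>N. \<forall>n\<ge>N. Y2 a n u = 0"
    and r1: "vrep Y1 act1 a a' u N1 p1" and r2: "vrep Y2 act2 b b' u' N2 p2"
  defines "p \<equiv> (\<lambda>\<mu> \<nu>. Sum_any (\<lambda>(\<mu>1, \<nu>1). p1 \<mu>1 \<nu>1 \<otimes>\<^sub>C p2 (\<mu> - 1 - \<mu>1) (\<nu> - 1 - \<nu>1)))"
  shows "vrep (tensor_action Y1 Y2) (tensor_action act1 act2) (a \<otimes>\<^sub>C b) (a' \<otimes>\<^sub>C b') (u \<otimes>\<^sub>C u') (N1 + N2) p"
proof -
  let ?N = "N1 + N2"
  note T = tensor_action_tensor[of act1 act2, OF act1 act2]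
  note TY = tensor_action_tensor(1)[of Y1 Y2, OF Y1 Y2]
  note finT = tensor_action_lift(2)[of act1 act2, OF act1 act2]
  note finY = tensor_action_lift(2)[of Y1 Y2, OF Y1 Y2]
  note linT = cbilinearD(1)[OF T(2)] and linT1 = cbilinearD(2)[OF T(2)]
  have bd1: "bdd_series p1" and bd2: "bdd_series p2" using r1 r2 by (simp_all add: vrep_def)
  note DT = dsum_tensor(2)[OF bd1 bd2, folded p_def]
  have bd: "bdd_series p" unfolding p_def by (rule dsum_tensor(1)[OF bd1 bd2])
  have e1: "act1 a m (act1 a' n u) = dsum (\<lambda>\<mu>. cb N1 (m - int N1 - \<mu>)) (m + n - int N1) p1"
    "act1 a' n (act1 a m u) = dsum (\<lambda>\<mu>. sgn1 (int N1) * cb N1 (\<mu> - m)) (m + n - int N1) p1"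
    "act1 (Y1 a t a') n u = dsum (kap3 N1 t) (n + t - int N1) p1" for m n t
    using r1 by (simp_all add: vrep_def)
  have e2: "act2 b m (act2 b' n u') = dsum (\<lambda>\<mu>. cb N2 (m - int N2 - \<mu>)) (m + n - int N2) p2"
    "act2 b' n (act2 b m u') = dsum (\<lambda>\<mu>. sgn1 (int N2) * cb N2 (\<mu> - m)) (m + n - int N2) p2"
    "act2 (Y2 b t b') n u' = dsum (kap3 N2 t) (n + t - int N2) p2" for m n t
    using r2 by (simp_all add: vrep_def)
  have R1: "tensor_action act1 act2 (a \<otimes>\<^sub>C b) m (tensor_action act1 act2 (a' \<otimes>\<^sub>C b') n (u \<otimes>\<^sub>C u'))
      = dsum (\<lambda>\<mu>. cb ?N (m - int ?N - \<mu>)) (m + n - int ?N) p" for m n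
  proof -
    have "finite {(i, j). act1 a i (act1 a' j u) \<otimes>\<^sub>C act2 b (m - 1 - i) (act2 b' (n - 1 - j) u') \<noteq> 0} \<and>
       Sum_any (\<lambda>(i, j). act1 a i (act1 a' j u) \<otimes>\<^sub>C act2 b (m - 1 - i) (act2 b' (n - 1 - j) u')) =
       dsum (\<lambda>\<mu>. cb ?N (m - int ?N - \<mu>)) (m + n - int ?N) p" (is "finite {(i, j). ?g i j \<noteq> 0} \<and> _")
    proof -
      have idx: "m - 1 - i + (n - 1 - j) - int N2 = m + n - int ?N - 2 - (i + j - int N1)" for i j by simp
      show ?thesis
        unfolding e1 e2 idx
      proof (rule DT)
        fix \<mu>1 \<mu>2
        have e: "cb N1 (i - int N1 - \<mu>1) * cb N2 (m - 1 - i - int N2 - \<mu>2) =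
            cb N1 (i - (int N1 + \<mu>1)) * cb N2 ((m - 1 - int N2 - \<mu>2) - i)" for i by (simp add: algebra_simps)
        show "finite {i. cb N1 (i - int N1 - \<mu>1) * cb N2 (m - 1 - i - int N2 - \<mu>2) \<noteq> 0}"
          unfolding e by (rule cb_conv)
        show "Sum_any (\<lambda>i. cb N1 (i - int N1 - \<mu>1) * cb N2 (m - 1 - i - int N2 - \<mu>2)) = cb ?N (m - int ?N - (\<mu>1 + \<mu>2 + 1))"
          unfolding e cb_conv by (simp add: algebra_simps)
      qed
    qed
    then have fin: "finite {(i, j). ?g i j \<noteq> 0}"
      and sum: "Sum_any (\<lambda>(i, j). ?g i j) = dsum (\<lambda>\<mu>. cb ?N (m - int ?N - \<mu>)) (m + n - int ?N) p" by auto
    have "tensor_action act1 act2 (a \<otimes>\<^sub>C b) m (tensor_action act1 act2 (a' \<otimes>\<^sub>C b') n (u \<otimes>\<^sub>C u'))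
      = Sum_any (\<lambda>j. Sum_any (\<lambda>i. ?g i j))"
      unfolding T(1)[of a'] by (subst Sum_any_clinear[OF linT finT]) (simp only: T(1))
    also have "\<dots> = dsum (\<lambda>\<mu>. cb ?N (m - int ?N - \<mu>)) (m + n - int ?N) p"
      using Sum_any_pair(2)[OF fin] sum by simp
    finally show ?thesis .
  qed
  have R2: "tensor_action act1 act2 (a' \<otimes>\<^sub>C b') n (tensor_action act1 act2 (a \<otimes>\<^sub>C b) m (u \<otimes>\<^sub>C u'))
      = dsum (\<lambda>\<mu>. sgn1 (int ?N) * cb ?N (\<mu> - m)) (m + n - int ?N) p" for m n
  proof -
    have "finite {(i, j). act1 a' j (act1 a i u) \<otimes>\<^sub>C act2 b' (n - 1 - j) (act2 b (m - 1 - i) u') \<noteq> 0} \<and>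
       Sum_any (\<lambda>(i, j). act1 a' j (act1 a i u) \<otimes>\<^sub>C act2 b' (n - 1 - j) (act2 b (m - 1 - i) u')) =
       dsum (\<lambda>\<mu>. sgn1 (int ?N) * cb ?N (\<mu> - m)) (m + n - int ?N) p" (is "finite {(i, j). ?g i j \<noteq> 0} \<and> _")
    proof -
      have idx: "m - 1 - i + (n - 1 - j) - int N2 = m + n - int ?N - 2 - (i + j - int N1)" for i j by simp
      show ?thesis
        unfolding e1 e2 idx
      proof (rule DT)
        fix \<mu>1 \<mu>2
        have e: "sgn1 (int N1) * cb N1 (\<mu>1 - i) * (sgn1 (int N2) * cb N2 (\<mu>2 - (m - 1 - i))) =
            sgn1 (int ?N) * (cb N2 (i - (m - 1 - \<mu>2)) * cb N1 (\<mu>1 - i))" for i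
          by (simp add: algebra_simps sgn1_add)
        show "finite {i. sgn1 (int N1) * cb N1 (\<mu>1 - i) * (sgn1 (int N2) * cb N2 (\<mu>2 - (m - 1 - i))) \<noteq> 0}"
          unfolding e by (rule finite_subset[OF _ cb_conv(1)[of N2 "m - 1 - \<mu>2" N1 \<mu>1]]) auto
        show "Sum_any (\<lambda>i. sgn1 (int N1) * cb N1 (\<mu>1 - i) * (sgn1 (int N2) * cb N2 (\<mu>2 - (m - 1 - i)))) =
            sgn1 (int ?N) * cb ?N (\<mu>1 + \<mu>2 + 1 - m)"
          unfolding e by (subst Sum_any_right_distrib[symmetric, OF cb_conv(1)])
              (simp only: cb_conv(2), simp add: algebra_simps)
      qed
    qed
    then have fin: "finite {(i, j). ?g i j \<noteq> 0}"
      and sum: "Sum_any (\<lambda>(i, j). ?g i j) = dsum (\<lambda>\<mu>. sgn1 (int ?N) * cb ?N (\<mu> - m)) (m + n - int ?N) p" by auto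
    have "tensor_action act1 act2 (a' \<otimes>\<^sub>C b') n (tensor_action act1 act2 (a \<otimes>\<^sub>C b) m (u \<otimes>\<^sub>C u'))
      = Sum_any (\<lambda>i. Sum_any (\<lambda>j. ?g i j))"
      unfolding T(1)[of a] by (subst Sum_any_clinear[OF linT finT]) (simp only: T(1))
    also have "\<dots> = dsum (\<lambda>\<mu>. sgn1 (int ?N) * cb ?N (\<mu> - m)) (m + n - int ?N) p"
      using Sum_any_pair(1)[OF fin] sum by simp
    finally show ?thesis .
  qed
  have R3: "tensor_action act1 act2 (tensor_action Y1 Y2 (a \<otimes>\<^sub>C b) t (a' \<otimes>\<^sub>C b')) q (u \<otimes>\<^sub>C u')
      = dsum (kap3 ?N t) (q + t - int ?N) p" for t q
  proof -
    have "finite {(i, j). act1 (Y1 a i a') j u \<otimes>\<^sub>C act2 (Y2 b (t - 1 - i) b') (q - 1 - j) u' \<noteq> 0} \<and>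
       Sum_any (\<lambda>(i, j). act1 (Y1 a i a') j u \<otimes>\<^sub>C act2 (Y2 b (t - 1 - i) b') (q - 1 - j) u') =
       dsum (kap3 ?N t) (q + t - int ?N) p" (is "finite {(i, j). ?g i j \<noteq> 0} \<and> _")
    proof -
      have idx: "q - 1 - j + (t - 1 - i) - int N2 = q + t - int ?N - 2 - (i + j - int N1)"
          "j + i - int N1 = i + j - int N1" for i j by simp_all
      show ?thesis
        unfolding e1 e2 idx
      proof (rule DT)
        fix \<mu>1 \<mu>2
        have e: "kap3 N1 i \<mu>1 * kap3 N2 (t - 1 - i) \<mu>2 =
            gb (of_int (- \<mu>2 - 1)) (i - (t - int N2)) * gb (of_int (- \<mu>1 - 1)) (int N1 - 1 - i)" for i
          by (simp add: kap3_def algebra_simps)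
        show "finite {i. kap3 N1 i \<mu>1 * kap3 N2 (t - 1 - i) \<mu>2 \<noteq> 0}"
          unfolding e by (rule gb_conv)
        show "Sum_any (\<lambda>i. kap3 N1 i \<mu>1 * kap3 N2 (t - 1 - i) \<mu>2) = kap3 ?N t (\<mu>1 + \<mu>2 + 1)"
          unfolding e gb_conv by (simp add: kap3_def algebra_simps)
      qed
    qed
    then have fin: "finite {(i, j). ?g i j \<noteq> 0}"
      and sum: "Sum_any (\<lambda>(i, j). ?g i j) = dsum (kap3 ?N t) (q + t - int ?N) p" by auto
    have "tensor_action act1 act2 (tensor_action Y1 Y2 (a \<otimes>\<^sub>C b) t (a' \<otimes>\<^sub>C b')) q (u \<otimes>\<^sub>C u')
      = Sum_any (\<lambda>i. Sum_any (\<lambda>j. ?g i j))"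
      unfolding TY by (subst Sum_any_clinear[OF linT1 finY]) (simp only: T(1))
    also have "\<dots> = dsum (kap3 ?N t) (q + t - int ?N) p"
      using Sum_any_pair(1)[OF fin] sum by simp
    finally show ?thesis .
  qed
  show ?thesis unfolding vrep_def using bd R1 R2 R3 by blast
qed

text \<open>Of the second factor only expansions on spanning sets are required, because it is itself
  going to be a tensor product, for which \<open>vrep\<close> is known on pure tensors and not as
  part of a module structure. All terms are linear in each argument, so the formula extends from the
  spanning sets.\<close>

lemma tensor_commutator:
  assumes act1: "vertex_module vac1 Y1 act1" and act2: "\<And>n. cbilinear (\<lambda>a. act2 a n)" "\<And>a u. \<exists>N. \<forall>n\<ge>N. act2 a n u = 0"
    and Y1: "vertex_module vac1 Y1 Y1" and Y2: "\<And>n. cbilinear (\<lambda>a. Y2 a n)" "\<And>a u. \<exists>N. \<forall>n\<ge>N. Y2 a n u = 0"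
    and gen: "\<And>b. b \<in> cvec.span B" "\<And>u. u \<in> cvec.span U"
    and r2: "\<And>b b' u. b \<in> B \<Longrightarrow> b' \<in> B \<Longrightarrow> u \<in> U \<Longrightarrow> \<exists>N p. vrep Y2 act2 b b' u N p"
  shows "tensor_action act1 act2 s m (tensor_action act1 act2 s' n t) - tensor_action act1 act2 s' n (tensor_action act1 act2 s m t) =
    Sum_any (\<lambda>j::nat. (of_int m gchoose j) *\<^sub>C tensor_action act1 act2 (tensor_action Y1 Y2 s (int j) s') (m + n - int j) t)"
proof -
  note a1 = vertex_moduleD(1)[OF act1] vertex_moduleD(4)[OF act1]
  note y1 = vertex_moduleD(1)[OF Y1] vertex_moduleD(4)[OF Y1]
  let ?T = "tensor_action act1 act2" and ?Y = "tensor_action Y1 Y2"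
  note T = cbilinearD[OF tensor_action_tensor(2)[of act1 act2, OF a1 act2]]
  note YT = cbilinearD[OF tensor_action_tensor(2)[of Y1 Y2, OF y1 Y2]]
  have trY: "\<exists>N. \<forall>n\<ge>N. ?Y s n s' = 0" for s s'
    by (rule tensor_action_lift(1)[of Y1 Y2, OF y1 Y2])
  define F where "F s s' t j = (of_int m gchoose j) *\<^sub>C ?T (?Y s (int j) s') (m + n - int j) t" for s s' t and j :: nat
  have fin: "finite {j. F s s' t j \<noteq> 0}" for s s' t
  proof -
    obtain N where N: "\<And>j. j \<ge> N \<Longrightarrow> ?Y s j s' = 0" using trY by meson
    have "{j. F s s' t j \<noteq> 0} \<subseteq> {..<nat N}"
    proof
      fix j assume j: "j \<in> {j. F s s' t j \<noteq> 0}"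
      then have "?Y s (int j) s' \<noteq> 0" by (auto simp: F_def clinear_0[OF T(2)])
      then have "\<not> N \<le> int j" using N by blast
      then show "j \<in> {..<nat N}" by simp
    qed
    then show ?thesis by (rule finite_subset) simp
  qed
  define R where "R s s' t = Sum_any (F s s' t)" for s s' t
  have R: "clinear (\<lambda>s. R s s' t)" "clinear (\<lambda>s'. R s s' t)" "clinear (R s s')" for s s' t
  proof -
    have F: "clinear (\<lambda>s. F s s' t j)" "clinear (\<lambda>s'. F s s' t j)" "clinear (\<lambda>t. F s s' t j)" for s s' t j
      unfolding F_def by (intro clinear_const_scale clinear_compose[OF T(2)] YT T)+
    show "clinear (\<lambda>s. R s s' t)" "clinear (\<lambda>s'. R s s' t)" "clinear (R s s')"
      unfolding R_def by (rule clinear_Sum_any[OF F(1) fin], rule clinear_Sum_any[OF F(2) fin], rule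
          clinear_Sum_any[OF F(3) fin])
  qed
  define L where "L s s' t = ?T s m (?T s' n t) - ?T s' n (?T s m t)" for s s' t
  have L: "clinear (\<lambda>s. L s s' t)" "clinear (\<lambda>s'. L s s' t)" "clinear (L s s')" for s s' t
    unfolding L_def by (intro clinear_minus_fun T clinear_compose[OF T(1) T(2)] clinear_compose[OF T(1) T(1)])+
  let ?P = "{a \<otimes>\<^sub>C b | a b. b \<in> B}" and ?M = "{a \<otimes>\<^sub>C u | a u. u \<in> U}"
  have spanP: "s \<in> cvec.span {a \<otimes>\<^sub>C b | a b. b \<in> B'}" if "\<And>b. b \<in> cvec.span B'" for s B'
  proof (induction s rule: tensor_induct)
    case zero show ?case by (rule cvec.span_zero)
  next
    case (step a b s)
    have "a \<otimes>\<^sub>C b \<in> cvec.span {a \<otimes>\<^sub>C b | a b. b \<in> B'}"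
      by (rule clinear_maps_span[OF clinear_tensor_right[OF clinear_id] cvec.subspace_span _ that])
        (auto intro: cvec.span_base)
    then show ?case using step by (rule cvec.span_add)
  qed
  have pure: "L s s' t = R s s' t" if P: "s \<in> ?P" "s' \<in> ?P" "t \<in> ?M" for s s' t
  proof -
    obtain a b a' b' v u where e: "s = a \<otimes>\<^sub>C b" "s' = a' \<otimes>\<^sub>C b'" "t = v \<otimes>\<^sub>C u" "b \<in> B" "b' \<in> B" "u \<in> U" using P by blast
    obtain N1 p1 where "vrep Y1 act1 a a' v N1 p1"
      using vrep_exists[OF act1 vertex_moduleD(4)[OF Y1]] by blast
    moreover obtain N2 p2 where "vrep Y2 act2 b b' u N2 p2" using r2 e by blast
    ultimately obtain p where r: "vrep ?Y ?T s s' t (N1 + N2) p"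
      unfolding e using vrep_tensor[of act1 act2 Y1 Y2, OF a1 act2 y1 Y2] by blast
    have "L s s' t = (\<Sum>j<N1 + N2. F s s' t j)"
      unfolding L_def F_def by (rule vrep_commutator(1)[OF r])
    also have "\<dots> = R s s' t"
      unfolding R_def
    proof (rule Sum_any.expand_superset[symmetric])
      show "{j. F s s' t j \<noteq> 0} \<subseteq> {..<N1 + N2}"
      proof
        fix j assume "j \<in> {j. F s s' t j \<noteq> 0}"
        then have "?T (?Y s (int j) s') (m + n - int j) t \<noteq> 0" by (auto simp: F_def)
        then have "\<not> int (N1 + N2) \<le> int j" using vrep_commutator(2)[OF r] by blast
        then show "j \<in> {..<N1 + N2}" by simp
      qed
    qed simp
    finally show ?thesis .
  qed
  have 1: "L s s' t = R s s' t" if "s' \<in> ?P" "t \<in> ?M" for s s' t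
    by (rule clinear_eq_on_span[OF L(1) R(1) _ spanP[OF gen(1)]]) (rule pure[OF _ that])
  have 2: "L s s' t = R s s' t" if "t \<in> ?M" for s s' t
    by (rule clinear_eq_on_span[OF L(2) R(2) _ spanP[OF gen(1)]]) (rule 1[OF _ that])
  have "L s s' t = R s s' t"
    by (rule clinear_eq_on_span[OF L(3) R(3) _ spanP[OF gen(2)]]) (rule 2)
  then show ?thesis by (simp add: L_def R_def F_def)
qed

subsection \<open>Modes of vertex modules\<close>

lemma vm_commutator_ope:
  assumes M: "vertex_module vac Y act" and o: "ope Y a b cs"
  shows "act a m (act b n u) = act b n (act a m u) +
    (\<Sum>j<length cs. (of_int m gchoose j) *\<^sub>C act (cs ! j) (m + n - int j) u)"
proof -
  have "(\<Sum>j<length cs. (of_int m gchoose j) *\<^sub>C act (cs ! j) (m + n - int j) u) =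
     Sum_any (\<lambda>j::nat. ((of_int m :: complex) gchoose j) *\<^sub>C act (Y a (0 + int j) b) (m + n - int j) u)"
    using o by (subst Sum_any.expand_superset[of "{..<length cs}"])
      (auto simp: ope_def clinear_0[OF vertex_moduleD(3)[OF M]] intro!: sum.cong split: if_splits)
  also have "\<dots> = act a m (act b n u) - act b n (act a m u)"
    unfolding borcherds[OF M]
    by (subst Sum_any_single[of 0]) (auto simp: gbinomial_0_left cscale_one)
  finally show ?thesis by simp
qed

lemma vm_iterate:
  assumes M: "vertex_module vac Y act"
  shows "act (Y a n b) p u = Sum_any (\<lambda>j::nat. ((- 1) ^ j * ((of_int n :: complex) gchoose j)) *\<^sub>C
            (act a (n - int j) (act b (p + int j) u)
             - ((- 1) powi n) *\<^sub>C act b (n + p - int j) (act a (int j) u)))"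
  using borcherds[OF M, where m = 0 and a = a and b = b and n = n and p = p and u = u]
  by (subst (asm) Sum_any_single[of 0]) (auto simp: cscale_one gbinomial_0_left)

lemma vm_iterate_minus1:
  assumes M: "vertex_module vac Y act"
  shows "act (Y a (- 1) b) p u = Sum_any (\<lambda>j::nat. act a (- 1 - int j) (act b (p + int j) u)
             + act b (p - 1 - int j) (act a (int j) u))"
proof -
  have c: "(- 1) ^ j * ((of_int (- 1) :: complex) gchoose j) = 1" for j
    using gbinomial_minus[of "1::complex" j] by (simp add: binomial_gbinomial[symmetric] flip: power_mult_distrib)
  show ?thesis
    unfolding vm_iterate[OF M] c by (simp add: cscale_one cvec.scale_minus_left algebra_simps)
qed

lemma vm_closed_iterate:
  assumes M: "vertex_module vac Y act" and N: "cvec.subspace N"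
    and ab: "\<And>m u. u \<in> N \<Longrightarrow> act a m u \<in> N" "\<And>m u. u \<in> N \<Longrightarrow> act b m u \<in> N"
    and u: "u \<in> N"
  shows "act (Y a n b) p u \<in> N"
  unfolding vm_iterate[OF M]
  by (rule Sum_any_in_subspace[OF N]) (intro cvec.subspace_scale[OF N] cvec.subspace_diff[OF N] ab u)

text \<open>In the iterate formula the modes of the vacuum vanish except at -1, so at most one term
  survives; its coefficient comes from \<open>(-1)^j (-2 gchoose j) = j + 1\<close>.\<close>

lemma vm_translation:
  assumes M: "vertex_module vac Y act"
  shows "act (translation vac Y a) n u = (- of_int n) *\<^sub>C act a (n - 1) u"
proof -
  have c: "(- 1) ^ j * ((of_int (- 2) :: complex) gchoose j) = of_nat (Suc j)" for j
  proof -
    have "((of_int (- 2) :: complex) gchoose j) = (- 1) ^ j * (of_nat (Suc j) gchoose j)"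
      using gbinomial_minus[of "2::complex" j] by (simp add: algebra_simps)
    also have "(of_nat (Suc j) gchoose j :: complex) = of_nat (Suc j choose j)" by (simp only: binomial_gbinomial)
    finally show ?thesis by (simp flip: power_mult_distrib)
  qed
  note v = vertex_moduleD(5)[OF M] and z = clinear_0[OF vertex_moduleD(2)[OF M]]
  have "act (Y a (- 2) vac) n u = Sum_any (\<lambda>j::nat. of_nat (Suc j) *\<^sub>C
            (act a (- 2 - int j) (act vac (n + int j) u) - act vac (- 2 + n - int j) (act a (int j) u)))" (is "_ =
                Sum_any ?f")
    unfolding vm_iterate[OF M] c by (simp add: cscale_one)
  also have "\<dots> = (- of_int n) *\<^sub>C act a (n - 1) u"
  proof (cases "n < 0")
    case True
    have "Sum_any ?f = ?f (nat (- 1 - n))"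
      by (rule Sum_any_single) (use True in \<open>auto simp: v z\<close>)
    then show ?thesis using True by (simp add: v z)
  next
    case False
    show ?thesis
    proof (cases "n = 0")
      case True then show ?thesis by (subst Sum_any_single[of 0]) (auto simp: v z)
    next
      case n: False
      have "Sum_any ?f = ?f (nat (n - 1))"
        by (rule Sum_any_single) (use n False in \<open>auto simp: v z\<close>)
      then show ?thesis using n False by (simp add: v z cvec.scale_minus_left cvec.scale_minus_right)
    qed
  qed
  finally show ?thesis by (simp add: translation_def)
qed

text \<open>Commuting fields need no normal ordering: the creation half and the annihilation half of
  the iterate formula join to a single sum over all integers.\<close>

lemma vm_product:
  assumes M: "vertex_module vac Y act" and o: "ope Y a b []"
  shows "act a m (act b n u) = act b n (act a m u)"
    and "act (Y a (- 1) b) p u = Sum_any (\<lambda>i::int. act a i (act b (p - 1 - i) u))"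
proof -
  show comm: "act a m (act b n u) = act b n (act a m u)" for m n u
    using vm_commutator_ope[OF M o] by simp
  note z = clinear_0[OF vertex_moduleD(2)[OF M]]
  obtain Ka where Ka: "\<And>n. n \<ge> Ka \<Longrightarrow> act a n u = 0" using vertex_moduleD(4)[OF M] by meson
  obtain Kb where Kb: "\<And>n. n \<ge> Kb \<Longrightarrow> act b n u = 0" using vertex_moduleD(4)[OF M] by meson
  define g where "g i = act a i (act b (p - 1 - i) u)" for i
  define K where "K = nat (\<bar>Ka\<bar> + \<bar>Kb\<bar> + \<bar>p\<bar> + 2)"
  have g0: "g i = 0" if "i \<ge> int K \<or> i \<le> - int K" for i
    using that
  proof
    assume "i \<ge> int K" then show ?thesis unfolding g_def comm[of i] by (subst Ka) (auto simp: K_def z)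
  next
    assume "i \<le> - int K" then show ?thesis unfolding g_def by (subst Kb) (auto simp: K_def z)
  qed
  have "act (Y a (- 1) b) p u = Sum_any (\<lambda>j::nat. g (- 1 - int j) + g (int j))"
    unfolding vm_iterate_minus1[OF M] g_def by (simp add: comm algebra_simps)
  also have "\<dots> = (\<Sum>j<K. g (- 1 - int j) + g (int j))"
  proof (rule Sum_any.expand_superset)
    show "{j. g (- 1 - int j) + g (int j) \<noteq> 0} \<subseteq> {..<K}"
    proof
      fix j assume "j \<in> {j. g (- 1 - int j) + g (int j) \<noteq> 0}"
      then have "g (- 1 - int j) \<noteq> 0 \<or> g (int j) \<noteq> 0" by auto
      then show "j \<in> {..<K}" using g0[of "- 1 - int j"] g0[of "int j"] by force
    qed
  qed simp
  also have "\<dots> = (\<Sum>j<K. g (- 1 - int j)) + (\<Sum>j<K. g (int j))" by (rule sum.distrib)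
  also have "(\<Sum>j<K. g (- 1 - int j)) = (\<Sum>i\<in>{- int K..<0}. g i)"
    by (rule sum.reindex_bij_witness[of _ "\<lambda>i. nat (- 1 - i)" "\<lambda>j. - 1 - int j"]) auto
  also have "(\<Sum>j<K. g (int j)) = (\<Sum>i\<in>{0..<int K}. g i)"
    by (rule sum.reindex_bij_witness[of _ nat int]) auto
  also have "(\<Sum>i\<in>{- int K..<0}. g i) + (\<Sum>i\<in>{0..<int K}. g i) = (\<Sum>i\<in>{- int K..<0} \<union> {0..<int K}. g i)"
    by (rule sum.union_disjoint[symmetric]) auto
  also have "\<dots> = Sum_any g"
  proof (rule Sum_any.expand_superset[symmetric])
    show "{i. g i \<noteq> 0} \<subseteq> {- int K..<0} \<union> {0..<int K}"
    proof
      fix i assume "i \<in> {i. g i \<noteq> 0}"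
      then have "\<not> (i \<ge> int K \<or> i \<le> - int K)" using g0 by blast
      then show "i \<in> {- int K..<0} \<union> {0..<int K}" by auto
    qed
  qed simp
  finally show "act (Y a (- 1) b) p u = Sum_any (\<lambda>i::int. act a i (act b (p - 1 - i) u))" by (simp add: g_def)
qed

lemma pbw_basis_span:
  assumes "pbw_basis Y gs I u"
  shows "w \<in> cvec.span {pbw_monomial Y gs ws (u l) | ws l. ws \<in> pbw_words (length gs) \<and> l \<in> I}"
proof -
  have "(\<lambda>(ws, l). pbw_monomial Y gs ws (u l)) ` (pbw_words (length gs) \<times> I) =
      {pbw_monomial Y gs ws (u l) | ws l. ws \<in> pbw_words (length gs) \<and> l \<in> I}" by auto
  then show ?thesis using assms by (simp add: pbw_basis_def Let_def)
qed

lemma pbw_words_Cons: "x # ws \<in> pbw_words r \<Longrightarrow> ws \<in> pbw_words r \<and> fst x < r"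
  by (auto simp: pbw_words_def)

lemma pbw_basis_nonzero:
  assumes "pbw_basis Y gs I u" "l \<in> I" shows "u l \<noteq> 0"
proof
  assume "u l = 0"
  moreover have "pbw_monomial Y gs [] (u l) \<in> (\<lambda>(ws, l). pbw_monomial Y gs ws (u l)) ` (pbw_words (length gs) \<times> I)"
    using assms(2) by (force simp: pbw_words_def)
  ultimately have "cvec.dependent ((\<lambda>(ws, l). pbw_monomial Y gs ws (u l)) ` (pbw_words (length gs) \<times> I))"
    using cvec.dependent_zero by (simp add: pbw_monomial_def)
  then show False using assms(1) by (simp add: pbw_basis_def Let_def)
qed

lemma pbw_monomial_Cons: "pbw_monomial act gs (x # ws) u = act (gs ! fst x) (- int (snd x) - 1) (pbw_monomial act gs ws u)"
  by (simp add: pbw_monomial_def split_def)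

lemma pbw_induct:
  assumes pbw: "pbw_basis Y gs I u" and N: "cvec.subspace N"
    and base: "\<And>l. l \<in> I \<Longrightarrow> u l \<in> N" and step: "\<And>g n w. g \<in> set gs \<Longrightarrow> w \<in> N \<Longrightarrow> Y g (- int n - 1) w \<in> N"
  shows "w \<in> N"
proof -
  have "pbw_monomial Y gs ws (u l) \<in> N" if "ws \<in> pbw_words (length gs)" "l \<in> I" for ws l
    using that(1)
  proof (induction ws)
    case Nil then show ?case using base[OF that(2)] by (simp add: pbw_monomial_def)
  next
    case (Cons x ws)
    then show ?case using pbw_words_Cons[OF Cons.prems] by (simp add: pbw_monomial_Cons step)
  qed
  then have "{pbw_monomial Y gs ws (u l) | ws l. ws \<in> pbw_words (length gs) \<and> l \<in> I} \<subseteq> N" by auto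
  from subsetD[OF cvec.span_minimal[OF this N] pbw_basis_span[OF pbw]] show ?thesis .
qed

text \<open>By the iterate formula, the elements all of whose modes preserve \<open>N\<close> are
  closed under every product.\<close>

lemma vm_closed_generated:
  assumes M: "vertex_module vac Y act" and pbw: "pbw_basis Y gs I u" and N: "cvec.subspace N"
    and gs: "\<And>g m w. g \<in> set gs \<Longrightarrow> w \<in> N \<Longrightarrow> act g m w \<in> N"
    and us: "\<And>l m w. l \<in> I \<Longrightarrow> w \<in> N \<Longrightarrow> act (u l) m w \<in> N"
    and w: "w \<in> N"
  shows "act a m w \<in> N"
proof -
  let ?A = "{a. \<forall>m. \<forall>w\<in>N. act a m w \<in> N}"
  have "cvec.subspace ?A"
    using clinear_simps[OF vertex_moduleD(3)[OF M]] N
    by (auto simp: cvec.subspace_def)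
  then have "a \<in> ?A"
    by (rule pbw_induct[OF pbw]) (use us vm_closed_iterate[OF M N] gs in auto)
  then show ?thesis using w by blast
qed

text \<open>The module axioms are linear in the vector, so they may be checked on the images of the
  embeddings \<open>emb i\<close>, where they are the axioms of the given module. This lets each
  factor of a tensor product act on the whole product through its own slot.\<close>

lemma vertex_module_lift:
  fixes act :: "'v::cvec \<Rightarrow> int \<Rightarrow> 'm::cvec \<Rightarrow> 'm" and lft :: "('m \<Rightarrow> 'm) \<Rightarrow> 'r::cvec \<Rightarrow> 'r"
  assumes M: "vertex_module vac Y act" and Y: "vertex_module vac Y Y"
    and lft: "\<And>f. clinear f \<Longrightarrow> clinear (lft f)" "\<And>f x i. clinear f \<Longrightarrow> i \<in> I \<Longrightarrow> lft f (emb i x) = emb i (f x)"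
    and emb: "\<And>i. i \<in> I \<Longrightarrow> clinear (emb i)" "\<And>r. r \<in> cvec.span {emb i x | i x. i \<in> I}"
  shows "vertex_module vac Y (\<lambda>a n. lft (act a n))"
proof -
  note lin = vertex_moduleD(2)[OF M] and lin1 = vertex_moduleD(3)[OF M]
  let ?S = "{emb i x | i x. i \<in> I}"
  let ?A = "\<lambda>a n. lft (act a n)"
  have L: "clinear (?A a n)" for a n by (rule lft(1)[OF lin])
  have E: "?A a n (emb i x) = emb i (act a n x)" if "i \<in> I" for a n i x by (rule lft(2)[OF lin that])
  have eqI: "f r = g r" if "clinear f" "clinear g" "\<And>i x. i \<in> I \<Longrightarrow> f (emb i x) = g (emb i x)" for f g :: "'r \<Rightarrow> 'r" and r
    by (rule clinear_eq_on_span[OF that(1,2) _ emb(2)]) (use that(3) in auto)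
  have L1: "clinear (\<lambda>a. ?A a n r)" for n r
  proof -
    have "?A (a + b) n r = ?A a n r + ?A b n r" for a b
      by (rule eqI[of "?A (a + b) n" "\<lambda>r. ?A a n r + ?A b n r"])
        (auto simp: L clinear_add[OF lin1] E clinear_add[OF emb(1)])
    moreover have "?A (z *\<^sub>C a) n r = z *\<^sub>C ?A a n r" for a z
      by (rule eqI[of "?A (z *\<^sub>C a) n" "\<lambda>r. z *\<^sub>C ?A a n r"])
        (auto simp: L clinear_scale[OF lin1] E clinear_scale[OF emb(1)])
    ultimately show ?thesis by (simp add: clinear_iff)
  qed
  have tr: "\<exists>N. \<forall>n\<ge>N. ?A a n r = 0" for a r
    using emb(2)[of r]
  proof (induction rule: cvec.span_induct_alt)
    case base then show ?case by (simp add: clinear_0[OF L])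
  next
    case (step z s r)
    then obtain i x where s: "s = emb i x" "i \<in> I" by auto
    obtain N where N: "\<And>n. n \<ge> N \<Longrightarrow> act a n x = 0" using vertex_moduleD(4)[OF M] by meson
    obtain K where K: "\<And>n. n \<ge> K \<Longrightarrow> ?A a n r = 0" using step(2) by auto
    show ?case
      by (intro exI[of _ "max N K"])
        (simp add: clinear_add[OF L] clinear_scale[OF L] s E N K clinear_0[OF emb(1)])
  qed
  have vac: "?A vac n r = (if n = -1 then r else 0)" for n r
  proof -
    have c: "clinear (\<lambda>r::'r. if n = -1 then r else 0)" by (simp add: clinear_iff)
    show ?thesis
      by (rule eqI[OF L c]) (simp add: E vertex_moduleD(5)[OF M] clinear_0[OF emb(1)])
  qed
  have bor: "Sum_any (\<lambda>j::nat. ((of_int m :: complex) gchoose j) *\<^sub>C ?A (Y a (n + int j) b) (m + p - int j) r) =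
        Sum_any (\<lambda>j::nat. ((- 1) ^ j * ((of_int n :: complex) gchoose j)) *\<^sub>C
            (?A a (m + n - int j) (?A b (p + int j) r)
             - ((- 1) powi n) *\<^sub>C ?A b (n + p - int j) (?A a (m + int j) r)))" (is "Sum_any (?F r) = Sum_any (?G
                 r)") for m n p a b r
  proof -
    have fin1: "finite {j::nat. ((of_int m :: complex) gchoose j) *\<^sub>C B (Y a (n + int j) b) (m + p - int j) q \<noteq> 0}"
      if B: "\<And>n q. clinear (\<lambda>a. B a n q)" for B :: "'v \<Rightarrow> int \<Rightarrow> 'q \<Rightarrow> 'q::cvec" and q
    proof -
      obtain N where N: "\<And>j. j \<ge> N \<Longrightarrow> Y a j b = 0" using vertex_moduleD(4)[OF Y] by meson
      have "{j::nat. ((of_int m :: complex) gchoose j) *\<^sub>C B (Y a (n + int j) b) (m + p - int j) q \<noteq> 0} \<subseteq> {..nat (\<bar>N\<bar> + \<bar>n\<bar>)}"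
      proof
        fix j :: nat assume "j \<in> {j. ((of_int m :: complex) gchoose j) *\<^sub>C B (Y a (n + int j) b) (m + p - int j) q \<noteq> 0}"
        then have "Y a (n + int j) b \<noteq> 0" by (auto simp: clinear_0[OF B])
        then have "\<not> n + int j \<ge> N" using N by blast
        then show "j \<in> {..nat (\<bar>N\<bar> + \<bar>n\<bar>)}" by auto
      qed
      then show ?thesis by (rule finite_subset) simp
    qed
    have fin2: "finite {j::nat. ((- 1) ^ j * ((of_int n :: complex) gchoose j)) *\<^sub>C
            (B a (m + n - int j) (B b (p + int j) q)
             - ((- 1) powi n) *\<^sub>C B b (n + p - int j) (B a (m + int j) q)) \<noteq> 0}"
      if B: "\<And>a n. clinear (B a n)" "\<And>a q. \<exists>N. \<forall>n\<ge>N. B a n q = 0" for B :: "'v \<Rightarrow> int \<Rightarrow> 'q \<Rightarrow> 'q::cvec" and q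
    proof -
      obtain N where N: "\<And>n. n \<ge> N \<Longrightarrow> B b n q = 0" using B(2) by meson
      obtain K where K: "\<And>n. n \<ge> K \<Longrightarrow> B a n q = 0" using B(2) by meson
      show ?thesis
      proof (rule finite_subset[of _ "{..nat (\<bar>N\<bar> + \<bar>K\<bar> + \<bar>p\<bar> + \<bar>m\<bar>)}"], rule subsetI, rule ccontr)
        fix j assume j: "j \<in> {j::nat. ((- 1) ^ j * ((of_int n :: complex) gchoose j)) *\<^sub>C
            (B a (m + n - int j) (B b (p + int j) q)
             - ((- 1) powi n) *\<^sub>C B b (n + p - int j) (B a (m + int j) q)) \<noteq> 0}"
        assume "j \<notin> {..nat (\<bar>N\<bar> + \<bar>K\<bar> + \<bar>p\<bar> + \<bar>m\<bar>)}"
        then have "p + int j \<ge> N" "m + int j \<ge> K" by auto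
        then show False using j by (simp add: N K clinear_0[OF B(1)])
      qed simp
    qed
    show ?thesis
    proof (rule eqI[of "\<lambda>r. Sum_any (?F r)" "\<lambda>r. Sum_any (?G r)"])
      show "clinear (\<lambda>r. Sum_any (?F r))"
        by (rule clinear_Sum_any[OF _ fin1[OF L1]]) (intro clinear_const_scale L)
      show "clinear (\<lambda>r. Sum_any (?G r))"
        by (rule clinear_Sum_any[OF _ fin2[OF L tr]])
          (intro clinear_const_scale clinear_minus_fun clinear_compose[OF L L])
      fix i x assume i: "i \<in> I"
      have "Sum_any (?F (emb i x)) = emb i (Sum_any (\<lambda>j::nat. ((of_int m :: complex) gchoose j) *\<^sub>C act (Y a (n + int j) b) (m + p - int j) x))"
        by (subst Sum_any_clinear[OF emb(1)[OF i] fin1[OF lin1]]) (simp add: E i clinear_scale[OF emb(1)[OF i]])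
      also have "\<dots> = Sum_any (?G (emb i x))"
        unfolding borcherds[OF M]
        by (subst Sum_any_clinear[OF emb(1)[OF i] fin2[OF lin vertex_moduleD(4)[OF M]]])
          (simp add: E i clinear_scale[OF emb(1)[OF i]] clinear_diff[OF emb(1)[OF i]])
      finally show "Sum_any (?F (emb i x)) = Sum_any (?G (emb i x))" .
    qed
  qed
  show ?thesis
    unfolding vertex_module_def cbilinear_def using L L1 tr vac bor by blast
qed

subsection \<open>Affine modules\<close>

lemmas sl3_basis_defs = e1_def e2_def e3_def h1_def h2_def f1_def f2_def f3_def mat_unit_def

lemma sl3_basis [simp]: "e1 \<in> sl3" "e2 \<in> sl3" "e3 \<in> sl3" "h1 \<in> sl3" "h2 \<in> sl3" "f1 \<in> sl3" "f2 \<in> sl3" "f3 \<in> sl3"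
  by (simp_all add: sl3_def sl3_basis_defs trace_def sum_3)

lemma trace_simps:
  "trace (A + B) = trace A + trace (B::complex^3^3)" "trace (A - B) = trace A - trace B" "trace (- A) = - trace A"
  "trace (z *\<^sub>C A) = z * trace A" "trace (0::complex^3^3) = 0" "trace (commutator A B) = 0"
  by (simp_all add: trace_def sum_3 commutator_def matrix_matrix_mult_def cscale_vec_def
      cscale_complex_def algebra_simps)

lemma sl3_closed [simp]:
  "A \<in> sl3 \<Longrightarrow> B \<in> sl3 \<Longrightarrow> A + B \<in> sl3" "A \<in> sl3 \<Longrightarrow> B \<in> sl3 \<Longrightarrow> A - B \<in> sl3"
  "A \<in> sl3 \<Longrightarrow> - A \<in> sl3" "A \<in> sl3 \<Longrightarrow> z *\<^sub>C A \<in> sl3" "0 \<in> sl3" "commutator A B \<in> sl3"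
  by (simp_all add: sl3_def trace_simps)

lemma sl3_expand:
  assumes "A \<in> sl3"
  shows "A = (A $ 1 $ 2) *\<^sub>C e1 + (A $ 2 $ 3) *\<^sub>C e2 + (A $ 1 $ 3) *\<^sub>C e3 + (A $ 1 $ 1) *\<^sub>C h1
     + (A $ 1 $ 1 + A $ 2 $ 2) *\<^sub>C h2 + (A $ 2 $ 1) *\<^sub>C f1 + (A $ 3 $ 2) *\<^sub>C f2 + (A $ 3 $ 1) *\<^sub>C f3"
proof -
  have "A $ 3 $ 3 = - A $ 1 $ 1 - A $ 2 $ 2"
    using assms by (simp add: sl3_def trace_def sum_3 add_eq_0_iff algebra_simps)
  then show ?thesis
    by (simp add: vec_eq_iff forall_3 sl3_basis_defs cscale_vec_def cscale_complex_def)
qed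

lemma sl3_comm_table [simp]:
  "commutator e1 e2 = e3" "commutator e2 e1 = - e3" "commutator e1 e3 = 0" "commutator e3 e1 = 0"
  "commutator e2 e3 = 0" "commutator e3 e2 = 0"
  "commutator f2 f1 = f3" "commutator f1 f2 = - f3" "commutator f1 f3 = 0" "commutator f3 f1 = 0"
  "commutator f2 f3 = 0" "commutator f3 f2 = 0"
  "commutator e1 f1 = h1" "commutator f1 e1 = - h1" "commutator e2 f2 = h2" "commutator f2 e2 = - h2"
  "commutator e3 f3 = h1 + h2" "commutator f3 e3 = - (h1 + h2)"
  "commutator e1 f2 = 0" "commutator f2 e1 = 0" "commutator e2 f1 = 0" "commutator f1 e2 = 0"
  "commutator e3 f1 = - e2" "commutator f1 e3 = e2" "commutator e3 f2 = e1" "commutator f2 e3 = - e1"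
  "commutator e1 f3 = - f2" "commutator f3 e1 = f2" "commutator e2 f3 = f1" "commutator f3 e2 = - f1"
  "commutator h1 e1 = 2 *\<^sub>C e1" "commutator h1 e2 = - e2" "commutator h1 e3 = e3"
  "commutator h2 e1 = - e1" "commutator h2 e2 = 2 *\<^sub>C e2" "commutator h2 e3 = e3"
  "commutator h1 f1 = - (2 *\<^sub>C f1)" "commutator h1 f2 = f2" "commutator h1 f3 = - f3"
  "commutator h2 f1 = f1" "commutator h2 f2 = - (2 *\<^sub>C f2)" "commutator h2 f3 = - f3"
  "commutator e1 h1 = - (2 *\<^sub>C e1)" "commutator e2 h1 = e2" "commutator e3 h1 = - e3"
  "commutator e1 h2 = e1" "commutator e2 h2 = - (2 *\<^sub>C e2)" "commutator e3 h2 = - e3"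
  "commutator f1 h1 = 2 *\<^sub>C f1" "commutator f2 h1 = - f2" "commutator f3 h1 = f3"
  "commutator f1 h2 = - f1" "commutator f2 h2 = 2 *\<^sub>C f2" "commutator f3 h2 = f3"
  "commutator h1 h2 = 0" "commutator h2 h1 = 0" "commutator A A = 0"
  by (simp_all add: commutator_def matrix_matrix_mult_def vec_eq_iff forall_3 sum_3 sl3_basis_defs
      cscale_vec_def cscale_complex_def)

lemma sl3_trace_table [simp]:
  "trace (e1 ** f1) = 1" "trace (f1 ** e1) = 1" "trace (e2 ** f2) = 1" "trace (f2 ** e2) = 1"
  "trace (e3 ** f3) = 1" "trace (f3 ** e3) = 1"
  "trace (h1 ** e3) = 0" "trace (h2 ** e3) = 0" "trace (e1 ** e3) = 0" "trace (e2 ** e3) = 0"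
  "trace (e3 ** e3) = 0" "trace (f1 ** e3) = 0" "trace (f2 ** e3) = 0"
  "trace (e3 ** h1) = 0" "trace (e3 ** h2) = 0"
  by (simp_all add: trace_def sum_3 matrix_matrix_mult_def sl3_basis_defs)

text \<open>The \<open>sl\<^sub>2\<close> computation modulo \<open>N\<close>: it stands for a
  calculation in the quotient by \<open>N\<close> without forming the quotient, as
  \<open>e u\<close> is only known to lie in \<open>N\<close>.\<close>

lemma sl2_string:
  fixes e f h :: "'m::cvec \<Rightarrow> 'm"
  assumes lin: "clinear f" and N: "cvec.subspace N"
    and stable: "\<And>w. w \<in> N \<Longrightarrow> f w \<in> N"
    and rel: "\<And>w. e (f w) = f (e w) + h w" "\<And>w. h (f w) = f (h w) - 2 *\<^sub>C f w"
    and u: "h u = l *\<^sub>C u" "e u \<in> N"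
  shows "h ((f ^^ i) u) = (l - 2 * of_nat i) *\<^sub>C (f ^^ i) u"
    and "e ((f ^^ Suc i) u) - (of_nat (Suc i) * (l - of_nat i)) *\<^sub>C (f ^^ i) u \<in> N"
proof -
  show hw: "h ((f ^^ i) u) = (l - 2 * of_nat i) *\<^sub>C (f ^^ i) u" for i
  proof (induction i)
    case (Suc i)
    then show ?case by (simp add: rel clinear_scale[OF lin] algebra_simps flip: cvec.scale_left_diff_distrib)
  qed (simp add: u)
  show "e ((f ^^ Suc i) u) - (of_nat (Suc i) * (l - of_nat i)) *\<^sub>C (f ^^ i) u \<in> N"
  proof (induction i)
    case 0
    show ?case using stable[OF u(2)] by (simp add: rel u)
  next
    case (Suc i)
    let ?w = "(f ^^ Suc i) u" and ?c = "of_nat (Suc i) * (l - of_nat i)"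
    have "f (e ?w) - ?c *\<^sub>C f ((f ^^ i) u) \<in> N"
      using stable[OF Suc] by (simp add: clinear_diff[OF lin] clinear_scale[OF lin])
    moreover have "f (e ?w) + h ?w - (?c + (l - 2 * of_nat (Suc i))) *\<^sub>C ?w = f (e ?w) - ?c *\<^sub>C f ((f ^^ i) u)"
      unfolding hw by (simp add: cscale_left_distrib)
    moreover have "?c + (l - 2 * of_nat (Suc i)) = of_nat (Suc (Suc i)) * (l - of_nat (Suc i))"
      by (simp add: algebra_simps)
    ultimately show ?case by (simp only: funpow.simps comp_def rel)
  qed
qed

text \<open>At the last power of \<open>f\<close> that keeps \<open>u\<close> outside
  \<open>N\<close>, the coefficient \<open>(i + 1)(l - i)\<close> of the string formula has to
  vanish.\<close>

lemma sl2_dominant: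
  fixes e f h :: "'m::cvec \<Rightarrow> 'm"
  assumes lin: "clinear f" and N: "cvec.subspace N"
    and stable: "\<And>w. w \<in> N \<Longrightarrow> f w \<in> N" "\<And>w. w \<in> N \<Longrightarrow> e w \<in> N"
    and rel: "\<And>w. e (f w) = f (e w) + h w" "\<And>w. h (f w) = f (h w) - 2 *\<^sub>C f w"
    and u: "h u = l *\<^sub>C u" "e u \<in> N" "u \<notin> N" and nil: "(f ^^ n) u \<in> N"
  obtains m :: nat where "l = of_nat m"
proof -
  note ew = sl2_string(2)[OF lin N stable(1) rel u(1,2)]
  define n0 where "n0 = (LEAST n. (f ^^ n) u \<in> N)"
  have n0: "(f ^^ n0) u \<in> N" unfolding n0_def by (rule LeastI[where P = "\<lambda>n. (f ^^ n) u \<in> N", OF nil])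
  have "n0 \<noteq> 0" using n0 u(3) by (metis funpow_0)
  then obtain i where i: "n0 = Suc i" by (cases n0) auto
  then have nN: "(f ^^ i) u \<notin> N" using not_less_Least[of i "\<lambda>n. (f ^^ n) u \<in> N"] by (simp add: n0_def)
  have "(of_nat (Suc i) * (l - of_nat i)) *\<^sub>C (f ^^ i) u \<in> N"
    using cvec.subspace_diff[OF N stable(2)[OF n0] ew[of i]] by (simp add: i)
  then have s: "inverse (of_nat (Suc i) * (l - of_nat i)) *\<^sub>C (of_nat (Suc i) * (l - of_nat i)) *\<^sub>C (f ^^ i) u \<in> N"
    by (rule cvec.subspace_scale[OF N])
  have "l = of_nat i"
  proof (rule ccontr)
    assume "l \<noteq> of_nat i"
    then have nz: "of_nat (Suc i) * (l - of_nat i) \<noteq> 0" by (simp del: of_nat_Suc)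
    show False using s nN unfolding cscale_cscale left_inverse[OF nz] cscale_one by simp
  qed
  then show ?thesis by (rule that)
qed

lemma funpow_closed:
  assumes f: "\<And>w. w \<in> U \<Longrightarrow> f w \<in> U" and u: "u \<in> U" shows "(f ^^ n) u \<in> U"
proof (induction n)
  case 0 show ?case using u by simp
next
  case (Suc n) show ?case using f[OF Suc] by simp
qed

text \<open>Otherwise the powers would be eigenvectors of \<open>h\<close> for infinitely many
  eigenvalues in a finite-dimensional space.\<close>

lemma weight_nilpotent:
  fixes f h :: "'m::cvec \<Rightarrow> 'm"
  assumes lin: "clinear f" "clinear h" and rel: "\<And>w. h (f w) = f (h w) + c *\<^sub>C f w" and c: "c \<noteq> 0"
    and U: "fin_dim U" "\<And>w. w \<in> U \<Longrightarrow> f w \<in> U" and u: "u \<in> U" "h u = l *\<^sub>C u"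
  obtains n where "(f ^^ n) u = 0"
proof -
  have hw: "h ((f ^^ i) u) = (l + c * of_nat i) *\<^sub>C (f ^^ i) u" for i
  proof (induction i)
    case (Suc i)
    then show ?case by (simp add: rel clinear_scale[OF lin(1)] algebra_simps flip: cvec.scale_left_distrib)
  qed (simp add: u)
  show ?thesis
  proof (rule ccontr)
    assume n: "\<not> thesis"
    have nz: "(f ^^ n) u \<noteq> 0" for n using n that by blast
    have inj: "inj (\<lambda>i::nat. l + c * of_nat i)" using c by (simp add: inj_def)
    show False
      by (rule eigenvectors_independent[OF lin(2) hw inj nz U(1) funpow_closed[OF U(2) u(1)]])
  qed
qed

section \<open>Calculus in modules over the affine Lie algebra\<close>

locale affine_module =
  fixes k :: complex and X :: "complex^3^3 \<Rightarrow> int \<Rightarrow> 'm::cvec \<Rightarrow> 'm"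
  assumes module: "affine_sl3_module k X"
begin

lemma X_linear: "A \<in> sl3 \<Longrightarrow> clinear (X A n)"
  using module by (simp add: affine_sl3_module_def)

lemmas X_simps = clinear_0[OF X_linear] clinear_add[OF X_linear] clinear_diff[OF X_linear]
  clinear_minus[OF X_linear] clinear_scale[OF X_linear]

lemma X_add: "A \<in> sl3 \<Longrightarrow> B \<in> sl3 \<Longrightarrow> X (A + B) n u = X A n u + X B n u"
  and X_scale: "A \<in> sl3 \<Longrightarrow> X (z *\<^sub>C A) n u = z *\<^sub>C X A n u"
  using module by (simp_all add: affine_sl3_module_def linear_on_def)

lemma X_zero: "X 0 n u = 0"
  using X_scale[of 0 0 n u] by simp

lemma X_minus: "A \<in> sl3 \<Longrightarrow> X (- A) n u = - X A n u"
  using X_scale[of A "- 1" n u] by (simp add: cvec.scale_minus_left cscale_one)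

lemma X_sub: "A \<in> sl3 \<Longrightarrow> B \<in> sl3 \<Longrightarrow> X (A - B) n u = X A n u - X B n u"
  using X_add[of A "- B" n u] by (simp add: X_minus)

lemma rel: "A \<in> sl3 \<Longrightarrow> B \<in> sl3 \<Longrightarrow> X A m (X B n u) = X B n (X A m u) + X (commutator A B) (m + n) u +
          (if m + n = 0 then (of_int m * k * trace (A ** B)) *\<^sub>C u else 0)"
proof -
  assume "A \<in> sl3" "B \<in> sl3"
  then have "X A m (X B n u) - X B n (X A m u) = X (commutator A B) (m + n) u +
          (if m + n = 0 then (of_int m * k * trace (A ** B)) *\<^sub>C u else 0)"
    using module unfolding affine_sl3_module_def by blast
  then show ?thesis by (simp only: diff_eq_eq ac_simps)
qed

lemmas X_table = X_add X_scale X_zero X_minus X_sub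

lemma X_expand:
  assumes "A \<in> sl3"
  shows "X A n u = (A $ 1 $ 2) *\<^sub>C X e1 n u + (A $ 2 $ 3) *\<^sub>C X e2 n u + (A $ 1 $ 3) *\<^sub>C X e3 n u + (A $ 1 $ 1) *\<^sub>C X h1 n u
     + (A $ 1 $ 1 + A $ 2 $ 2) *\<^sub>C X h2 n u + (A $ 2 $ 1) *\<^sub>C X f1 n u + (A $ 3 $ 2) *\<^sub>C X f2 n u + (A $ 3 $ 1) *\<^sub>C X f3 n u"
  by (subst sl3_expand[OF assms]) (simp add: X_table)

definition stab :: "'m set \<Rightarrow> complex^3^3 \<Rightarrow> int \<Rightarrow> bool"
  where "stab N A n \<longleftrightarrow> (\<forall>u\<in>N. X A n u \<in> N)"

lemma stab_commutator:
  assumes N: "cvec.subspace N" and AB: "A \<in> sl3" "B \<in> sl3" and s: "stab N A m" "stab N B n"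
  shows "stab N (commutator A B) (m + n)"
  unfolding stab_def
proof
  fix u assume u: "u \<in> N"
  have e: "X (commutator A B) (m + n) u = X A m (X B n u) - X B n (X A m u) -
          (if m + n = 0 then (of_int m * k * trace (A ** B)) *\<^sub>C u else 0)"
    using rel[OF AB, of m n u] by simp
  have "X A m (X B n u) \<in> N" "X B n (X A m u) \<in> N"
    "(if m + n = 0 then (of_int m * k * trace (A ** B)) *\<^sub>C u else 0) \<in> N"
    using s u N by (auto simp: stab_def cvec.subspace_scale cvec.subspace_0)
  then show "X (commutator A B) (m + n) u \<in> N"
    unfolding e by (intro cvec.subspace_diff[OF N])
qed

lemma stab_minus: "cvec.subspace N \<Longrightarrow> A \<in> sl3 \<Longrightarrow> stab N (- A) n \<Longrightarrow> stab N A n"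
  unfolding stab_def using cvec.subspace_neg[of N] by (force simp: X_minus)

lemma invariant_basis:
  assumes N: "cvec.subspace N"
    and s: "\<And>n. stab N e1 n" "\<And>n. stab N e2 n" "\<And>n. stab N f1 n" "\<And>n. stab N f2 n"
  shows "affine_invariant X N"
proof -
  have h: "stab N h1 n" "stab N h2 n" "stab N e3 n" "stab N f3 n" for n
    using stab_commutator[OF N _ _ s(1) s(3), of 0 n] stab_commutator[OF N _ _ s(2) s(4), of 0 n]
      stab_commutator[OF N _ _ s(1) s(2), of 0 n] stab_commutator[OF N _ _ s(4) s(3), of 0 n] by simp_all
  show ?thesis
    unfolding affine_invariant_def
  proof (intro conjI ballI allI N)
    fix A n u assume "A \<in> sl3" "u \<in> N"
    then show "X A n u \<in> N"
      using s h by (subst X_expand) (auto simp: stab_def intro!: cvec.subspace_add[OF N] cvec.subspace_scale[OF N])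
  qed
qed

text \<open>The hypotheses concern the Chevalley generators of the affine algebra. Brackets yield
  the modes 1 and -1 of \<open>h1 + h2\<close>, which act on \<open>e1\<close>, \<open>e2\<close>,
  \<open>f1\<close>, \<open>f2\<close> by 1 or -1 and move the mode by one, so all modes are reached
  from mode 0.\<close>

lemma invariant_chevalley:
  assumes N: "cvec.subspace N"
    and s: "stab N e1 0" "stab N e2 0" "stab N f3 1" "stab N f1 0" "stab N f2 0" "stab N e3 (- 1)"
  shows "affine_invariant X N"
proof -
  note C = stab_commutator[OF N]
  have e3: "stab N e3 0" using C[OF _ _ s(1,2)] by simp
  have f3: "stab N f3 0" using C[OF _ _ s(5,4)] by simp
  have h3: "stab N (h1 + h2) 1" "stab N (h1 + h2) (- 1)"
    using C[OF _ _ e3 s(3)] C[OF _ _ s(6) f3] by simp_all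
  have brk: "commutator (h1 + h2) e1 = e1" "commutator (h1 + h2) e2 = e2"
    "commutator (h1 + h2) f1 = - f1" "commutator (h1 + h2) f2 = - f2"
    by (simp_all add: commutator_def matrix_matrix_mult_def vec_eq_iff forall_3 sum_3 sl3_basis_defs)
  have step: "stab N A n" if A: "A \<in> sl3" "commutator (h1 + h2) A = A \<or> commutator (h1 + h2) A = - A" "stab N A 0" for A n
  proof (induction n rule: int_induct[where k = 0])
    case base then show ?case by (rule A)
  next
    case (step1 i)
    have "stab N (commutator (h1 + h2) A) (1 + i)" by (rule C[OF _ A(1) h3(1) step1(2)]) simp
    then show ?case using A(2) stab_minus[OF N A(1)] by (auto simp: add.commute)
  next
    case (step2 i)
    have "stab N (commutator (h1 + h2) A) (- 1 + i)" by (rule C[OF _ A(1) h3(2) step2(2)]) simp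
    then show ?case using A(2) stab_minus[OF N A(1)] by (auto simp: add.commute)
  qed
  show ?thesis
    by (rule invariant_basis[OF N]; rule step) (simp_all add: brk s)
qed

definition singular :: "complex \<Rightarrow> complex \<Rightarrow> 'm \<Rightarrow> bool" where
  "singular a b z \<longleftrightarrow> X e1 0 z = 0 \<and> X e2 0 z = 0 \<and> X f3 1 z = 0 \<and> X h1 0 z = a *\<^sub>C z \<and> X h2 0 z = b *\<^sub>C z"

text \<open>The three raising Chevalley generators generate the positive part; modes are raised by
  \<open>[e3(0), f3(1)]\<close>, the mode 1 of \<open>h1 + h2\<close>.\<close>

lemma singular_annihilates:
  assumes z: "X e1 0 z = 0" "X e2 0 z = 0" "X f3 1 z = 0"
  shows "n \<ge> 0 \<Longrightarrow> X e1 n z = 0" "n \<ge> 0 \<Longrightarrow> X e2 n z = 0" "n \<ge> 0 \<Longrightarrow> X e3 n z = 0"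
    "n \<ge> 1 \<Longrightarrow> X h1 n z = 0" "n \<ge> 1 \<Longrightarrow> X h2 n z = 0" "n \<ge> 1 \<Longrightarrow> X f1 n z = 0" "n \<ge> 1 \<Longrightarrow> X f2 n z = 0"
    "n \<ge> 1 \<Longrightarrow> X f3 n z = 0" "n \<ge> 1 \<Longrightarrow> A \<in> sl3 \<Longrightarrow> X A n z = 0"
proof -
  \<comment> \<open>The last premise makes the central term vanish, which would otherwise return a
    multiple of \<open>z\<close>.\<close>
  have C: "X (commutator A B) (m + n) z = 0" if "A \<in> sl3" "B \<in> sl3" "X A m z = 0" "X B n z = 0"
      "m + n \<noteq> 0 \<or> trace (A ** B) = 0 \<or> m = 0" for A B m n
    using rel[OF that(1,2), of m n z] that by (auto simp: X_simps split: if_splits)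
  have t: "trace (e1 ** e2) = 0" by (simp add: trace_def sum_3 matrix_matrix_mult_def sl3_basis_defs)
  have e3: "X e3 0 z = 0" using C[OF _ _ z(1,2)] by simp
  have h3: "X (h1 + h2) 1 z = 0" using C[OF _ _ e3 z(3)] by simp
  have brk: "commutator (h1 + h2) e1 = e1" "commutator (h1 + h2) e2 = e2" "commutator (h1 + h2) e3 = 2 *\<^sub>C e3"
    "commutator (h1 + h2) f1 = - f1" "commutator (h1 + h2) f2 = - f2" "commutator (h1 + h2) f3 = - (2 *\<^sub>C f3)"
    by (simp_all add: commutator_def matrix_matrix_mult_def vec_eq_iff forall_3 sum_3 sl3_basis_defs cscale_vec_def
        cscale_complex_def)
  have f2: "X f2 1 z = 0" using C[OF _ _ z(3,1)] by simp
  have f1: "X f1 1 z = 0" using C[OF _ _ z(2,3)] by simp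
  have step: "X A (m + int j) z = 0" if A: "A \<in> sl3" "commutator (h1 + h2) A = A \<or> commutator (h1 + h2) A = - A \<or>
     commutator (h1 + h2) A = 2 *\<^sub>C A \<or> commutator (h1 + h2) A = - (2 *\<^sub>C A)" "X A m z = 0" "m \<ge> 0" for A m j
  proof (induction j)
    case (Suc j)
    have "X (commutator (h1 + h2) A) (1 + (m + int j)) z = 0"
      by (rule C[OF _ A(1) h3 Suc]) (use A in auto)
    then show ?case using A(1,2) by (auto simp: X_table algebra_simps)
  qed (use A in simp)
  show e: "n \<ge> 0 \<Longrightarrow> X e1 n z = 0" "n \<ge> 0 \<Longrightarrow> X e2 n z = 0" and e3n: "n \<ge> 0 \<Longrightarrow> X e3 n z = 0" for n
    using step[of e1 0 "nat n"] step[of e2 0 "nat n"] step[of e3 0 "nat n"] z e3 by (simp_all add: brk)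
  show f: "n \<ge> 1 \<Longrightarrow> X f1 n z = 0" "n \<ge> 1 \<Longrightarrow> X f2 n z = 0" and f3: "n \<ge> 1 \<Longrightarrow> X f3 n z = 0" for n
    using step[of f1 1 "nat (n - 1)"] step[of f2 1 "nat (n - 1)"] step[of f3 1 "nat (n - 1)"] z f1 f2 by (simp_all add: brk)
  show h: "n \<ge> 1 \<Longrightarrow> X h1 n z = 0" "n \<ge> 1 \<Longrightarrow> X h2 n z = 0" for n
    using C[OF _ _ z(1) f(1), of n] C[OF _ _ z(2) f(2), of n] by simp_all
  show "n \<ge> 1 \<Longrightarrow> A \<in> sl3 \<Longrightarrow> X A n z = 0"
    by (subst X_expand) (simp_all add: e e3n f f3 h)
qed

section \<open>Submodules generated by a singular vector\<close>

definition aff_gen :: "'m \<Rightarrow> 'm set"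
  where "aff_gen z = \<Inter>{N. affine_invariant X N \<and> z \<in> N}"

lemma aff_gen_invariant: "affine_invariant X (aff_gen z)"
  unfolding aff_gen_def affine_invariant_def
  by (auto intro: cvec.subspace_Inter)

lemma aff_gen_base: "z \<in> aff_gen z" by (auto simp: aff_gen_def)

lemma aff_gen_minimal: "affine_invariant X N \<Longrightarrow> z \<in> N \<Longrightarrow> aff_gen z \<subseteq> N"
  by (auto simp: aff_gen_def)

text \<open>Words in the three lowering Chevalley generators in arbitrary order, together with the
  number of occurrences of each. Only weights are read off them, so no PBW ordering is
  chosen.\<close>

inductive fword :: "'m \<Rightarrow> nat \<Rightarrow> nat \<Rightarrow> nat \<Rightarrow> 'm \<Rightarrow> bool" for z where
  fword0: "fword z 0 0 0 z"
| fword_f0: "fword z i j l u \<Longrightarrow> fword z (Suc i) j l (X e3 (- 1) u)"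
| fword_f1: "fword z i j l u \<Longrightarrow> fword z i (Suc j) l (X f1 0 u)"
| fword_f2: "fword z i j l u \<Longrightarrow> fword z i j (Suc l) (X f2 0 u)"

lemma fword_h1: "fword z i j l u \<Longrightarrow> X h1 0 z = a *\<^sub>C z \<Longrightarrow> X h1 0 u = (a + of_nat i - 2 * of_nat j + of_nat l) *\<^sub>C u"
proof (induction rule: fword.induct)
  case (fword_f0 i j l u)
  then show ?case using rel[of h1 e3 0 "- 1" u] by (simp add: X_simps X_table cscale_left_distrib
      cvec.scale_left_diff_distrib cscale_one)
next
  case (fword_f1 i j l u)
  then show ?case using rel[of h1 f1 0 0 u] by (simp add: X_simps X_table cscale_left_distrib
      cvec.scale_left_diff_distrib cscale_one)
next
  case (fword_f2 i j l u)
  then show ?case using rel[of h1 f2 0 0 u] by (simp add: X_simps X_table cscale_left_distrib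
      cvec.scale_left_diff_distrib cscale_one)
qed simp

lemma fword_h2: "fword z i j l u \<Longrightarrow> X h2 0 z = b *\<^sub>C z \<Longrightarrow> X h2 0 u = (b + of_nat i + of_nat j - 2 * of_nat l) *\<^sub>C u"
proof (induction rule: fword.induct)
  case (fword_f0 i j l u)
  then show ?case using rel[of h2 e3 0 "- 1" u] by (simp add: X_simps X_table cscale_left_distrib
      cvec.scale_left_diff_distrib cscale_one)
next
  case (fword_f1 i j l u)
  then show ?case using rel[of h2 f1 0 0 u] by (simp add: X_simps X_table cscale_left_distrib
      cvec.scale_left_diff_distrib cscale_one)
next
  case (fword_f2 i j l u)
  then show ?case using rel[of h2 f2 0 0 u] by (simp add: X_simps X_table cscale_left_distrib
      cvec.scale_left_diff_distrib cscale_one)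
qed simp

text \<open>A raising generator is moved through a word by induction; each bracket with a letter is
  0 or acts on the remaining word by a scalar, because raising and lowering Chevalley generators
  bracket into the Cartan part and the centre.\<close>

lemma aff_gen_fwords:
  assumes z: "singular a b z"
  shows "aff_gen z \<subseteq> cvec.span {u. \<exists>i j l. fword z i j l u}"
proof (rule aff_gen_minimal)
  let ?S = "{u. \<exists>i j l. fword z i j l u}" and ?N = "cvec.span {u. \<exists>i j l. fword z i j l u}"
  have z': "X e1 0 z = 0" "X e2 0 z = 0" "X f3 1 z = 0" "X h1 0 z = a *\<^sub>C z" "X h2 0 z = b *\<^sub>C z"
    using z by (simp_all add: singular_def)
  note N = cvec.subspace_span[of ?S]
  note clos = cvec.subspace_add[OF N] cvec.subspace_diff[OF N] cvec.subspace_scale[OF N] cvec.subspace_0[OF N]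
      cvec.subspace_neg[OF N]
  have lift: "stab ?N A n" if "A \<in> sl3" "\<And>i j l u. fword z i j l u \<Longrightarrow> X A n u \<in> ?N" for A n
    unfolding stab_def
    by (rule ballI, rule clinear_maps_span[OF X_linear[OF that(1)] N]) (use that(2) in auto)
  have f: "stab ?N e3 (- 1)" "stab ?N f1 0" "stab ?N f2 0"
    by (rule lift, simp, blast intro: cvec.span_base fword.intros)+
  have h: "stab ?N h1 0" "stab ?N h2 0"
  proof -
    have "u \<in> ?N" if "fword z i j l u" for i j l u using that by (blast intro: cvec.span_base)
    then show "stab ?N h1 0" "stab ?N h2 0"
      by (auto intro!: lift clos(3) simp: fword_h1[OF _ z'(4)] fword_h2[OF _ z'(5)])
  qed
  have e1: "X e1 0 u \<in> ?N" if "fword z i j l u" for i j l u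
    using that
  proof (induction rule: fword.induct)
    case (fword_f0 i j l u)
    then show ?case using rel[of e1 e3 0 "- 1" u] f by (simp add: X_table stab_def)
  next
    case (fword_f1 i j l u)
    moreover have "u \<in> ?N" using fword_f1 by (blast intro: cvec.span_base)
    ultimately show ?case using rel[of e1 f1 0 0 u] f h by (simp add: stab_def clos)
  next
    case (fword_f2 i j l u)
    then show ?case using rel[of e1 f2 0 0 u] f by (simp add: X_table stab_def)
  qed (simp add: z' clos)
  have e2: "X e2 0 u \<in> ?N" if "fword z i j l u" for i j l u
    using that
  proof (induction rule: fword.induct)
    case (fword_f0 i j l u)
    then show ?case using rel[of e2 e3 0 "- 1" u] f by (simp add: X_table stab_def)
  next
    case (fword_f1 i j l u)
    then show ?case using rel[of e2 f1 0 0 u] f by (simp add: X_table stab_def)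
  next
    case (fword_f2 i j l u)
    moreover have "u \<in> ?N" using fword_f2 by (blast intro: cvec.span_base)
    ultimately show ?case using rel[of e2 f2 0 0 u] f h by (simp add: stab_def clos)
  qed (simp add: z' clos)
  have f3: "X f3 1 u \<in> ?N" if "fword z i j l u" for i j l u
    using that
  proof (induction rule: fword.induct)
    case (fword_f0 i j l u)
    moreover have "u \<in> ?N" using fword_f0 by (blast intro: cvec.span_base)
    ultimately show ?case using rel[of f3 e3 1 "- 1" u] f h by (simp add: X_table stab_def clos)
  next
    case (fword_f1 i j l u)
    then show ?case using rel[of f3 f1 1 0 u] f by (simp add: X_table stab_def)
  next
    case (fword_f2 i j l u)
    then show ?case using rel[of f3 f2 1 0 u] f by (simp add: X_table stab_def)
  qed (simp add: z' clos)
  show "affine_invariant X ?N"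
    by (rule invariant_chevalley[OF N]) (auto intro: lift e1 e2 f3 f)
  show "z \<in> ?N" by (blast intro: cvec.span_base fword0)
qed

end

subsection \<open>The Sugawara operator and uniqueness of irreducible highest weight modules\<close>

text \<open>The zero vector may belong to several members of the family, so it is removed before the
  eigenvalue is read off as a function of the vector.\<close>

lemma eigenvector_in_span_family:
  assumes T: "clinear T" and E: "\<And>i s. s \<in> E i \<Longrightarrow> T s = i *\<^sub>C s"
    and u: "u \<in> cvec.span (\<Union>i. E i)" "T u = \<mu> *\<^sub>C u"
  shows "u \<in> cvec.span (E \<mu>)"
proof -
  define S where "S = (\<Union>i. E i) - {0}"
  define ev where "ev s = (THE l. T s = l *\<^sub>C s)" for s
  have ev: "ev s = i" if "s \<in> E i" "s \<noteq> 0" for s i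
    unfolding ev_def
  proof (rule the_equality)
    show "T s = i *\<^sub>C s" by (rule E[OF that(1)])
    fix l assume "T s = l *\<^sub>C s"
    then show "l = i" using E[OF that(1)] that(2) by simp
  qed
  have "u \<in> cvec.span {s \<in> S. ev s = \<mu>}"
  proof (rule eigenvector_in_span[OF T _ _ u(2)])
    show "T s = ev s *\<^sub>C s" if "s \<in> S" for s using that E ev by (auto simp: S_def)
    show "u \<in> cvec.span S" using u(1) by (simp add: S_def cvec.span_delete_0)
  qed
  also have "{s \<in> S. ev s = \<mu>} \<subseteq> E \<mu>" using ev by (auto simp: S_def)
  then have "cvec.span {s \<in> S. ev s = \<mu>} \<subseteq> cvec.span (E \<mu>)" by (rule cvec.span_mono)
  finally show ?thesis .
qed

locale smooth_affine = affine_module +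
  assumes smooth: "\<And>A u. A \<in> sl3 \<Longrightarrow> \<exists>N. \<forall>n\<ge>N. X A n u = 0"
begin

text \<open>The factor 3 clears the denominators of the inverse Cartan matrix, whose entries are 2/3
  and 1/3.\<close>

definition cas :: "int \<Rightarrow> int \<Rightarrow> 'a \<Rightarrow> 'a" where
  "cas n m u = 3 *\<^sub>C (X e1 n (X f1 m u) + X f1 n (X e1 m u) + X e2 n (X f2 m u) + X f2 n (X e2 m u)
      + X e3 n (X f3 m u) + X f3 n (X e3 m u))
    + 2 *\<^sub>C (X h1 n (X h1 m u) + X h2 n (X h2 m u)) + X h1 n (X h2 m u) + X h2 n (X h1 m u)"

text \<open>\<open>6(k + 3)L\<^sub>0\<close>, where \<open>L\<^sub>0\<close> is the Sugawara operator; \<open>cas\<close> is three times the Casimir tensor.\<close>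

definition sug :: "'a \<Rightarrow> 'a"
  where "sug u = cas 0 0 u + 2 *\<^sub>C Sum_any (\<lambda>n::nat. cas (- int n - 1) (int n + 1) u)"

lemma rel0: "A \<in> sl3 \<Longrightarrow> B \<in> sl3 \<Longrightarrow> X A m (X B 0 u) = X B 0 (X A m u) + X (commutator A B) m u"
  using rel[of A B m 0 u] by (auto simp: cvec.scale_zero_left)

lemma two: "(2::complex) *\<^sub>C u = u + u" and three: "(3::complex) *\<^sub>C u = u + u + u" for u :: 'a
  using cscale_left_distrib[of 1 1 u] cscale_left_distrib[of 2 1 u] by (simp_all add: cscale_one)

lemma cas_f1: "cas n m (X f1 0 u) = X f1 0 (cas n m u)"
  unfolding cas_def two three
  by (simp add: rel0[of _ f1] X_simps X_table two three)

lemma cas_f2: "cas n m (X f2 0 u) = X f2 0 (cas n m u)"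
  unfolding cas_def two three
  by (simp add: rel0[of _ f2] X_simps X_table two three)

text \<open>What remains, up to the factor 3, when \<open>cas\<close> is commuted with a mode of
  \<open>e3\<close>: by invariance of the Casimir tensor the brackets in the left and in the right
  factor give opposite expressions, differing only in the modes.\<close>

definition cas3 :: "int \<Rightarrow> int \<Rightarrow> 'a \<Rightarrow> 'a" where
  "cas3 p q u = X e2 p (X e1 q u) - X e1 p (X e2 q u) - (X h1 p (X e3 q u) + X h2 p (X e3 q u))
     + (X e3 p (X h1 q u) + X e3 p (X h2 q u))"

lemma rel_e3: "A \<in> sl3 \<Longrightarrow> X A m (X e3 (- 1) u) = X e3 (- 1) (X A m u) + X (commutator A e3) (m - 1) u +
          (if m = 1 then (k * trace (A ** e3)) *\<^sub>C u else 0)"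
  using rel[of A e3 m "- 1" u] by auto

text \<open>For \<open>n \<le> 0\<close> the left factor contributes no central term, since that
  needs mode 1; the summand with \<open>k\<close> comes from the right factor.\<close>

lemma cas_e3: "n \<le> 0 \<Longrightarrow> cas n m (X e3 (- 1) u) = X e3 (- 1) (cas n m u) + 3 *\<^sub>C (cas3 (n - 1) m u - cas3 n (m - 1) u)
   + (if m = 1 then (3 * k) *\<^sub>C X e3 n u else 0)"
  unfolding cas_def cas3_def two three
  by (simp add: rel_e3 X_simps X_table two three cvec.scale_scale[symmetric] del: cvec.scale_scale)

lemma cas_finite: "\<exists>N::nat. \<forall>n\<ge>N. \<forall>p. cas p (int n) u = 0 \<and> cas3 p (int n) u = 0"
proof -
  let ?S = "{e1, e2, e3, f1, f2, f3, h1, h2}"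
  have "\<forall>A\<in>?S. \<forall>\<^sub>F n in at_top. X A n u = 0"
    unfolding eventually_at_top_linorder by (intro ballI smooth) auto
  then have "\<forall>\<^sub>F n in at_top. \<forall>A\<in>?S. X A n u = 0" by (intro eventually_ball_finite) simp_all
  then obtain N where N: "\<And>A n. A \<in> ?S \<Longrightarrow> n \<ge> N \<Longrightarrow> X A n u = 0"
    unfolding eventually_at_top_linorder by blast
  have "int n \<ge> N" if "n \<ge> nat N" for n using that by simp
  then show ?thesis
    by (intro exI[of _ "nat N"]) (simp add: cas_def cas3_def N X_simps)
qed

lemma cas_linear: "clinear (cas p q)"
  unfolding cas_def
  by (intro clinear_plus clinear_const_scale clinear_compose[OF X_linear X_linear]) simp_all

lemma sug_finite: "finite {n::nat. cas (- int n - 1) (int n + 1) u \<noteq> 0}"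
proof -
  obtain N where N: "\<And>n p. n \<ge> N \<Longrightarrow> cas p (int n) u = 0" using cas_finite by meson
  have "{n::nat. cas (- int n - 1) (int n + 1) u \<noteq> 0} \<subseteq> {..N}"
    using N[of "Suc n" for n] by (auto simp: add.commute intro: ccontr)
  then show ?thesis by (rule finite_subset) simp
qed

lemma sug_linear: "clinear sug"
  unfolding sug_def
  by (intro clinear_plus clinear_const_scale clinear_Sum_any[OF cas_linear sug_finite] cas_linear)

lemma sug_f1: "sug (X f1 0 u) = X f1 0 (sug u)"
  unfolding sug_def cas_f1
  by (simp add: X_simps Sum_any_clinear[OF X_linear sug_finite])

lemma sug_f2: "sug (X f2 0 u) = X f2 0 (sug u)"
  unfolding sug_def cas_f2
  by (simp add: X_simps Sum_any_clinear[OF X_linear sug_finite])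

text \<open>Summed over the modes, the \<open>cas3\<close> differences telescope. The boundary term
  at 0 joins the contribution of the zero modes, and the central terms give
  \<open>6 * k\<close>.\<close>

lemma sug_e3: "sug (X e3 (- 1) u) = X e3 (- 1) (sug u) + (6 * (k + 3)) *\<^sub>C X e3 (- 1) u"
proof -
  obtain N where N: "\<And>n p. n \<ge> N \<Longrightarrow> cas p (int n) u = 0 \<and> cas3 p (int n) u = 0" using cas_finite by meson
  obtain N' where N': "\<And>n p. n \<ge> N' \<Longrightarrow> cas p (int n) (X e3 (- 1) u) = 0" using cas_finite by meson
  define K where "K = N + N' + 1"
  have N1: "cas p (int n + 1) u = 0" if "n \<ge> N" for n p using N[of "Suc n"] that by (simp add: add.commute)
  have N1': "cas p (int n + 1) (X e3 (- 1) u) = 0" if "n \<ge> N'" for n p using N'[of "Suc n"] that by (simp add: add.commute)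
  have s: "Sum_any (\<lambda>n::nat. cas (- int n - 1) (int n + 1) w) = (\<Sum>n<K. cas (- int n - 1) (int n + 1) w)"
    if "w = u \<or> w = X e3 (- 1) u" for w
    by (rule Sum_any.expand_superset) (use that N1 N1' in \<open>auto simp: K_def not_le[symmetric]\<close>)
  define g where "g n = cas3 (- int n - 1) (int n) u" for n :: nat
  have "(\<Sum>n<K. cas (- int n - 1) (int n + 1) (X e3 (- 1) u))
    = (\<Sum>n<K. X e3 (- 1) (cas (- int n - 1) (int n + 1) u) + 3 *\<^sub>C (g (Suc n) - g n) + (if n = 0 then (3 * k) *\<^sub>C X e3
        (- 1) u else 0))"
    by (rule sum.cong) (auto simp: cas_e3 g_def algebra_simps)
  also have "\<dots> = X e3 (- 1) (\<Sum>n<K. cas (- int n - 1) (int n + 1) u) + 3 *\<^sub>C (\<Sum>n<K. g (Suc n) - g n) + (3 * k) *\<^sub>C X e3 (- 1) u"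
    by (simp add: sum.distrib clinear_sum[OF X_linear] flip: cvec.scale_sum_right)
      (simp add: K_def)
  also have "(\<Sum>n<K. g (Suc n) - g n) = g K - g 0" by (rule sum_lessThan_telescope)
  also have "g K = 0" using N[of K] by (simp add: g_def K_def)
  finally have e: "(\<Sum>n<K. cas (- int n - 1) (int n + 1) (X e3 (- 1) u))
    = X e3 (- 1) (\<Sum>n<K. cas (- int n - 1) (int n + 1) u) - 3 *\<^sub>C g 0 + (3 * k) *\<^sub>C X e3 (- 1) u"
    by (simp add: cvec.scale_minus_right)
  \<comment> \<open>Reordering the two boundary terms gives -6; multiplied by -3 this is 18 = 6 * 3,
    the shift of the level by the dual Coxeter number 3.\<close>
  have c: "cas3 0 (- 1) u + cas3 (- 1) 0 u = - (6 *\<^sub>C X e3 (- 1) u)"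
  proof -
    have six: "(6::complex) *\<^sub>C w = w + w + w + w + w + w" for w :: 'a
      using cscale_left_distrib[of 3 3 w] by (simp add: three)
    show ?thesis
      unfolding cas3_def six
      using rel0[of e1 e2 "- 1" u] rel0[of e2 e1 "- 1" u] rel0[of h1 e3 "- 1" u] rel0[of h2 e3 "- 1" u] rel0[of e3 h1
          "- 1" u] rel0[of e3 h2 "- 1" u]
      by (simp add: X_table)
  qed
  have "sug (X e3 (- 1) u) = X e3 (- 1) (sug u) + 3 *\<^sub>C (cas3 (- 1) 0 u - cas3 0 (- 1) u) +
      2 *\<^sub>C (- (3 *\<^sub>C cas3 (- 1) 0 u) + (3 * k) *\<^sub>C X e3 (- 1) u)"
    unfolding sug_def s[of u, simplified] s[of "X e3 (- 1) u", simplified] e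
    by (simp add: cas_e3 X_simps g_def algebra_simps)
  also have "\<dots> = X e3 (- 1) (sug u) - 3 *\<^sub>C (cas3 0 (- 1) u + cas3 (- 1) 0 u) + (6 * k) *\<^sub>C X e3 (- 1) u"
  proof -
    have "(6::complex) *\<^sub>C w = 3 *\<^sub>C w + 3 *\<^sub>C w" for w :: 'a
      using cscale_left_distrib[of 3 3 w] by simp
    then show ?thesis by (simp add: algebra_simps)
  qed
  also have "\<dots> = X e3 (- 1) (sug u) + (6 * (k + 3)) *\<^sub>C X e3 (- 1) u"
    unfolding c by (simp add: algebra_simps)
  finally show ?thesis .
qed

text \<open>Three times the Casimir eigenvalue \<open>(\<lambda>, \<lambda> + 2\<rho>)\<close> at
  \<open>\<lambda> = a\<omega>\<^sub>1 + b\<omega>\<^sub>2\<close>.\<close>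

definition sugval :: "complex \<Rightarrow> complex \<Rightarrow> complex"
  where "sugval a b = 3 * (a + b + (a + b)) + 2 * (a * a + b * b) + 2 * (a * b)"

lemma sug_singular:
  assumes z: "singular a b z" shows "sug z = sugval a b *\<^sub>C z"
proof -
  have z': "X e1 0 z = 0" "X e2 0 z = 0" "X f3 1 z = 0" "X h1 0 z = a *\<^sub>C z" "X h2 0 z = b *\<^sub>C z"
    using z by (simp_all add: singular_def)
  note ann = singular_annihilates[OF z'(1-3)]
  have "cas (- int n - 1) (int n + 1) z = 0" for n
    by (simp add: cas_def ann X_simps)
  moreover have "cas 0 0 z = sugval a b *\<^sub>C z"
    using rel0[of e1 f1 0 z] rel0[of e2 f2 0 z] rel0[of e3 f3 0 z]
    unfolding cas_def by (simp add: ann z' X_simps X_table)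
      (simp add: sugval_def algebra_simps flip: cvec.scale_left_distrib)
  ultimately show ?thesis by (simp add: sug_def)
qed

lemma fword_sug: "fword z i j l u \<Longrightarrow> sug z = \<sigma> *\<^sub>C z \<Longrightarrow> sug u = (\<sigma> + 6 * (k + 3) * of_nat i) *\<^sub>C u"
proof (induction rule: fword.induct)
  case (fword_f0 i j l u)
  then show ?case by (simp add: sug_e3 X_simps algebra_simps)
qed (simp_all add: sug_f1 sug_f2 X_simps)

text \<open>Each letter \<open>e3(-1)\<close> adds \<open>6 * (k + 3)\<close> to the eigenvalue of
  \<open>sug\<close>, so for \<open>k \<noteq> -3\<close> a vector with the eigenvalue of
  \<open>z\<close> involves only words in \<open>f1\<close> and \<open>f2\<close>. The two weights
  then determine how often each occurs.\<close>

lemma weight_in_gen: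
  assumes k: "k \<noteq> - 3" and z: "singular a b z" "z' \<in> aff_gen z" "z' \<noteq> 0" "sug z' = sugval a b *\<^sub>C z'"
    "X h1 0 z' = a' *\<^sub>C z'" "X h2 0 z' = b' *\<^sub>C z'"
  obtains p q :: nat where "a' = a - 2 * of_nat p + of_nat q" "b' = b + of_nat p - 2 * of_nat q"
    "p = 0 \<and> q = 0 \<longrightarrow> (\<exists>c. z' = c *\<^sub>C z)"
proof -
  have h: "X h1 0 z = a *\<^sub>C z" "X h2 0 z = b *\<^sub>C z" using z(1) by (simp_all add: singular_def)
  define E1 where "E1 s = {u. \<exists>i j l. fword z i j l u \<and> sugval a b + 6 * (k + 3) * of_nat i = s}" for s
  have "(\<Union>s. E1 s) = {u. \<exists>i j l. fword z i j l u}" by (auto simp: E1_def)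
  then have "z' \<in> cvec.span (\<Union>s. E1 s)" using aff_gen_fwords[OF z(1)] z(2) by auto
  then have "z' \<in> cvec.span (E1 (sugval a b))"
    by (rule eigenvector_in_span_family[OF sug_linear, rotated])
      (use fword_sug[OF _ sug_singular[OF z(1)]] z(4) in \<open>auto simp: E1_def\<close>)
  moreover have "E1 (sugval a b) \<subseteq> {u. \<exists>j l. fword z 0 j l u}"
  proof
    fix u assume "u \<in> E1 (sugval a b)"
    then obtain i j l where u: "fword z i j l u" "sugval a b + 6 * (k + 3) * of_nat i = sugval a b"
      unfolding E1_def by blast
    have "k + 3 \<noteq> 0" using k by (simp only: eq_neg_iff_add_eq_0 not_False_eq_True)
    moreover have "6 * (k + 3) * (of_nat i :: complex) = 0" using u(2) by (simp only: add_cancel_left_right)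
    ultimately have "i = 0" by (simp only: mult_eq_0_iff) simp
    then show "u \<in> {u. \<exists>j l. fword z 0 j l u}" using u(1) by auto
  qed
  ultimately have z'1: "z' \<in> cvec.span {u. \<exists>j l. fword z 0 j l u}" using cvec.span_mono by blast
  define E2 where "E2 s = {u. \<exists>j l. fword z 0 j l u \<and> a - 2 * of_nat j + of_nat l = s}" for s
  have "(\<Union>s. E2 s) = {u. \<exists>j l. fword z 0 j l u}" by (auto simp: E2_def)
  then have "z' \<in> cvec.span (\<Union>s. E2 s)" using z'1 by simp
  then have z'2: "z' \<in> cvec.span (E2 a')"
    by (rule eigenvector_in_span_family[OF X_linear[of h1 0], rotated 2])
      (use fword_h1[OF _ h(1)] z(5) in \<open>auto simp: E2_def\<close>)
  define E3 where "E3 s = {u. \<exists>j l. fword z 0 j l u \<and> a - 2 * of_nat j + of_nat l = a' \<and> b + of_nat j - 2 * of_nat l = s}" for s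
  have "(\<Union>s. E3 s) = E2 a'" by (auto simp: E2_def E3_def)
  then have "z' \<in> cvec.span (\<Union>s. E3 s)" using z'2 by simp
  then have z'3: "z' \<in> cvec.span (E3 b')"
    by (rule eigenvector_in_span_family[OF X_linear[of h2 0], rotated 2])
      (use fword_h2[OF _ h(2)] z(6) in \<open>auto simp: E3_def\<close>)
  have "E3 b' \<noteq> {}" using z'3 z(3) by auto
  then obtain u p q where u: "fword z 0 p q u" "a - 2 * of_nat p + of_nat q = a'" "b + of_nat p - 2 * of_nat q = b'"
    by (auto simp: E3_def)
  show ?thesis
  proof (rule that[of p q])
    show "a' = a - 2 * of_nat p + of_nat q" "b' = b + of_nat p - 2 * of_nat q" using u by simp_all
    show "p = 0 \<and> q = 0 \<longrightarrow> (\<exists>c. z' = c *\<^sub>C z)"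
    proof
    assume pq: "p = 0 \<and> q = 0"
    have "E3 b' \<subseteq> {z}"
    proof
      fix w assume "w \<in> E3 b'"
      then obtain j l where w: "fword z 0 j l w" "a - 2 * of_nat j + of_nat l = a'" "b + of_nat j - 2 * of_nat l = b'"
        by (auto simp: E3_def)
      \<comment> \<open>Nondegeneracy of the Cartan matrix: the weight of \<open>z\<close> leaves
        only the empty word.\<close>
      have 1: "(of_nat l :: complex) = 2 * of_nat j" "(of_nat j :: complex) = 2 * of_nat l"
        using w u pq by (auto simp: algebra_simps)
      then have "l = 2 * j" "j = 2 * l" by (metis of_nat_eq_iff of_nat_mult of_nat_numeral)+
      then have "j = 0" "l = 0" by auto
      with w(1) show "w \<in> {z}" by (auto elim: fword.cases)
    qed
    then have "z' \<in> cvec.span {z}" using z'3 cvec.span_mono by blast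
    then show "\<exists>c. z' = c *\<^sub>C z" by (auto simp: cvec.span_singleton)
    qed
  qed
qed

lemma singular_unique:
  assumes k: "k \<noteq> - 3" and z: "singular a b z" "z' \<in> aff_gen z" "singular a b z'"
  shows "\<exists>c. z' = c *\<^sub>C z"
proof (cases "z' = 0")
  case True
  then show ?thesis by (intro exI[of _ 0]) simp
next
  case False
  have h: "X h1 0 z' = a *\<^sub>C z'" "X h2 0 z' = b *\<^sub>C z'" using z(3) by (simp_all add: singular_def)
  obtain p q :: nat where pq: "a = a - 2 * of_nat p + of_nat q" "b = b + of_nat p - 2 * of_nat q"
    "p = 0 \<and> q = 0 \<longrightarrow> (\<exists>c. z' = c *\<^sub>C z)"
    by (rule weight_in_gen[OF k z(1,2) False sug_singular[OF z(3)] h]) (rule that; assumption)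
  from pq(1,2) have "(of_nat q :: complex) = 2 * of_nat p" "(of_nat p :: complex) = 2 * of_nat q"
    by (simp_all add: algebra_simps)
  then have "q = 2 * p" "p = 2 * q" by (metis of_nat_eq_iff of_nat_mult of_nat_numeral)+
  then show ?thesis using pq(3) by simp
qed

end

section \<open>Direct products and the graph of an isomorphism\<close>

instantiation prod :: (cvec, cvec) cvec
begin
definition cscale_prod :: "complex \<Rightarrow> 'a \<times> 'b \<Rightarrow> 'a \<times> 'b" where "cscale_prod z p = (z *\<^sub>C fst p, z *\<^sub>C snd p)"
instance
  by standard (simp_all add: cscale_prod_def cscale_right_distrib cscale_left_distrib cscale_cscale cscale_one prod_eq_iff)
end

lemma smooth_affine_prod:
  assumes "smooth_affine k X" "smooth_affine k X'"
  shows "smooth_affine k (\<lambda>A n p. (X A n (fst p), X' A n (snd p)))"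
proof -
  interpret R: smooth_affine k X by (rule assms)
  interpret R': smooth_affine k X' by (rule assms)
  show ?thesis
  proof
    show "affine_sl3_module k (\<lambda>A n p. (X A n (fst p), X' A n (snd p)))"
      unfolding affine_sl3_module_def
    proof (intro conjI ballI allI)
      show "clinear (\<lambda>p. (X A n (fst p), X' A n (snd p)))" if "A \<in> sl3" for A n
        using that by (simp add: clinear_iff cscale_prod_def R.X_simps R'.X_simps)
      show "linear_on sl3 (\<lambda>A. (X A n (fst u), X' A n (snd u)))" for n u
        by (simp add: linear_on_def cscale_prod_def R.X_table R'.X_table)
      show "(X A m (fst (X B n (fst u), X' B n (snd u))), X' A m (snd (X B n (fst u), X' B n (snd u)))) -
         (X B n (fst (X A m (fst u), X' A m (snd u))), X' B n (snd (X A m (fst u), X' A m (snd u)))) =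
         (X (commutator A B) (m + n) (fst u), X' (commutator A B) (m + n) (snd u)) +
         (if m + n = 0 then (of_int m * k * trace (A ** B)) *\<^sub>C u else 0)" if "A \<in> sl3" "B \<in> sl3" for A B m n u
        using R.rel[OF that, of m n "fst u"] R'.rel[OF that, of m n "snd u"] by (simp add: cscale_prod_def prod_eq_iff)
    qed
    show "\<exists>N. \<forall>n\<ge>N. (X A n (fst u), X' A n (snd u)) = 0" if A: "A \<in> sl3" for A and u
    proof -
      obtain N where "\<And>n. n \<ge> N \<Longrightarrow> X A n (fst u) = 0" using R.smooth[OF A] by meson
      moreover obtain N' where "\<And>n. n \<ge> N' \<Longrightarrow> X' A n (snd u) = 0" using R'.smooth[OF A] by meson
      ultimately show ?thesis by (intro exI[of _ "max N N'"]) (simp add: zero_prod_def)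
    qed
  qed
qed

text \<open>The submodule \<open>Z\<close> of the product generated by the pair
  \<open>(w, v)\<close> is the graph of the isomorphism. By \<open>singular_unique\<close> its
  singular vectors of the given weight are multiples of this pair, and irreducibility on both sides
  makes the two projections injective and surjective.\<close>

lemma irreducible_hw_unique:
  assumes X: "smooth_affine k X" and X': "smooth_affine k X'" and k: "k \<noteq> - 3"
    and w: "affine_module.singular X a b w" "w \<noteq> 0"
    and irr: "\<And>N. affine_invariant X N \<Longrightarrow> N \<subseteq> affine_module.aff_gen X w \<Longrightarrow> N = {0} \<or> N = affine_module.aff_gen X w"
    and v: "affine_module.singular X' a b v" "v \<noteq> 0"
    and irr': "\<And>N. affine_invariant X' N \<Longrightarrow> N = {0} \<or> N = UNIV"
  shows "affine_sl3_iso X (affine_module.aff_gen X w) X'"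
proof -
  interpret R: smooth_affine k X by (rule X)
  interpret R': smooth_affine k X' by (rule X')
  let ?XX = "\<lambda>A n p. (X A n (fst p), X' A n (snd p))"
  interpret P: smooth_affine k ?XX by (rule smooth_affine_prod[OF X X'])
  note sing = R.singular_def R'.singular_def P.singular_def
  have z: "P.singular a b (w, v)" using w(1) v(1) by (simp add: sing cscale_prod_def zero_prod_def)
  define Z where "Z = P.aff_gen (w, v)"
  have Zinv: "affine_invariant ?XX Z" unfolding Z_def by (rule P.aff_gen_invariant)
  then have Zs: "cvec.subspace Z" and ZX: "\<And>A n p. A \<in> sl3 \<Longrightarrow> p \<in> Z \<Longrightarrow> ?XX A n p \<in> Z"
    by (auto simp: affine_invariant_def)
  have uniq: "\<exists>c. z' = c *\<^sub>C (w, v)" if "z' \<in> Z" "P.singular a b z'" for z'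
    using P.singular_unique[OF k z that(1)[unfolded Z_def] that(2)] .
  let ?M = "R.aff_gen w"
  have Minv: "affine_invariant X ?M" by (rule R.aff_gen_invariant)
  then have Ms: "cvec.subspace ?M" and MX: "\<And>A n u. A \<in> sl3 \<Longrightarrow> u \<in> ?M \<Longrightarrow> X A n u \<in> ?M"
    by (auto simp: affine_invariant_def)
  have ZM: "fst p \<in> ?M" if "p \<in> Z" for p
  proof -
    have "affine_invariant ?XX {p. fst p \<in> ?M}"
      using Ms MX by (auto simp: affine_invariant_def cvec.subspace_def cscale_prod_def)
    then have "Z \<subseteq> {p. fst p \<in> ?M}" unfolding Z_def by (rule P.aff_gen_minimal) (simp add: R.aff_gen_base)
    then show ?thesis using that by auto
  qed
  have Zv: "(w, v) \<in> Z" unfolding Z_def by (rule P.aff_gen_base)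
  \<comment> \<open>A nonzero \<open>(r, 0)\<close> would by irreducibility put
    \<open>(w, 0)\<close> into \<open>Z\<close>, a singular vector of the same weight that is not a
    multiple of \<open>(w, v)\<close>.\<close>
  have inj1: "r = 0" if "(r, 0) \<in> Z" for r
  proof (rule ccontr)
    assume r: "r \<noteq> 0"
    define N where "N = {r. (r, 0) \<in> Z}"
    have "affine_invariant X N"
      unfolding affine_invariant_def N_def
    proof (intro conjI ballI allI)
      show "cvec.subspace {r. (r, 0) \<in> Z}"
        using cvec.subspace_0[OF Zs] cvec.subspace_add[OF Zs, of "(x, 0)" "(y, 0)" for x y]
          cvec.subspace_scale[OF Zs, of "(x, 0)" for x]
        by (auto simp: cvec.subspace_def zero_prod_def cscale_prod_def)
      show "X A n u \<in> {r. (r, 0) \<in> Z}" if "A \<in> sl3" "u \<in> {r. (r, 0) \<in> Z}" for A n u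
        using ZX[OF that(1), of "(u, 0)" n] that by (simp add: R'.X_simps)
    qed
    moreover have "N \<subseteq> ?M" using ZM by (force simp: N_def)
    moreover have "N \<noteq> {0}" using that r by (auto simp: N_def)
    ultimately have "N = ?M" using irr by blast
    then have "(w, 0) \<in> Z" using R.aff_gen_base by (auto simp: N_def)
    moreover have "P.singular a b (w, 0)" using w by (simp add: sing R'.X_simps zero_prod_def cscale_prod_def)
    ultimately obtain c where "(w, 0) = c *\<^sub>C (w, v)" using uniq by blast
    then show False using w(2) v(2) by (auto simp: cscale_prod_def)
  qed
  have inj2: "t = 0" if "(0, t) \<in> Z" for t
  proof (rule ccontr)
    assume r: "t \<noteq> 0"
    define N where "N = {t. (0, t) \<in> Z}"
    have "affine_invariant X' N"
      unfolding affine_invariant_def N_def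
    proof (intro conjI ballI allI)
      show "cvec.subspace {t. (0, t) \<in> Z}"
        using cvec.subspace_0[OF Zs] cvec.subspace_add[OF Zs, of "(0, x)" "(0, y)" for x y]
          cvec.subspace_scale[OF Zs, of "(0, x)" for x]
        by (auto simp: cvec.subspace_def zero_prod_def cscale_prod_def)
      show "X' A n u \<in> {t. (0, t) \<in> Z}" if "A \<in> sl3" "u \<in> {t. (0, t) \<in> Z}" for A n u
        using ZX[OF that(1), of "(0, u)" n] that by (simp add: R.X_simps)
    qed
    moreover have "N \<noteq> {0}" using that r by (auto simp: N_def)
    ultimately have "N = UNIV" using irr' by blast
    then have "(0, v) \<in> Z" by (auto simp: N_def)
    moreover have "P.singular a b (0, v)" using v by (simp add: sing R.X_simps zero_prod_def cscale_prod_def)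
    ultimately obtain c where "(0, v) = c *\<^sub>C (w, v)" using uniq by blast
    then show False using w(2) v(2) by (auto simp: cscale_prod_def)
  qed
  have sur1: "\<exists>t. (r, t) \<in> Z" if "r \<in> ?M" for r
  proof -
    have "affine_invariant X (fst ` Z)"
      unfolding affine_invariant_def
    proof (intro conjI ballI allI)
      show "cvec.subspace (fst ` Z)"
        by (rule subspace_image_clinear[OF _ Zs]) (simp add: clinear_iff cscale_prod_def)
      show "X A n u \<in> fst ` Z" if "A \<in> sl3" "u \<in> fst ` Z" for A n u
        using that ZX[OF that(1)] by (force simp: image_iff)
    qed
    moreover have "w \<in> fst ` Z" using Zv by force
    ultimately have "?M \<subseteq> fst ` Z" by (rule R.aff_gen_minimal)
    then show ?thesis using that by force
  qed
  have sur2: "\<exists>r. (r, t) \<in> Z" for t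
  proof -
    have "affine_invariant X' (snd ` Z)"
      unfolding affine_invariant_def
    proof (intro conjI ballI allI)
      show "cvec.subspace (snd ` Z)"
        by (rule subspace_image_clinear[OF _ Zs]) (simp add: clinear_iff cscale_prod_def)
      show "X' A n u \<in> snd ` Z" if "A \<in> sl3" "u \<in> snd ` Z" for A n u
        using that ZX[OF that(1)] by (force simp: image_iff)
    qed
    moreover have "v \<in> snd ` Z" using Zv by force
    ultimately have "snd ` Z = UNIV" using irr' v(2) by blast
    then show ?thesis by (metis UNIV_I imageE prod.collapse)
  qed
  define f where "f r = (THE t. (r, t) \<in> Z)" for r
  have f: "f r = t" if "(r, t) \<in> Z" for r t
    unfolding f_def
  proof (rule the_equality)
    show "(r, t) \<in> Z" by (rule that)
    fix t' assume "(r, t') \<in> Z"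
    then have "(r, t') - (r, t) \<in> Z" using that by (rule cvec.subspace_diff[OF Zs])
    then show "t' = t" using inj2[of "t' - t"] by simp
  qed
  have fZ: "(r, f r) \<in> Z" if "r \<in> ?M" for r using sur1[OF that] f by auto
  show ?thesis
    unfolding affine_sl3_iso_def
  proof (intro conjI exI[of _ f] ballI allI Minv)
    show "linear_on ?M f"
      unfolding linear_on_def
    proof (intro conjI ballI allI)
      show "f (u + u') = f u + f u'" if "u \<in> ?M" "u' \<in> ?M" for u u'
        using cvec.subspace_add[OF Zs fZ[OF that(1)] fZ[OF that(2)]] by (intro f) simp
      show "f (c *\<^sub>C u) = c *\<^sub>C f u" if "u \<in> ?M" for c u
        using cvec.subspace_scale[OF Zs fZ[OF that], of c] by (intro f) (simp add: cscale_prod_def)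
    qed
    show "bij_betw f ?M UNIV"
      unfolding bij_betw_def
    proof
      show "inj_on f ?M"
      proof (rule inj_onI)
        fix r r' assume r: "r \<in> ?M" "r' \<in> ?M" "f r = f r'"
        have "(r, f r) - (r', f r') \<in> Z" by (rule cvec.subspace_diff[OF Zs fZ[OF r(1)] fZ[OF r(2)]])
        then show "r = r'" using inj1[of "r - r'"] r(3) by simp
      qed
      show "f ` ?M = UNIV"
      proof (intro equalityI subset_UNIV subsetI)
        fix t
        obtain r where r: "(r, t) \<in> Z" using sur2 by blast
        have "r \<in> ?M" using ZM[OF r] by simp
        then show "t \<in> f ` ?M" using f[OF r] by blast
      qed
    qed
    show "f (X A n u) = X' A n (f u)" if "A \<in> sl3" "u \<in> ?M" for A n u
      using ZX[OF that(1) fZ[OF that(2)], of n] by (intro f) simp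
  qed
qed

subsection \<open>Integrable highest weight modules\<close>

lemma fin_dim_subset: "fin_dim V \<Longrightarrow> U \<subseteq> V \<Longrightarrow> fin_dim U"
  by (auto simp: fin_dim_def)

lemma fin_dim_span: "finite B \<Longrightarrow> fin_dim (cvec.span B)"
  by (auto simp: fin_dim_def)

context affine_module
begin

lemma sl3_invariant_basis:
  assumes N: "cvec.subspace N"
    and s: "stab N e1 0" "stab N e2 0" "stab N f1 0" "stab N f2 0"
  shows "sl3_invariant X N"
proof -
  have h: "stab N h1 0" "stab N h2 0" "stab N e3 0" "stab N f3 0"
    using stab_commutator[OF N _ _ s(1) s(3)] stab_commutator[OF N _ _ s(2) s(4)]
      stab_commutator[OF N _ _ s(1) s(2)] stab_commutator[OF N _ _ s(4) s(3)] by simp_all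
  show ?thesis
    unfolding sl3_invariant_def
  proof (intro conjI ballI allI N)
    fix A u assume "A \<in> sl3" "u \<in> N"
    then show "X A 0 u \<in> N"
      using s h by (subst X_expand) (auto simp: stab_def intro!: cvec.subspace_add[OF N] cvec.subspace_scale[OF N])
  qed
qed

lemma sl3_orbit_invariant: "sl3_invariant X (sl3_orbit X w)"
  unfolding sl3_orbit_def sl3_invariant_def by (auto intro: cvec.subspace_Inter)

lemma sl3_orbit_base: "w \<in> sl3_orbit X w" by (auto simp: sl3_orbit_def)

lemma sl3_orbit_minimal: "sl3_invariant X U \<Longrightarrow> w \<in> U \<Longrightarrow> sl3_orbit X w \<subseteq> U"
  by (auto simp: sl3_orbit_def)

lemma integrableI: "sl3_invariant X U \<Longrightarrow> w \<in> U \<Longrightarrow> fin_dim U \<Longrightarrow> w \<in> integrable_part X"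
  using sl3_orbit_minimal[of U w] by (auto simp: integrable_part_def fin_dim_def)

lemma integrable_orbit: "w \<in> integrable_part X \<Longrightarrow> fin_dim (sl3_orbit X w)"
  by (auto simp: integrable_part_def fin_dim_def)

end

context smooth_affine
begin

text \<open>The relation \<open>f\<^sub>2 f\<^sub>1\<^sup>n f\<^sub>2\<^sup>m = f\<^sub>1\<^sup>n f\<^sub>2\<^sup>m\<^sup>+\<^sup>1 + n f\<^sub>3 f\<^sub>1\<^sup>n\<^sup>-\<^sup>1 f\<^sub>2\<^sup>m\<close> transports nilpotency of
  \<open>f\<^sub>3\<close> from the monomials with large \<open>n\<close> or \<open>m\<close>, which vanish, to all the others.\<close>

lemma integrable_singular:
  fixes a b :: nat
  assumes e: "X e1 0 w = 0" "X e2 0 w = 0" and h: "X h1 0 w = x *\<^sub>C w" "X h2 0 w = y *\<^sub>C w"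
    and nil: "(X f1 0 ^^ Suc a) w = 0" "(X f2 0 ^^ Suc b) w = 0"
  shows "w \<in> integrable_part X"
proof -
  define F1 where "F1 = X f1 0"
  define F2 where "F2 = X f2 0"
  define F3 where "F3 = X f3 0"
  have lin: "clinear F1" "clinear F2" "clinear F3" by (simp_all add: F1_def F2_def F3_def X_linear)
  note lp = clinear_funpow[OF lin(1)] clinear_funpow[OF lin(2)] clinear_funpow[OF lin(3)]
  have c: "F3 (F1 u) = F1 (F3 u)" "F3 (F2 u) = F2 (F3 u)" "F2 (F1 u) = F1 (F2 u) + F3 u" for u
    using rel0[of f3 f1 0 u] rel0[of f3 f2 0 u] rel0[of f2 f1 0 u] by (simp_all add: F1_def F2_def F3_def X_table)
  have c31: "F3 ((F1 ^^ n) u) = (F1 ^^ n) (F3 u)" for n u by (induction n) (simp_all add: c)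
  have c13: "(F3 ^^ n) (F1 u) = F1 ((F3 ^^ n) u)" for n u by (induction n) (simp_all add: c)
  have c23: "(F3 ^^ n) (F2 u) = F2 ((F3 ^^ n) u)" for n u by (induction n) (simp_all add: c)
  define W where "W n m = (F1 ^^ n) ((F2 ^^ m) w)" for n m
  have c21: "F2 ((F1 ^^ n) u) = (F1 ^^ n) (F2 u) + of_nat n *\<^sub>C F3 ((F1 ^^ (n - 1)) u)" for n u
  proof (induction n)
    case (Suc n)
    have "F1 (F3 ((F1 ^^ (n - 1)) u)) = F3 ((F1 ^^ n) u)" if "n > 0"
      using that by (cases n) (simp_all add: c)
    then show ?case
      using Suc by (cases "n = 0")
        (simp_all add: c clinear_add[OF lin(1)] clinear_scale[OF lin(1)] cscale_left_distrib cscale_one)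
  qed simp
  have F2W: "F2 (W n m) = W n (Suc m) + of_nat n *\<^sub>C F3 (W (n - 1) m)" for n m
    unfolding W_def c21 by simp
  have F1W: "F1 (W n m) = W (Suc n) m" for n m by (simp add: W_def)
  have high: "(f ^^ n) u = 0" if H: "(f ^^ N) u = 0" "n \<ge> N" "clinear f" for f :: "'a \<Rightarrow> 'a" and n N u
  proof -
    obtain d where "n = d + N" using H(2) by (metis le_add_diff_inverse2)
    then show ?thesis using H(1) by (simp add: funpow_add clinear_0[OF clinear_funpow[OF H(3)]])
  qed
  \<comment> \<open>In \<open>F2W\<close> both \<open>W n m\<close> and \<open>W (n - 1) m\<close>
    vanish by induction, hence so does \<open>W n (Suc m)\<close>; the bound on \<open>n\<close>
    grows by one with each \<open>f\<^sub>2\<close>.\<close>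
  have z1: "W n m = 0" if "n > a + m" for n m
    using that
  proof (induction m arbitrary: n)
    case 0 then show ?case using high[OF nil(1), of n] by (simp add: W_def F1_def X_linear)
  next
    case (Suc m)
    have "W n m = 0" "W (n - 1) m = 0" using Suc by simp_all
    then show ?case using F2W[of n m] by (simp add: clinear_0[OF lin(2)] clinear_0[OF lin(3)])
  qed
  have z2: "W n m = 0" if "m > b" for n m
    using high[OF nil(2), of m] that by (simp add: W_def F2_def X_linear clinear_0[OF lp(1)])
  have nilW: "\<exists>J. (F3 ^^ J) (W n m) = 0" for n m
  proof (induction "Suc b - m" arbitrary: n m)
    case 0
    then have "W n m = 0" by (intro z2) simp
    then show ?case by (intro exI[of _ 0]) simp
  next
    case (Suc d)
    have IH: "\<exists>J. (F3 ^^ J) (W n (Suc m)) = 0" for n using Suc by (intro Suc.hyps(1)) simp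
    show ?case
    proof (induction "Suc (a + m) - n" arbitrary: n)
      case 0
      then have "W n m = 0" by (intro z1) simp
      then show ?case by (intro exI[of _ 0]) simp
    next
      case (Suc d)
      have "d = Suc (a + m) - Suc n" using Suc.hyps(2) by linarith
      then obtain J1 where J1: "(F3 ^^ J1) (W (Suc n) m) = 0" using Suc.hyps(1)[of "Suc n"] by blast
      obtain J2 where J2: "(F3 ^^ J2) (W (Suc n) (Suc m)) = 0" using IH by blast
      define J where "J = max J1 J2"
      have J: "(F3 ^^ J) (W (Suc n) m) = 0" "(F3 ^^ J) (W (Suc n) (Suc m)) = 0"
        using high[OF J1, of J] high[OF J2, of J] lin(3) by (simp_all add: J_def)
      have "(F3 ^^ J) (F2 (W (Suc n) m)) = 0" unfolding c23 J by (rule clinear_0[OF lin(2)])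
      then have "of_nat (Suc n) *\<^sub>C (F3 ^^ J) (F3 (W n m)) = 0"
        unfolding F2W by (simp add: clinear_add[OF lp(3)] clinear_scale[OF lp(3)] J)
      then have "(F3 ^^ J) (F3 (W n m)) = 0" by (simp del: of_nat_Suc)
      then show ?case by (intro exI[of _ "Suc J"]) (simp add: funpow_swap1)
    qed
  qed
  have "\<exists>J. \<forall>n\<le>a + b. \<forall>m\<le>b. (F3 ^^ J) (W n m) = 0"
  proof -
    obtain j where j: "\<And>n m. (F3 ^^ j n m) (W n m) = 0" using nilW by metis
    have "(F3 ^^ (\<Sum>n\<le>a + b. \<Sum>m\<le>b. j n m)) (W n m) = 0" if "n \<le> a + b" "m \<le> b" for n m
    proof (rule high[OF j _ lin(3)])
      have "j n m \<le> (\<Sum>m\<le>b. j n m)" using that by (intro member_le_sum) auto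
      also have "\<dots> \<le> (\<Sum>n\<le>a + b. \<Sum>m\<le>b. j n m)"
        using that by (intro member_le_sum[of n _ "\<lambda>n. \<Sum>m\<le>b. j n m"]) auto
      finally show "j n m \<le> (\<Sum>n\<le>a + b. \<Sum>m\<le>b. j n m)" .
    qed
    then show ?thesis by blast
  qed
  then obtain J where J: "\<And>n m. n \<le> a + b \<Longrightarrow> m \<le> b \<Longrightarrow> (F3 ^^ J) (W n m) = 0" by blast
  define U where "U = cvec.span {(F3 ^^ j) (W n m) | j n m. True}"
  have Us: "cvec.subspace U" unfolding U_def by (rule cvec.subspace_span)
  note clos = cvec.subspace_add[OF Us] cvec.subspace_diff[OF Us] cvec.subspace_scale[OF Us] cvec.subspace_0[OF Us]
      cvec.subspace_neg[OF Us]
  have gen: "(F3 ^^ j) (W n m) \<in> U" for j n m unfolding U_def by (rule cvec.span_base) blast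
  have fin: "fin_dim U"
  proof -
    let ?B = "insert 0 ((\<lambda>(j, n, m). (F3 ^^ j) (W n m)) ` ({..J} \<times> {..a + b} \<times> {..b}))"
    have "{(F3 ^^ j) (W n m) | j n m. True} \<subseteq> ?B"
    proof clarify
      fix j n m assume nz: "(F3 ^^ j) (W n m) \<notin> (\<lambda>(j, n, m). (F3 ^^ j) (W n m)) ` ({..J} \<times> {..a + b} \<times> {..b})"
      show "(F3 ^^ j) (W n m) = 0"
      proof (rule ccontr)
        assume z: "(F3 ^^ j) (W n m) \<noteq> 0"
        then have "W n m \<noteq> 0" using clinear_0[OF lp(3)] by auto
        then have "n \<le> a + m" "m \<le> b" using z1[of m n] z2[of m n] by (auto simp: not_less[symmetric])
        then have nm: "n \<le> a + b" "m \<le> b" by auto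
        have "j \<le> J" using high[OF J[OF nm], of j] z lin(3) by (meson nle_le)
        then show False using nz nm by force
      qed
    qed
    then have "U \<subseteq> cvec.span ?B" unfolding U_def by (rule cvec.span_mono)
    then show ?thesis by (rule fin_dim_subset[OF fin_dim_span, rotated]) simp
  qed
  have U_F: "F1 u \<in> U" "F2 u \<in> U" "F3 u \<in> U" if "u \<in> U" for u
  proof -
    have "F1 ((F3 ^^ j) (W n m)) \<in> U" for j n m using gen[of j "Suc n" m] by (simp add: F1W flip: c13)
    moreover have "F2 ((F3 ^^ j) (W n m)) \<in> U" for j n m
      using gen[of j n "Suc m"] gen[of "Suc j" "n - 1" m]
      by (simp add: F2W clinear_add[OF lp(3)] clinear_scale[OF lp(3)] funpow_swap1 clos flip: c23)
    moreover have "F3 ((F3 ^^ j) (W n m)) \<in> U" for j n m using gen[of "Suc j" n m] by simp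
    ultimately show "F1 u \<in> U" "F2 u \<in> U" "F3 u \<in> U"
      by (auto intro!: clinear_maps_span[OF lin(1) Us _ that[unfolded U_def]] clinear_maps_span[OF lin(2) Us _
          that[unfolded U_def]]
        clinear_maps_span[OF lin(3) Us _ that[unfolded U_def]])
  qed
  \<comment> \<open>Stability under the Cartan and raising operators is not checked on each spanning
    vector: \<open>U'\<close> contains \<open>w\<close> and is closed under the lowering operators,
    so it contains all of them.\<close>
  define U' where "U' = {u \<in> U. X h1 0 u \<in> U \<and> X h2 0 u \<in> U \<and> X e1 0 u \<in> U \<and> X e2 0 u \<in> U}"
  have U's: "cvec.subspace U'"
    unfolding U'_def cvec.subspace_def by (auto simp: clos X_simps)
  have U'_F: "F1 u \<in> U'" "F2 u \<in> U'" "F3 u \<in> U'" if "u \<in> U'" for u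
    using that rel0[of _ f1 0 u] rel0[of _ f2 0 u] rel0[of _ f3 0 u] U_F
    unfolding U'_def F1_def F2_def F3_def
    by (simp_all add: X_table clos)
  have "w \<in> U'" using gen[of 0 0 0] by (simp add: U'_def e h W_def clos)
  then have "(F3 ^^ j) (W n m) \<in> U'" for j n m
    unfolding W_def by (intro funpow_closed[of U'] U'_F)
  then have "U \<subseteq> U'" unfolding U_def by (intro cvec.span_minimal U's) auto
  then have "sl3_invariant X U"
    using U_F by (intro sl3_invariant_basis[OF Us]) (auto simp: stab_def U'_def F1_def F2_def)
  then show ?thesis using gen[of 0 0 0] fin by (intro integrableI[of U]) (simp_all add: W_def)
qed

end

section \<open>The grading of \<open>sl3\<close> by the coroot of the highest root\<close>

lemma jacobi: "commutator H (commutator A B) = commutator (commutator H A) B + commutator A (commutator H B)"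
proof -
  have d: "A ** (B - C) = A ** B - A ** C" "(B - C) ** A = B ** A - C ** A" for A B C :: "complex^3^3"
    by (simp_all add: matrix_matrix_mult_def vec_eq_iff sum_subtractf algebra_simps)
  show ?thesis by (simp add: commutator_def d matrix_mul_assoc)
qed

lemma commutator_scale: "commutator (z *\<^sub>C A) B = z *\<^sub>C commutator A B" "commutator A (z *\<^sub>C B) = z *\<^sub>C commutator A B"
  by (simp_all add: commutator_def matrix_matrix_mult_def vec_eq_iff cscale_vec_def cscale_complex_def sum_3 algebra_simps)

text \<open>The zero matrix belongs to every degree, so brackets of homogeneous elements stay
  homogeneous even when they vanish.\<close>

definition Hg :: "int \<Rightarrow> (complex^3^3) set"
  where "Hg i = {A \<in> sl3. commutator (h1 + h2) A = of_int i *\<^sub>C A}"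

lemma Hg_sl3: "A \<in> Hg i \<Longrightarrow> A \<in> sl3" by (simp add: Hg_def)

lemma Hg_commutator: "A \<in> Hg i \<Longrightarrow> B \<in> Hg j \<Longrightarrow> commutator A B \<in> Hg (i + j)"
  by (simp add: Hg_def jacobi commutator_scale cscale_left_distrib)

lemma Hg_basis: "e1 \<in> Hg 1" "e2 \<in> Hg 1" "e3 \<in> Hg 2" "h1 \<in> Hg 0" "h2 \<in> Hg 0" "f1 \<in> Hg (- 1)" "f2 \<in> Hg (- 1)" "f3 \<in> Hg (- 2)"
  by (simp_all add: Hg_def) (simp_all add: commutator_def matrix_matrix_mult_def vec_eq_iff forall_3 sum_3 sl3_basis_defs
      cscale_vec_def cscale_complex_def)

lemma Hg_entries:
  assumes "A \<in> Hg i"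
  shows "i \<noteq> 1 \<Longrightarrow> A $ 1 $ 2 = 0 \<and> A $ 2 $ 3 = 0" "i \<noteq> 2 \<Longrightarrow> A $ 1 $ 3 = 0"
    "i \<noteq> 0 \<Longrightarrow> A $ 1 $ 1 = 0 \<and> A $ 2 $ 2 = 0" "i \<noteq> - 1 \<Longrightarrow> A $ 2 $ 1 = 0 \<and> A $ 3 $ 2 = 0" "i \<noteq> - 2 \<Longrightarrow> A $ 3 $ 1 = 0"
proof -
  have "commutator (h1 + h2) A $ p $ q = of_int i * (A $ p $ q)" for p q
    using assms by (simp add: Hg_def cscale_vec_def cscale_complex_def)
  moreover have "commutator (h1 + h2) A $ 1 $ 2 = A $ 1 $ 2" "commutator (h1 + h2) A $ 2 $ 3 = A $ 2 $ 3"
    "commutator (h1 + h2) A $ 1 $ 3 = 2 * (A $ 1 $ 3)" "commutator (h1 + h2) A $ 1 $ 1 = 0"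
        "commutator (h1 + h2) A $ 2 $ 2 = 0"
    "commutator (h1 + h2) A $ 2 $ 1 = - A $ 2 $ 1" "commutator (h1 + h2) A $ 3 $ 2 = - A $ 3 $ 2"
    "commutator (h1 + h2) A $ 3 $ 1 = - 2 * (A $ 3 $ 1)"
    by (simp_all add: commutator_def matrix_matrix_mult_def sum_3 sl3_basis_defs)
  ultimately have e: "(of_int (i - 1) :: complex) * A $ 1 $ 2 = 0" "(of_int (i - 1) :: complex) * A $ 2 $ 3 = 0"
    "(of_int (i - 2) :: complex) * A $ 1 $ 3 = 0" "(of_int i :: complex) * A $ 1 $ 1 = 0"
        "(of_int i :: complex) * A $ 2 $ 2 = 0"
    "(of_int (i + 1) :: complex) * A $ 2 $ 1 = 0" "(of_int (i + 1) :: complex) * A $ 3 $ 2 = 0"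
        "(of_int (i + 2) :: complex) * A $ 3 $ 1 = 0"
    by (simp_all add: algebra_simps)
  have nz: "(of_int s :: complex) * t = 0 \<Longrightarrow> s \<noteq> 0 \<Longrightarrow> t = 0" for s t by simp
  show "i \<noteq> 1 \<Longrightarrow> A $ 1 $ 2 = 0 \<and> A $ 2 $ 3 = 0" "i \<noteq> 2 \<Longrightarrow> A $ 1 $ 3 = 0"
    "i \<noteq> 0 \<Longrightarrow> A $ 1 $ 1 = 0 \<and> A $ 2 $ 2 = 0" "i \<noteq> - 1 \<Longrightarrow> A $ 2 $ 1 = 0 \<and> A $ 3 $ 2 = 0" "i \<noteq> - 2 \<Longrightarrow> A $ 3 $ 1 = 0"
    using nz[OF e(1)] nz[OF e(2)] nz[OF e(3)] nz[OF e(4)] nz[OF e(5)] nz[OF e(6)] nz[OF e(7)] nz[OF e(8)] by auto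
qed

lemma Hg_zero:
  assumes A: "A \<in> Hg i" and i: "\<bar>i\<bar> > 2" shows "A = 0"
  using sl3_expand[OF Hg_sl3[OF A]] Hg_entries[OF A] i by auto

text \<open>The trace of a commutator is 0, so \<open>i + j\<close> times the trace of
  \<open>A ** B\<close> is 0. Consequently central terms, which have total mode 0, have degree 0 in
  the grading \<open>2n + i\<close>.\<close>

lemma Hg_trace:
  assumes "A \<in> Hg i" "B \<in> Hg j" "trace (A ** B) \<noteq> 0" shows "i + j = 0"
proof -
  have d: "A ** (B - C) = A ** B - A ** C" "(B - C) ** A = B ** A - C ** A" for A B C :: "complex^3^3"
    by (simp_all add: matrix_matrix_mult_def vec_eq_iff sum_subtractf algebra_simps)
  have s: "(z *\<^sub>C A) ** B = z *\<^sub>C (A ** B)" "A ** (z *\<^sub>C B) = z *\<^sub>C (A ** B)" for z and A B :: "complex^3^3"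
    by (simp_all add: matrix_matrix_mult_def vec_eq_iff cscale_vec_def cscale_complex_def sum_3 algebra_simps)
  have "commutator (h1 + h2) (A ** B) = commutator (h1 + h2) A ** B + A ** commutator (h1 + h2) B"
    by (simp add: commutator_def d matrix_mul_assoc)
  also have "\<dots> = of_int i *\<^sub>C (A ** B) + of_int j *\<^sub>C (A ** B)" using assms by (simp add: Hg_def s)
  finally have "of_int (i + j) * trace (A ** B) = 0"
    using trace_simps(6)[of "h1 + h2" "A ** B"] by (simp add: trace_simps algebra_simps)
  then show ?thesis using assms(3) by (simp flip: of_int_add)
qed

subsection \<open>Localization at \<open>e\<^sub>3(-1)\<close>\<close>

context affine_module
begin

abbreviation xop :: "'m \<Rightarrow> 'm" where "xop \<equiv> X e3 (- 1)"

lemma xop_linear: "clinear (xop ^^ n)"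
  by (rule clinear_funpow[OF X_linear]) simp

text \<open>\<open>e\<^sub>3(-1)\<close> has degree \<open>0\<close> in the grading \<open>2n + i\<close> of \<open>A t\<^sup>n\<close>, \<open>[h\<^sub>1 + h\<^sub>2, A] = i A\<close>, and is
  ad-nilpotent, so localization preserves filtered submodules.\<close>

lemma localization_step:
  assumes sub: "\<And>j. cvec.subspace (F j)"
    and shift: "\<And>A i n j u. A \<in> Hg i \<Longrightarrow> u \<in> F j \<Longrightarrow> X A n u \<in> F (j - (2 * n + i))"
    and A: "A \<in> Hg i" and t: "(xop ^^ r) t \<in> F j"
  shows "\<exists>r. (xop ^^ r) (X A n t) \<in> F (j - (2 * n + i))"
proof -
  have xF: "xop u \<in> F j" if "u \<in> F j" for u j using shift[OF Hg_basis(3) that, of "- 1"] by simp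
  have xnF: "(xop ^^ m) u \<in> F j" if "u \<in> F j" for u j m by (rule funpow_closed[of "F j"]) (rule xF, assumption, rule that)
  \<comment> \<open>Each bracket with \<open>e3\<close> raises the degree of \<open>A\<close> by 2,
    and \<open>q\<close> bounds the number of brackets before the degree exceeds 2, where the
    element is 0. The outer induction is on \<open>q\<close>, the inner one on the power
    \<open>r\<close> needed for \<open>t\<close>; finally \<open>q = nat (3 - i)\<close> is large
    enough.\<close>
  have "(xop ^^ (r + q)) (X A n t) \<in> F (j - (2 * n + i))"
    if "A \<in> Hg i" "i + 2 * int q > 2" "(xop ^^ r) t \<in> F j" for q A i n r t
    using that
  proof (induction q arbitrary: A i n r t)
    case 0
    then have "A = 0" using Hg_zero by simp
    then show ?case by (simp add: X_zero clinear_0[OF xop_linear] cvec.subspace_0[OF sub])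
  next
    case (Suc q)
    from Suc.prems(3) show ?case
    proof (induction r arbitrary: t)
      case 0
      then have "X A n t \<in> F (j - (2 * n + i))" by (intro shift Suc.prems(1)) simp
      then show ?case by (rule xnF)
    next
      case (Suc r)
      let ?d = "j - (2 * n + i)"
      have 1: "(xop ^^ (r + Suc q)) (X A n (xop t)) \<in> F ?d"
        using Suc.prems by (intro Suc.IH) (simp only: funpow_Suc_right comp_def)
      have "(xop ^^ (Suc r + q)) (X (commutator e3 A) (n - 1) t) \<in> F (j - (2 * (n - 1) + (2 + i)))"
        by (rule \<open>\<And>t r n i A. A \<in> Hg i \<Longrightarrow> 2 < i + 2 * int q \<Longrightarrow> (xop ^^ r) t \<in> F j \<Longrightarrow> (xop ^^ (r + q)) (X A n t) \<in> F (j - (2 * n + i))\<close>)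
          (use Hg_commutator[OF Hg_basis(3) \<open>A \<in> Hg i\<close>] \<open>2 < i + 2 * int (Suc q)\<close> Suc.prems in auto)
      then have 2: "(xop ^^ (r + Suc q)) (X (commutator e3 A) (- 1 + n) t) \<in> F ?d" by (simp add: algebra_simps)
      have 3: "(xop ^^ (r + Suc q)) (if - 1 + n = 0 then (of_int (- 1) * k * trace (e3 ** A)) *\<^sub>C t else 0) \<in> F ?d"
      proof (cases "n = 1 \<and> trace (e3 ** A) \<noteq> 0")
        case True
        then have "2 + i = 0" using Hg_trace[OF Hg_basis(3) \<open>A \<in> Hg i\<close>] by blast
        then have d: "?d = j" using True by simp
        have "(xop ^^ (q + Suc r)) t \<in> F j" unfolding funpow_add comp_def by (rule xnF[OF Suc.prems])
        then have "(xop ^^ (r + Suc q)) t \<in> F j" by (simp add: ac_simps)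
        then show ?thesis unfolding d using True by (simp only: if_P clinear_scale[OF xop_linear]
            cvec.subspace_scale[OF sub] simp_thms)
      next
        case False
        then have "(if - 1 + n = 0 then (of_int (- 1) * k * trace (e3 ** A)) *\<^sub>C t else 0) = 0" by auto
        then show ?thesis by (simp only: clinear_0[OF xop_linear] cvec.subspace_0[OF sub])
      qed
      have e: "(xop ^^ (Suc r + Suc q)) (X A n t) = (xop ^^ (r + Suc q)) (X A n (xop t)) +
         (xop ^^ (r + Suc q)) (X (commutator e3 A) (- 1 + n) t) +
         (xop ^^ (r + Suc q)) (if - 1 + n = 0 then (of_int (- 1) * k * trace (e3 ** A)) *\<^sub>C t else 0)"
        unfolding add_Suc[of r] funpow_Suc_right comp_def
          rel[OF sl3_basis(3) Hg_sl3[OF \<open>A \<in> Hg i\<close>], of "- 1" n t] clinear_add[OF xop_linear] ..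
      show ?case unfolding e by (intro cvec.subspace_add[OF sub] 1 2 3)
    qed
  qed
  from this[OF A _ t, of "nat (3 - i)"] show ?thesis by (intro exI[of _ "r + nat (3 - i)"]) simp
qed

lemma localization_subspace:
  assumes N: "cvec.subspace N" and x: "\<And>u. u \<in> N \<Longrightarrow> xop u \<in> N"
  shows "cvec.subspace {t. \<exists>r. (xop ^^ r) t \<in> N}"
proof -
  have xn: "(xop ^^ m) u \<in> N" if "u \<in> N" for u m by (rule funpow_closed[of N]) (rule x, assumption, rule that)
  show ?thesis
    unfolding cvec.subspace_def
  proof (intro conjI ballI allI; clarify)
    show "\<exists>r. (xop ^^ r) 0 \<in> N" by (simp add: clinear_0[OF xop_linear] cvec.subspace_0[OF N])
    fix u v r s assume u: "(xop ^^ r) u \<in> N" and v: "(xop ^^ s) v \<in> N"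
    have "(xop ^^ (s + r)) u \<in> N" "(xop ^^ (r + s)) v \<in> N" unfolding funpow_add comp_def by (rule xn[OF u], rule xn[OF v])
    then have "(xop ^^ (r + s)) (u + v) \<in> N" by (simp only: clinear_add[OF xop_linear] add.commute[of s r]
        cvec.subspace_add[OF N])
    then show "\<exists>r. (xop ^^ r) (u + v) \<in> N" by blast
  next
    fix c u r assume "(xop ^^ r) u \<in> N"
    then have "(xop ^^ r) (c *\<^sub>C u) \<in> N" by (simp add: clinear_scale[OF xop_linear] cvec.subspace_scale[OF N])
    then show "\<exists>r. (xop ^^ r) (c *\<^sub>C u) \<in> N" by blast
  qed
qed

lemma localization_invariant:
  assumes N: "affine_invariant X N"
  shows "affine_invariant X {t. \<exists>r. (xop ^^ r) t \<in> N}"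
proof -
  have Ns: "cvec.subspace N" and NX: "\<And>A n u. A \<in> sl3 \<Longrightarrow> u \<in> N \<Longrightarrow> X A n u \<in> N"
    using N by (auto simp: affine_invariant_def)
  let ?L = "{t. \<exists>r. (xop ^^ r) t \<in> N}"
  have Ls: "cvec.subspace ?L" by (rule localization_subspace[OF Ns NX]) simp
  have "stab ?L A n" if "A \<in> Hg i" for A i n
  proof -
    have "\<exists>r. (xop ^^ r) (X A n t) \<in> N" if "(xop ^^ r) t \<in> N" for t r
      by (rule localization_step[where F = "\<lambda>_. N" and j = 0, OF Ns _ \<open>A \<in> Hg i\<close> that]) (auto intro: NX Hg_sl3)
    then show ?thesis by (auto simp: stab_def)
  qed
  then show ?thesis using Hg_basis by (intro invariant_basis[OF Ls]) blast+
qed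

subsection \<open>The filtration by degree\<close>

text \<open>\<open>(A, i, n)\<close> stands for \<open>A t\<^sup>n\<close> with \<open>A\<close> in
  \<open>Hg i\<close>; the degree is recorded because the zero matrix does not determine it.\<close>

type_synonym letter = "(complex^3^3) \<times> int \<times> int"

definition valid :: "letter list \<Rightarrow> bool" where "valid ws \<longleftrightarrow> list_all (\<lambda>(A, i, n). A \<in> Hg i) ws"
definition deg :: "letter list \<Rightarrow> int" where "deg ws = (\<Sum>(A, i, n)\<leftarrow>ws. 2 * n + i)"
definition wop :: "letter list \<Rightarrow> 'm \<Rightarrow> 'm" where "wop ws u = foldr (\<lambda>(A, i, n). X A n) ws u"

lemma word_simps [simp]: "valid [] = True" "valid ((A, i, n) # ws) = (A \<in> Hg i \<and> valid ws)"
    "valid (us @ vs) = (valid us \<and> valid vs)"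
  "deg [] = 0" "deg ((A, i, n) # ws) = 2 * n + i + deg ws" "deg (us @ vs) = deg us + deg vs"
  "wop [] u = u" "wop ((A, i, n) # ws) u = X A n (wop ws u)" "wop (us @ vs) u = wop us (wop vs u)"
  by (auto simp: valid_def deg_def wop_def)

lemma wop_linear: "valid ws \<Longrightarrow> clinear (wop ws)"
proof (induction ws)
  case Nil then show ?case by (simp add: wop_def clinear_id)
next
  case (Cons l ws)
  obtain A i n where l: "l = (A, i, n)" by (cases l)
  have "wop (l # ws) = (\<lambda>u. X A n (wop ws u))" by (rule ext) (simp add: l)
  moreover have "clinear (\<lambda>u. X A n (wop ws u))"
    using Cons by (intro clinear_compose[OF X_linear]) (auto simp: l Hg_sl3)
  ultimately show ?case by simp
qed

text \<open>A word of positive degree has a letter of positive degree, which is pushed to the right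
  until it kills \<open>z\<close>. Brackets and central terms leave shorter words of the same
  degree, covered by the induction on the length.\<close>

lemma singular_words:
  assumes z: "singular a b z"
  shows "valid ws \<Longrightarrow> deg ws > 0 \<Longrightarrow> wop ws z = 0"
proof (induction "length ws" arbitrary: ws rule: less_induct)
  case less
  have z': "X e1 0 z = 0" "X e2 0 z = 0" "X f3 1 z = 0" using z by (simp_all add: singular_def)
  note ann = singular_annihilates[OF z']
  have kill: "X A n z = 0" if A: "A \<in> Hg i" and p: "2 * n + i > 0" for A i n
  proof -
    have "\<bar>i\<bar> > 2 \<Longrightarrow> A = 0" by (rule Hg_zero[OF A])
    then have "A = 0 \<or> i = - 2 \<or> i = - 1 \<or> i = 0 \<or> i = 1 \<or> i = 2" by linarith
    then show ?thesis
      using p Hg_entries[OF A] by (subst X_expand[OF Hg_sl3[OF A]]) (elim disjE; simp add: ann)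
  qed
  have move: "wop (us @ (A, i, n) # vs) z = 0"
    if "valid (us @ (A, i, n) # vs)" "deg (us @ (A, i, n) # vs) > 0" "2 * n + i > 0"
        "length (us @ (A, i, n) # vs) = length ws" for us vs A i n
    using that
  proof (induction vs arbitrary: us)
    case Nil then show ?case using kill[of A i n] by (simp add: clinear_0[OF wop_linear])
  next
    case (Cons l vs)
    obtain B j m where l: "l = (B, j, m)" by (cases l)
    have AB: "A \<in> Hg i" "B \<in> Hg j" and v: "valid us" "valid vs" using Cons.prems by (simp_all add: l)
    have 1: "wop ((us @ [l]) @ (A, i, n) # vs) z = 0"
      using Cons.prems by (intro Cons.IH) (simp_all add: l)
    have 2: "wop (us @ (commutator A B, i + j, n + m) # vs) z = 0"
      using Cons.prems AB v by (intro less.hyps) (simp_all add: l Hg_commutator)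
    have 3: "wop us ((if n + m = 0 then (of_int n * k * trace (A ** B)) *\<^sub>C wop vs z else 0)) = 0"
    proof (cases "n + m = 0 \<and> trace (A ** B) \<noteq> 0")
      case True
      then have "i + j = 0" using Hg_trace[OF AB] by blast
      then have "wop (us @ vs) z = 0" using Cons.prems True v by (intro less.hyps) (simp_all add: l)
      then show ?thesis by (simp add: clinear_0[OF wop_linear] clinear_scale[OF wop_linear] v)
    next
      case False
      then have "(if n + m = 0 then (of_int n * k * trace (A ** B)) *\<^sub>C wop vs z else 0) = 0" by auto
      then show ?thesis by (simp only: clinear_0[OF wop_linear] v)
    qed
    have "wop (us @ (A, i, n) # l # vs) z = wop us (X A n (X B m (wop vs z)))" by (simp add: l)
    also have "\<dots> = 0"
      unfolding rel[OF AB[THEN Hg_sl3], of n m] clinear_add[OF wop_linear[OF v(1)]]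
      using 1 2 3 by (simp add: l)
    finally show ?case .
  qed
  have "\<exists>l\<in>set ws. case l of (A, i, n) \<Rightarrow> 2 * n + i > 0"
  proof (rule ccontr)
    assume "\<not> ?thesis"
    then have "deg ws \<le> 0" unfolding deg_def by (intro sum_list_nonpos) auto
    then show False using less.prems by simp
  qed
  then obtain A i n where l: "(A, i, n) \<in> set ws" "2 * n + i > 0" by auto
  then obtain us vs where "ws = us @ (A, i, n) # vs" by (meson split_list)
  then show ?case using move[of us A i n vs] less.prems l by simp
qed

text \<open>A degree filtration defined by annihilation, so that it makes sense on all of the module
  and not only where a grading is known. The empty word has degree 0, hence negative steps are
  zero.\<close>

definition filt :: "int \<Rightarrow> 'm set"
  where "filt j = {u. \<forall>ws. valid ws \<longrightarrow> deg ws > j \<longrightarrow> wop ws u = 0}"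

lemma filt_subspace: "cvec.subspace (filt j)"
  by (auto simp: cvec.subspace_def filt_def clinear_simps[OF wop_linear])

lemma filt_shift:
  assumes "A \<in> Hg i" "u \<in> filt j" shows "X A n u \<in> filt (j - (2 * n + i))"
  unfolding filt_def
proof (intro CollectI allI impI)
  fix ws assume ws: "valid ws" "deg ws > j - (2 * n + i)"
  have "\<forall>ws. valid ws \<longrightarrow> deg ws > j \<longrightarrow> wop ws u = 0" using assms(2) by (simp add: filt_def)
  from this[rule_format, of "ws @ [(A, i, n)]"] have "wop (ws @ [(A, i, n)]) u = 0"
    using ws assms(1) by simp
  then show "wop ws (X A n u) = 0" by simp
qed

lemma filt_neg: "j < 0 \<Longrightarrow> u \<in> filt j \<Longrightarrow> u = 0"
  by (auto simp: filt_def dest!: spec[of _ "[]"])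

lemma filt_mono: "i \<le> j \<Longrightarrow> filt i \<subseteq> filt j"
  by (auto simp: filt_def)

lemma aff_gen_filt:
  assumes "singular a b z" shows "aff_gen z \<subseteq> (\<Union>j. filt j)"
proof (rule aff_gen_minimal)
  have "z \<in> filt 0" using singular_words[OF assms] by (auto simp: filt_def)
  then show "z \<in> (\<Union>j. filt j)" by blast
  have s: "cvec.subspace (\<Union>j. filt j)"
    unfolding cvec.subspace_def
  proof (intro conjI ballI allI)
    show "0 \<in> (\<Union>j. filt j)" using cvec.subspace_0[OF filt_subspace] by blast
    show "u + v \<in> (\<Union>j. filt j)" if "u \<in> (\<Union>j. filt j)" "v \<in> (\<Union>j. filt j)" for u v
    proof -
      obtain i j where "u \<in> filt i" "v \<in> filt j" using \<open>u \<in> _\<close> \<open>v \<in> _\<close> by blast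
      then have "u \<in> filt (max i j)" "v \<in> filt (max i j)"
        using filt_mono[of i "max i j"] filt_mono[of j "max i j"] by auto
      then show ?thesis using cvec.subspace_add[OF filt_subspace] by blast
    qed
    show "c *\<^sub>C u \<in> (\<Union>j. filt j)" if "u \<in> (\<Union>j. filt j)" for c u
      using that cvec.subspace_scale[OF filt_subspace] by blast
  qed
  have "stab (\<Union>j. filt j) A n" if "A \<in> Hg i" for A i n
    unfolding stab_def using filt_shift[OF that] by blast
  then show "affine_invariant X (\<Union>j. filt j)" using Hg_basis by (intro invariant_basis[OF s]) blast+
qed

definition lfilt :: "int \<Rightarrow> 'm set"
  where "lfilt j = {u. \<exists>r. (xop ^^ r) u \<in> filt j}"

lemma filt_xop: "u \<in> filt j \<Longrightarrow> xop u \<in> filt j"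
  using filt_shift[OF Hg_basis(3), of u j "- 1"] by simp

lemma lfilt_subspace: "cvec.subspace (lfilt j)"
  unfolding lfilt_def by (rule localization_subspace[OF filt_subspace filt_xop])

lemma lfilt_shift: "A \<in> Hg i \<Longrightarrow> u \<in> lfilt j \<Longrightarrow> X A n u \<in> lfilt (j - (2 * n + i))"
  unfolding lfilt_def using localization_step[of filt A i _ u j n, OF filt_subspace filt_shift] by blast

end

subsection \<open>Irreducibility of the integrable part\<close>

context smooth_affine
begin

lemma sl2_1: "X e1 0 (X f1 0 w) = X f1 0 (X e1 0 w) + X h1 0 w" "X h1 0 (X f1 0 w) = X f1 0 (X h1 0 w) - 2 *\<^sub>C X f1 0 w"
  "X h1 0 (X e1 0 w) = X e1 0 (X h1 0 w) + 2 *\<^sub>C X e1 0 w"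
  using rel0[of e1 f1 0 w] rel0[of h1 f1 0 w] rel0[of h1 e1 0 w] by (simp_all add: X_table)

lemma sl2_2: "X e2 0 (X f2 0 w) = X f2 0 (X e2 0 w) + X h2 0 w" "X h2 0 (X f2 0 w) = X f2 0 (X h2 0 w) - 2 *\<^sub>C X f2 0 w"
  using rel0[of e2 f2 0 w] rel0[of h2 f2 0 w] by (simp_all add: X_table)

text \<open>The coroot of the highest root, the Cartan element of the triple \<open>e3\<close>,
  \<open>h1 + h2\<close>, \<open>f3\<close>.\<close>

definition hth :: "'a \<Rightarrow> 'a" where "hth u = X h1 0 u + X h2 0 u"

lemma hth_linear: "clinear hth"
  unfolding hth_def by (intro clinear_plus X_linear) simp_all

lemma sl2_3: "X e3 0 (X f3 0 w) = X f3 0 (X e3 0 w) + hth w" "hth (X f3 0 w) = X f3 0 (hth w) - 2 *\<^sub>C X f3 0 w"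
  using rel0[of e3 f3 0 w] rel0[of h1 f3 0 w] rel0[of h2 f3 0 w] by (simp_all add: X_table hth_def X_simps two)

text \<open>The \<open>sl\<^sub>2\<close>-triple of the affine root \<open>\<alpha>\<^sub>0\<close>; this is where the level enters.\<close>

lemma sl2_0: "X f3 1 (xop w) = xop (X f3 1 w) + (k *\<^sub>C w - hth w)"
  "k *\<^sub>C xop w - hth (xop w) = xop (k *\<^sub>C w - hth w) - 2 *\<^sub>C xop w"
  "hth (X f3 1 w) = X f3 1 (hth w) - 2 *\<^sub>C X f3 1 w"
  using rel[of f3 e3 1 "- 1" w] rel[of h1 e3 0 "- 1" w] rel[of h2 e3 0 "- 1" w] rel[of h1 f3 0 1 w] rel[of h2 f3 0 1 w]
  by (simp_all add: X_table hth_def X_simps two)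

text \<open>Modulo \<open>N\<close>, \<open>u\<close> is a highest weight vector of weight
  \<open>k - l\<close> for the affine triple with raising operator \<open>f\<^sub>3(1)\<close>, and
  the lowering operator \<open>e\<^sub>3(-1)\<close> is nilpotent on it.\<close>

lemma level_nat:
  assumes N: "affine_invariant X N" and u: "u \<notin> N" "hth u = l *\<^sub>C u" "X f3 1 u \<in> N" "(xop ^^ n) u \<in> N"
  obtains m :: nat where "k = l + of_nat m"
proof -
  have Ns: "cvec.subspace N" and NX: "\<And>A n u. A \<in> sl3 \<Longrightarrow> u \<in> N \<Longrightarrow> X A n u \<in> N"
    using N by (auto simp: affine_invariant_def)
  have h: "k *\<^sub>C u - hth u = (k - l) *\<^sub>C u" by (simp add: u cvec.scale_left_diff_distrib)
  obtain m :: nat where "k - l = of_nat m"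
    by (rule sl2_dominant[of xop N "X f3 1" "\<lambda>w. k *\<^sub>C w - hth w", OF X_linear Ns NX NX sl2_0(1,2) h u(3,1,4)]) simp_all
  then show ?thesis by (intro that[of m]) (simp add: algebra_simps)
qed

text \<open>The last nonzero power of \<open>e1\<close> on \<open>u\<close> is a highest weight
  vector on which \<open>f1\<close> is nilpotent, so its weight is a natural number; the weight of
  \<open>u\<close> differs from it by an even integer.\<close>

lemma integrable_h1_integral:
  assumes u: "u \<in> integrable_part X" "X h1 0 u = l *\<^sub>C u" "u \<noteq> 0"
  obtains m :: int where "l = of_int m"
proof -
  let ?U = "sl3_orbit X u"
  have fin: "fin_dim ?U" by (rule integrable_orbit[OF u(1)])
  have inv: "A \<in> sl3 \<Longrightarrow> w \<in> ?U \<Longrightarrow> X A 0 w \<in> ?U" for A w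
    using sl3_orbit_invariant[of u] by (simp add: sl3_invariant_def)
  note lin = X_linear[OF sl3_basis(1), of 0] X_linear[OF sl3_basis(6), of 0] X_linear[OF sl3_basis(4), of 0]
  obtain n where n: "(X e1 0 ^^ n) u = 0"
    by (rule weight_nilpotent[OF lin(1,3) sl2_1(3) _ fin inv sl3_orbit_base u(2)]) simp_all
  define n0 where "n0 = (LEAST n. (X e1 0 ^^ n) u = 0)"
  have n0: "(X e1 0 ^^ n0) u = 0" unfolding n0_def by (rule LeastI[where P = "\<lambda>n. (X e1 0 ^^ n) u = 0", OF n])
  have "n0 \<noteq> 0" using n0 u(3) by (metis funpow_0)
  then obtain i where i: "n0 = Suc i" by (cases n0) auto
  define w where "w = (X e1 0 ^^ i) u"
  have w: "w \<notin> {0}" using not_less_Least[of i "\<lambda>n. (X e1 0 ^^ n) u = 0"] i by (simp add: n0_def w_def)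
  have ew: "X e1 0 w \<in> {0}" using n0 by (simp add: i w_def)
  have wU: "w \<in> ?U" unfolding w_def by (rule funpow_closed[OF inv sl3_orbit_base]) simp
  have hw: "X h1 0 ((X e1 0 ^^ i) u) = (l + 2 * of_nat i) *\<^sub>C (X e1 0 ^^ i) u" for i
    by (induction i) (simp_all add: u sl2_1 X_simps algebra_simps flip: cvec.scale_left_distrib)
  obtain m where m: "(X f1 0 ^^ m) w = 0"
    by (rule weight_nilpotent[OF lin(2,3), where c = "- 2" and U = ?U and u = w and l = "l + 2 * of_nat i"]) (use fin
        inv wU hw in \<open>simp_all add: sl2_1 cvec.scale_minus_left w_def\<close>)
  obtain q :: nat where "l + 2 * of_nat i = of_nat q"
    by (rule sl2_dominant[of "X f1 0" "{0}" "X e1 0" "X h1 0" w "l + 2 * of_nat i" m])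
      (use lin ew w hw m in \<open>simp_all add: sl2_1 X_simps w_def cvec.subspace_def\<close>)
  then have "l = of_int (int q - 2 * int i)" by (simp add: algebra_simps)
  then show ?thesis by (rule that)
qed

lemma integrable_dominant:
  assumes N: "affine_invariant X N" and u: "u \<in> integrable_part X" "u \<notin> N" "hth u = l *\<^sub>C u" "X e3 0 u \<in> N"
  obtains m :: nat where "l = of_nat m"
proof -
  have Ns: "cvec.subspace N" and NX: "\<And>A n u. A \<in> sl3 \<Longrightarrow> u \<in> N \<Longrightarrow> X A n u \<in> N"
    using N by (auto simp: affine_invariant_def)
  let ?U = "sl3_orbit X u"
  have fin: "fin_dim ?U" by (rule integrable_orbit[OF u(1)])
  have inv: "A \<in> sl3 \<Longrightarrow> w \<in> ?U \<Longrightarrow> X A 0 w \<in> ?U" for A w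
    using sl3_orbit_invariant[of u] by (simp add: sl3_invariant_def)
  obtain n where n: "(X f3 0 ^^ n) u = 0"
    by (rule weight_nilpotent[OF X_linear[of f3 0] hth_linear, where c = "- 2" and U = ?U and u = u and l = l])
      (use fin inv sl3_orbit_base u in \<open>simp_all add: sl2_3 cvec.scale_minus_left\<close>)
  then have n': "(X f3 0 ^^ n) u \<in> N" using cvec.subspace_0[OF Ns] by simp
  show ?thesis
    by (rule sl2_dominant[of "X f3 0" N "X e3 0" hth u l, OF X_linear Ns NX NX sl2_3 u(3,4,2) n']) (simp_all, rule that)
qed

text \<open>If \<open>z\<close> were outside \<open>N\<close>, the affine triple would force
  \<open>k = a + b + m\<close> for a natural number \<open>m\<close>. Only the coefficient of the
  highest root enters, because \<open>h1 + h2\<close> acts on \<open>z\<close> by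
  \<open>a + b\<close>.\<close>

theorem hw_irreducible:
  fixes a b :: nat
  assumes k: "k \<notin> \<nat>" and z: "singular (of_nat a) (of_nat b) z"
    and loc: "\<And>N. affine_invariant X N \<Longrightarrow> N \<subseteq> aff_gen z \<Longrightarrow> N \<noteq> {0} \<Longrightarrow> \<exists>n. (xop ^^ n) z \<in> N"
    and N: "affine_invariant X N" "N \<subseteq> aff_gen z"
  shows "N = {0} \<or> N = aff_gen z"
proof (cases "N = {0}")
  case False
  obtain n where n: "(xop ^^ n) z \<in> N" using loc[OF N False] by blast
  have "z \<in> N"
  proof (rule ccontr)
    assume zN: "z \<notin> N"
    have h: "hth z = of_nat (a + b) *\<^sub>C z" "X f3 1 z \<in> N"
      using z N(1) by (simp_all add: hth_def singular_def cscale_left_distrib affine_invariant_def cvec.subspace_0)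
    obtain m :: nat where "k = of_nat (a + b) + of_nat m" by (rule level_nat[OF N(1) zN h n])
    then have "k = of_nat (a + b + m)" by simp
    then show False using k by (metis of_nat_in_Nats)
  qed
  then show ?thesis using aff_gen_minimal[OF N(1)] N(2) by blast
qed simp

text \<open>A nonzero \<open>f\<^sub>1^(a+1) z\<close> or \<open>f\<^sub>2^(b+1) z\<close> would be
  singular and, by irreducibility, generate \<open>z\<close>. Having the same \<open>sug\<close>
  eigenvalue, \<open>z\<close> would then lie below it in weight, although it lies above.\<close>

theorem hw_integrable:
  fixes a b :: nat
  assumes k: "k \<noteq> - 3" and z: "singular (of_nat a) (of_nat b) z" "z \<noteq> 0"
    and irr: "\<And>N. affine_invariant X N \<Longrightarrow> N \<subseteq> aff_gen z \<Longrightarrow> N = {0} \<or> N = aff_gen z"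
  shows "z \<in> integrable_part X"
proof -
  have z': "X e1 0 z = 0" "X e2 0 z = 0" "X f3 1 z = 0" "X h1 0 z = of_nat a *\<^sub>C z" "X h2 0 z = of_nat b *\<^sub>C z"
    using z(1) by (simp_all add: singular_def)
  have inv: "A \<in> sl3 \<Longrightarrow> u \<in> aff_gen z \<Longrightarrow> X A n u \<in> aff_gen z" for A n u
    using aff_gen_invariant[of z] by (simp add: affine_invariant_def)
  have Z0: "cvec.subspace {0::'a}" by (simp add: cvec.subspace_def)
  have no_singular: "s = 0" if s: "singular a' b' s" "s \<in> aff_gen z" "sug s = sugval (of_nat a) (of_nat b) *\<^sub>C s"
    and nw: "\<And>p q :: nat. (of_nat a :: complex) = a' - 2 * of_nat p + of_nat q \<Longrightarrow> (of_nat b :: complex) = b' + of_nat p - 2 * of_nat q \<Longrightarrow> False" for s a' b'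
  proof (rule ccontr)
    assume nz: "s \<noteq> 0"
    have "aff_gen s \<subseteq> aff_gen z" by (rule aff_gen_minimal[OF aff_gen_invariant s(2)])
    moreover have "aff_gen s \<noteq> {0}" using aff_gen_base[of s] nz by auto
    ultimately have "aff_gen s = aff_gen z" using irr[OF aff_gen_invariant] by blast
    then have zs: "z \<in> aff_gen s" using aff_gen_base by simp
    have "sugval a' b' *\<^sub>C s = sugval (of_nat a) (of_nat b) *\<^sub>C s" by (rule trans[OF sym[OF sug_singular[OF s(1)]] s(3)])
    then have e: "sugval a' b' = sugval (of_nat a) (of_nat b)" using nz by simp
    obtain p q :: nat where "(of_nat a :: complex) = a' - 2 * of_nat p + of_nat q"
        "(of_nat b :: complex) = b' + of_nat p - 2 * of_nat q"
      by (rule weight_in_gen[OF k s(1) zs z(2) _ z'(4,5)]) (use sug_singular[OF z(1)] e in simp_all)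
    then show False by (rule nw)
  qed
  have s1: "(X f1 0 ^^ Suc a) z = 0"
  proof (rule no_singular)
    let ?s = "(X f1 0 ^^ Suc a) z"
    note str = sl2_string[of "X f1 0" "{0}" "X e1 0" "X h1 0" z "of_nat a", OF X_linear Z0 _ sl2_1(1,2) z'(4)]
    have "X e1 0 ?s = 0" using str(2)[of a] by (simp add: X_simps z')
    moreover have "X e2 0 ((X f1 0 ^^ n) z) = 0" for n
      using rel0[of e2 f1] by (induction n) (simp_all add: z' X_simps X_table)
    moreover have "X f3 1 ((X f1 0 ^^ n) z) = 0" for n
      using rel0[of f3 f1] by (induction n) (simp_all add: z' X_simps X_table)
    moreover have "X h1 0 ?s = (- of_nat a - 2) *\<^sub>C ?s" using str(1)[of "Suc a"] by (simp add: X_simps z' algebra_simps)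
    moreover have "X h2 0 ((X f1 0 ^^ n) z) = (of_nat b + of_nat n) *\<^sub>C (X f1 0 ^^ n) z" for n
      using rel0[of h2 f1] by (induction n) (simp_all add: z' X_simps X_table cscale_left_distrib cscale_one)
    from this[of "Suc a"] have "X h2 0 ?s = (of_nat b + of_nat a + 1) *\<^sub>C ?s" by (simp only: of_nat_Suc ac_simps)
    \<comment> \<open>The weight is the image of \<open>(a, b)\<close> under the first simple
      reflection, acting by the dot action.\<close>
    ultimately show "singular (- of_nat a - 2) (of_nat b + of_nat a + 1) ?s" by (simp only: singular_def simp_thms)
    show "?s \<in> aff_gen z" by (rule funpow_closed[OF inv aff_gen_base]) simp
    show "sug ?s = sugval (of_nat a) (of_nat b) *\<^sub>C ?s"
    proof -
      have "sug ((X f1 0 ^^ n) z) = sugval (of_nat a) (of_nat b) *\<^sub>C (X f1 0 ^^ n) z" for n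
        by (induction n) (simp_all add: sug_singular[OF z(1)] sug_f1 X_simps)
      then show ?thesis .
    qed
    fix p q :: nat
    assume "(of_nat a :: complex) = - of_nat a - 2 - 2 * of_nat p + of_nat q"
      "(of_nat b :: complex) = of_nat b + of_nat a + 1 + of_nat p - 2 * of_nat q"
    then have "complex_of_nat q = of_nat (2 * a + 2 + 2 * p)" "complex_of_nat (2 * q) = of_nat (a + 1 + p)"
      by (simp_all add: algebra_simps)
    then have "q = 2 * a + 2 + 2 * p" "2 * q = a + 1 + p" by (simp_all only: of_nat_eq_iff)
    then show False by simp
  qed
  have s2: "(X f2 0 ^^ Suc b) z = 0"
  proof (rule no_singular)
    let ?s = "(X f2 0 ^^ Suc b) z"
    note str = sl2_string[of "X f2 0" "{0}" "X e2 0" "X h2 0" z "of_nat b", OF X_linear Z0 _ sl2_2(1,2) z'(5)]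
    have "X e2 0 ?s = 0" using str(2)[of b] by (simp add: X_simps z')
    moreover have "X e1 0 ((X f2 0 ^^ n) z) = 0" for n
      using rel0[of e1 f2] by (induction n) (simp_all add: z' X_simps X_table)
    moreover have "X f3 1 ((X f2 0 ^^ n) z) = 0" for n
      using rel0[of f3 f2] by (induction n) (simp_all add: z' X_simps X_table)
    moreover have "X h2 0 ?s = (- of_nat b - 2) *\<^sub>C ?s" using str(1)[of "Suc b"] by (simp add: X_simps z' algebra_simps)
    moreover have "X h1 0 ((X f2 0 ^^ n) z) = (of_nat a + of_nat n) *\<^sub>C (X f2 0 ^^ n) z" for n
      using rel0[of h1 f2] by (induction n) (simp_all add: z' X_simps X_table cscale_left_distrib cscale_one)
    from this[of "Suc b"] have "X h1 0 ?s = (of_nat a + of_nat b + 1) *\<^sub>C ?s" by (simp only: of_nat_Suc ac_simps)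
    ultimately show "singular (of_nat a + of_nat b + 1) (- of_nat b - 2) ?s" by (simp only: singular_def simp_thms)
    show "?s \<in> aff_gen z" by (rule funpow_closed[OF inv aff_gen_base]) simp
    show "sug ?s = sugval (of_nat a) (of_nat b) *\<^sub>C ?s"
    proof -
      have "sug ((X f2 0 ^^ n) z) = sugval (of_nat a) (of_nat b) *\<^sub>C (X f2 0 ^^ n) z" for n
        by (induction n) (simp_all add: sug_singular[OF z(1)] sug_f2 X_simps)
      then show ?thesis .
    qed
    fix p q :: nat
    assume "(of_nat a :: complex) = of_nat a + of_nat b + 1 - 2 * of_nat p + of_nat q"
      "(of_nat b :: complex) = - of_nat b - 2 + of_nat p - 2 * of_nat q"
    then have "complex_of_nat p = of_nat (2 * b + 2 + 2 * q)" "complex_of_nat (2 * p) = of_nat (b + 1 + q)"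
      by (simp_all add: algebra_simps)
    then have "p = 2 * b + 2 + 2 * q" "2 * p = b + 1 + q" by (simp_all only: of_nat_eq_iff)
    then show False by simp
  qed
  show ?thesis by (rule integrable_singular[OF z'(1,2,4,5) s1 s2])
qed

text \<open>If the integrable part were larger, a vector outside of minimal degree could be lowered by \<open>f\<^sub>3(1)\<close> to a
  singular vector of the quotient on which \<open>e\<^sub>3(-1)\<close> is nilpotent, forcing \<open>k\<close> to be a natural number.\<close>

theorem integrable_part_generated:
  assumes k: "k \<notin> \<nat>" and z: "singular a b z"
    and I: "affine_invariant X (integrable_part X)"
    and loc: "\<And>u. u \<in> integrable_part X \<Longrightarrow> \<exists>n. (xop ^^ n) u \<in> aff_gen z"
    and inj: "\<And>u. xop u = 0 \<Longrightarrow> u = 0"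
    and diag: "\<And>u. u \<in> cvec.span {s. \<exists>l. hth s = l *\<^sub>C s}"
  shows "integrable_part X \<subseteq> aff_gen z"
proof (rule ccontr)
  let ?I = "integrable_part X" and ?M = "aff_gen z"
  assume "\<not> ?I \<subseteq> ?M"
  note Minv = aff_gen_invariant[of z]
  have Ms: "cvec.subspace ?M" and MX: "\<And>A n u. A \<in> sl3 \<Longrightarrow> u \<in> ?M \<Longrightarrow> X A n u \<in> ?M"
    using Minv by (auto simp: affine_invariant_def)
  have Is: "cvec.subspace ?I" and IX: "\<And>A n u. A \<in> sl3 \<Longrightarrow> u \<in> ?I \<Longrightarrow> X A n u \<in> ?I"
    using I by (auto simp: affine_invariant_def)
  have neg: "u = 0" if u: "u \<in> lfilt j" "j < 0" for u j
  proof -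
    obtain r where "(xop ^^ r) u \<in> filt j" using u(1) by (auto simp: lfilt_def)
    then have "(xop ^^ r) u = 0" using filt_neg[OF u(2)] by blast
    then show ?thesis by (induction r) (simp_all add: inj)
  qed
  define P where "P j \<longleftrightarrow> (\<exists>u \<in> ?I - ?M. u \<in> lfilt (int j))" for j
  have exP: "\<exists>j. P j"
  proof -
    obtain u where u: "u \<in> ?I" "u \<notin> ?M" using \<open>\<not> ?I \<subseteq> ?M\<close> by blast
    obtain n where "(xop ^^ n) u \<in> ?M" using loc[OF u(1)] by blast
    then obtain j where "(xop ^^ n) u \<in> filt j" using aff_gen_filt[OF z] by blast
    then have uj: "u \<in> lfilt j" by (auto simp: lfilt_def)
    have "j \<ge> 0"
    proof (rule ccontr)
      assume "\<not> j \<ge> 0"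
      then have "u = 0" using neg[OF uj] by simp
      then show False using u(2) cvec.subspace_0[OF Ms] by simp
    qed
    then have "P (nat j)" using u uj by (auto simp: P_def)
    then show ?thesis by blast
  qed
  define j where "j = (LEAST j. P j)"
  have Pj: "P j" unfolding j_def using exP by (rule LeastI_ex)
  have least: "u \<in> ?M" if "u \<in> ?I" "u \<in> lfilt i" "i < int j" for u i
  proof (cases "i < 0")
    case True then show ?thesis using neg[OF that(2)] cvec.subspace_0[OF Ms] by simp
  next
    case False
    then have "\<not> P (nat i)" using not_less_Least[of "nat i" P] that(3) by (simp add: j_def)
    then show ?thesis using that(1,2) False by (auto simp: P_def)
  qed
  \<comment> \<open>\<open>e\<^sub>3(0)\<close> lowers the step by 2, so by minimality of
    \<open>j\<close> it maps \<open>u\<close> into the submodule; modulo the submodule,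
    \<open>u\<close> is a highest weight vector for the finite triple of the highest root.\<close>
  have dom: "\<exists>m::nat. l = of_nat m" if u: "u \<in> ?I" "u \<notin> ?M" "u \<in> lfilt (int j)" "hth u = l *\<^sub>C u" for u l
  proof -
    have "X e3 0 u \<in> lfilt (int j - (2 * 0 + 2))" by (rule lfilt_shift[OF Hg_basis(3) u(3)])
    then have "X e3 0 u \<in> ?M" by (rule least[rotated]) (use IX u in simp_all)
    from integrable_dominant[OF Minv u(1,2,4) this] show ?thesis by blast
  qed
  obtain u where u: "u \<in> ?I" "u \<notin> ?M" "u \<in> lfilt (int j)" using Pj by (auto simp: P_def)
  let ?S = "{s. \<exists>l. hth s = l *\<^sub>C s}"
  have ev: "hth s = (SOME l. hth s = l *\<^sub>C s) *\<^sub>C s" if "s \<in> ?S" for s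
    using that by (auto intro: someI)
  obtain \<Lambda> f where f: "finite \<Lambda>" "u = (\<Sum>l\<in>\<Lambda>. f l)" "\<And>l. hth (f l) = l *\<^sub>C f l"
    "\<And>U l. cvec.subspace U \<Longrightarrow> hth ` U \<subseteq> U \<Longrightarrow> u \<in> U \<Longrightarrow> f l \<in> U"
    by (rule eigen_decomposition[OF hth_linear ev diag[of u]]) (use that in blast)+
  have fI: "f l \<in> ?I" for l
    by (rule f(4)[OF Is _ u(1)]) (auto simp: hth_def intro!: cvec.subspace_add[OF Is] IX)
  have fF: "f l \<in> lfilt (int j)" for l
    by (rule f(4)[OF lfilt_subspace _ u(3)])
      (use lfilt_shift[OF Hg_basis(4), of _ "int j" 0] lfilt_shift[OF Hg_basis(5), of _ "int j" 0]
        in \<open>auto simp: hth_def intro!: cvec.subspace_add[OF lfilt_subspace]\<close>)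
  obtain l where l: "f l \<notin> ?M"
    using u(2) cvec.subspace_sum[OF Ms, of \<Lambda> f] unfolding f(2) by blast
  \<comment> \<open>\<open>f\<^sub>3(1)\<close> has degree 0, so it stays in the same step, and it
    lowers the weight by 2. Weights outside the submodule are natural numbers, so the sequence must
    enter the submodule; its last member outside is the vector to which \<open>level_nat\<close>
    applies.\<close>
  define g where "g i = (X f3 1 ^^ i) (f l)" for i
  have gI: "g i \<in> ?I" for i unfolding g_def by (rule funpow_closed[OF IX fI]) simp
  have f3F: "X f3 1 w \<in> lfilt (int j)" if "w \<in> lfilt (int j)" for w
    using lfilt_shift[OF Hg_basis(8) that, of 1] by simp
  have gF: "g i \<in> lfilt (int j)" for i unfolding g_def by (rule funpow_closed[OF f3F fF])
  have gh: "hth (g i) = (l - 2 * of_nat i) *\<^sub>C g i" for i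
  proof (induction i)
    case 0 then show ?case by (simp add: g_def f(3))
  next
    case (Suc i)
    then show ?case
      by (simp add: g_def sl2_0(3) X_simps algebra_simps flip: cvec.scale_left_diff_distrib)
  qed
  obtain m :: nat where m: "l = of_nat m" using dom[OF fI l fF f(3)] by blast
  have "\<exists>i. g i \<in> ?M"
  proof (rule ccontr)
    assume "\<not> ?thesis"
    then obtain q :: nat where "l - 2 * of_nat (Suc m) = of_nat q" using dom[OF gI _ gF gh, of "Suc m"] by blast
    then have "complex_of_nat (q + 2 * Suc m) = (l - 2 * of_nat (Suc m)) + 2 * of_nat (Suc m)"
      by (simp only: of_nat_add of_nat_mult of_nat_numeral)
    then have "complex_of_nat m = of_nat (q + 2 * Suc m)" by (simp only: m diff_add_cancel)
    then have "m = q + 2 * Suc m" by (simp only: of_nat_eq_iff)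
    then show False by simp
  qed
  define n where "n = (LEAST i. g i \<in> ?M)"
  have gn: "g n \<in> ?M" unfolding n_def using \<open>\<exists>i. g i \<in> ?M\<close> by (rule LeastI_ex)
  have "n \<noteq> 0" using gn l unfolding g_def by (metis funpow_0)
  then obtain i where i: "n = Suc i" by (cases n) auto
  have gi: "g i \<notin> ?M" using not_less_Least[of i "\<lambda>i. g i \<in> ?M"] i by (simp add: n_def)
  obtain q :: nat where q: "l - 2 * of_nat i = of_nat q" using dom[OF gI gi gF gh] by blast
  obtain r where r: "(xop ^^ r) (g i) \<in> ?M" using loc[OF gI] by blast
  have "X f3 1 (g i) \<in> ?M" using gn by (simp add: i g_def)
  from level_nat[OF Minv gi gh this r] obtain p :: nat where "k = of_nat (q + p)" unfolding q by auto
  then show False using k by (metis of_nat_in_Nats)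
qed

end

subsection \<open>Products of commuting fields\<close>

definition fld :: "(int \<Rightarrow> 'r::cvec \<Rightarrow> 'r) \<Rightarrow> bool"
  where "fld A \<longleftrightarrow> (\<forall>n. clinear (A n)) \<and> (\<forall>r. \<exists>N. \<forall>n\<ge>N. A n r = 0)"

definition fcomm :: "(int \<Rightarrow> 'r \<Rightarrow> 'r) \<Rightarrow> (int \<Rightarrow> 'r \<Rightarrow> 'r) \<Rightarrow> bool"
  where "fcomm A B \<longleftrightarrow> (\<forall>m n r. A m (B n r) = B n (A m r))"

definition fprod :: "(int \<Rightarrow> 'r::cvec \<Rightarrow> 'r) \<Rightarrow> (int \<Rightarrow> 'r \<Rightarrow> 'r) \<Rightarrow> int \<Rightarrow> 'r \<Rightarrow> 'r"
  where "fprod A B n r = Sum_any (\<lambda>i. A i (B (n - 1 - i) r))"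

lemma fldD: "fld A \<Longrightarrow> clinear (A n)" "fld A \<Longrightarrow> \<exists>N. \<forall>n\<ge>N. A n r = 0"
  by (simp_all add: fld_def)

lemma fcommD: "fcomm A B \<Longrightarrow> A m (B n r) = B n (A m r)"
  by (simp add: fcomm_def)

lemma fprod_bounds:
  assumes A: "fld A" and B: "fld B" and c: "fcomm A B"
  obtains K where "\<And>n i. i \<ge> K \<or> n - 1 - i \<ge> K \<Longrightarrow> A i (B (n - 1 - i) r) = 0"
proof -
  obtain Ka where Ka: "\<And>n. n \<ge> Ka \<Longrightarrow> A n r = 0" using fldD(2)[OF A] by meson
  obtain Kb where Kb: "\<And>n. n \<ge> Kb \<Longrightarrow> B n r = 0" using fldD(2)[OF B] by meson
  show ?thesis
  proof (rule that[of "max Ka Kb"])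
    fix n i assume "i \<ge> max Ka Kb \<or> n - 1 - i \<ge> max Ka Kb"
    then show "A i (B (n - 1 - i) r) = 0"
    proof
      assume "i \<ge> max Ka Kb" then show ?thesis by (simp add: fcommD[OF c] Ka clinear_0[OF fldD(1)[OF B]])
    next
      assume "n - 1 - i \<ge> max Ka Kb" then show ?thesis by (simp add: Kb clinear_0[OF fldD(1)[OF A]])
    qed
  qed
qed

lemma fprod_finite:
  assumes "fld A" "fld B" "fcomm A B"
  shows "finite {i. A i (B (n - 1 - i) r) \<noteq> 0}"
proof -
  obtain K where K: "\<And>n i. i \<ge> K \<or> n - 1 - i \<ge> K \<Longrightarrow> A i (B (n - 1 - i) r) = 0"
    by (rule fprod_bounds[OF assms, of r]) blast
  have "{i. A i (B (n - 1 - i) r) \<noteq> 0} \<subseteq> {n - 1 - K..K}"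
  proof
    fix i assume "i \<in> {i. A i (B (n - 1 - i) r) \<noteq> 0}"
    then have "\<not> (i \<ge> K \<or> n - 1 - i \<ge> K)" using K by blast
    then show "i \<in> {n - 1 - K..K}" by auto
  qed
  then show ?thesis by (rule finite_subset) simp
qed

lemma fld_fprod:
  assumes "fld A" "fld B" "fcomm A B" shows "fld (fprod A B)"
  unfolding fld_def
proof (intro conjI allI)
  show "clinear (fprod A B n)" for n
    unfolding fprod_def
    by (rule clinear_Sum_any[OF clinear_compose[OF fldD(1)[OF assms(1)] fldD(1)[OF assms(2)]] fprod_finite[OF assms]])
  fix r
  obtain K where K: "\<And>n i. i \<ge> K \<or> n - 1 - i \<ge> K \<Longrightarrow> A i (B (n - 1 - i) r) = 0"
    by (rule fprod_bounds[OF assms, of r]) blast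
  have "fprod A B n r = 0" if "n \<ge> 2 * K" for n
    unfolding fprod_def
  proof -
    have "A i (B (n - 1 - i) r) = 0" for i by (rule K) (use that in linarith)
    then show "Sum_any (\<lambda>i. A i (B (n - 1 - i) r)) = 0" by simp
  qed
  then show "\<exists>N. \<forall>n\<ge>N. fprod A B n r = 0" by blast
qed

lemma fcomm_fprod:
  assumes A: "fld A" "fld B" "fcomm A B" and C: "fld C" "fcomm C A" "fcomm C B"
  shows "fcomm C (fprod A B)"
  unfolding fcomm_def
proof (intro allI)
  fix m n r
  have "C m (fprod A B n r) = Sum_any (\<lambda>i. C m (A i (B (n - 1 - i) r)))"
    unfolding fprod_def by (rule Sum_any_clinear[OF fldD(1)[OF C(1)] fprod_finite[OF A]])
  then show "C m (fprod A B n r) = fprod A B n (C m r)"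
    by (simp add: fprod_def fcommD[OF C(2)] fcommD[OF C(3)])
qed

lemma fprod_closed:
  assumes "cvec.subspace N" "\<And>n r. r \<in> N \<Longrightarrow> A n r \<in> N" "\<And>n r. r \<in> N \<Longrightarrow> B n r \<in> N" "r \<in> N"
  shows "fprod A B n r \<in> N"
  unfolding fprod_def by (rule Sum_any_in_subspace[OF assms(1)]) (intro assms)

lemma fprod_unit:
  assumes A: "\<And>n r. A n r = (if n = -1 then r else 0)" and B: "fld B"
  shows "fprod A B n r = B n r" "fprod B A n r = B n r"
proof -
  show "fprod A B n r = B n r"
    unfolding fprod_def by (subst Sum_any_single[of "-1"]) (simp_all add: A)
  show "fprod B A n r = B n r"
    unfolding fprod_def by (subst Sum_any_single[of n]) (simp_all add: A clinear_0[OF fldD(1)[OF B]])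
qed

text \<open>Associativity of products of commuting fields: \<open>A = (A B) B'\<close>. It recovers
  a field from its product with a power of \<open>e^c\<close>.\<close>

lemma fprod_cancel:
  assumes fld: "fld A" "fld B" "fld B'" and c: "fcomm A B" "fcomm A B'" "fcomm B B'"
    and inv: "\<And>n r. fprod B B' n r = (if n = -1 then r else 0)"
  shows "fprod (fprod A B) B' n r = A n r"
proof -
  obtain Ka where Ka: "\<And>n. n \<ge> Ka \<Longrightarrow> A n r = 0" using fldD(2)[OF fld(1)] by meson
  obtain Kb where Kb: "\<And>n. n \<ge> Kb \<Longrightarrow> B n r = 0" using fldD(2)[OF fld(2)] by meson
  obtain Kc where Kc: "\<And>n. n \<ge> Kc \<Longrightarrow> B' n r = 0" using fldD(2)[OF fld(3)] by meson
  note z = clinear_0[OF fldD(1)[OF fld(1)]] clinear_0[OF fldD(1)[OF fld(2)]] clinear_0[OF fldD(1)[OF fld(3)]]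
  define g where "g i j = A j (B (i - 1 - j) (B' (n - 1 - i) r))" for i j
  have g0: "g i j = 0" if "j \<ge> Ka \<or> i - 1 - j \<ge> Kb \<or> n - 1 - i \<ge> Kc" for i j
    using that
  proof (elim disjE)
    assume "j \<ge> Ka" then show ?thesis unfolding g_def fcommD[OF c(1)] fcommD[OF c(2)] by (simp add: Ka z)
  next
    assume "i - 1 - j \<ge> Kb" then show ?thesis unfolding g_def fcommD[OF c(3)] by (simp add: Kb z)
  next
    assume "n - 1 - i \<ge> Kc" then show ?thesis unfolding g_def by (simp add: Kc z)
  qed
  have fin: "finite {(i, j). g i j \<noteq> 0}"
  proof (rule finite_subset)
    show "{(i, j). g i j \<noteq> 0} \<subseteq> {n - 1 - Kc..Ka + Kb} \<times> {n - 2 - Kc - Kb..Ka}"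
    proof clarify
      fix i j assume "g i j \<noteq> 0"
      then have "\<not> (j \<ge> Ka \<or> i - 1 - j \<ge> Kb \<or> n - 1 - i \<ge> Kc)" using g0 by blast
      then show "i \<in> {n - 1 - Kc..Ka + Kb} \<and> j \<in> {n - 2 - Kc - Kb..Ka}" by auto
    qed
  qed simp
  have "fprod (fprod A B) B' n r = Sum_any (\<lambda>i. Sum_any (\<lambda>j. g i j))"
    by (simp add: fprod_def g_def)
  also have "\<dots> = Sum_any (\<lambda>j. Sum_any (\<lambda>i. g i j))"
    using Sum_any_pair[OF fin] by simp
  also have "\<dots> = Sum_any (\<lambda>j. A j (fprod B B' (n - 1 - j) r))"
  proof (rule Sum_any.cong)
    fix j
    have "A j (fprod B B' (n - 1 - j) r) = Sum_any (\<lambda>i. A j (B i (B' (n - 1 - j - 1 - i) r)))"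
      unfolding fprod_def by (rule Sum_any_clinear[OF fldD(1)[OF fld(1)] fprod_finite[OF fld(2,3) c(3)]])
    also have "\<dots> = Sum_any (\<lambda>i. g i j)"
      unfolding g_def by (subst Sum_any_bij[OF bij_int_shift(4)[of "1 + j"]]) (simp add: algebra_simps)
    finally show "Sum_any (\<lambda>i. g i j) = A j (fprod B B' (n - 1 - j) r)" ..
  qed
  also have "\<dots> = A n r"
    unfolding inv by (subst Sum_any_single[of n]) (simp_all add: z)
  finally show ?thesis .
qed

lemma fld_vertex_module: "vertex_module vac Y act \<Longrightarrow> fld (act a)"
  unfolding fld_def using vertex_moduleD(2,4) by blast

subsection \<open>The Fock space argument\<close>

text \<open>If the annihilation operators \<open>Y\<close> preserve \<open>N\<close>, a nonzero vector of \<open>N\<close> of minimal length is killed by all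
  of them, hence by the number operator, so it has length \<open>0\<close>.\<close>

fun fock_level :: "('i \<Rightarrow> 'm \<Rightarrow> 'm) \<Rightarrow> 'm set \<Rightarrow> nat \<Rightarrow> 'm::cvec set" where
  "fock_level X B 0 = B"
| "fock_level X B (Suc r) = cvec.span (fock_level X B r \<union> {X i t | i t. t \<in> fock_level X B r})"

lemma fock_level_mono: "r \<le> s \<Longrightarrow> fock_level X B r \<subseteq> fock_level X B s"
proof (induction s)
  case (Suc s)
  have "fock_level X B s \<subseteq> fock_level X B (Suc s)" by (auto intro: cvec.span_base)
  then show ?case using Suc by (metis le_Suc_eq order.trans order_refl)
qed simp

lemma fock_level_subspace: "cvec.subspace B \<Longrightarrow> cvec.subspace (fock_level X B r)"
  by (cases r) auto

lemma fock_level_Union: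
  assumes "cvec.subspace B"
  shows "cvec.subspace (\<Union>r. fock_level X B r)" and "t \<in> (\<Union>r. fock_level X B r) \<Longrightarrow> X i t \<in> (\<Union>r. fock_level X B r)"
proof -
  show "cvec.subspace (\<Union>r. fock_level X B r)"
    unfolding cvec.subspace_def
  proof (intro conjI ballI allI)
    show "0 \<in> (\<Union>r. fock_level X B r)" using cvec.subspace_0[OF fock_level_subspace[OF assms]] by blast
    show "u + v \<in> (\<Union>r. fock_level X B r)" if uv: "u \<in> (\<Union>r. fock_level X B r)" "v \<in> (\<Union>r. fock_level X B r)" for u v
    proof -
      obtain r s where "u \<in> fock_level X B r" "v \<in> fock_level X B s" using uv by blast
      then have "u \<in> fock_level X B (max r s)" "v \<in> fock_level X B (max r s)"
        using fock_level_mono[of r "max r s" X B] fock_level_mono[of s "max r s" X B] by auto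
      then show ?thesis using cvec.subspace_add[OF fock_level_subspace[OF assms]] by blast
    qed
    show "c *\<^sub>C u \<in> (\<Union>r. fock_level X B r)" if "u \<in> (\<Union>r. fock_level X B r)" for c u
      using that cvec.subspace_scale[OF fock_level_subspace[OF assms]] by blast
  qed
  assume "t \<in> (\<Union>r. fock_level X B r)"
  then obtain r where "t \<in> fock_level X B r" by blast
  then have "X i t \<in> fock_level X B (Suc r)" by (auto intro!: cvec.span_base)
  then show "X i t \<in> (\<Union>r. fock_level X B r)" by blast
qed

lemma fock_vacuum:
  fixes X Y :: "'i \<Rightarrow> 'm::cvec \<Rightarrow> 'm"
  assumes lin: "\<And>i. clinear (X i)" "\<And>i. clinear (Y i)"
    and rel: "\<And>i j t. Y i (X j t) = X j (Y i t) + (if i = j then t else 0)" "\<And>i j t. X i (X j t) = X j (X i t)"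
    and fin: "\<And>t. finite {i. Y i t \<noteq> 0}"
    and B: "cvec.subspace B" "\<And>i t. t \<in> B \<Longrightarrow> Y i t = 0"
    and N: "\<And>i t. t \<in> N \<Longrightarrow> Y i t \<in> N" and t: "t \<in> N" "t \<noteq> 0" "t \<in> (\<Union>r. fock_level X B r)"
  shows "\<exists>t\<in>N \<inter> B. t \<noteq> 0"
proof -
  let ?R = "fock_level X B"
  note sub = fock_level_subspace[OF B(1), of X]
  have Xl: "X i t \<in> ?R (Suc r)" if "t \<in> ?R r" for i t r using that by (auto intro!: cvec.span_base)
  have low: "Y i t \<in> ?R r" if "t \<in> ?R (Suc r)" for i t r
    using that
  proof (induction r arbitrary: t)
    case 0
    have "Y i s \<in> B" if "s \<in> B \<union> {X i t | i t. t \<in> B}" for s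
      using that B by (auto simp: rel clinear_0[OF lin(1)] cvec.subspace_0)
    then show ?case using clinear_maps_span[OF lin(2) B(1), of "B \<union> {X i t | i t. t \<in> B}" i t] 0 by simp
  next
    case (Suc r)
    have "Y i s \<in> ?R (Suc r)" if "s \<in> ?R (Suc r) \<union> {X j t | j t. t \<in> ?R (Suc r)}" for s
      using that
    proof
      assume "s \<in> ?R (Suc r)"
      then have "Y i s \<in> ?R r" by (rule Suc.IH)
      then show ?thesis using fock_level_mono[of r "Suc r" X B] by auto
    next
      assume "s \<in> {X j t | j t. t \<in> ?R (Suc r)}"
      then obtain j t where s: "s = X j t" "t \<in> ?R (Suc r)" by blast
      have "X j (Y i t) \<in> ?R (Suc r)" by (rule Xl[OF Suc.IH[OF s(2)]])
      moreover have "(if i = j then t else 0) \<in> ?R (Suc r)" using s(2) cvec.subspace_0[OF sub[of "Suc r"]]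
        by presburger
      ultimately show ?thesis unfolding s(1) rel by (rule cvec.subspace_add[OF sub])
    qed
    then show ?case
      using clinear_maps_span[OF lin(2) sub[of "Suc r"], of "?R (Suc r) \<union> {X j t | j t. t \<in> ?R (Suc r)}" i t] Suc.prems
      by (simp only: fock_level.simps(2)[of X B "Suc r"])
  qed
  define num where "num t = Sum_any (\<lambda>i. X i (Y i t))" for t
  have fin2: "finite {i. X i (Y i t) \<noteq> 0}" for t
    by (rule finite_subset[OF _ fin[of t]]) (auto simp: clinear_0[OF lin(1)])
  have numl: "clinear num" unfolding num_def by (rule clinear_Sum_any[OF clinear_compose[OF lin] fin2])
  have num0: "num t = 0" if "t \<in> B" for t by (simp add: num_def B(2)[OF that] clinear_0[OF lin(1)])
  have numX: "num (X j t) = X j (num t) + X j t" for j t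
  proof -
    have "num (X j t) = Sum_any (\<lambda>i. X j (X i (Y i t)) + X i (if i = j then t else 0))"
      by (simp add: num_def rel clinear_add[OF lin(1)])
    also have "\<dots> = Sum_any (\<lambda>i. X j (X i (Y i t))) + Sum_any (\<lambda>i. X i (if i = j then t else 0))"
    proof (rule Sum_any.distrib)
      show "finite {i. X j (X i (Y i t)) \<noteq> 0}" by (rule finite_subset[OF _ fin2[of t]]) (auto simp: clinear_0[OF lin(1)])
      show "finite {i. X i (if i = j then t else 0) \<noteq> 0}" by (rule finite_subset[of _ "{j}"]) (auto simp: clinear_0[OF
          lin(1)])
    qed
    also have "Sum_any (\<lambda>i. X j (X i (Y i t))) = X j (num t)"
      unfolding num_def by (rule Sum_any_clinear[OF lin(1) fin2, symmetric])
    also have "Sum_any (\<lambda>i. X i (if i = j then t else 0)) = X j t"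
      by (subst Sum_any_single[of j]) (simp_all add: clinear_0[OF lin(1)])
    finally show ?thesis .
  qed
  \<comment> \<open>On level \<open>Suc r\<close> the number operator is multiplication by
    \<open>Suc r\<close> modulo the level below. A vector killed by all annihilation operators,
    hence by \<open>num\<close>, therefore drops one level.\<close>
  have numr: "num t - of_nat (Suc r) *\<^sub>C t \<in> ?R r" if "t \<in> ?R (Suc r)" for t r
    using that
  proof (induction r arbitrary: t)
    case 0
    have "num s - of_nat 1 *\<^sub>C s \<in> B" if "s \<in> B \<union> {X i t | i t. t \<in> B}" for s
      using that B by (auto simp: num0 numX clinear_0[OF lin(1)] cscale_one cvec.subspace_0 cvec.subspace_neg)
    with 0 show ?case
      using clinear_maps_span[OF clinear_minus_fun[OF numl clinear_const_scale[OF clinear_id]] B(1),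
          of "B \<union> {X i t | i t. t \<in> B}" "of_nat 1" t] by simp
  next
    case (Suc r)
    let ?n = "of_nat (Suc (Suc r)) :: complex"
    have nn: "?n *\<^sub>C s = of_nat (Suc r) *\<^sub>C s + s" for s :: 'm
      unfolding of_nat_Suc[of "Suc r"] cscale_left_distrib cscale_one by (rule add.commute)
    have "num s - ?n *\<^sub>C s \<in> ?R (Suc r)" if "s \<in> ?R (Suc r) \<union> {X j t | j t. t \<in> ?R (Suc r)}" for s
      using that
    proof
      assume s: "s \<in> ?R (Suc r)"
      have "num s - of_nat (Suc r) *\<^sub>C s \<in> ?R (Suc r)" using Suc.IH[OF s] fock_level_mono[of r "Suc r" X B] by auto
      then have "num s - of_nat (Suc r) *\<^sub>C s - s \<in> ?R (Suc r)" using s by (rule cvec.subspace_diff[OF sub])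
      moreover have "num s - of_nat (Suc r) *\<^sub>C s - s = num s - ?n *\<^sub>C s" by (simp add: nn del: of_nat_Suc)
      ultimately show ?thesis by (simp only:)
    next
      assume "s \<in> {X j t | j t. t \<in> ?R (Suc r)}"
      then obtain j t where s: "s = X j t" "t \<in> ?R (Suc r)" by blast
      have "X j (num t - of_nat (Suc r) *\<^sub>C t) \<in> ?R (Suc r)" by (rule Xl[OF Suc.IH[OF s(2)]])
      moreover have "X j (num t - of_nat (Suc r) *\<^sub>C t) = num s - ?n *\<^sub>C s"
        unfolding s numX clinear_diff[OF lin(1)] clinear_scale[OF lin(1)]
        by (simp add: nn del: of_nat_Suc)
      ultimately show ?thesis by (simp only:)
    qed
    then show ?case
      using clinear_maps_span[OF clinear_minus_fun[OF numl clinear_const_scale[OF clinear_id]] sub[of "Suc r"],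
          of "?R (Suc r) \<union> {X j t | j t. t \<in> ?R (Suc r)}" ?n t] Suc.prems
      by (simp only: fock_level.simps(2)[of X B "Suc r"])
  qed
  define P where "P r \<longleftrightarrow> (\<exists>t\<in>N \<inter> ?R r. t \<noteq> 0)" for r
  have "\<exists>r. P r" using t unfolding P_def by blast
  then have P: "P (LEAST r. P r)" by (rule LeastI_ex)
  have least: "(LEAST r. P r) = 0"
  proof (rule ccontr)
    assume "(LEAST r. P r) \<noteq> 0"
    then obtain r where r: "(LEAST r. P r) = Suc r" by (cases "LEAST r. P r") auto
    have nP: "\<not> P r" using not_less_Least[of r P] r by simp
    obtain t where t: "t \<in> N" "t \<in> ?R (Suc r)" "t \<noteq> 0" using P[unfolded r] unfolding P_def by blast
    have "Y i t = 0" for i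
    proof (rule ccontr)
      assume "Y i t \<noteq> 0"
      with N[OF t(1), of i] low[OF t(2), of i] have "P r" unfolding P_def by (intro bexI[of _ "Y i t"] IntI)
      then show False using nP by contradiction
    qed
    then have "num t = 0" by (simp add: num_def clinear_0[OF lin(1)])
    then have "- (of_nat (Suc r) *\<^sub>C t) \<in> ?R r" using numr[OF t(2)] by simp
    then have "(- inverse (of_nat (Suc r))) *\<^sub>C - (of_nat (Suc r) *\<^sub>C t) \<in> ?R r"
      by (rule cvec.subspace_scale[OF sub])
    then have "t \<in> ?R r" by (simp add: cscale_cscale cscale_one del: of_nat_Suc)
    with t(1,3) have "P r" unfolding P_def by (intro bexI[of _ t] IntI)
    then show False using nP by contradiction
  qed
  show ?thesis using P[unfolded least] unfolding P_def by (simp only: fock_level.simps(1))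
qed

subsection \<open>The module \<open>L[x,y] \<otimes> S \<otimes> \<Pi>(0)\<^sup>1\<^sup>/\<^sup>3\<close>\<close>

lemma triple_span: "t \<in> cvec.span {u \<otimes>\<^sub>C s \<otimes>\<^sub>C q | u s q. True}"
proof (induction t rule: tensor_induct)
  case zero show ?case by (rule cvec.span_zero)
next
  case (step u w t)
  have "u \<otimes>\<^sub>C w \<in> cvec.span {u \<otimes>\<^sub>C s \<otimes>\<^sub>C q | u s q. True}"
    by (rule clinear_maps_span[OF clinear_tensor_right[OF clinear_id] cvec.subspace_span _ tensor_span])
      (auto intro: cvec.span_base)
  then show ?case using step by (rule cvec.span_add)
qed

lemma triple_eqI:
  assumes "clinear f" "clinear g" "\<And>u s q. f (u \<otimes>\<^sub>C s \<otimes>\<^sub>C q) = g (u \<otimes>\<^sub>C s \<otimes>\<^sub>C q)"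
  shows "f t = g t"
  by (rule clinear_eq_on_span[OF assms(1,2) _ triple_span]) (auto simp: assms(3))

locale bp_setting =
  fixes k x y m\<^sub>1 :: complex and a b :: nat
    and vacW :: "'w::cvec" and YW and J Gp Gm L :: 'w
    and YL :: "'w \<Rightarrow> int \<Rightarrow> 'l::cvec \<Rightarrow> 'l" and v :: 'l
    and vacS :: "'s::cvec" and YS and \<beta> \<gamma> :: 's
    and vacP :: "'p::cvec" and YP and c d :: 'p and e :: "int \<Rightarrow> 'p"
    and YQ :: "'p \<Rightarrow> int \<Rightarrow> 'q::cvec \<Rightarrow> 'q" and E :: "complex \<Rightarrow> 'q"
    and vacV :: "'v::cvec" and YV and \<iota> :: "complex^3^3 \<Rightarrow> 'v"
    and \<phi> :: "'v \<Rightarrow> ('w, ('s, 'p) ctensor) ctensor"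
    and act :: "'v \<Rightarrow> int \<Rightarrow> ('l, ('s, 'q) ctensor) ctensor \<Rightarrow> ('l, ('s, 'q) ctensor) ctensor"
  assumes k: "k \<noteq> - 3" "k \<notin> \<nat>"
    and x: "x = (of_nat b - of_nat a) / 3"
    and y: "y = ((of_nat b - of_nat a)^2
               - 3 * (of_nat a + of_nat b) * (2 * (k + 1) - of_nat a - of_nat b)) / (12 * (k + 3))
             - (of_nat b - of_nat a) / 6"
    and m1: "m\<^sub>1 = (of_nat a + 2 * of_nat b) / 3"
    and W: "universal_BP k vacW YW J Gp Gm L"
    and hwL: "BP_irreducible_hw_module vacW YW J Gp Gm L YL v x y"
    and S: "beta_gamma_algebra vacS YS \<beta> \<gamma>"
    and P: "Pi0_algebra vacP YP c d e"
    and Q: "Pi0_third vacP YP c d e YQ E"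
    and V: "universal_affine_sl3 k vacV YV \<iota>"
    and emb: "BP_affine_embedding k vacW YW J Gp Gm vacS YS \<beta> \<gamma> vacP YP c d e vacV YV \<iota> \<phi>"
    and act: "act = (\<lambda>u. tensor_action YL (tensor_action YS YQ) (\<phi> u))"
begin

lemma vmW: "vertex_module vacW YW YW" and vacW: "YW w (- 1) vacW = w" "n \<ge> 0 \<Longrightarrow> YW w n vacW = 0"
  using W by (auto simp: universal_BP_def vertex_algebra_def)

lemma vmS: "vertex_module vacS YS YS" and vacS: "YS s (- 1) vacS = s" "n \<ge> 0 \<Longrightarrow> YS s n vacS = 0"
  using S by (auto simp: beta_gamma_algebra_def vertex_algebra_def)

lemma vmP: "vertex_module vacP YP YP" and vacP: "YP p (- 1) vacP = p" "n \<ge> 0 \<Longrightarrow> YP p n vacP = 0"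
  using P by (auto simp: Pi0_algebra_def vertex_algebra_def)

lemma vmL: "vertex_module vacW YW YL"
  using hwL by (simp add: BP_irreducible_hw_module_def Let_def)

lemma vmQ: "vertex_module vacP YP YQ"
  using Q by (simp add: Pi0_third_def Pi0_lattice_module_def)

lemmas pureL = vertex_moduleD(1)[OF vmL] vertex_moduleD(4)[OF vmL]
lemmas pureS = vertex_moduleD(1)[OF vmS] vertex_moduleD(4)[OF vmS]
lemmas pureQ = vertex_moduleD(1)[OF vmQ] vertex_moduleD(4)[OF vmQ]
lemmas pureW = vertex_moduleD(1)[OF vmW] vertex_moduleD(4)[OF vmW]
lemmas pureP = vertex_moduleD(1)[OF vmP] vertex_moduleD(4)[OF vmP]
lemmas tSQ = tensor_action_tensor[of YS YQ, OF pureS pureQ]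
lemmas tSP = tensor_action_tensor[of YS YP, OF pureS pureP]
lemmas trSQ = tensor_action_lift[of YS YQ, OF pureS pureQ]
lemmas trSP = tensor_action_lift[of YS YP, OF pureS pureP]

definition "YR = tensor_action YL (tensor_action YS YQ)"
definition "YA = tensor_action YW (tensor_action YS YP)"

lemmas tR = tensor_action_tensor[of YL "tensor_action YS YQ", OF pureL tSQ(2) trSQ(1), folded YR_def]
lemmas tA = tensor_action_tensor[of YW "tensor_action YS YP", OF pureW tSP(2) trSP(1), folded YA_def]
lemmas trR = tensor_action_lift[of YL "tensor_action YS YQ", OF pureL tSQ(2) trSQ(1), folded YR_def]

lemma act_YR: "act u = YR (\<phi> u)" by (simp add: act YR_def)

definition "LW w n = tmap (YL w n) (\<lambda>t::('s, 'q) ctensor. t)" for w n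
definition "LS s n = tmap (\<lambda>u::'l. u) (tmap (YS s n) (\<lambda>q::'q. q))" for s n
definition "LP p n = tmap (\<lambda>u::'l. u) (tmap (\<lambda>s::'s. s) (YQ p n))" for p n

lemma modes_tensor [simp]:
  "LW w n (u \<otimes>\<^sub>C t) = YL w n u \<otimes>\<^sub>C t"
  "LS s n (u \<otimes>\<^sub>C s' \<otimes>\<^sub>C q) = u \<otimes>\<^sub>C YS s n s' \<otimes>\<^sub>C q"
  "LP p n (u \<otimes>\<^sub>C s' \<otimes>\<^sub>C q) = u \<otimes>\<^sub>C s' \<otimes>\<^sub>C YQ p n q"
  by (simp_all add: LW_def LS_def LP_def tmap_tensor clinear_tmap clinear_id vertex_moduleD(2)[OF vmL]
      vertex_moduleD(2)[OF vmS] vertex_moduleD(2)[OF vmQ])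

lemma vmLW: "vertex_module vacW YW LW"
  unfolding LW_def[abs_def]
proof (rule vertex_module_lift[where I = UNIV and emb = "\<lambda>t u. u \<otimes>\<^sub>C t", OF vmL vmW])
  show "r \<in> cvec.span {x \<otimes>\<^sub>C i | i x. i \<in> UNIV}" for r :: "('l, ('s, 'q) ctensor) ctensor"
    using tensor_span[of r] by (rule rev_subsetD[OF _ cvec.span_mono]) auto
qed (auto simp: tmap_tensor clinear_tmap clinear_id intro!: clinear_tensor_left clinear_id)

lemma vmLS: "vertex_module vacS YS LS"
  unfolding LS_def[abs_def]
proof (rule vertex_module_lift[where I = UNIV and emb = "\<lambda>(u, q) s. u \<otimes>\<^sub>C s \<otimes>\<^sub>C q", OF vmS vmS])
  show "r \<in> cvec.span {(case i of (u, q) \<Rightarrow> \<lambda>s. u \<otimes>\<^sub>C s \<otimes>\<^sub>C q) x | i x. i \<in> UNIV}" for r :: "('l, ('s, 'q) ctensor) ctensor"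
    using triple_span[of r] by (rule rev_subsetD[OF _ cvec.span_mono]) force
qed (auto simp: tmap_tensor clinear_tmap clinear_id intro!: clinear_tensor_left clinear_tensor_right clinear_id)

lemma vmLP: "vertex_module vacP YP LP"
  unfolding LP_def[abs_def]
proof (rule vertex_module_lift[where I = UNIV and emb = "\<lambda>(u, s) q. u \<otimes>\<^sub>C s \<otimes>\<^sub>C q", OF vmQ vmP])
  show "r \<in> cvec.span {(case i of (u, s) \<Rightarrow> \<lambda>q. u \<otimes>\<^sub>C s \<otimes>\<^sub>C q) x | i x. i \<in> UNIV}" for r :: "('l, ('s, 'q) ctensor) ctensor"
    using triple_span[of r] by (rule rev_subsetD[OF _ cvec.span_mono]) force
qed (auto simp: tmap_tensor clinear_tmap clinear_id intro!: clinear_tensor_left clinear_tensor_right clinear_id)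

lemmas fldW = fld_vertex_module[OF vmLW] and fldS = fld_vertex_module[OF vmLS] and fldP = fld_vertex_module[OF vmLP]
lemmas linW = vertex_moduleD(2)[OF vmLW] and linS = vertex_moduleD(2)[OF vmLS] and linP = vertex_moduleD(2)[OF vmLP]

lemma commute_slots: "fcomm (LW w) (LS s)" "fcomm (LW w) (LP p)" "fcomm (LS s) (LP p)"
  unfolding fcomm_def
  by (intro allI, rule triple_eqI[OF clinear_compose clinear_compose]; simp add: linW linS linP)+

lemmas fldSP = fld_fprod[OF fldS fldP commute_slots(3)]

lemma commW_SP: "fcomm (LW w) (fprod (LS s) (LP p))"
  by (rule fcomm_fprod[OF fldS fldP commute_slots(3) fldW commute_slots(1,2)])

text \<open>The operators of different slots commute, so the nested \<open>tensor_action\<close> of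
  a pure tensor becomes an iterated product of commuting fields. From here on, the calculation takes
  place with \<open>fprod\<close> alone.\<close>

lemma YR_pure: "YR (w \<otimes>\<^sub>C s \<otimes>\<^sub>C p) n r = fprod (LW w) (fprod (LS s) (LP p)) n r"
proof (rule triple_eqI[OF cbilinearD(1)[OF tR(2)] fldD(1)[OF fld_fprod[OF fldW fldSP commW_SP]]])
  fix u s' q
  have "fprod (LS s) (LP p) m (u \<otimes>\<^sub>C s' \<otimes>\<^sub>C q) = u \<otimes>\<^sub>C tensor_action YS YQ (s \<otimes>\<^sub>C p) m (s' \<otimes>\<^sub>C q)" for u m
    unfolding fprod_def tSQ(1)
    by (subst Sum_any_clinear[OF clinear_tensor_right[OF clinear_id] trSQ(2)]) simp
  then show "YR (w \<otimes>\<^sub>C s \<otimes>\<^sub>C p) n (u \<otimes>\<^sub>C s' \<otimes>\<^sub>C q) = fprod (LW w) (fprod (LS s) (LP p)) n (u \<otimes>\<^sub>C s' \<otimes>\<^sub>C q)"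
    unfolding tR(1) fprod_def[of "LW w"] by simp
qed

lemmas unitW = vertex_moduleD(5)[OF vmLW] and unitS = vertex_moduleD(5)[OF vmLS] and unitP = vertex_moduleD(5)[OF vmLP]

lemma fprod_cong: "(\<And>n r. A n r = A' n r) \<Longrightarrow> (\<And>n r. B n r = B' n r) \<Longrightarrow> fprod A B n r = fprod A' B' n r"
  by (simp add: fprod_def)

lemma YR_slots:
  "YR (vacW \<otimes>\<^sub>C s \<otimes>\<^sub>C p) n r = fprod (LS s) (LP p) n r"
  "YR (vacW \<otimes>\<^sub>C s \<otimes>\<^sub>C vacP) n r = LS s n r"
  "YR (vacW \<otimes>\<^sub>C vacS \<otimes>\<^sub>C p) n r = LP p n r"
  "YR (w \<otimes>\<^sub>C vacS \<otimes>\<^sub>C vacP) n r = LW w n r"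
  "YR (w \<otimes>\<^sub>C vacS \<otimes>\<^sub>C p) n r = fprod (LW w) (LP p) n r"
  "YR (w \<otimes>\<^sub>C s \<otimes>\<^sub>C vacP) n r = fprod (LW w) (LS s) n r"
proof -
  show 1: "YR (vacW \<otimes>\<^sub>C s \<otimes>\<^sub>C p) n r = fprod (LS s) (LP p) n r" for s p n
    unfolding YR_pure by (rule fprod_unit(1)[OF unitW fldSP])
  show "YR (vacW \<otimes>\<^sub>C s \<otimes>\<^sub>C vacP) n r = LS s n r"
    unfolding 1 by (rule fprod_unit(2)[OF unitP fldS])
  show "YR (vacW \<otimes>\<^sub>C vacS \<otimes>\<^sub>C p) n r = LP p n r"
    unfolding 1 by (rule fprod_unit(1)[OF unitS fldP])
  have s: "fprod (LS vacS) (LP p) n r = LP p n r" "fprod (LS s) (LP vacP) n r = LS s n r" for n r p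
    by (rule fprod_unit(1)[OF unitS fldP], rule fprod_unit(2)[OF unitP fldS])
  show 2: "YR (w \<otimes>\<^sub>C vacS \<otimes>\<^sub>C p) n r = fprod (LW w) (LP p) n r" for p
    unfolding YR_pure by (rule fprod_cong[OF refl s(1)])
  show "YR (w \<otimes>\<^sub>C vacS \<otimes>\<^sub>C vacP) n r = LW w n r"
    unfolding 2 by (rule fprod_unit(2)[OF unitP fldW])
  show "YR (w \<otimes>\<^sub>C s \<otimes>\<^sub>C vacP) n r = fprod (LW w) (LS s) n r"
    unfolding YR_pure by (rule fprod_cong[OF refl s(2)])
qed

lemmas YR_linear = cbilinearD[OF tR(2)]
lemmas YR_simps = clinear_simps[OF YR_linear(2)]

lemma YA_slots:
  "YA (w \<otimes>\<^sub>C vacS \<otimes>\<^sub>C vacP) n (w' \<otimes>\<^sub>C s \<otimes>\<^sub>C p) = YW w n w' \<otimes>\<^sub>C s \<otimes>\<^sub>C p"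
  "YA (vacW \<otimes>\<^sub>C s \<otimes>\<^sub>C vacP) n (w' \<otimes>\<^sub>C s' \<otimes>\<^sub>C p) = w' \<otimes>\<^sub>C YS s n s' \<otimes>\<^sub>C p"
  "YA (vacW \<otimes>\<^sub>C vacS \<otimes>\<^sub>C p) n (w' \<otimes>\<^sub>C s' \<otimes>\<^sub>C p') = w' \<otimes>\<^sub>C s' \<otimes>\<^sub>C YP p n p'"
proof -
  have vP: "YP vacP m t = (if m = -1 then t else 0)" and vS: "YS vacS m t' = (if m = -1 then t' else 0)"
    and vW: "YW vacW m t'' = (if m = -1 then t'' else 0)" for m t t' t''
    by (rule vertex_moduleD(5)[OF vmP], rule vertex_moduleD(5)[OF vmS], rule vertex_moduleD(5)[OF vmW])
  have 1: "tensor_action YS YP (vacS \<otimes>\<^sub>C p) m (s' \<otimes>\<^sub>C p') = s' \<otimes>\<^sub>C YP p m p'" for p m s' p'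
    unfolding tSP(1) by (subst Sum_any_single[of "- 1"]) (simp_all add: vS)
  have 2: "tensor_action YS YP (s \<otimes>\<^sub>C vacP) m (s' \<otimes>\<^sub>C p') = YS s m s' \<otimes>\<^sub>C p'" for s m s' p'
    unfolding tSP(1) by (subst Sum_any_single[of m]) (simp_all add: vP)
  show "YA (w \<otimes>\<^sub>C vacS \<otimes>\<^sub>C vacP) n (w' \<otimes>\<^sub>C s \<otimes>\<^sub>C p) = YW w n w' \<otimes>\<^sub>C s \<otimes>\<^sub>C p"
    unfolding tA(1) 1 vP by (subst Sum_any_single[of n]) simp_all
  show "YA (vacW \<otimes>\<^sub>C s \<otimes>\<^sub>C vacP) n (w' \<otimes>\<^sub>C s' \<otimes>\<^sub>C p) = w' \<otimes>\<^sub>C YS s n s' \<otimes>\<^sub>C p"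
    unfolding tA(1) 2 vW by (subst Sum_any_single[of "- 1"]) simp_all
  show "YA (vacW \<otimes>\<^sub>C vacS \<otimes>\<^sub>C p) n (w' \<otimes>\<^sub>C s' \<otimes>\<^sub>C p') = w' \<otimes>\<^sub>C s' \<otimes>\<^sub>C YP p n p'"
    unfolding tA(1) 1 vW by (subst Sum_any_single[of "- 1"]) simp_all
qed

lemmas YA_linear = cbilinearD[OF tA(2)]

definition "dcur = translation vacS YS"

text \<open>The factors of each normally ordered product lie in different slots or in one common
  slot, so every product collapses to a sum of pure tensors.\<close>

lemma embedding:
  "vertex_embedding vacV YV (vacW \<otimes>\<^sub>C vacS \<otimes>\<^sub>C vacP) YA \<phi>"
  "\<phi> (\<iota> e1) = - (vacW \<otimes>\<^sub>C \<gamma> \<otimes>\<^sub>C e 1)"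
  "\<phi> (\<iota> e2) = vacW \<otimes>\<^sub>C \<beta> \<otimes>\<^sub>C vacP"
  "\<phi> (\<iota> e3) = vacW \<otimes>\<^sub>C vacS \<otimes>\<^sub>C e 1"
  "\<phi> (\<iota> h1) = - (2 *\<^sub>C (J \<otimes>\<^sub>C vacS \<otimes>\<^sub>C vacP)) + vacW \<otimes>\<^sub>C YS \<gamma> (- 1) \<beta> \<otimes>\<^sub>C vacP
     - ((2 * k + 9) / 6) *\<^sub>C (vacW \<otimes>\<^sub>C vacS \<otimes>\<^sub>C c) + (1/2) *\<^sub>C (vacW \<otimes>\<^sub>C vacS \<otimes>\<^sub>C d)"
  "\<phi> (\<iota> h2) = J \<otimes>\<^sub>C vacS \<otimes>\<^sub>C vacP - 2 *\<^sub>C (vacW \<otimes>\<^sub>C YS \<gamma> (- 1) \<beta> \<otimes>\<^sub>C vacP)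
     + ((4 * k + 9) / 6) *\<^sub>C (vacW \<otimes>\<^sub>C vacS \<otimes>\<^sub>C c) + (1/2) *\<^sub>C (vacW \<otimes>\<^sub>C vacS \<otimes>\<^sub>C d)"
  "\<phi> (\<iota> f1) = Gp \<otimes>\<^sub>C vacS \<otimes>\<^sub>C vacP
     - (2 *\<^sub>C (J \<otimes>\<^sub>C \<beta> \<otimes>\<^sub>C e (- 1)) + ((8 * k + 9) / 6) *\<^sub>C (vacW \<otimes>\<^sub>C \<beta> \<otimes>\<^sub>C YP c (- 1) (e (- 1)))
         - (1/2) *\<^sub>C (vacW \<otimes>\<^sub>C \<beta> \<otimes>\<^sub>C YP d (- 1) (e (- 1))))
     + (k + 1) *\<^sub>C (vacW \<otimes>\<^sub>C dcur \<beta> \<otimes>\<^sub>C e (- 1))"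
  "\<phi> (\<iota> f2) = Gm \<otimes>\<^sub>C vacS \<otimes>\<^sub>C e (- 1)
     + (J \<otimes>\<^sub>C \<gamma> \<otimes>\<^sub>C vacP + ((4 * k + 9) / 6) *\<^sub>C (vacW \<otimes>\<^sub>C \<gamma> \<otimes>\<^sub>C c) + (1/2) *\<^sub>C (vacW \<otimes>\<^sub>C \<gamma> \<otimes>\<^sub>C d))
     + k *\<^sub>C (vacW \<otimes>\<^sub>C dcur \<gamma> \<otimes>\<^sub>C vacP) - vacW \<otimes>\<^sub>C YS \<gamma> (- 1) (YS \<gamma> (- 1) \<beta>) \<otimes>\<^sub>C vacP"
  using emb unfolding BP_affine_embedding_def Let_def YA_def[symmetric] translation_def dcur_def
  by (simp_all add: YA_slots vacW vacS vacP clinear_simps[OF YA_linear(2)])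

lemma ope_facts:
  "ope YW L J [translation vacW YW J, 1 *\<^sub>C J]" "ope YW J J [0, ((2 * k + 3) / 3) *\<^sub>C vacW]"
  "ope YW L Gp [translation vacW YW Gp, (3/2) *\<^sub>C Gp]" "ope YW L Gm [translation vacW YW Gm, (3/2) *\<^sub>C Gm]"
  "ope YW J Gp [Gp]" "ope YW J Gm [- Gm]"
  "ope YW Gp Gm [3 *\<^sub>C YW J (-1) J + (3 * (k + 1) / 2) *\<^sub>C translation vacW YW J - (k + 3) *\<^sub>C L,
        (3 * (k + 1)) *\<^sub>C J, ((k + 1) * (2 * k + 3)) *\<^sub>C vacW]"
  "ope YS \<beta> \<gamma> [vacS]" "ope YS \<beta> \<beta> []" "ope YS \<gamma> \<gamma> []"
  "ope YP c d [0, 2 *\<^sub>C vacP]" "ope YP c c []" "ope YP d d []" "ope YP c (e m) []" "ope YP d (e m) [(2 * of_int m) *\<^sub>C e m]"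
  "ope YP (e m) (e m') []" "YP (e m) (- 1) (e m') = e (m + m')" "e 0 = vacP"
  "translation vacP YP (e m) = of_int m *\<^sub>C YP c (- 1) (e m)"
  using W S P by (simp_all add: universal_BP_def primary_field_def beta_gamma_algebra_def Pi0_algebra_def)

lemma pbw_facts:
  "pbw_basis YW [J, Gp, Gm, L] {()} (\<lambda>_. vacW)" "pbw_basis YS [\<beta>, \<gamma>] {()} (\<lambda>_. vacS)" "pbw_basis YP [c, d] UNIV e"
  "pbw_basis YV (map \<iota> [e1, e2, e3, h1, h2, f1, f2, f3]) {()} (\<lambda>_. vacV)"
  using W S P V by (simp_all add: universal_BP_def beta_gamma_algebra_def Pi0_algebra_def
      freely_strongly_generated_def universal_affine_sl3_def)

subsection \<open>The affine action\<close>

definition "X A n = act (\<iota> A) n" for A n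

lemma YR_commutator:
  "YR s m (YR s' n t) - YR s' n (YR s m t) = Sum_any (\<lambda>j::nat. (of_int m gchoose j) *\<^sub>C YR (YA s (int j) s') (m + n - int j) t)"
  unfolding YR_def YA_def
proof (rule tensor_commutator[where B = "{s \<otimes>\<^sub>C p | s p. True}" and U = "{s \<otimes>\<^sub>C q | s q. True}",
      OF vmL tSQ(2) trSQ(1) vmW tSP(2) trSP(1) tensor_span tensor_span])
  fix b b' :: "('s, 'p) ctensor" and u :: "('s, 'q) ctensor"
  assume "b \<in> {s \<otimes>\<^sub>C p | s p. True}" "b' \<in> {s \<otimes>\<^sub>C p | s p. True}" "u \<in> {s \<otimes>\<^sub>C q | s q. True}"
  then obtain s p s' p' \<sigma> q where e: "b = s \<otimes>\<^sub>C p" "b' = s' \<otimes>\<^sub>C p'" "u = \<sigma> \<otimes>\<^sub>C q" by blast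
  obtain N1 p1 where 1: "vrep YS YS s s' \<sigma> N1 p1" by (rule vrep_exists[OF vmS vertex_moduleD(4)[OF vmS]])
  obtain N2 p2 where 2: "vrep YP YQ p p' q N2 p2" by (rule vrep_exists[OF vmQ vertex_moduleD(4)[OF vmP]])
  show "\<exists>N pa. vrep (tensor_action YS YP) (tensor_action YS YQ) b b' u N pa"
    unfolding e using vrep_tensor[of YS YQ YS YP, OF pureS pureQ pureS pureP 1 2] by blast
qed

lemma phi: "clinear \<phi>" "\<phi> vacV = vacW \<otimes>\<^sub>C vacS \<otimes>\<^sub>C vacP" "\<phi> (YV u n w) = YA (\<phi> u) n (\<phi> w)"
  using embedding(1) by (simp_all add: vertex_embedding_def)

lemma act_linear: "clinear (act u n)" "clinear (\<lambda>u. act u n r)"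
  unfolding act_YR by (rule YR_linear(1), rule clinear_compose[OF YR_linear(2) phi(1)])

lemma act_commutator:
  "act u m (act w n t) - act w n (act u m t) = Sum_any (\<lambda>j::nat. (of_int m gchoose j) *\<^sub>C act (YV u (int j) w) (m + n - int j) t)"
  unfolding act_YR phi(3) by (rule YR_commutator)

lemma act_vac: "act vacV n r = (if n = - 1 then r else 0)"
  unfolding act_YR phi(2) YR_slots(2) by (rule unitS)

lemma iota: "linear_on sl3 \<iota>" "A \<in> sl3 \<Longrightarrow> B \<in> sl3 \<Longrightarrow> ope YV (\<iota> A) (\<iota> B) [\<iota> (commutator A B), (k * trace (A ** B)) *\<^sub>C vacV]"
  using V by (auto simp: universal_affine_sl3_def)

lemma smooth_affine_X: "smooth_affine k X"
proof
  show "affine_sl3_module k X"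
    unfolding affine_sl3_module_def X_def
  proof (intro conjI ballI allI)
    show "clinear (act (\<iota> A) n)" for A n by (rule act_linear)
    show "linear_on sl3 (\<lambda>A. act (\<iota> A) n u)" for n u
      using iota(1) clinear_simps[OF act_linear(2)] by (simp add: linear_on_def)
    show "act (\<iota> A) m (act (\<iota> B) n u) - act (\<iota> B) n (act (\<iota> A) m u) =
          act (\<iota> (commutator A B)) (m + n) u +
          (if m + n = 0 then (of_int m * k * trace (A ** B)) *\<^sub>C u else 0)" if AB: "A \<in> sl3" "B \<in> sl3" for A B m n u
    proof -
      have o: "YV (\<iota> A) (int j) (\<iota> B) = (if j = 0 then \<iota> (commutator A B) else if j = 1 then (k * trace (A ** B)) *\<^sub>C vacV else 0)" for j
        using iota(2)[OF AB] by (auto simp: ope_def less_Suc_eq)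
      have "Sum_any (\<lambda>j::nat. (of_int m gchoose j) *\<^sub>C act (YV (\<iota> A) (int j) (\<iota> B)) (m + n - int j) u)
        = (\<Sum>j\<in>{0, 1}. (of_int m gchoose j) *\<^sub>C act (YV (\<iota> A) (int j) (\<iota> B)) (m + n - int j) u)"
        by (rule Sum_any.expand_superset) (auto simp: o clinear_0[OF act_linear(2)])
      also have "\<dots> = act (\<iota> (commutator A B)) (m + n) u +
          (if m + n = 0 then (of_int m * k * trace (A ** B)) *\<^sub>C u else 0)"
        by (simp add: o[of 0, simplified] o[of 1, simplified] clinear_scale[OF act_linear(2)] act_vac cscale_one mult.assoc)
      finally show ?thesis unfolding act_commutator .
    qed
  qed
  show "\<exists>N. \<forall>n\<ge>N. X A n u = 0" for A u
    unfolding X_def act_YR by (rule trR(1))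
qed

sublocale smooth_affine k X by (rule smooth_affine_X)

end

lemma Sum_any_remove:
  fixes f :: "'i \<Rightarrow> 'm::cvec"
  assumes "finite {i. f i \<noteq> 0}"
  shows "Sum_any f = f j + Sum_any (\<lambda>i. if i = j then 0 else f i)"
proof -
  have "Sum_any f = Sum_any (\<lambda>i. (if i = j then f i else 0) + (if i = j then 0 else f i))"
    by (rule Sum_any.cong) simp
  also have "\<dots> = Sum_any (\<lambda>i. if i = j then f i else 0) + Sum_any (\<lambda>i. if i = j then 0 else f i)"
    by (rule Sum_any.distrib; rule finite_subset[OF _ assms]) (auto split: if_splits)
  also have "Sum_any (\<lambda>i. if i = j then f i else 0) = f j"
    by (subst Sum_any_single[of j]) auto
  finally show ?thesis .
qed

context bp_setting
begin

lemma slot_operators: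
  "X e1 n t = - fprod (LS \<gamma>) (LP (e 1)) n t"
  "X e2 n t = LS \<beta> n t"
  "X e3 n t = LP (e 1) n t"
  "X h1 n t = - (2 *\<^sub>C LW J n t) + LS (YS \<gamma> (- 1) \<beta>) n t - ((2 * k + 9) / 6) *\<^sub>C LP c n t + (1/2) *\<^sub>C LP d n t"
  "X h2 n t = LW J n t - 2 *\<^sub>C LS (YS \<gamma> (- 1) \<beta>) n t + ((4 * k + 9) / 6) *\<^sub>C LP c n t + (1/2) *\<^sub>C LP d n t"
  "X f1 n t = LW Gp n t
     - (2 *\<^sub>C fprod (LW J) (fprod (LS \<beta>) (LP (e (- 1)))) n t + ((8 * k + 9) / 6) *\<^sub>C fprod (LS \<beta>) (LP (YP c (- 1) (e
         (- 1)))) n t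
         - (1/2) *\<^sub>C fprod (LS \<beta>) (LP (YP d (- 1) (e (- 1)))) n t)
     + (k + 1) *\<^sub>C fprod (LS (dcur \<beta>)) (LP (e (- 1))) n t"
  "X f2 n t = fprod (LW Gm) (LP (e (- 1))) n t
     + (fprod (LW J) (LS \<gamma>) n t + ((4 * k + 9) / 6) *\<^sub>C fprod (LS \<gamma>) (LP c) n t + (1/2) *\<^sub>C fprod (LS \<gamma>) (LP d) n t)
     + k *\<^sub>C LS (dcur \<gamma>) n t - LS (YS \<gamma> (- 1) (YS \<gamma> (- 1) \<beta>)) n t"
  unfolding X_def act_YR embedding YR_simps YR_pure by (simp_all add: YR_slots[unfolded YR_pure] fprod_unit(1)[OF
      unitW fldS] fprod_unit(1)[OF unitW fldP]
      fprod_unit(2)[OF unitS fldW])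

text \<open>The fields \<open>e^c\<close> and \<open>e^(-c)\<close> have a regular operator product,
  so their product field is that of \<open>e 0\<close>, the vacuum.\<close>

lemma e_inverse:
  "fprod (LP (e 1)) (LP (e (- 1))) n t = (if n = - 1 then t else 0)"
  "fprod (LP (e (- 1))) (LP (e 1)) n t = (if n = - 1 then t else 0)"
  using vm_product(2)[OF vmLP ope_facts(16), of 1 "- 1" n t] vm_product(2)[OF vmLP ope_facts(16), of "- 1" 1 n t]
  by (simp_all add: ope_facts(17,18) unitP fprod_def)

lemma commute_e: "fcomm (LP (e i)) (LP (e j))" "fcomm (LP c) (LP (e i))"
  unfolding fcomm_def using vm_product(1)[OF vmLP ope_facts(16)] vm_product(1)[OF vmLP ope_facts(14)] by blast+

subsection \<open>The filtration by the number of \<open>d\<close>'s\<close>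

text \<open>On a vector with \<open>r - 1\<close> letters \<open>d\<close> the nonnegative modes of \<open>e\<^sup>c\<close> act like derivatives, each removing a \<open>d\<close>.\<close>

primrec dlevel :: "nat \<Rightarrow> ('l, ('s, 'q) ctensor) ctensor set" where
  "dlevel 0 = {0}"
| "dlevel (Suc r) = {t. \<forall>q\<ge>0. LP (e 1) q t \<in> dlevel r}"

lemma dlevel_subspace: "cvec.subspace (dlevel r)"
proof (induction r)
  case (Suc r)
  then show ?case by (auto simp: cvec.subspace_def clinear_simps[OF linP])
qed (simp add: cvec.subspace_def)

lemma dlevel_Suc: "t \<in> dlevel r \<Longrightarrow> t \<in> dlevel (Suc r)"
  by (induction r arbitrary: t) (simp_all add: clinear_simps[OF linP])

lemma dlevel_mono: "r \<le> s \<Longrightarrow> dlevel r \<subseteq> dlevel s"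
  by (rule lift_Suc_mono_le[of dlevel]) (use dlevel_Suc in blast)

lemma dlevel_commuting:
  assumes c: "fcomm A (LP (e 1))" and z: "A n 0 = 0" shows "t \<in> dlevel r \<Longrightarrow> A n t \<in> dlevel r"
proof (induction r arbitrary: t)
  case (Suc r)
  have "LP (e 1) q (A n t) = A n (LP (e 1) q t)" for q by (rule fcommD[OF c, symmetric])
  then show ?case using Suc by simp
qed (simp add: z)

text \<open>\<open>[d(n), e^c(q)] = 2 e^c(n + q)\<close>: moving \<open>e^c\<close> past a
  \<open>d\<close> costs a term in which that \<open>d\<close> is gone.\<close>

lemma dlevel_d: "t \<in> dlevel r \<Longrightarrow> LP d n t \<in> dlevel (Suc r)"
proof (induction r arbitrary: t)
  case (Suc r)
  have "LP (e 1) q (LP d n t) \<in> dlevel (Suc r)" if q: "q \<ge> 0" for q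
  proof -
    have "LP d n (LP (e 1) q t) = LP (e 1) q (LP d n t) + 2 *\<^sub>C LP (e 1) (n + q) t"
      using vm_commutator_ope[OF vmLP ope_facts(15)[of 1], of n q t] by (simp add: clinear_simps[OF
          vertex_moduleD(3)[OF vmLP]])
    then have e: "LP (e 1) q (LP d n t) = LP d n (LP (e 1) q t) - 2 *\<^sub>C LP (e 1) (n + q) t" by simp
    have "LP d n (LP (e 1) q t) \<in> dlevel (Suc r)" using Suc.prems q by (intro Suc.IH) simp
    moreover have "LP (e 1) (n + q) t \<in> dlevel (Suc r)"
      by (rule dlevel_commuting[OF commute_e(1) _ Suc.prems]) (rule clinear_0[OF linP])
    ultimately show ?thesis unfolding e by (intro cvec.subspace_diff cvec.subspace_scale dlevel_subspace)
  qed
  then show ?case by simp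
qed (simp add: clinear_0[OF linP])

definition "Lam = {of_nat i / 3 + of_int j :: complex | i j. i < (3::nat)}"

lemma Q_facts:
  "pbw_basis YQ [c, d] Lam E" "l \<in> Lam \<Longrightarrow> n \<ge> 0 \<Longrightarrow> YQ c n (E l) = 0"
  "l \<in> Lam \<Longrightarrow> n \<ge> 0 \<Longrightarrow> YQ d n (E l) = (if n = 0 then (2 * l) *\<^sub>C E l else 0)"
  "l \<in> Lam \<Longrightarrow> n \<ge> 0 \<Longrightarrow> YQ (e m) n (E l) = 0" "l \<in> Lam \<Longrightarrow> YQ (e m) (- 1) (E l) = E (l + of_int m)"
  using Q unfolding Pi0_third_def Pi0_lattice_module_def Lam_def by blast+

lemma dlevel_exhaust: obtains r where "t \<in> dlevel r"
proof -
  let ?D = "\<Union>r. dlevel r"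
  have D: "cvec.subspace ?D"
    unfolding cvec.subspace_def
  proof (intro conjI ballI allI)
    show "0 \<in> ?D" by (rule UN_I[of 0]) simp_all
    show "u + w \<in> ?D" if uw: "u \<in> ?D" "w \<in> ?D" for u w
    proof -
      obtain r s where "u \<in> dlevel r" "w \<in> dlevel s" using uw by blast
      then have "u \<in> dlevel (max r s)" "w \<in> dlevel (max r s)"
        using dlevel_mono[of r "max r s"] dlevel_mono[of s "max r s"] by auto
      then show ?thesis using cvec.subspace_add[OF dlevel_subspace] by blast
    qed
    show "z *\<^sub>C u \<in> ?D" if "u \<in> ?D" for z u
      using that cvec.subspace_scale[OF dlevel_subspace] by blast
  qed
  have "u \<otimes>\<^sub>C s \<otimes>\<^sub>C q \<in> ?D" for u s q
  proof -
    have "q \<in> {q. u \<otimes>\<^sub>C s \<otimes>\<^sub>C q \<in> ?D}"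
    proof (rule pbw_induct[OF Q_facts(1)])
      show "cvec.subspace {q. u \<otimes>\<^sub>C s \<otimes>\<^sub>C q \<in> ?D}"
        by (rule subspace_vimage[OF _ D]) (intro clinear_tensor_right clinear_id)
      show "E l \<in> {q. u \<otimes>\<^sub>C s \<otimes>\<^sub>C q \<in> ?D}" if "l \<in> Lam" for l
        by (simp, rule exI[of _ 1]) (simp add: Q_facts(4)[OF that])
      show "YQ g (- int n - 1) w \<in> {q. u \<otimes>\<^sub>C s \<otimes>\<^sub>C q \<in> ?D}"
        if g: "g \<in> set [c, d]" and w: "w \<in> {q. u \<otimes>\<^sub>C s \<otimes>\<^sub>C q \<in> ?D}" for g n w
      proof -
        obtain r where r: "u \<otimes>\<^sub>C s \<otimes>\<^sub>C w \<in> dlevel r" using w by blast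
        have "LP c m (u \<otimes>\<^sub>C s \<otimes>\<^sub>C w) \<in> dlevel r" for m
          by (rule dlevel_commuting[OF commute_e(2) _ r]) (rule clinear_0[OF linP])
        have "g = c \<or> g = d" using g by simp
        then have "LP g (- int n - 1) (u \<otimes>\<^sub>C s \<otimes>\<^sub>C w) \<in> dlevel r \<union> dlevel (Suc r)"
          using \<open>\<And>m. LP c m (u \<otimes>\<^sub>C s \<otimes>\<^sub>C w) \<in> dlevel r\<close> dlevel_d[OF r] by blast
        then show ?thesis unfolding modes_tensor by blast
      qed
    qed
    then show ?thesis by simp
  qed
  then have "{u \<otimes>\<^sub>C s \<otimes>\<^sub>C q | u s q. True} \<subseteq> ?D" by blast
  then have "t \<in> ?D" by (rule subsetD[OF cvec.span_minimal[OF _ D] triple_span])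
  then show ?thesis by (elim UN_E) (rule that)
qed

subsection \<open>Localized submodules are stable under all three tensor factors\<close>

definition full_submodule :: "('l, ('s, 'q) ctensor) ctensor set \<Rightarrow> bool" where
  "full_submodule N \<longleftrightarrow> cvec.subspace N \<and> (\<forall>n. \<forall>t\<in>N. (\<forall>w. LW w n t \<in> N) \<and> (\<forall>s. LS s n t \<in> N) \<and> (\<forall>p. LP p n t \<in> N))"

text \<open>The identity \<open>\<Sum>\<^sub>i e\<^sup>c\<^sub>(\<^sub>i\<^sub>) e\<^sup>-\<^sup>c\<^sub>(\<^sub>n\<^sub>-\<^sub>1\<^sub>-\<^sub>i\<^sub>) = \<delta>\<^sub>n\<^sub>,\<^sub>-\<^sub>1\<close> is solved for \<open>e\<^sup>c\<^sub>(\<^sub>-\<^sub>1\<^sub>) e\<^sup>-\<^sup>c\<^sub>(\<^sub>n\<^sub>)\<close>: the terms with \<open>i < -1\<close> involve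
  higher modes of \<open>e\<^sup>-\<^sup>c\<close>, those with \<open>i \<ge> 0\<close> a smaller number of \<open>d\<close>'s.\<close>

lemma e_minus_stable:
  assumes N: "cvec.subspace N" and e1: "\<And>n t. t \<in> N \<Longrightarrow> LP (e 1) n t \<in> N"
    and sat: "\<And>t. LP (e 1) (- 1) t \<in> N \<Longrightarrow> t \<in> N" and t: "t \<in> N"
  shows "LP (e (- 1)) n t \<in> N"
proof -
  obtain r where "t \<in> dlevel r" by (rule dlevel_exhaust)
  then show ?thesis using t
  proof (induction r arbitrary: t n)
    case 0
    then show ?case using clinear_0[OF linP] by simp
  next
    case (Suc r)
    \<comment> \<open>The modes of \<open>e^(-c)\<close> vanish on \<open>t\<close> from
      \<open>K\<close> on; this starts a downward induction on \<open>n\<close>, nested inside the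
      induction on the number of letters \<open>d\<close>.\<close>
    obtain K where K: "\<And>n. n \<ge> K \<Longrightarrow> LP (e (- 1)) n t = 0" using fldD(2)[OF fldP] by meson
    show ?case
    proof (induction "nat (K - n)" arbitrary: n rule: less_induct)
      case less
      show ?case
      proof (cases "n \<ge> K")
        case True
        then show ?thesis using K cvec.subspace_0[OF N] by simp
      next
        case False
        define g where "g i = LP (e 1) i (LP (e (- 1)) (n - 1 - i) t)" for i
        have g: "g i \<in> N" if i: "i \<noteq> - 1" for i
        proof (cases "i \<ge> 0")
          case True
          have "LP (e 1) i t \<in> dlevel r" using Suc.prems(1) True by simp
          then have "LP (e (- 1)) (n - 1 - i) (LP (e 1) i t) \<in> N" using e1[OF Suc.prems(2)] by (rule Suc.IH)
          then show ?thesis unfolding g_def fcommD[OF commute_e(1)[of 1 "- 1"]] .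
        next
          case False
          then have "LP (e (- 1)) (n - 1 - i) t \<in> N" using i \<open>\<not> n \<ge> K\<close> by (intro less) linarith
          then show ?thesis unfolding g_def by (rule e1)
        qed
        have "Sum_any g \<in> N"
          using e_inverse(1)[of n t] Suc.prems(2) cvec.subspace_0[OF N] unfolding fprod_def g_def[symmetric] by simp
        moreover have "Sum_any (\<lambda>i. if i = - 1 then 0 else g i) \<in> N"
          using g cvec.subspace_0[OF N] by (intro Sum_any_in_subspace[OF N]) simp
        ultimately have "Sum_any g - Sum_any (\<lambda>i. if i = - 1 then 0 else g i) \<in> N" by (rule cvec.subspace_diff[OF N])
        moreover have "finite {i. g i \<noteq> 0}" unfolding g_def by (rule fprod_finite[OF fldP fldP commute_e(1)])
        ultimately have "g (- 1) \<in> N" using Sum_any_remove[of g "- 1"] by simp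
        then show ?thesis unfolding g_def by (simp add: sat)
      qed
    qed
  qed
qed

text \<open>\<open>e2\<close> and \<open>e3\<close> give \<beta> and \<open>e^c\<close>, and
  saturation gives \<open>e^(-c)\<close>. Cancelling \<open>e^c\<close> yields \<gamma> from
  \<open>e1\<close> and \<open>c\<close> from the derivative of \<open>e^c\<close>. The Cartan
  currents then separate \<open>J\<close> and \<open>d\<close>, after which \<open>f1\<close> and
  \<open>f2\<close> leave \<open>Gp\<close> and \<open>Gm\<close>, and their operator product leaves
  \<open>L\<close>.\<close>

lemma saturated_full:
  assumes inv: "affine_invariant X N" and sat: "\<And>t. xop t \<in> N \<Longrightarrow> t \<in> N"
  shows "full_submodule N"
proof -
  have N: "cvec.subspace N" and XN: "A \<in> sl3 \<Longrightarrow> t \<in> N \<Longrightarrow> X A n t \<in> N" for A n t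
    using inv by (auto simp: affine_invariant_def)
  note sub = cvec.subspace_add[OF N] cvec.subspace_diff[OF N] cvec.subspace_neg[OF N] cvec.subspace_scale[OF N]
  note pr = fprod_closed[OF N]
  have cancel: "A n t \<in> N"
    if A: "fld A" and c: "fcomm A (LP (e i))" "fcomm A (LP (e j))"
      and inv: "\<And>n t. fprod (LP (e i)) (LP (e j)) n t = (if n = - 1 then t else 0)"
      and st: "\<And>n t. t \<in> N \<Longrightarrow> fprod A (LP (e i)) n t \<in> N" "\<And>n t. t \<in> N \<Longrightarrow> LP (e j) n t \<in> N" and t: "t \<in> N"
    for A i j n t
    using pr[where A = "fprod A (LP (e i))" and B = "LP (e j)", OF st t] unfolding fprod_cancel[OF A fldP fldP c
        commute_e(1) inv] .
  have \<beta>: "LS \<beta> n t \<in> N" if "t \<in> N" for n t using XN[OF sl3_basis(2) that, of n] by (simp add: slot_operators)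
  have e1: "LP (e 1) n t \<in> N" if "t \<in> N" for n t using XN[OF sl3_basis(3) that, of n] by (simp add: slot_operators)
  have e': "LP (e (- 1)) n t \<in> N" if "t \<in> N" for n t
    by (rule e_minus_stable[OF N e1 _ that]) (simp_all add: sat slot_operators(3))
  have "fprod (LS \<gamma>) (LP (e 1)) n t \<in> N" if "t \<in> N" for n t
    using sub(3)[OF XN[OF sl3_basis(1) that, of n]] by (simp add: slot_operators)
  note \<gamma> = cancel[OF fldS commute_slots(3) commute_slots(3) e_inverse(1) this e']
  \<comment> \<open>The derivative of \<open>e^c\<close> is \<open>:c e^c:\<close>, so the modes of
    \<open>e^c\<close> control this product.\<close>
  have "fprod (LP c) (LP (e 1)) n t \<in> N" if "t \<in> N" for n t
    using sub(4)[OF e1[OF that], of "- of_int n" "n - 1"] vm_translation[OF vmLP, of "e 1" n t] vm_product(2)[OF vmLP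
        ope_facts(14)[of 1], of n t]
    unfolding ope_facts(19) by (simp add: cscale_one fprod_def)
  note c = cancel[OF fldP commute_e(2) commute_e(2) e_inverse(1) this e']
  have S: "LS s n t \<in> N" if "t \<in> N" for s n t
    by (rule vm_closed_generated[OF vmLS pbw_facts(2) N _ _ that])
      (use \<beta> \<gamma> cvec.subspace_0[OF N] in \<open>auto simp: unitS\<close>)
  have h1: "- (2 *\<^sub>C LW J n t) + (1/2) *\<^sub>C LP d n t \<in> N" if t: "t \<in> N" for n t
  proof -
    have "- (2 *\<^sub>C LW J n t) + (1/2) *\<^sub>C LP d n t = X h1 n t - LS (YS \<gamma> (- 1) \<beta>) n t + ((2 * k + 9) / 6) *\<^sub>C LP c n t"
      by (simp add: slot_operators)
    also have "\<dots> \<in> N" by (intro sub XN S c t sl3_basis)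
    finally show ?thesis .
  qed
  have h2: "LW J n t + (1/2) *\<^sub>C LP d n t \<in> N" if t: "t \<in> N" for n t
  proof -
    have "LW J n t + (1/2) *\<^sub>C LP d n t = X h2 n t + 2 *\<^sub>C LS (YS \<gamma> (- 1) \<beta>) n t - ((4 * k + 9) / 6) *\<^sub>C LP c n t"
      by (simp add: slot_operators)
    also have "\<dots> \<in> N" by (intro sub XN S c t sl3_basis)
    finally show ?thesis .
  qed
  \<comment> \<open>The difference of \<open>h2\<close> and \<open>h1\<close> contains
    \<open>J\<close> three times and \<open>d\<close> not at all.\<close>
  have J: "LW J n t \<in> N" if "t \<in> N" for n t
  proof -
    have "LW J n t = (1/3) *\<^sub>C ((LW J n t + (1/2) *\<^sub>C LP d n t) - (- (2 *\<^sub>C LW J n t) + (1/2) *\<^sub>C LP d n t))"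
      by (simp add: cscale_right_distrib cscale_cscale cscale_one cvec.scale_right_diff_distrib flip:
          cvec.scale_left_distrib)
    also have "\<dots> \<in> N" by (intro sub h1 h2 that)
    finally show ?thesis .
  qed
  have d: "LP d n t \<in> N" if "t \<in> N" for n t
    using sub(4)[OF sub(2)[OF h2[OF that] J[OF that]], of 2 n n] by (simp add: cscale_cscale cscale_one)
  have em: "LP (e m) n t \<in> N" if "t \<in> N" for m n t
    using that
  proof (induction m arbitrary: n t rule: int_induct[of _ 0])
    case base
    then show ?case using cvec.subspace_0[OF N] by (simp add: ope_facts(18) unitP)
  next
    case (step1 i)
    have "LP (YP (e i) (- 1) (e 1)) n t \<in> N"
      by (rule vm_closed_iterate[OF vmLP N _ e1 step1.prems]) (rule step1.IH)
    then show ?case by (simp add: ope_facts(17))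
  next
    case (step2 i)
    have "LP (YP (e i) (- 1) (e (- 1))) n t \<in> N"
      by (rule vm_closed_iterate[OF vmLP N _ e' step2.prems]) (rule step2.IH)
    then show ?case by (simp add: ope_facts(17))
  qed
  have P: "LP p n t \<in> N" if "t \<in> N" for p n t
    by (rule vm_closed_generated[OF vmLP pbw_facts(3) N _ em that]) (use c d in auto)
  have Gp: "LW Gp n t \<in> N" if t: "t \<in> N" for n t
  proof -
    have "LW Gp n t = X f1 n t
     + (2 *\<^sub>C fprod (LW J) (fprod (LS \<beta>) (LP (e (- 1)))) n t + ((8 * k + 9) / 6) *\<^sub>C fprod (LS \<beta>) (LP (YP c (- 1) (e
         (- 1)))) n t
         - (1/2) *\<^sub>C fprod (LS \<beta>) (LP (YP d (- 1) (e (- 1)))) n t)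
     - (k + 1) *\<^sub>C fprod (LS (dcur \<beta>)) (LP (e (- 1))) n t"
      by (simp add: slot_operators(6))
    also have "\<dots> \<in> N" by (intro sub XN pr S P J t sl3_basis)
    finally show ?thesis .
  qed
  have "fprod (LW Gm) (LP (e (- 1))) n t \<in> N" if t: "t \<in> N" for n t
  proof -
    have "fprod (LW Gm) (LP (e (- 1))) n t = X f2 n t
     - (fprod (LW J) (LS \<gamma>) n t + ((4 * k + 9) / 6) *\<^sub>C fprod (LS \<gamma>) (LP c) n t + (1/2) *\<^sub>C fprod (LS \<gamma>) (LP d) n t)
     - k *\<^sub>C LS (dcur \<gamma>) n t + LS (YS \<gamma> (- 1) (YS \<gamma> (- 1) \<beta>)) n t"
      by (simp add: slot_operators(7))
    also have "\<dots> \<in> N" by (intro sub XN pr S P J t sl3_basis)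
    finally show ?thesis .
  qed
  note Gm = cancel[OF fldW commute_slots(2) commute_slots(2) e_inverse(2) this e1]
  have L: "LW L n t \<in> N" if t: "t \<in> N" for n t
  proof -
    note lin = clinear_simps[OF vertex_moduleD(3)[OF vmLW]]
    have k3: "k + 3 \<noteq> 0" using k(1) eq_neg_iff_add_eq_0 by blast
    \<comment> \<open>The simple pole of \<open>Gp\<close> and \<open>Gm\<close> contains
      \<open>L\<close> with coefficient \<open>-(k + 3)\<close>, which is invertible.\<close>
    have "YW Gp 0 Gm = 3 *\<^sub>C YW J (-1) J + (3 * (k + 1) / 2) *\<^sub>C translation vacW YW J - (k + 3) *\<^sub>C L"
      using ope_facts(7)[unfolded ope_def, rule_format, of 0] by simp
    then have "L = (1 / (k + 3)) *\<^sub>C (3 *\<^sub>C YW J (-1) J + (3 * (k + 1) / 2) *\<^sub>C translation vacW YW J - YW Gp 0 Gm)"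
      using k3 by (simp add: cscale_cscale cscale_one)
    from arg_cong[OF this, of "\<lambda>w. LW w n t"] have "LW L n t = (1 / (k + 3)) *\<^sub>C (3 *\<^sub>C LW (YW J (-1) J) n t
        + (3 * (k + 1) / 2) *\<^sub>C LW (translation vacW YW J) n t - LW (YW Gp 0 Gm) n t)"
      by (simp only: lin)
    also have "\<dots> \<in> N"
      unfolding vm_translation[OF vmLW] by (intro sub vm_closed_iterate[OF vmLW N] J Gp Gm t)
    finally show ?thesis .
  qed
  have W: "LW w n t \<in> N" if "t \<in> N" for w n t
    by (rule vm_closed_generated[OF vmLW pbw_facts(1) N _ _ that])
      (use J Gp Gm L cvec.subspace_0[OF N] in \<open>auto simp: unitW\<close>)
  show ?thesis unfolding full_submodule_def using N W S P by blast
qed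

end

lemma diagonal_components:
  assumes T: "clinear T" and u: "u \<in> cvec.span {s. \<exists>\<mu>. T s = \<mu> *\<^sub>C s}"
    and U: "cvec.subspace U" "T ` U \<subseteq> U" "u \<in> U"
  obtains \<Lambda> f where "finite \<Lambda>" "u = (\<Sum>l\<in>\<Lambda>. f l)" "\<And>l. T (f l) = l *\<^sub>C f l" "\<And>l. f l \<in> U"
proof -
  have "T s = (SOME \<mu>. T s = \<mu> *\<^sub>C s) *\<^sub>C s" if "s \<in> {s. \<exists>\<mu>. T s = \<mu> *\<^sub>C s}" for s
    using someI_ex[of "\<lambda>\<mu>. T s = \<mu> *\<^sub>C s"] that by simp
  then obtain \<Lambda> f where "finite \<Lambda>" "u = (\<Sum>l\<in>\<Lambda>. f l)" "\<And>l. T (f l) = l *\<^sub>C f l"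
    "\<And>U l. cvec.subspace U \<Longrightarrow> T ` U \<subseteq> U \<Longrightarrow> u \<in> U \<Longrightarrow> f l \<in> U"
    by (rule eigen_decomposition[OF T _ u]) blast+
  then show ?thesis using U by (intro that) blast+
qed

context bp_setting
begin

subsection \<open>Creation and annihilation operators\<close>

lemma free_field_relations:
  "LS \<beta> m (LS \<gamma> n t) = LS \<gamma> n (LS \<beta> m t) + (if m + n = - 1 then t else 0)"
  "LS \<beta> m (LS \<beta> n t) = LS \<beta> n (LS \<beta> m t)" "LS \<gamma> m (LS \<gamma> n t) = LS \<gamma> n (LS \<gamma> m t)"
  "LP c m (LP d n t) = LP d n (LP c m t) + (if m + n = 0 then (2 * of_int m) *\<^sub>C t else 0)"
  "LP c m (LP c n t) = LP c n (LP c m t)" "LP d m (LP d n t) = LP d n (LP d m t)"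
  using vm_commutator_ope[OF vmLS ope_facts(8), of m n t] vm_commutator_ope[OF vmLS ope_facts(9), of m n t]
    vm_commutator_ope[OF vmLS ope_facts(10), of m n t] vm_commutator_ope[OF vmLP ope_facts(11), of m n t]
    vm_commutator_ope[OF vmLP ope_facts(12), of m n t] vm_commutator_ope[OF vmLP ope_facts(13), of m n t]
  by (simp_all add: unitS unitP cscale_one clinear_simps[OF vertex_moduleD(3)[OF vmLP]] cscale_cscale lessThan_Suc
      numeral_2_eq_2 mult.commute)

text \<open>In an index \<open>(s, g, n)\<close>, \<open>s\<close> tells the factor \<open>S\<close> from \<open>\<Pi>(0)\<close>, and \<open>g\<close> tells \<open>\<beta>\<close> or \<open>c\<close> from \<open>\<gamma>\<close> or \<open>d\<close>;
  \<open>ann i\<close> is the annihilation operator dual to \<open>cre i\<close>.\<close>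

definition cre :: "bool \<times> bool \<times> nat \<Rightarrow> ('l, ('s, 'q) ctensor) ctensor \<Rightarrow> ('l, ('s, 'q) ctensor) ctensor" where
  "cre = (\<lambda>(s, g, n). if s then LS (if g then \<beta> else \<gamma>) (- int n - 1) else LP (if g then c else d) (- int n - 1))"

definition ann :: "bool \<times> bool \<times> nat \<Rightarrow> ('l, ('s, 'q) ctensor) ctensor \<Rightarrow> ('l, ('s, 'q) ctensor) ctensor" where
  "ann = (\<lambda>(s, g, n) t. if s then (if g then - LS \<gamma> (int n) t else LS \<beta> (int n) t)
     else (1 / (2 * (of_nat n + 1))) *\<^sub>C LP (if g then d else c) (int n + 1) t)"

lemma cre_linear: "clinear (cre i)"
  by (cases i) (auto simp: cre_def linS linP)

lemma ann_linear: "clinear (ann i)"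
proof -
  obtain s g n where i: "i = (s, g, n)" by (cases i)
  show ?thesis unfolding i ann_def
    by (cases s; cases g) (simp_all add: linS linP clinear_neg_fun clinear_const_scale)
qed

lemma ann_cre: "ann i (cre j t) = cre j (ann i t) + (if i = j then t else 0)"
proof -
  obtain s g n where i: "i = (s, g, n)" by (cases i)
  obtain s' g' n' where j: "j = (s', g', n')" by (cases j)
  \<comment> \<open>\<open>[c(n + 1), d(-n-1)] = 2 (n + 1)\<close>; the normalization in
    \<open>ann\<close> cancels this constant.\<close>
  define z :: complex where "z = 2 * (of_nat n + 1)"
  have nz: "z \<noteq> 0" unfolding z_def by (metis add.commute mult_eq_0_iff of_nat_Suc of_nat_neq_0 zero_neq_numeral)
  note c1 = fcommD[OF commute_slots(3)]
  show ?thesis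
  proof (cases s; cases s')
    assume "s" "s'"
    then show ?thesis unfolding i j cre_def ann_def
      using free_field_relations(1)[of "- int n' - 1" "int n" t] free_field_relations(1)[of "int n" "- int n' - 1" t]
      by (cases g; cases g') (auto simp: clinear_simps[OF linS] free_field_relations(2,3)[of "int n"] eq_diff_eq)
  next
    assume "s" "\<not> s'"
    then show ?thesis unfolding i j cre_def ann_def by (simp add: clinear_simps[OF linP] c1)
  next
    assume "\<not> s" "s'"
    then show ?thesis unfolding i j cre_def ann_def by (simp add: clinear_simps[OF linS] c1)
  next
    assume "\<not> s" "\<not> s'"
    have "LP c (int n + 1) (LP d (- int n' - 1) t) = LP d (- int n' - 1) (LP c (int n + 1) t) + (if n = n' then z *\<^sub>C t else 0)"
      "LP d (int n + 1) (LP c (- int n' - 1) t) = LP c (- int n' - 1) (LP d (int n + 1) t) + (if n = n' then z *\<^sub>C t else 0)"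
      using free_field_relations(4)[of "- int n' - 1" "int n + 1" t] free_field_relations(4)[of "int n + 1" "- int n' - 1" t]
      by (auto simp: z_def algebra_simps)
    then show ?thesis using \<open>\<not> s\<close> \<open>\<not> s'\<close> nz unfolding i j cre_def ann_def prod.case z_def[symmetric]
      by (cases g; cases g') (auto simp: clinear_simps[OF linP] free_field_relations(5,6)[of "int n + 1"]
          cscale_right_distrib cscale_cscale cscale_one)
  qed
qed

lemma cre_commute: "cre i (cre j t) = cre j (cre i t)"
proof -
  obtain s g n where i: "i = (s, g, n)" by (cases i)
  obtain s' g' n' where j: "j = (s', g', n')" by (cases j)
  note c1 = fcommD[OF commute_slots(3)]
  show ?thesis unfolding i j cre_def
    using free_field_relations(1)[of "- int n' - 1" "- int n - 1" t] free_field_relations(1)[of "- int n - 1"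
        "- int n' - 1" t]
      free_field_relations(4)[of "- int n' - 1" "- int n - 1" t] free_field_relations(4)[of "- int n - 1" "- int n' - 1" t]
      free_field_relations(2,3,5,6)[of "- int n - 1" "- int n' - 1" t]
    by (cases s; cases s'; cases g; cases g') (simp_all add: c1)
qed

lemma ann_finite: "finite {i. ann i t \<noteq> 0}"
proof -
  obtain K1 where K1: "\<And>n. n \<ge> K1 \<Longrightarrow> LS \<beta> n t = 0" using fldD(2)[OF fldS] by meson
  obtain K2 where K2: "\<And>n. n \<ge> K2 \<Longrightarrow> LS \<gamma> n t = 0" using fldD(2)[OF fldS] by meson
  obtain K3 where K3: "\<And>n. n \<ge> K3 \<Longrightarrow> LP c n t = 0" using fldD(2)[OF fldP] by meson
  obtain K4 where K4: "\<And>n. n \<ge> K4 \<Longrightarrow> LP d n t = 0" using fldD(2)[OF fldP] by meson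
  define K where "K = Max {K1, K2, K3, K4}"
  have K: "K1 \<le> K" "K2 \<le> K" "K3 \<le> K" "K4 \<le> K" by (simp_all add: K_def)
  have "ann (s, g, n) t = 0" if "n \<ge> nat K" for s g n
    using that K by (cases s; cases g) (simp_all add: ann_def K1 K2 K3 K4)
  then have "{i. ann i t \<noteq> 0} \<subseteq> UNIV \<times> UNIV \<times> {..<nat K}" by (force simp: not_less[symmetric])
  then show ?thesis by (rule finite_subset) simp
qed

text \<open>The common vacuum space of the annihilation operators over the exponents in
  \<open>C\<close>, with the whole factor \<open>L[x,y]\<close> as multiplicity space.\<close>

definition hbase :: "complex set \<Rightarrow> ('l, ('s, 'q) ctensor) ctensor set"
  where "hbase C = cvec.span {u \<otimes>\<^sub>C vacS \<otimes>\<^sub>C E l | u l. l \<in> C}"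

lemma ann_hbase:
  assumes C: "C \<subseteq> Lam" and t: "t \<in> hbase C" shows "ann i t = 0"
proof -
  have "ann i t \<in> {0}"
  proof (rule clinear_maps_span[OF ann_linear _ _ t[unfolded hbase_def]])
    fix w :: "('l, ('s, 'q) ctensor) ctensor" assume "w \<in> {u \<otimes>\<^sub>C vacS \<otimes>\<^sub>C E l | u l. l \<in> C}"
    then obtain u l where w: "w = u \<otimes>\<^sub>C vacS \<otimes>\<^sub>C E l" "l \<in> Lam" using C by blast
    then show "ann i w \<in> {0}" by (cases i) (simp add: ann_def vacS Q_facts)
  qed simp
  then show ?thesis by simp
qed

lemma d0_hbase: "l \<in> Lam \<Longrightarrow> LP d 0 (u \<otimes>\<^sub>C vacS \<otimes>\<^sub>C E l) = (2 * l) *\<^sub>C (u \<otimes>\<^sub>C vacS \<otimes>\<^sub>C E l)"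
  by (simp add: Q_facts)

lemma L_irreducible: "submodule YL N \<Longrightarrow> u \<in> N \<Longrightarrow> u \<noteq> 0 \<Longrightarrow> w \<in> N"
  using hwL unfolding BP_irreducible_hw_module_def irreducible_module_def Let_def by blast

lemma generated_submodule_closed:
  "submodule Y N \<Longrightarrow> u \<in> N \<Longrightarrow> generated_submodule Y u \<subseteq> N"
  "u \<in> generated_submodule Y u" "w \<in> generated_submodule Y u \<Longrightarrow> Y p n w \<in> generated_submodule Y u"
  "cvec.subspace (generated_submodule Y u)"
  by (auto simp: generated_submodule_def submodule_def cvec.subspace_def)

text \<open>After the Fock argument, the eigenvalue \<open>2 * l\<close> of \<open>d(0)\<close>
  isolates a single exponent \<open>l\<close>, so that a pure tensor
  \<open>u \<otimes> vacS \<otimes> E l\<close> lies in \<open>N\<close>. Irreducibility of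
  \<open>L[x,y]\<close> replaces \<open>u\<close> by any vector, and the other two factors are
  generated from their vacua.\<close>

lemma full_submodule_vacuum:
  assumes C: "C \<subseteq> Lam" and N: "full_submodule N" and t: "t \<in> N" "t \<noteq> 0" "t \<in> (\<Union>r. fock_level cre (hbase C) r)"
  obtains l where "l \<in> C" "\<And>u s q. q \<in> generated_submodule YQ (E l) \<Longrightarrow> u \<otimes>\<^sub>C s \<otimes>\<^sub>C q \<in> N"
proof -
  have N0: "cvec.subspace N" and NW: "\<And>w n t. t \<in> N \<Longrightarrow> LW w n t \<in> N" and NS: "\<And>s n t. t \<in> N \<Longrightarrow> LS s n t \<in> N"
    and NP: "\<And>p n t. t \<in> N \<Longrightarrow> LP p n t \<in> N" using N by (auto simp: full_submodule_def)
  have ann: "ann i t \<in> N" if "t \<in> N" for i t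
    by (cases i) (simp add: ann_def NS[OF that] NP[OF that] cvec.subspace_neg[OF N0] cvec.subspace_scale[OF N0])
  have sub: "cvec.subspace (hbase C)" by (simp add: hbase_def)
  obtain t where t: "t \<in> N \<inter> hbase C" "t \<noteq> 0"
    using fock_vacuum[OF cre_linear ann_linear ann_cre cre_commute ann_finite sub ann_hbase[OF C] ann t] by blast
  have U: "cvec.subspace (N \<inter> hbase C)" by (rule cvec.subspace_inter[OF N0 sub])
  have d0: "LP d 0 w \<in> hbase C" if w: "w \<in> hbase C" for w
  proof (rule clinear_maps_span[OF linP sub _ w[unfolded hbase_def]])
    fix s :: "('l, ('s, 'q) ctensor) ctensor" assume s: "s \<in> {u \<otimes>\<^sub>C vacS \<otimes>\<^sub>C E l | u l. l \<in> C}"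
    then obtain u l where "s = u \<otimes>\<^sub>C vacS \<otimes>\<^sub>C E l" "l \<in> Lam" using C by blast
    then have "LP d 0 s = (2 * l) *\<^sub>C s" by (simp only: d0_hbase)
    then show "LP d 0 s \<in> hbase C" using s unfolding hbase_def by (simp only: cvec.span_scale cvec.span_base)
  qed
  have st: "LP d 0 ` (N \<inter> hbase C) \<subseteq> N \<inter> hbase C" using NP d0 by blast
  have "hbase C \<subseteq> cvec.span {s. \<exists>\<mu>. LP d 0 s = \<mu> *\<^sub>C s}"
    unfolding hbase_def by (rule cvec.span_mono) (use C d0_hbase in blast)
  then have "t \<in> cvec.span {s. \<exists>\<mu>. LP d 0 s = \<mu> *\<^sub>C s}" using t by blast
  then obtain \<Lambda> f where f: "t = (\<Sum>l\<in>\<Lambda>. f l)" "\<And>l. LP d 0 (f l) = l *\<^sub>C f l" "\<And>l. f l \<in> N \<inter> hbase C"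
    by (rule diagonal_components[OF linP _ U st t(1)]) blast
  obtain \<mu> where \<mu>: "f \<mu> \<noteq> 0" using t(2) f(1) by (metis sum.neutral)
  define F where "F \<mu> = {(u::'l) \<otimes>\<^sub>C vacS \<otimes>\<^sub>C E l | u l. l \<in> C \<and> 2 * l = \<mu>}" for \<mu>
  have "f \<mu> \<in> cvec.span (F \<mu>)"
  proof (rule eigenvector_in_span_family[where T = "LP d 0" and E = F, OF linP])
    show "LP d 0 s = i *\<^sub>C s" if "s \<in> F i" for i s
      using that C by (auto simp: F_def d0_hbase subset_iff simp del: modes_tensor)
    have "(\<Union>i. F i) = {u \<otimes>\<^sub>C vacS \<otimes>\<^sub>C E l | u l. l \<in> C}" by (auto simp: F_def)
    then show "f \<mu> \<in> cvec.span (\<Union>i. F i)" using f(3) by (simp add: hbase_def)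
  qed (rule f(2))
  moreover have "F \<mu> \<subseteq> (\<lambda>u. u \<otimes>\<^sub>C vacS \<otimes>\<^sub>C E (\<mu> / 2)) ` UNIV" by (auto simp: F_def)
  ultimately have "f \<mu> \<in> (\<lambda>u. u \<otimes>\<^sub>C vacS \<otimes>\<^sub>C E (\<mu> / 2)) ` UNIV"
    using cvec.span_minimal[OF _ subspace_image_clinear[OF clinear_tensor_left[OF clinear_id] cvec.subspace_UNIV]] by blast
  then obtain u where u: "f \<mu> = u \<otimes>\<^sub>C vacS \<otimes>\<^sub>C E (\<mu> / 2)" by blast
  have "\<mu> / 2 \<in> C"
  proof (rule ccontr)
    assume "\<mu> / 2 \<notin> C"
    then have "F \<mu> = {}" by (auto simp: F_def)
    then show False using \<open>f \<mu> \<in> cvec.span (F \<mu>)\<close> \<mu> by simp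
  qed
  have "u \<noteq> 0" using \<mu> unfolding u by auto
  have L: "submodule YL {u. u \<otimes>\<^sub>C vacS \<otimes>\<^sub>C E (\<mu> / 2) \<in> N}"
    unfolding submodule_def
    using subspace_vimage[OF clinear_tensor_left[OF clinear_id] N0] NW[of "_ \<otimes>\<^sub>C _"] by simp
  have base: "w \<otimes>\<^sub>C vacS \<otimes>\<^sub>C E (\<mu> / 2) \<in> N" for w
    using L_irreducible[OF L _ \<open>u \<noteq> 0\<close>, of w] f(3)[of \<mu>] unfolding u by simp
  have "submodule YQ {q. u \<otimes>\<^sub>C vacS \<otimes>\<^sub>C q \<in> N}" for u
    unfolding submodule_def
    using subspace_vimage[OF clinear_tensor_right[OF clinear_tensor_right[OF clinear_id]] N0] NP[of
        "u \<otimes>\<^sub>C vacS \<otimes>\<^sub>C _"] by simp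
  then have q: "u \<otimes>\<^sub>C vacS \<otimes>\<^sub>C q \<in> N" if "q \<in> generated_submodule YQ (E (\<mu> / 2))" for u q
    using generated_submodule_closed(1)[of YQ "{q. u \<otimes>\<^sub>C vacS \<otimes>\<^sub>C q \<in> N}"] base that by blast
  have "s \<in> {s. u \<otimes>\<^sub>C s \<otimes>\<^sub>C q \<in> N}" if "q \<in> generated_submodule YQ (E (\<mu> / 2))" for u s q
  proof (rule pbw_induct[OF pbw_facts(2)])
    show "cvec.subspace {s. u \<otimes>\<^sub>C s \<otimes>\<^sub>C q \<in> N}"
      by (rule subspace_vimage[OF clinear_tensor_right[OF clinear_tensor_left[OF clinear_id]] N0])
    show "vacS \<in> {s. u \<otimes>\<^sub>C s \<otimes>\<^sub>C q \<in> N}" using q[OF that] by simp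
    show "YS g (- int n - 1) w \<in> {s. u \<otimes>\<^sub>C s \<otimes>\<^sub>C q \<in> N}" if "w \<in> {s. u \<otimes>\<^sub>C s \<otimes>\<^sub>C q \<in> N}" for g n w
      using NS[of "u \<otimes>\<^sub>C w \<otimes>\<^sub>C q" g "- int n - 1"] that by simp
  qed
  then show ?thesis using that[OF \<open>\<mu> / 2 \<in> C\<close>] by blast
qed

end

context bp_setting
begin

subsection \<open>Weight decompositions\<close>

text \<open>The charge operator of the \<beta>\<gamma>-system: its zero mode gives \<beta> charge -1
  and \<gamma> charge 1.\<close>

definition "Ngb = YS \<gamma> (- 1) \<beta>"

lemma number_commutators:
  "YS Ngb 0 (YS \<beta> m s) = YS \<beta> m (YS Ngb 0 s) - YS \<beta> m s"
  "YS Ngb 0 (YS \<gamma> m s) = YS \<gamma> m (YS Ngb 0 s) + YS \<gamma> m s"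
proof -
  note lin = vertex_moduleD(2)[OF vmS] and lin' = vertex_moduleD(3)[OF vmS]
  have u: "YS vacS n t = (if n = - 1 then t else 0)" for n t by (rule vertex_moduleD(5)[OF vmS])
  have b: "YS \<beta> (int n) \<beta> = 0" for n using ope_facts(9) by (simp add: ope_def)
  have "YS \<beta> (int n) Ngb = (if n = 0 then \<beta> else 0)" for n
    using vm_commutator_ope[OF vmS ope_facts(8), of "int n" "- 1" \<beta>] by (simp add: Ngb_def b u clinear_0[OF lin] cscale_one)
  then have "ope YS \<beta> Ngb [\<beta>]" by (simp add: ope_def)
  from vm_commutator_ope[OF vmS this, of m 0 s]
  show "YS Ngb 0 (YS \<beta> m s) = YS \<beta> m (YS Ngb 0 s) - YS \<beta> m s" by (simp add: cscale_one)
  have g: "YS \<gamma> (int n) \<beta> = (if n = 0 then - vacS else 0)" for n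
    using vm_commutator_ope[OF vmS ope_facts(8), of "- 1" "int n" vacS] by (auto simp: vacS u clinear_0[OF lin]
        cscale_one eq_neg_iff_add_eq_0 add.commute)
  have "YS \<gamma> (int n) Ngb = (if n = 0 then - \<gamma> else 0)" for n
    using vm_commutator_ope[OF vmS ope_facts(10), of "int n" "- 1" \<beta>] by (simp add: Ngb_def g vacS clinear_simps[OF lin])
  then have "ope YS \<gamma> Ngb [- \<gamma>]" by (simp add: ope_def)
  from vm_commutator_ope[OF vmS this, of m 0 s]
  show "YS Ngb 0 (YS \<gamma> m s) = YS \<gamma> m (YS Ngb 0 s) + YS \<gamma> m s"
    by (simp add: cscale_one clinear_minus[OF lin'])
qed

lemma S_diagonal: "s \<in> cvec.span {s. \<exists>j::int. YS Ngb 0 s = of_int j *\<^sub>C s}" (is "_ \<in> cvec.span ?B")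
proof (rule pbw_induct[OF pbw_facts(2) cvec.subspace_span])
  have "YS Ngb 0 vacS = of_int 0 *\<^sub>C vacS" by (simp add: vacS)
  then show "vacS \<in> cvec.span ?B" by (intro cvec.span_base) blast
  show "YS g (- int n - 1) w \<in> cvec.span ?B" if g: "g \<in> set [\<beta>, \<gamma>]" and w: "w \<in> cvec.span ?B" for g n w
  proof (rule clinear_maps_span[OF vertex_moduleD(2)[OF vmS] cvec.subspace_span _ w])
    fix s assume "s \<in> ?B"
    then obtain j :: int where j: "YS Ngb 0 s = of_int j *\<^sub>C s" by blast
    have "YS Ngb 0 (YS \<beta> m s) = of_int (j - 1) *\<^sub>C YS \<beta> m s" "YS Ngb 0 (YS \<gamma> m s) = of_int (j + 1) *\<^sub>C YS \<gamma> m s" for m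
      by (simp_all add: number_commutators j clinear_scale[OF vertex_moduleD(2)[OF vmS]] cscale_left_distrib
          cvec.scale_left_diff_distrib cscale_one)
    then have "YS \<beta> m s \<in> ?B" "YS \<gamma> m s \<in> ?B" for m by blast+
    moreover have "g = \<beta> \<or> g = \<gamma>" using g by simp
    ultimately show "YS g (- int n - 1) s \<in> cvec.span ?B" by (elim disjE) (simp_all only: cvec.span_base)
  qed
qed

lemma hw_vector:
  "YL J 0 v = x *\<^sub>C v" "n \<ge> 1 \<Longrightarrow> YL J n v = 0" "n \<ge> 1 \<Longrightarrow> YL Gp n v = 0" "n \<ge> 1 \<Longrightarrow> YL Gm n v = 0"
  "YL L 1 v = (y + x / 2) *\<^sub>C v" "v \<noteq> 0"
proof -
  have h: "v \<noteq> 0" "YL J 0 v = x *\<^sub>C v" "YL (L + (1/2) *\<^sub>C translation vacW YW J) 1 v = y *\<^sub>C v"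
    "\<And>n. n \<ge> 0 \<Longrightarrow> YL Gp (n + 1) v = 0 \<and> YL Gm (n + 1) v = 0 \<and> YL J (n + 1) v = 0"
    using hwL unfolding BP_irreducible_hw_module_def Let_def by auto
  show "v \<noteq> 0" "YL J 0 v = x *\<^sub>C v" by (fact h)+
  show "n \<ge> 1 \<Longrightarrow> YL J n v = 0" "n \<ge> 1 \<Longrightarrow> YL Gp n v = 0" "n \<ge> 1 \<Longrightarrow> YL Gm n v = 0" for n
    using h(4)[of "n - 1"] by auto
  show "YL L 1 v = (y + x / 2) *\<^sub>C v"
    using h(3) by (simp add: clinear_simps[OF vertex_moduleD(3)[OF vmL]] vm_translation[OF vmL] h(2) cscale_cscale cscale_one
        cscale_left_distrib diff_eq_eq)
qed

lemma J0_commutators: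
  "YL J 0 (YL J m u) = YL J m (YL J 0 u)" "YL J 0 (YL Gp m u) = YL Gp m (YL J 0 u) + YL Gp m u"
  "YL J 0 (YL Gm m u) = YL Gm m (YL J 0 u) - YL Gm m u" "YL J 0 (YL L m u) = YL L m (YL J 0 u)"
proof -
  note lin = clinear_simps[OF vertex_moduleD(3)[OF vmL]]
  show "YL J 0 (YL J m u) = YL J m (YL J 0 u)"
    using vm_commutator_ope[OF vmL ope_facts(2), of 0 m u] by (simp add: lin lessThan_Suc numeral_2_eq_2)
  show "YL J 0 (YL Gp m u) = YL Gp m (YL J 0 u) + YL Gp m u"
    using vm_commutator_ope[OF vmL ope_facts(5), of 0 m u] by (simp add: cscale_one)
  show "YL J 0 (YL Gm m u) = YL Gm m (YL J 0 u) - YL Gm m u"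
    using vm_commutator_ope[OF vmL ope_facts(6), of 0 m u] by (simp add: cscale_one lin)
  show "YL J 0 (YL L m u) = YL L m (YL J 0 u)"
    using vm_commutator_ope[OF vmL ope_facts(1), of m 0 u] by (simp add: cscale_one vm_translation[OF vmL]
        lessThan_Suc numeral_2_eq_2)
qed

text \<open>The span of the \<open>J(0)\<close>-eigenvectors with eigenvalues in the coset of
  \<open>x\<close> modulo integers contains \<open>v\<close> and is stable under the four
  generators, so irreducibility makes it everything.\<close>

lemma L_diagonal: "u \<in> cvec.span {u. \<exists>i::int. YL J 0 u = (x + of_int i) *\<^sub>C u}" (is "_ \<in> cvec.span ?B")
proof (rule L_irreducible[OF _ _ hw_vector(6)])
  show "v \<in> cvec.span ?B"
    by (rule cvec.span_base) (use hw_vector(1) in \<open>auto intro!: exI[of _ 0]\<close>)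
  have "YL w m u \<in> cvec.span ?B" if u: "u \<in> cvec.span ?B" for w m u
  proof (rule vm_closed_generated[OF vmL pbw_facts(1) cvec.subspace_span _ _ u])
    show "YL g m w \<in> cvec.span ?B" if g: "g \<in> set [J, Gp, Gm, L]" and w: "w \<in> cvec.span ?B" for g m w
    proof (rule clinear_maps_span[OF vertex_moduleD(2)[OF vmL] cvec.subspace_span _ w])
      fix s assume "s \<in> ?B"
      then obtain i :: int where i: "YL J 0 s = (x + of_int i) *\<^sub>C s" by blast
      have "YL J 0 (YL J m s) = (x + of_int i) *\<^sub>C YL J m s" "YL J 0 (YL L m s) = (x + of_int i) *\<^sub>C YL L m s"
        "YL J 0 (YL Gp m s) = (x + of_int (i + 1)) *\<^sub>C YL Gp m s" "YL J 0 (YL Gm m s) = (x + of_int (i - 1)) *\<^sub>C YL Gm m s"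
        by (simp_all add: J0_commutators i clinear_simps[OF vertex_moduleD(2)[OF vmL]] cscale_left_distrib
            cvec.scale_left_diff_distrib cscale_one)
      then have "YL J m s \<in> ?B" "YL L m s \<in> ?B" "YL Gp m s \<in> ?B" "YL Gm m s \<in> ?B" by blast+
      moreover have "g = J \<or> g = Gp \<or> g = Gm \<or> g = L" using g by simp
      ultimately show "YL g m s \<in> cvec.span ?B" by (elim disjE) (simp_all only: cvec.span_base)
    qed
    show "YL vacW m w \<in> cvec.span ?B" if "w \<in> cvec.span ?B" for m w
      using that by (simp add: vertex_moduleD(5)[OF vmL] cvec.span_zero)
  qed
  then show "submodule YL (cvec.span ?B)" by (simp add: submodule_def)
qed

definition "Qwords l = {pbw_monomial YQ [c, d] ws (E l) | ws. ws \<in> pbw_words 2}"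

lemma Q_span: "q \<in> cvec.span (\<Union>l\<in>Lam. Qwords l)"
  using pbw_basis_span[OF Q_facts(1), of q]
  by (rule rev_subsetD[OF _ cvec.span_mono]) (auto simp: Qwords_def numeral_2_eq_2)

lemma Qwords_induct [consumes 1, case_names base step]:
  assumes q: "q \<in> Qwords l" and "P (E l)" and "\<And>g n w. g = c \<or> g = d \<Longrightarrow> P w \<Longrightarrow> P (YQ g (- int n - 1) w)"
  shows "P q"
proof -
  have "ws \<in> pbw_words 2 \<Longrightarrow> P (pbw_monomial YQ [c, d] ws (E l))" for ws
  proof (induction ws)
    case Nil
    then show ?case using assms(2) by (simp add: pbw_monomial_def)
  next
    case (Cons p ws)
    have "fst p = 0 \<or> fst p = 1" "ws \<in> pbw_words 2" using pbw_words_Cons[OF Cons.prems] by auto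
    then show ?case unfolding pbw_monomial_Cons by (intro assms(3) Cons.IH) auto
  qed
  then show ?thesis using q by (auto simp: Qwords_def)
qed

lemma Qwords_weight:
  assumes q: "q \<in> Qwords l" and l: "l \<in> Lam"
  shows "YQ c 0 q = 0 \<and> YQ d 0 q = (2 * l) *\<^sub>C q"
  using q
proof (induction rule: Qwords_induct)
  case base
  then show ?case by (simp add: Q_facts l)
next
  case (step g n w)
  note lin = clinear_simps[OF vertex_moduleD(3)[OF vmQ]] clinear_simps[OF vertex_moduleD(2)[OF vmQ]]
  have "YQ c 0 (YQ g m w) = YQ g m (YQ c 0 w)" "YQ d 0 (YQ g m w) = YQ g m (YQ d 0 w)" for m
    using step(1) vm_commutator_ope[OF vmQ ope_facts(11), of 0 m w] vm_commutator_ope[OF vmQ ope_facts(11), of m 0 w]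
      vm_commutator_ope[OF vmQ ope_facts(12), of 0 m w] vm_commutator_ope[OF vmQ ope_facts(13), of 0 m w]
    by (auto simp: lin lessThan_Suc numeral_2_eq_2 vertex_moduleD(5)[OF vmQ])
  then show ?case using step(2) by (simp add: lin)
qed

lemma Qwords_generated: "q \<in> Qwords l \<Longrightarrow> q \<in> generated_submodule YQ (E l)"
  by (induction rule: Qwords_induct) (intro generated_submodule_closed)+

lemma Qwords_fock:
  assumes l: "l \<in> C" and q: "q \<in> Qwords l"
  shows "u \<otimes>\<^sub>C s \<otimes>\<^sub>C q \<in> (\<Union>r. fock_level cre (hbase C) r)" (is "_ \<in> ?U")
proof -
  have sub: "cvec.subspace (hbase C)" by (simp add: hbase_def)
  note U = fock_level_Union[where X = cre, OF sub]
  have 1: "u \<otimes>\<^sub>C vacS \<otimes>\<^sub>C q \<in> ?U" using q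
  proof (induction rule: Qwords_induct)
    case base
    have "u \<otimes>\<^sub>C vacS \<otimes>\<^sub>C E l \<in> fock_level cre (hbase C) 0" using l by (auto simp: hbase_def intro: cvec.span_base)
    then show ?case by blast
  next
    case (step g n w)
    then show ?case using U(2)[where t = "u \<otimes>\<^sub>C vacS \<otimes>\<^sub>C w" and i = "(False, True, n)"] U(2)[where t =
        "u \<otimes>\<^sub>C vacS \<otimes>\<^sub>C w" and i = "(False, False, n)"]
      by (auto simp: cre_def simp del: fock_level.simps UN_iff)
  qed
  have "s \<in> {s. u \<otimes>\<^sub>C s \<otimes>\<^sub>C q \<in> ?U}"
  proof (rule pbw_induct[OF pbw_facts(2)])
    show "cvec.subspace {s. u \<otimes>\<^sub>C s \<otimes>\<^sub>C q \<in> ?U}"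
      by (rule subspace_vimage[OF clinear_tensor_right[OF clinear_tensor_left[OF clinear_id]] U(1)])
    show "vacS \<in> {s. u \<otimes>\<^sub>C s \<otimes>\<^sub>C q \<in> ?U}" using 1 by (rule CollectI)
    show "YS g (- int n - 1) w \<in> {s. u \<otimes>\<^sub>C s \<otimes>\<^sub>C q \<in> ?U}" if "g \<in> set [\<beta>, \<gamma>]" "w \<in> {s. u \<otimes>\<^sub>C s \<otimes>\<^sub>C q \<in> ?U}" for g n w
      using that U(2)[where t = "u \<otimes>\<^sub>C w \<otimes>\<^sub>C q" and i = "(True, True, n)"] U(2)[where t = "u \<otimes>\<^sub>C w \<otimes>\<^sub>C q" and i =
          "(True, False, n)"]
      by (auto simp: cre_def simp del: fock_level.simps UN_iff)
  qed
  then show ?thesis by (rule CollectD)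
qed

definition "Gvec = (\<lambda>(i::int, j::int, l). {u \<otimes>\<^sub>C s \<otimes>\<^sub>C q | u s q. YL J 0 u = (x + of_int i) *\<^sub>C u \<and> YS Ngb 0 s = of_int j *\<^sub>C s \<and> q \<in> Qwords l})"

lemma Gvec_span: "t \<in> cvec.span (\<Union>(i, j, l)\<in>UNIV \<times> UNIV \<times> Lam. Gvec (i, j, l))" (is "_ \<in> cvec.span ?G")
proof -
  have 1: "u \<otimes>\<^sub>C s \<otimes>\<^sub>C q \<in> cvec.span ?G"
    if "u \<in> {u. \<exists>i::int. YL J 0 u = (x + of_int i) *\<^sub>C u}" "s \<in> {s. \<exists>j::int. YS Ngb 0 s = of_int j *\<^sub>C s}"
      "q \<in> (\<Union>l\<in>Lam. Qwords l)" for u s q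
    by (rule cvec.span_base) (use that in \<open>auto simp: Gvec_def; blast\<close>)
  have 2: "u \<otimes>\<^sub>C s \<otimes>\<^sub>C q \<in> cvec.span ?G"
    if "u \<in> {u. \<exists>i::int. YL J 0 u = (x + of_int i) *\<^sub>C u}" "s \<in> {s. \<exists>j::int. YS Ngb 0 s = of_int j *\<^sub>C s}" for u s q
    by (rule clinear_maps_span[OF clinear_tensor_right[OF clinear_tensor_right[OF clinear_id]] cvec.subspace_span 1[OF
        that] Q_span])
  have 3: "u \<otimes>\<^sub>C s \<otimes>\<^sub>C q \<in> cvec.span ?G"
    if "u \<in> {u. \<exists>i::int. YL J 0 u = (x + of_int i) *\<^sub>C u}" for u s q
    by (rule clinear_maps_span[OF clinear_tensor_right[OF clinear_tensor_left[OF clinear_id]] cvec.subspace_span 2[OF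
        that] S_diagonal])
  have 4: "u \<otimes>\<^sub>C s \<otimes>\<^sub>C q \<in> cvec.span ?G" for u s q
    by (rule clinear_maps_span[OF clinear_tensor_left[OF clinear_id] cvec.subspace_span 3 L_diagonal])
  show ?thesis by (rule subsetD[OF cvec.span_minimal[OF _ cvec.subspace_span] triple_span]) (use 4 in blast)
qed

lemma Gvec_weights:
  assumes t: "t \<in> Gvec (i, j, l)" and l: "l \<in> Lam"
  shows "X h1 0 t = (l + of_int j - 2 * (x + of_int i)) *\<^sub>C t" "X h2 0 t = (x + of_int i - 2 * of_int j + l) *\<^sub>C t"
proof -
  obtain u s q where t: "t = u \<otimes>\<^sub>C s \<otimes>\<^sub>C q" "YL J 0 u = (x + of_int i) *\<^sub>C u" "YS Ngb 0 s = of_int j *\<^sub>C s" "q \<in> Qwords l"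
    using t by (auto simp: Gvec_def)
  show "X h1 0 t = (l + of_int j - 2 * (x + of_int i)) *\<^sub>C t" "X h2 0 t = (x + of_int i - 2 * of_int j + l) *\<^sub>C t"
    unfolding t(1) slot_operators using Qwords_weight[OF t(4) l]
    by (simp_all add: t(2,3)[unfolded Ngb_def] cscale_cscale cscale_left_distrib cvec.scale_left_diff_distrib
        cscale_right_distrib algebra_simps)
qed

lemma R_diagonal:
  "t \<in> cvec.span {s. \<exists>\<mu>. X h1 0 s = \<mu> *\<^sub>C s}" "t \<in> cvec.span {s. \<exists>\<mu>. hth s = \<mu> *\<^sub>C s}"
proof -
  have "(\<Union>(i, j, l)\<in>UNIV \<times> UNIV \<times> Lam. Gvec (i, j, l)) \<subseteq> {s. \<exists>\<mu>. X h1 0 s = \<mu> *\<^sub>C s}"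
    using Gvec_weights(1) by blast
  then show "t \<in> cvec.span {s. \<exists>\<mu>. X h1 0 s = \<mu> *\<^sub>C s}" using cvec.span_mono Gvec_span by blast
  have "(\<Union>(i, j, l)\<in>UNIV \<times> UNIV \<times> Lam. Gvec (i, j, l)) \<subseteq> {s. \<exists>\<mu>. hth s = \<mu> *\<^sub>C s}"
    unfolding hth_def using Gvec_weights by (fastforce simp: cscale_left_distrib[symmetric])
  then show "t \<in> cvec.span {s. \<exists>\<mu>. hth s = \<mu> *\<^sub>C s}" using cvec.span_mono Gvec_span by blast
qed

definition "Cos = {m\<^sub>1 + of_int j | j. True}"

lemma Cos_Lam: "Cos \<subseteq> Lam"
proof
  fix l assume "l \<in> Cos"
  then obtain j where j: "l = m\<^sub>1 + of_int j" by (auto simp: Cos_def)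
  have "(of_nat (a + 2 * b) :: complex) = of_nat ((a + 2 * b) mod 3) + 3 * of_nat ((a + 2 * b) div 3)"
    by (metis mod_mult_div_eq of_nat_add of_nat_mult of_nat_numeral)
  then have "l = of_nat ((a + 2 * b) mod 3) / 3 + of_int (int ((a + 2 * b) div 3) + j)"
    by (simp add: j m1)
  moreover have "(a + 2 * b) mod 3 < 3" by simp
  ultimately show "l \<in> Lam" unfolding Lam_def by blast
qed

lemma Cos_generated:
  assumes "l \<in> Cos" shows "generated_submodule YQ (E l) = generated_submodule YQ (E m\<^sub>1)"
proof -
  obtain j where j: "l = m\<^sub>1 + of_int j" using assms by (auto simp: Cos_def)
  have sm: "submodule YQ (generated_submodule YQ u)" for u
    unfolding submodule_def by (intro conjI allI ballI generated_submodule_closed)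
  have m: "m\<^sub>1 \<in> Cos" by (auto simp: Cos_def intro: exI[of _ 0])
  have "E l \<in> generated_submodule YQ (E m\<^sub>1)" "E m\<^sub>1 \<in> generated_submodule YQ (E l)"
    using generated_submodule_closed(3)[OF generated_submodule_closed(2), of YQ "e j" "- 1" "E m\<^sub>1"]
      generated_submodule_closed(3)[OF generated_submodule_closed(2), of YQ "e (- j)" "- 1" "E l"]
      Q_facts(5)[of m\<^sub>1 j] Q_facts(5)[of l "- j"] assms m Cos_Lam by (auto simp: j)
  then show ?thesis by (intro antisym generated_submodule_closed(1)[OF sm])
qed

text \<open>The summand \<open>L[x,y] \<otimes> S\<^sub>0(m\<^sub>1)\<close>, spanned by words over
  the coset of \<open>m\<^sub>1\<close> so that weights can be read off.\<close>

definition "RC = cvec.span {u \<otimes>\<^sub>C s \<otimes>\<^sub>C q | u s q. \<exists>l\<in>Cos. q \<in> Qwords l}"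

lemma RC_fock: "t \<in> RC \<Longrightarrow> t \<in> (\<Union>r. fock_level cre (hbase Cos) r)"
proof -
  have sub: "cvec.subspace (hbase Cos)" by (simp add: hbase_def)
  assume "t \<in> RC"
  then show ?thesis unfolding RC_def
    by (rule rev_subsetD[OF _ cvec.span_minimal[OF _ fock_level_Union(1)[OF sub]]]) (use Qwords_fock in blast)
qed

lemma RC_generated: "RC \<subseteq> cvec.span {u \<otimes>\<^sub>C s \<otimes>\<^sub>C q | u s q. q \<in> generated_submodule YQ (E m\<^sub>1)}"
  unfolding RC_def by (rule cvec.span_mono) (use Qwords_generated Cos_generated in blast)

text \<open>An integral weight \<open>l + j - 2(x + i)\<close> forces \<open>l\<close> to be
  congruent to \<open>2x = m\<^sub>1 - a\<close>, so the weight of \<open>h1\<close> alone tells the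
  three cosets apart.\<close>

lemma integral_weight_RC:
  assumes "X h1 0 u = of_int m *\<^sub>C u" shows "u \<in> RC"
proof -
  define F where "F \<mu> = (\<Union>(i, j, l)\<in>{(i, j, l). l \<in> Lam \<and> \<mu> = l + of_int j - 2 * (x + of_int i)}. Gvec (i, j, l))" for \<mu>
  have "u \<in> cvec.span (F (of_int m))"
  proof (rule eigenvector_in_span_family[where T = "X h1 0" and E = F])
    show "clinear (X h1 0)" by (rule X_linear) simp
    show "X h1 0 s = i *\<^sub>C s" if "s \<in> F i" for i s using that Gvec_weights(1) by (auto simp: F_def)
    have "(\<Union>(i, j, l)\<in>UNIV \<times> UNIV \<times> Lam. Gvec (i, j, l)) \<subseteq> (\<Union>i. F i)" unfolding F_def by blast
    then show "u \<in> cvec.span (\<Union>i. F i)" using cvec.span_mono Gvec_span by blast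
  qed (rule assms)
  also have "cvec.span (F (of_int m)) \<subseteq> RC"
    unfolding RC_def
  proof (rule cvec.span_mono, rule subsetI)
    fix s assume "s \<in> F (of_int m)"
    then obtain i j :: int and l where l: "of_int m = l + of_int j - 2 * (x + of_int i)" "s \<in> Gvec (i, j, l)"
      by (auto simp: F_def)
    have "2 * x = m\<^sub>1 - of_nat a" by (simp add: x m1 field_simps)
    moreover have "l = of_int m - of_int j + 2 * x + 2 * of_int i" using l(1) by (simp add: algebra_simps)
    ultimately have "l = m\<^sub>1 + of_int (m - int a + 2 * i - j)" by simp
    then have "l \<in> Cos" unfolding Cos_def by blast
    then show "s \<in> {u \<otimes>\<^sub>C s \<otimes>\<^sub>C q | u s q. \<exists>l\<in>Cos. q \<in> Qwords l}" using l(2) by (auto simp: Gvec_def)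
  qed
  finally show ?thesis .
qed

subsection \<open>Localization at the lattice operator\<close>

lemma localized_full:
  assumes "affine_invariant X N" shows "full_submodule {t. \<exists>r. (xop ^^ r) t \<in> N}"
proof (rule saturated_full[OF localization_invariant[OF assms]])
  fix t assume "xop t \<in> {t. \<exists>r. (xop ^^ r) t \<in> N}"
  then obtain r where "(xop ^^ Suc r) t \<in> N" by (auto simp: funpow_swap1)
  then show "t \<in> {t. \<exists>r. (xop ^^ r) t \<in> N}" by blast
qed

lemma xop_E: "l \<in> Lam \<Longrightarrow> (xop ^^ n) (u \<otimes>\<^sub>C s \<otimes>\<^sub>C E l) = u \<otimes>\<^sub>C s \<otimes>\<^sub>C E (l + of_nat n) \<and> l + of_nat n \<in> Lam"
proof (induction n)
  case (Suc n)
  have "l + of_nat n + 1 \<in> Lam"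
  proof -
    obtain i :: nat and j :: int where "l + of_nat n = of_nat i / 3 + of_int j" "i < 3" using Suc by (auto simp: Lam_def)
    then have "l + of_nat n + 1 = of_nat i / 3 + of_int (j + 1)" "i < 3" by simp_all
    then show ?thesis unfolding Lam_def by blast
  qed
  then show ?case using Suc Q_facts(5)[of "l + of_nat n" 1] by (simp add: slot_operators add.commute add.left_commute)
qed simp

definition "w0 = v \<otimes>\<^sub>C vacS \<otimes>\<^sub>C E m\<^sub>1"

lemma m1_Cos: "m\<^sub>1 \<in> Cos" "m\<^sub>1 \<in> Lam"
proof -
  show "m\<^sub>1 \<in> Cos" by (auto simp: Cos_def intro: exI[of _ 0])
  then show "m\<^sub>1 \<in> Lam" using Cos_Lam by blast
qed

lemma vac_E_nonzero: "l \<in> Lam \<Longrightarrow> u \<noteq> 0 \<Longrightarrow> u \<otimes>\<^sub>C vacS \<otimes>\<^sub>C E l \<noteq> 0"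
  using pbw_basis_nonzero[OF pbw_facts(2)] pbw_basis_nonzero[OF Q_facts(1)] by (intro tensor_nonzero) auto

lemma localized_generator:
  assumes N: "affine_invariant X N" and t: "t \<in> N" "t \<noteq> 0" "t \<in> RC"
  shows "\<exists>n. (xop ^^ n) (u \<otimes>\<^sub>C s \<otimes>\<^sub>C E m\<^sub>1) \<in> N" and "t' \<in> RC \<Longrightarrow> \<exists>n. (xop ^^ n) t' \<in> N"
proof -
  let ?N = "{t. \<exists>r. (xop ^^ r) t \<in> N}"
  have "t \<in> ?N" using t(1) by (auto intro!: exI[of _ 0])
  then obtain l where l: "l \<in> Cos" "\<And>u s q. q \<in> generated_submodule YQ (E l) \<Longrightarrow> u \<otimes>\<^sub>C s \<otimes>\<^sub>C q \<in> ?N"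
    by (rule full_submodule_vacuum[OF Cos_Lam localized_full[OF N] _ t(2) RC_fock[OF t(3)]]) (rule that, assumption, blast)
  have g: "u \<otimes>\<^sub>C s \<otimes>\<^sub>C q \<in> ?N" if "q \<in> generated_submodule YQ (E m\<^sub>1)" for u s q
    using l(2) that unfolding Cos_generated[OF l(1)] .
  show "\<exists>n. (xop ^^ n) (u \<otimes>\<^sub>C s \<otimes>\<^sub>C E m\<^sub>1) \<in> N" using g[OF generated_submodule_closed(2)] by blast
  have "cvec.subspace ?N" using localized_full[OF N] by (simp add: full_submodule_def)
  then have "cvec.span {u \<otimes>\<^sub>C s \<otimes>\<^sub>C q | u s q. q \<in> generated_submodule YQ (E m\<^sub>1)} \<subseteq> ?N"
    by (rule cvec.span_minimal[rotated]) (use g in blast)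
  then show "t' \<in> RC \<Longrightarrow> \<exists>n. (xop ^^ n) t' \<in> N" using RC_generated by blast
qed

text \<open>The localization of the zero submodule is stable under all three factors. If it were
  nonzero it would contain some \<open>v \<otimes> vacS \<otimes> E l\<close>, but on these
  \<open>e\<^sub>3(-1)\<close> only shifts the exponent.\<close>

lemma xop_injective:
  assumes "xop t = 0" shows "t = 0"
proof (rule ccontr)
  assume t: "t \<noteq> 0"
  have N: "affine_invariant X {0}" by (simp add: affine_invariant_def cvec.subspace_def X_simps)
  have "t \<in> {t. \<exists>r. (xop ^^ r) t \<in> {0}}" using assms by (auto intro!: exI[of _ 1])
  moreover have "t \<in> (\<Union>r. fock_level cre (hbase Lam) r)"
  proof -
    have sub: "cvec.subspace (hbase Lam)" by (simp add: hbase_def)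
    have "(\<Union>(i, j, l)\<in>UNIV \<times> UNIV \<times> Lam. Gvec (i, j, l)) \<subseteq> (\<Union>r. fock_level cre (hbase Lam) r)"
      using Qwords_fock[of _ Lam] unfolding Gvec_def by blast
    then show ?thesis by (rule subsetD[OF cvec.span_minimal[OF _ fock_level_Union(1)[OF sub]] Gvec_span])
  qed
  ultimately obtain l where l: "l \<in> Lam"
      "\<And>u s q. q \<in> generated_submodule YQ (E l) \<Longrightarrow> u \<otimes>\<^sub>C s \<otimes>\<^sub>C q \<in> {t. \<exists>r. (xop ^^ r) t \<in> {0}}"
    by (rule full_submodule_vacuum[OF order_refl localized_full[OF N] _ t]) (rule that, assumption, blast)
  obtain r where "(xop ^^ r) (v \<otimes>\<^sub>C vacS \<otimes>\<^sub>C E l) = 0" using l(2)[OF generated_submodule_closed(2)] by blast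
  then show False using xop_E[OF l(1)] vac_E_nonzero hw_vector(6) by metis
qed

end

text \<open>\<open>p\<close> and \<open>q\<close> are bounds from which on the modes kill
  \<open>t\<close>; at the highest possible mode only one pair of indices avoids both
  bounds.\<close>

lemma fprod_top:
  assumes A: "fld A" and B: "fld B" and c: "fcomm A B"
    and t: "\<And>i. i \<ge> p \<Longrightarrow> A i t = 0" "\<And>i. i \<ge> q \<Longrightarrow> B i t = 0"
  shows "n \<ge> p + q \<Longrightarrow> fprod A B n t = 0" and "n = p + q - 1 \<Longrightarrow> fprod A B n t = A (p - 1) (B (q - 1) t)"
proof -
  have z: "A i (B j t) = 0" if "i \<ge> p \<or> j \<ge> q" for i j
    using that t by (elim disjE) (simp_all add: fcommD[OF c] clinear_0[OF fldD(1)[OF A]] clinear_0[OF fldD(1)[OF B]])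
  show "fprod A B n t = 0" if "n \<ge> p + q"
  proof -
    have "A i (B (n - 1 - i) t) = 0" for i by (rule z) (use that in linarith)
    then show ?thesis by (simp add: fprod_def)
  qed
  show "fprod A B n t = A (p - 1) (B (q - 1) t)" if n: "n = p + q - 1"
  proof -
    have "fprod A B n t = A (p - 1) (B (n - 1 - (p - 1)) t)"
      unfolding fprod_def
    proof (rule Sum_any_single)
      fix j assume "j \<noteq> p - 1"
      then show "A j (B (n - 1 - j) t) = 0" by (intro z) (use n in linarith)
    qed
    moreover have "n - 1 - (p - 1) = q - 1" using n by simp
    ultimately show ?thesis by (simp only:)
  qed
qed

context bp_setting
begin

subsection \<open>The highest weight vector\<close>

lemma Q_top:
  assumes l: "l \<in> Lam" and n: "n \<ge> 0"
  shows "YQ (YP c (- 1) (e m)) n (E l) = 0"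
    "YQ (YP d (- 1) (e m)) n (E l) = (if n = 0 then (2 * l) *\<^sub>C E (l + of_int m) else 0)"
proof -
  note lin = clinear_simps[OF vertex_moduleD(2)[OF vmQ]]
  have "fcomm (YQ c) (YQ (e m))" unfolding fcomm_def using vm_product(1)[OF vmQ ope_facts(14)] by blast
  then have "fprod (YQ c) (YQ (e m)) n (E l) = 0"
    using n by (intro fprod_top(1)[OF fld_vertex_module[OF vmQ] fld_vertex_module[OF vmQ], where p = 0 and q = 0])
      (simp_all add: Q_facts l)
  then show "YQ (YP c (- 1) (e m)) n (E l) = 0"
    unfolding vm_product(2)[OF vmQ ope_facts(14)] by (simp only: fprod_def)
  have "YQ (YP d (- 1) (e m)) n (E l) = YQ (e m) (n - 1) (YQ d 0 (E l))"
    unfolding vm_iterate_minus1[OF vmQ]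
    using n by (subst Sum_any_single[of 0]) (simp_all add: Q_facts l lin)
  then show "YQ (YP d (- 1) (e m)) n (E l) = (if n = 0 then (2 * l) *\<^sub>C E (l + of_int m) else 0)"
    using n by (auto simp: Q_facts l lin)
qed

text \<open>Mode 1 is at or above the top mode of every product in \<open>f1\<close>, so
  \<open>fprod_top\<close> leaves at most one term of each: \<open>d(0)\<close> contributes
  \<open>l\<close>, the derivative of \<beta> contributes \<open>-(k + 1)\<close> because its mode 1
  is minus mode 0 of \<beta>, and the product with \<open>c\<close> contributes nothing.\<close>

lemma f1_mode1:
  assumes u: "\<And>n. n \<ge> 1 \<Longrightarrow> YL J n u = 0" and s: "\<And>n. n \<ge> 1 \<Longrightarrow> YS \<beta> n s = 0" and l: "l \<in> Lam"
  shows "X f1 1 (u \<otimes>\<^sub>C s \<otimes>\<^sub>C E l) = YL Gp 1 u \<otimes>\<^sub>C s \<otimes>\<^sub>C E l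
    + ((l - k - 1) *\<^sub>C u - 2 *\<^sub>C YL J 0 u) \<otimes>\<^sub>C YS \<beta> 0 s \<otimes>\<^sub>C E (l - 1)"
proof -
  let ?t = "u \<otimes>\<^sub>C s \<otimes>\<^sub>C E l"
  note com = commute_slots
  have db: "YS (dcur \<beta>) n s = (- of_int n) *\<^sub>C YS \<beta> (n - 1) s" for n unfolding dcur_def by (rule vm_translation[OF vmS])
  have e': "YQ (e (- 1)) (- 1) (E l) = E (l - 1)" using Q_facts(5)[OF l, of "- 1"] by simp
  have be0: "fprod (LS \<beta>) (LP (e (- 1))) n ?t = 0" if "n \<ge> 1" for n
    by (rule fprod_top(1)[OF fldS fldP com(3), where p = 1 and q = 0]) (use that in \<open>simp_all add: s Q_facts l\<close>)
  have be1: "fprod (LS \<beta>) (LP (e (- 1))) 0 ?t = u \<otimes>\<^sub>C YS \<beta> 0 s \<otimes>\<^sub>C E (l - 1)"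
    by (subst fprod_top(2)[OF fldS fldP com(3), where p = 1 and q = 0]) (simp_all add: s Q_facts(4) l e')
  have "fprod (LW J) (fprod (LS \<beta>) (LP (e (- 1)))) 1 ?t = YL J 0 u \<otimes>\<^sub>C YS \<beta> 0 s \<otimes>\<^sub>C E (l - 1)"
    by (subst fprod_top(2)[OF fldW fldSP commW_SP, where p = 1 and q = 1]) (simp_all add: u be0 be1)
  moreover have "fprod (LS \<beta>) (LP (YP c (- 1) (e (- 1)))) 1 ?t = 0"
    by (rule fprod_top(1)[OF fldS fldP com(3), where p = 1 and q = 0]) (simp_all add: s Q_top l)
  moreover have "fprod (LS \<beta>) (LP (YP d (- 1) (e (- 1)))) 1 ?t = (2 * l) *\<^sub>C (u \<otimes>\<^sub>C YS \<beta> 0 s \<otimes>\<^sub>C E (l - 1))"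
    by (subst fprod_top(2)[OF fldS fldP com(3), where p = 1 and q = 1]) (simp_all add: s Q_top l clinear_scale[OF linS])
  moreover have "fprod (LS (dcur \<beta>)) (LP (e (- 1))) 1 ?t = - (u \<otimes>\<^sub>C YS \<beta> 0 s \<otimes>\<^sub>C E (l - 1))"
    by (subst fprod_top(2)[OF fldS fldP com(3), where p = 2 and q = 0]) (simp_all add: s Q_facts(4) l e' db cscale_one)
  ultimately show ?thesis unfolding slot_operators
    by (simp add: cscale_cscale cscale_left_distrib cvec.scale_left_diff_distrib cscale_one)
qed

text \<open>The coefficient \<open>b\<close> arises as \<open>x + m\<^sub>1\<close>, with
  \<open>x\<close> from \<open>J(0)\<close> and \<open>m\<^sub>1\<close> from half of
  \<open>d(0)\<close>.\<close>

lemma f2_mode0: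
  "X f2 0 w0 = YL Gm 0 v \<otimes>\<^sub>C vacS \<otimes>\<^sub>C E (m\<^sub>1 - 1) + of_nat b *\<^sub>C (v \<otimes>\<^sub>C \<gamma> \<otimes>\<^sub>C E m\<^sub>1)"
proof -
  note com = commute_slots and l = m1_Cos(2)
  have e': "YQ (e (- 1)) (- 1) (E m\<^sub>1) = E (m\<^sub>1 - 1)" using Q_facts(5)[OF l, of "- 1"] by simp
  have "fprod (LW Gm) (LP (e (- 1))) 0 w0 = YL Gm 0 v \<otimes>\<^sub>C vacS \<otimes>\<^sub>C E (m\<^sub>1 - 1)"
    unfolding w0_def by (subst fprod_top(2)[OF fldW fldP com(2), where p = 1 and q = 0]) (simp_all add: hw_vector
        Q_facts(4) l e')
  moreover have "fprod (LW J) (LS \<gamma>) 0 w0 = x *\<^sub>C (v \<otimes>\<^sub>C \<gamma> \<otimes>\<^sub>C E m\<^sub>1)"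
    unfolding w0_def by (subst fprod_top(2)[OF fldW fldS com(1), where p = 1 and q = 0]) (simp_all add: hw_vector vacS)
  moreover have "fprod (LS \<gamma>) (LP c) 0 w0 = 0"
    unfolding w0_def by (rule fprod_top(1)[OF fldS fldP com(3), where p = 0 and q = 0]) (simp_all add: vacS Q_facts l)
  moreover have "fprod (LS \<gamma>) (LP d) 0 w0 = (2 * m\<^sub>1) *\<^sub>C (v \<otimes>\<^sub>C \<gamma> \<otimes>\<^sub>C E m\<^sub>1)"
    unfolding w0_def by (subst fprod_top(2)[OF fldS fldP com(3), where p = 0 and q = 1]) (simp_all add: vacS Q_facts l
        clinear_scale[OF linS])
  moreover have "(of_nat b :: complex) = x + m\<^sub>1" by (simp add: x m1 field_simps)
  ultimately show ?thesis unfolding slot_operators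
    by (simp add: w0_def vacS cscale_cscale cscale_left_distrib)
qed

lemma e1_mode0: "X e1 0 w0 = 0"
  unfolding slot_operators w0_def
  by (subst fprod_top(1)[OF fldS fldP commute_slots(3), where p = 0 and q = 0]) (simp_all add: vacS Q_facts m1_Cos)

lemma Gp_Gm: "YL Gp 1 (YL Gm 0 v) = (3 * x^2 + 3 / 2 * (k + 1) * x - (k + 3) * (y + x / 2)) *\<^sub>C v"
proof -
  note lin = clinear_simps[OF vertex_moduleD(3)[OF vmL]] and lin' = clinear_simps[OF vertex_moduleD(2)[OF vmL]]
  have "YL (YW J (- 1) J) 1 v = YL J 0 (YL J 0 v)"
    unfolding vm_iterate_minus1[OF vmL] by (subst Sum_any_single[of 0]) (simp_all add: hw_vector lin')
  then have JJ: "YL (YW J (- 1) J) 1 v = x^2 *\<^sub>C v" by (simp add: hw_vector lin' cscale_cscale power2_eq_square)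
  have "YL Gp 1 (YL Gm 0 v) = YL (3 *\<^sub>C YW J (-1) J + (3 * (k + 1) / 2) *\<^sub>C translation vacW YW J - (k + 3) *\<^sub>C L) 1 v
      + (3 * (k + 1)) *\<^sub>C YL J 0 v"
  proof -
    \<comment> \<open>The triple pole drops out, since its coefficient for mode 1 is the binomial
      coefficient of 1 over 2.\<close>
    have "(1::complex) gchoose Suc (Suc 0) = 0"
      using binomial_gbinomial[of 1 "Suc (Suc 0)", where 'a = complex] by (simp add: binomial_eq_0)
    then show ?thesis
      unfolding vm_commutator_ope[OF vmL ope_facts(7), of 1 0 v]
      by (simp add: cscale_one hw_vector(3) clinear_0[OF vertex_moduleD(2)[OF vmL]] clinear_scale[OF
          vertex_moduleD(3)[OF vmL]])
  qed
  also have "YL (3 *\<^sub>C YW J (-1) J + (3 * (k + 1) / 2) *\<^sub>C translation vacW YW J - (k + 3) *\<^sub>C L) 1 v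
      = 3 *\<^sub>C x^2 *\<^sub>C v + (3 * (k + 1) / 2) *\<^sub>C (- x) *\<^sub>C v - (k + 3) *\<^sub>C (y + x / 2) *\<^sub>C v"
    by (simp only: lin JJ vm_translation[OF vmL] hw_vector(1,5)) (simp add: hw_vector(1) cscale_one)
  also have "\<dots> + (3 * (k + 1)) *\<^sub>C YL J 0 v
      = (3 * x^2 + (3 * (k + 1) / 2) * (- x) - (k + 3) * (y + x / 2) + (3 * (k + 1)) * x) *\<^sub>C v"
    unfolding hw_vector(1) cscale_cscale by (simp only: cscale_left_distrib cvec.scale_left_diff_distrib)
  also have "3 * x^2 + (3 * (k + 1) / 2) * (- x) - (k + 3) * (y + x / 2) + (3 * (k + 1)) * x
      = 3 * x^2 + 3 / 2 * (k + 1) * x - (k + 3) * (y + x / 2)"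
    by (simp add: field_simps)
  finally show ?thesis .
qed

text \<open>The left side is the coefficient of
  \<open>v \<otimes> vacS \<otimes> E (m\<^sub>1 - 1)\<close> in
  \<open>f\<^sub>1(1) f\<^sub>2(0) w0\<close>; solving this equation for \<open>y\<close> is the
  origin of its value.\<close>

lemma w0_relation: "3 * x^2 + 3 / 2 * (k + 1) * x - (k + 3) * (y + x / 2) + of_nat b * (of_nat a - k - 1) = 0"
proof -
  have k3: "k + 3 \<noteq> 0" using k(1) eq_neg_iff_add_eq_0 by blast
  have "(k + 3) * y = ((of_nat b - of_nat a)^2 - 3 * (of_nat a + of_nat b) * (2 * (k + 1) - of_nat a - of_nat b)) / 12
             - (k + 3) * (of_nat b - of_nat a) / 6"
  proof -
    have "(k + 3) * (n / (12 * (k + 3)) - z / 6) = n / 12 - (k + 3) * z / 6" for n z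
      using nonzero_mult_divide_mult_cancel_right[OF k3, of n 12] by (simp only: right_diff_distrib
          times_divide_eq_right mult.commute[of n])
    then show ?thesis unfolding y by simp
  qed
  then have e: "(k + 3) * (y + x / 2) = ((of_nat b - of_nat a)^2 - 3 * (of_nat a + of_nat b) * (2 * (k + 1) - of_nat a - of_nat b)) / 12"
    unfolding x by (simp add: algebra_simps)
  show ?thesis unfolding e by (simp add: x power2_eq_square field_simps)
qed

text \<open>As \<open>f3 = [f2, f1]\<close> and \<open>f\<^sub>1(1) w0 = 0\<close>, the condition
  \<open>f\<^sub>3(1) w0 = 0\<close> reduces to
  \<open>f\<^sub>1(1) f\<^sub>2(0) w0 = 0\<close>.\<close>

lemma w0_singular: "singular (of_nat a) (of_nat b) w0"
proof -
  note l = m1_Cos(2)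
  have gb: "YS \<beta> (int n) \<gamma> = (if n = 0 then vacS else 0)" for n using ope_facts(8) by (simp add: ope_def)
  have g: "YS \<beta> n \<gamma> = (if n = 0 then vacS else 0)" if "n \<ge> 0" for n using gb[of "nat n"] that by auto
  have "m\<^sub>1 - 1 \<in> Lam" using Cos_Lam unfolding Cos_def by (auto intro!: exI[of _ "- 1"])
  have "YL J n (YL Gm 0 v) = 0" if "n \<ge> 1" for n
    using vm_commutator_ope[OF vmL ope_facts(6), of n 0 v] that
    by (simp add: hw_vector clinear_simps[OF vertex_moduleD(2)[OF vmL]] clinear_simps[OF vertex_moduleD(3)[OF vmL]])
  then have "X f1 1 (YL Gm 0 v \<otimes>\<^sub>C vacS \<otimes>\<^sub>C E (m\<^sub>1 - 1))
      = (3 * x^2 + 3 / 2 * (k + 1) * x - (k + 3) * (y + x / 2)) *\<^sub>C (v \<otimes>\<^sub>C vacS \<otimes>\<^sub>C E (m\<^sub>1 - 1))"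
    by (subst f1_mode1) (simp_all add: vacS Gp_Gm \<open>m\<^sub>1 - 1 \<in> Lam\<close>)
  moreover have "X f1 1 (v \<otimes>\<^sub>C \<gamma> \<otimes>\<^sub>C E m\<^sub>1) = (m\<^sub>1 - k - 1 - 2 * x) *\<^sub>C (v \<otimes>\<^sub>C vacS \<otimes>\<^sub>C E (m\<^sub>1 - 1))"
    by (subst f1_mode1) (simp_all add: hw_vector g l cscale_cscale flip: cvec.scale_left_diff_distrib)
  moreover have "m\<^sub>1 - k - 1 - 2 * x = of_nat a - k - 1" by (simp add: x m1 field_simps)
  ultimately have "X f1 1 (X f2 0 w0) = 0"
    unfolding f2_mode0
    by (simp only: X_simps sl3_basis cscale_cscale cscale_left_distrib[symmetric] w0_relation cvec.scale_zero_left)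
  moreover have "X f1 1 w0 = 0"
    unfolding w0_def by (subst f1_mode1) (simp_all add: hw_vector vacS l)
  ultimately have "X f3 1 w0 = 0"
    using rel[of f2 f1 0 1 w0] by (simp add: X_simps)
  moreover have "X h1 0 w0 = of_nat a *\<^sub>C w0" "X h2 0 w0 = of_nat b *\<^sub>C w0"
  proof -
    have "of_nat a = m\<^sub>1 - 2 * x" "of_nat b = m\<^sub>1 + x" by (simp_all add: x m1 field_simps)
    then show "X h1 0 w0 = of_nat a *\<^sub>C w0" "X h2 0 w0 = of_nat b *\<^sub>C w0"
      unfolding slot_operators w0_def
      by (simp_all add: hw_vector vacS Q_facts l cscale_cscale cscale_left_distrib cvec.scale_left_diff_distrib)
  qed
  moreover have "X e2 0 w0 = 0" unfolding slot_operators w0_def by (simp add: vacS)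
  ultimately show ?thesis unfolding singular_def by (simp add: e1_mode0)
qed

end

section \<open>Operators preserving the integrable part\<close>

context affine_module
begin

text \<open>The vectors \<open>T s u\<close>, with \<open>s\<close> in a set stable under
  \<open>ad\<close> and \<open>u\<close> in the orbit of \<open>w\<close>, span an invariant space,
  and finitely many \<open>s\<close> suffice to make it finite-dimensional. It is applied to the
  modes of the currents, with the adjoint action, and to the modes of the elements of an
  \<open>sl3\<close>-orbit in \<open>V\<^sup>k\<close>.\<close>

lemma integrable_operator:
  assumes T: "\<And>s. s \<in> S \<Longrightarrow> clinear (T s)" "\<And>s. s \<in> F \<Longrightarrow> clinear (T s)"
    and F: "finite F" "\<And>s u. s \<in> S \<Longrightarrow> T s u \<in> cvec.span ((\<lambda>s. T s u) ` F)"
    and S: "\<And>A s. A \<in> sl3 \<Longrightarrow> s \<in> S \<Longrightarrow> ad A s \<in> S"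
    and rel: "\<And>A s u. A \<in> sl3 \<Longrightarrow> s \<in> S \<Longrightarrow> X A 0 (T s u) = T s (X A 0 u) + T (ad A s) u"
    and w: "w \<in> integrable_part X" and s: "s \<in> S"
  shows "T s w \<in> integrable_part X"
proof (rule integrableI)
  obtain B where B: "finite B" "sl3_orbit X w \<subseteq> cvec.span B" using integrable_orbit[OF w] by (auto simp: fin_dim_def)
  have orb: "X A 0 u \<in> sl3_orbit X w" if "A \<in> sl3" "u \<in> sl3_orbit X w" for A u
    using sl3_orbit_invariant[of w] that by (auto simp: sl3_invariant_def)
  let ?U = "cvec.span {T s u | s u. s \<in> S \<and> u \<in> sl3_orbit X w}"
  have base: "T s u \<in> ?U" if "s \<in> S" "u \<in> sl3_orbit X w" for s u by (rule cvec.span_base) (use that in blast)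
  have "X A 0 u \<in> ?U" if A: "A \<in> sl3" and u: "u \<in> ?U" for A u
  proof (rule clinear_maps_span[OF X_linear[OF A] cvec.subspace_span _ u])
    fix r assume "r \<in> {T s u | s u. s \<in> S \<and> u \<in> sl3_orbit X w}"
    then obtain s u where "r = T s u" "s \<in> S" "u \<in> sl3_orbit X w" by blast
    then show "X A 0 r \<in> ?U" using A by (simp add: rel cvec.span_add base orb S)
  qed
  then show "sl3_invariant X ?U" by (simp add: sl3_invariant_def)
  show "T s w \<in> ?U" by (rule base[OF s sl3_orbit_base])
  have "T f u \<in> cvec.span ((\<lambda>(f, b). T f b) ` (F \<times> B))" if "f \<in> F" "u \<in> cvec.span B" for f u
    by (rule clinear_maps_span[OF T(2)[OF that(1)] cvec.subspace_span _ that(2)]) (use that(1) in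
        \<open>auto intro: cvec.span_base\<close>)
  then have "(\<lambda>f. T f u) ` F \<subseteq> cvec.span ((\<lambda>(f, b). T f b) ` (F \<times> B))" if "u \<in> cvec.span B" for u using that by blast
  then have "T s u \<in> cvec.span ((\<lambda>(f, b). T f b) ` (F \<times> B))" if "s \<in> S" "u \<in> sl3_orbit X w" for s u
    using F(2)[OF that(1), of u] cvec.span_minimal[OF _ cvec.subspace_span] that B(2) by blast
  then have "?U \<subseteq> cvec.span ((\<lambda>(f, b). T f b) ` (F \<times> B))" by (intro cvec.span_minimal cvec.subspace_span) blast
  then show "fin_dim ?U" unfolding fin_dim_def using F(1) B(1) by (intro exI[of _ "(\<lambda>(f, b). T f b) ` (F \<times> B)"]) simp
qed

lemma integrable_subspace: "cvec.subspace (integrable_part X)"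
  unfolding cvec.subspace_def
proof (intro conjI ballI allI)
  have orb: "cvec.subspace (sl3_orbit X w)" "A \<in> sl3 \<Longrightarrow> u \<in> sl3_orbit X w \<Longrightarrow> X A 0 u \<in> sl3_orbit X w" for A u w
    using sl3_orbit_invariant[of w] by (auto simp: sl3_invariant_def)
  show "0 \<in> integrable_part X"
    by (rule integrableI[of "{0}"]) (auto simp: sl3_invariant_def cvec.subspace_def X_simps fin_dim_def intro: exI[of
        _ "{}"])
  show "u + w \<in> integrable_part X" if u: "u \<in> integrable_part X" and w: "w \<in> integrable_part X" for u w
  proof (rule integrableI)
    let ?U = "{p + q | p q. p \<in> sl3_orbit X u \<and> q \<in> sl3_orbit X w}"
    have "X A 0 r \<in> ?U" if A: "A \<in> sl3" and r: "r \<in> ?U" for A r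
    proof -
      obtain p q where "r = p + q" "p \<in> sl3_orbit X u" "q \<in> sl3_orbit X w" using r by blast
      then have "X A 0 r = X A 0 p + X A 0 q" "X A 0 p \<in> sl3_orbit X u" "X A 0 q \<in> sl3_orbit X w"
        using A orb(2) by (simp_all add: X_simps)
      then show ?thesis by blast
    qed
    then show "sl3_invariant X ?U" using cvec.subspace_sums[OF orb(1) orb(1)] by (auto simp: sl3_invariant_def)
    show "u + w \<in> ?U" using sl3_orbit_base by blast
    obtain B1 B2 where "finite B1" "sl3_orbit X u \<subseteq> cvec.span B1" "finite B2" "sl3_orbit X w \<subseteq> cvec.span B2"
      using integrable_orbit[OF u] integrable_orbit[OF w] by (auto simp: fin_dim_def)
    then have "finite (B1 \<union> B2)" "?U \<subseteq> cvec.span (B1 \<union> B2)" unfolding cvec.span_Un by auto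
    then show "fin_dim ?U" unfolding fin_dim_def by blast
  qed
  show "z *\<^sub>C u \<in> integrable_part X" if u: "u \<in> integrable_part X" for z u
    by (rule integrableI[OF sl3_orbit_invariant _ integrable_orbit[OF u]]) (rule cvec.subspace_scale[OF orb(1)
        sl3_orbit_base])
qed

lemma integrable_invariant: "affine_invariant X (integrable_part X)"
  unfolding affine_invariant_def
proof (intro conjI ballI allI)
  fix A n u assume A: "A \<in> sl3" and u: "u \<in> integrable_part X"
  have rel: "X B 0 (X C n w) = X C n (X B 0 w) + X (commutator B C) n w" if "B \<in> sl3" "C \<in> sl3" for B C w
    using rel[OF that, of 0 n w] by simp
  show "X A n u \<in> integrable_part X"
  proof (rule integrable_operator[where S = sl3 and F = "{e1, e2, e3, h1, h2, f1, f2, f3}" and T = "\<lambda>A. X A n" and ad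
      = commutator])
    show "X B n w \<in> cvec.span ((\<lambda>s. X s n w) ` {e1, e2, e3, h1, h2, f1, f2, f3})" if "B \<in> sl3" for B w
      by (subst X_expand[OF that]) (intro cvec.span_add cvec.span_scale cvec.span_base; simp)
  qed (use A u rel X_linear in auto)
qed (rule integrable_subspace)

lemma smooth_vectors_invariant: "affine_invariant X {u. \<forall>A\<in>sl3. \<exists>N. \<forall>n\<ge>N. X A n u = 0}" (is "affine_invariant X ?S")
  unfolding affine_invariant_def
proof (intro conjI ballI allI)
  show "cvec.subspace ?S"
    unfolding cvec.subspace_def
  proof (intro conjI ballI allI)
    show "0 \<in> ?S" by (simp add: X_simps)
    show "u + w \<in> ?S" if u: "u \<in> ?S" and w: "w \<in> ?S" for u w
    proof (intro CollectI ballI)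
      fix A assume A: "A \<in> sl3"
      obtain N1 N2 where "\<And>n. n \<ge> N1 \<Longrightarrow> X A n u = 0" "\<And>n. n \<ge> N2 \<Longrightarrow> X A n w = 0" using A u w by blast
      then have "\<forall>n\<ge>max N1 N2. X A n (u + w) = 0" using A by (simp add: X_simps)
      then show "\<exists>N. \<forall>n\<ge>N. X A n (u + w) = 0" by blast
    qed
    show "z *\<^sub>C u \<in> ?S" if u: "u \<in> ?S" for z u
    proof (intro CollectI ballI)
      fix A assume A: "A \<in> sl3"
      obtain N1 where "\<And>n. n \<ge> N1 \<Longrightarrow> X A n u = 0" using A u by blast
      then have "\<forall>n\<ge>N1. X A n (z *\<^sub>C u) = 0" using A by (simp add: X_simps)
      then show "\<exists>N. \<forall>n\<ge>N. X A n (z *\<^sub>C u) = 0" by blast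
    qed
  qed
  fix B m u assume B: "B \<in> sl3" and u: "u \<in> ?S"
  show "X B m u \<in> ?S"
  proof (intro CollectI ballI)
    fix A assume A: "A \<in> sl3"
    obtain N1 where N1: "\<And>n. n \<ge> N1 \<Longrightarrow> X A n u = 0" using A u by blast
    obtain N2 where N2: "\<And>n. n \<ge> N2 \<Longrightarrow> X (commutator A B) n u = 0" using A B u sl3_closed(6) by blast
    have "X A n (X B m u) = 0" if "n \<ge> max (max N1 (N2 - m)) (1 - m)" for n
      using that B by (simp add: rel[OF A B] N1 N2 X_simps)
    then show "\<exists>N. \<forall>n\<ge>N. X A n (X B m u) = 0" by blast
  qed
qed

end

text \<open>Smoothness is not part of \<open>is_Lk_sl3\<close> but follows from it: the smooth
  vectors form an affine submodule containing the top component, so irreducibility makes them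
  everything.\<close>

lemma is_Lk_singular:
  assumes X: "is_Lk_sl3 k a b X"
  obtains v where "smooth_affine k X" "affine_module.singular X a b v" "v \<noteq> 0"
proof -
  interpret affine_module k X using X by unfold_locales (simp add: is_Lk_sl3_def)
  obtain v where v: "v \<in> top_component X" "v \<noteq> 0" "X e1 0 v = 0" "X e2 0 v = 0" "X h1 0 v = a *\<^sub>C v" "X h2 0 v = b *\<^sub>C v"
    using X unfolding is_Lk_sl3_def sl3_irreducible_hw_def by blast
  have top: "A \<in> sl3 \<Longrightarrow> n \<ge> 1 \<Longrightarrow> X A n v = 0" for A n using v(1) by (simp add: top_component_def)
  then have "v \<in> {u. \<forall>A\<in>sl3. \<exists>N. \<forall>n\<ge>N. X A n u = 0}" by blast
  then have "{u. \<forall>A\<in>sl3. \<exists>N. \<forall>n\<ge>N. X A n u = 0} = UNIV"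
    using X smooth_vectors_invariant v(2) unfolding is_Lk_sl3_def by blast
  then have "smooth_affine k X" by unfold_locales blast
  moreover have "singular a b v" unfolding singular_def using v top by simp
  ultimately show ?thesis using v(2) by (rule that)
qed

context bp_setting
begin

subsection \<open>The integrable part is a module over the affine vertex algebra\<close>

lemma V_affine: "affine_module k (\<lambda>A. YV (\<iota> A))"
proof
  have vm: "vertex_module vacV YV YV" using V by (simp add: universal_affine_sl3_def vertex_algebra_def)
  note lin = clinear_simps[OF vertex_moduleD(3)[OF vm]]
  show "affine_sl3_module k (\<lambda>A. YV (\<iota> A))"
    unfolding affine_sl3_module_def
  proof (intro conjI ballI allI)
    show "clinear (YV (\<iota> A) n)" for A n by (rule vertex_moduleD(2)[OF vm])
    show "linear_on sl3 (\<lambda>A. YV (\<iota> A) n u)" for n u using iota(1) lin by (simp add: linear_on_def)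
    show "YV (\<iota> A) m (YV (\<iota> B) n u) - YV (\<iota> B) n (YV (\<iota> A) m u) =
          YV (\<iota> (commutator A B)) (m + n) u +
          (if m + n = 0 then (of_int m * k * trace (A ** B)) *\<^sub>C u else 0)" if AB: "A \<in> sl3" "B \<in> sl3" for A B m n u
      using vm_commutator_ope[OF vm iota(2)[OF AB], of m n u]
      by (simp add: lin vertex_moduleD(5)[OF vm] cscale_one cscale_cscale mult.assoc add.commute)
  qed
qed

text \<open>Zero modes annihilate the vacuum and the modes of currents preserve integrability, so
  induction over the PBW words covers all of \<open>V\<^sup>k\<close>.\<close>

lemma V_integrable: "u \<in> integrable_part (\<lambda>A. YV (\<iota> A))"
proof -
  interpret V: affine_module k "\<lambda>A. YV (\<iota> A)" by (rule V_affine)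
  have vac: "YV u n vacV = 0" if "n \<ge> 0" for u n
    using V that by (auto simp: universal_affine_sl3_def vertex_algebra_def)
  show ?thesis
  proof (rule pbw_induct[OF pbw_facts(4) V.integrable_subspace])
    show "vacV \<in> integrable_part (\<lambda>A. YV (\<iota> A))"
    proof (rule V.integrableI)
      have "YV (\<iota> A) 0 u = 0" if "u \<in> cvec.span {vacV}" "A \<in> sl3" for A u
        using that by (auto simp: cvec.span_singleton vac clinear_scale[OF V.X_linear])
      then show "sl3_invariant (\<lambda>A. YV (\<iota> A)) (cvec.span {vacV})" by (simp add: sl3_invariant_def cvec.span_zero)
      show "vacV \<in> cvec.span {vacV}" by (rule cvec.span_base) simp
    qed (simp add: fin_dim_span)
    fix g n w assume g: "g \<in> set (map \<iota> [e1, e2, e3, h1, h2, f1, f2, f3])" and w: "w \<in> integrable_part (\<lambda>A. YV (\<iota> A))"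
    then obtain A where "g = \<iota> A" "A \<in> sl3" by auto
    then show "YV g (- int n - 1) w \<in> integrable_part (\<lambda>A. YV (\<iota> A))"
      using V.integrable_invariant w by (simp add: affine_invariant_def)
  qed
qed

text \<open>The orbit of \<open>u\<close> in \<open>V\<^sup>k\<close> is finite-dimensional, and the
  commutator with a zero mode has only the term \<open>j = 0\<close>. So every mode of every
  \<open>u\<close>, not just of a current, is an operator as in
  \<open>integrable_operator\<close>.\<close>

lemma integrable_submodule: "submodule act (integrable_part X)"
  unfolding submodule_def
proof (intro conjI ballI allI)
  fix u n w assume w: "w \<in> integrable_part X"
  interpret V: affine_module k "\<lambda>A. YV (\<iota> A)" by (rule V_affine)
  obtain B where B: "finite B" "sl3_orbit (\<lambda>A. YV (\<iota> A)) u \<subseteq> cvec.span B"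
    using V.integrable_orbit[OF V_integrable[of u]] by (auto simp: fin_dim_def)
  show "act u n w \<in> integrable_part X"
  proof (rule integrable_operator[where S = "sl3_orbit (\<lambda>A. YV (\<iota> A)) u" and F = B and T = "\<lambda>u. act u n" and ad =
      "\<lambda>A. YV (\<iota> A) 0"])
    show "act s n r \<in> cvec.span ((\<lambda>s. act s n r) ` B)" if "s \<in> sl3_orbit (\<lambda>A. YV (\<iota> A)) u" for s r
      by (rule clinear_maps_span[OF act_linear(2) cvec.subspace_span _ subsetD[OF B(2) that]]) (auto intro: cvec.span_base)
    show "YV (\<iota> A) 0 s \<in> sl3_orbit (\<lambda>A. YV (\<iota> A)) u" if "A \<in> sl3" "s \<in> sl3_orbit (\<lambda>A. YV (\<iota> A)) u" for A s
      using V.sl3_orbit_invariant[of u] that by (simp add: sl3_invariant_def)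
    show "X A 0 (act s n r) = act s n (X A 0 r) + act (YV (\<iota> A) 0 s) n r" for A s r
    proof -
      have "X A 0 (act s n r) - act s n (X A 0 r) = act (YV (\<iota> A) 0 s) n r"
        unfolding X_def act_commutator by (subst Sum_any_single[of 0]) (auto simp: cscale_one gr0_conv_Suc)
      then show ?thesis by (simp add: diff_eq_eq add.commute)
    qed
  qed (use w B(1) V.sl3_orbit_base act_linear in auto)
qed (rule integrable_subspace)

section \<open>Identification of the generated submodule and the integrable part\<close>

lemma aff_gen_RC: "aff_gen w0 \<subseteq> RC"
proof -
  have "{u. \<exists>i j l. fword w0 i j l u} \<subseteq> RC"
  proof (intro subsetI, elim CollectE exE)
    fix u i j l assume u: "fword w0 i j l u"
    have "X h1 0 u = (of_nat a + of_nat i - 2 * of_nat j + of_nat l) *\<^sub>C u"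
      by (rule fword_h1[OF u]) (use w0_singular in \<open>simp add: singular_def\<close>)
    then have "X h1 0 u = of_int (int a + int i - 2 * int j + int l) *\<^sub>C u" by simp
    then show "u \<in> RC" by (rule integral_weight_RC)
  qed
  then show ?thesis using aff_gen_fwords[OF w0_singular] cvec.span_minimal[of _ RC] unfolding RC_def by blast
qed

text \<open>An integrable vector is a sum of integrable \<open>h1\<close>-eigenvectors; their
  weights are integers, and this singles out the coset of \<open>m\<^sub>1\<close>.\<close>

lemma integrable_RC: "integrable_part X \<subseteq> RC"
proof
  fix u assume u: "u \<in> integrable_part X"
  have "X h1 0 ` integrable_part X \<subseteq> integrable_part X"
    using integrable_invariant by (auto simp: affine_invariant_def)
  then obtain \<Lambda> f where f: "u = (\<Sum>l\<in>\<Lambda>. f l)" "\<And>l. X h1 0 (f l) = l *\<^sub>C f l" "\<And>l. f l \<in> integrable_part X"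
    by (rule diagonal_components[OF X_linear[OF sl3_basis(4)] R_diagonal(1) integrable_subspace _ u]) blast
  have "f l \<in> RC" for l
  proof (cases "f l = 0")
    case True
    then show ?thesis by (simp add: RC_def cvec.span_zero)
  next
    case False
    then obtain m :: int where "l = of_int m" using integrable_h1_integral[OF f(3,2)] by blast
    then show ?thesis using integral_weight_RC f(2)[of l] by simp
  qed
  then show "u \<in> RC" unfolding f(1) RC_def by (intro cvec.span_sum)
qed

lemma w0_nonzero: "w0 \<noteq> 0"
  unfolding w0_def using m1_Cos(2) hw_vector(6) by (rule vac_E_nonzero)

lemma w0_irreducible:
  assumes "affine_invariant X N" "N \<subseteq> aff_gen w0" shows "N = {0} \<or> N = aff_gen w0"
proof (rule hw_irreducible[OF k(2) w0_singular _ assms])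
  fix N assume N: "affine_invariant X N" "N \<subseteq> aff_gen w0" "N \<noteq> {0}"
  then obtain t where "t \<in> N" "t \<noteq> 0" using cvec.subspace_0 by (auto simp: affine_invariant_def)
  then show "\<exists>n. (xop ^^ n) w0 \<in> N"
    using localized_generator(1)[OF N(1)] N(2) aff_gen_RC unfolding w0_def by blast
qed

lemma integrable_part_eq: "integrable_part X = aff_gen w0"
proof
  have w0: "w0 \<in> integrable_part X" by (rule hw_integrable[OF k(1) w0_singular w0_nonzero w0_irreducible])
  then show "aff_gen w0 \<subseteq> integrable_part X" by (rule aff_gen_minimal[OF integrable_invariant])
  show "integrable_part X \<subseteq> aff_gen w0"
  proof (rule integrable_part_generated[OF k(2) w0_singular integrable_invariant _ xop_injective R_diagonal(2)])
    fix u assume "u \<in> integrable_part X"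
    then have "u \<in> RC" using integrable_RC by blast
    moreover have "w0 \<in> RC" using aff_gen_RC aff_gen_base by blast
    ultimately show "\<exists>n. (xop ^^ n) u \<in> aff_gen w0"
      by (intro localized_generator(2)[OF aff_gen_invariant aff_gen_base w0_nonzero])
  qed
qed

text \<open>Stability of \<open>aff_gen w0\<close> under the modes of arbitrary elements of
  \<open>V\<^sup>k\<close> is inherited from the integrable part, with which it coincides.\<close>

lemma generated_eq: "generated_submodule act w0 = aff_gen w0"
proof
  show "generated_submodule act w0 \<subseteq> aff_gen w0"
    using generated_submodule_closed(1)[OF integrable_submodule, of w0] aff_gen_base unfolding integrable_part_eq by blast
  have "affine_invariant X (generated_submodule act w0)"
    unfolding affine_invariant_def X_def by (intro conjI ballI allI generated_submodule_closed)
  then show "aff_gen w0 \<subseteq> generated_submodule act w0" using generated_submodule_closed(2) by (rule aff_gen_minimal)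
qed

lemma realization:
  assumes X': "is_Lk_sl3 k (of_nat a) (of_nat b) X'"
  shows "generated_submodule act (v \<otimes>\<^sub>C vacS \<otimes>\<^sub>C E m\<^sub>1)
           \<subseteq> cvec.span {u \<otimes>\<^sub>C s \<otimes>\<^sub>C q | u s q. q \<in> generated_submodule YQ (E m\<^sub>1)}
       \<and> affine_sl3_iso (\<lambda>A. act (\<iota> A)) (generated_submodule act (v \<otimes>\<^sub>C vacS \<otimes>\<^sub>C E m\<^sub>1)) X'
       \<and> affine_sl3_iso (\<lambda>A. act (\<iota> A)) (integrable_part (\<lambda>A. act (\<iota> A))) X'"
proof -
  have X: "(\<lambda>A. act (\<iota> A)) = X" by (intro ext) (simp add: X_def)
  obtain v' where v': "smooth_affine k X'" "affine_module.singular X' (of_nat a) (of_nat b) v'" "v' \<noteq> 0"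
    by (rule is_Lk_singular[OF X'])
  have irr': "\<And>N. affine_invariant X' N \<Longrightarrow> N = {0} \<or> N = UNIV" using X' by (simp add: is_Lk_sl3_def)
  have "affine_sl3_iso X (aff_gen w0) X'"
    by (rule irreducible_hw_unique[OF smooth_affine_X v'(1) k(1) w0_singular w0_nonzero w0_irreducible v'(2,3) irr'])
  then show ?thesis
    unfolding X w0_def[symmetric] integrable_part_eq generated_eq using aff_gen_RC RC_generated by blast
qed

end

text \<open>Since \<open>3 m\<^sub>1 = a + 2b\<close> is an integer,
  \<open>L[x,y] \<otimes> S\<^sub>0(m\<^sub>1)\<close> is a summand of
  \<open>L[x,y] \<otimes> S \<otimes> \<Pi>(0)^(1/3)\<close>, so a single action serves both parts;
  the inclusion expresses that the generated submodule stays in this summand.\<close>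

theorem theorem6p3:
  fixes k x y m\<^sub>1 :: complex and a b :: nat
    and vacW :: "'w::cvec" and YW and J Gp Gm L :: 'w
    and YL :: "'w \<Rightarrow> int \<Rightarrow> 'l::cvec \<Rightarrow> 'l" and v :: 'l
    and vacS :: "'s::cvec" and YS and \<beta> \<gamma> :: 's
    and vacP :: "'p::cvec" and YP and c d :: 'p and e :: "int \<Rightarrow> 'p"
    and YQ :: "'p \<Rightarrow> int \<Rightarrow> 'q::cvec \<Rightarrow> 'q" and E :: "complex \<Rightarrow> 'q"
    and vacV :: "'v::cvec" and YV and \<iota> :: "complex^3^3 \<Rightarrow> 'v"
    and \<phi> :: "'v \<Rightarrow> ('w, ('s, 'p) ctensor) ctensor"
    and act :: "'v \<Rightarrow> int \<Rightarrow> ('l, ('s, 'q) ctensor) ctensor \<Rightarrow> ('l, ('s, 'q) ctensor) ctensor"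
    and X :: "complex^3^3 \<Rightarrow> int \<Rightarrow> 'm::cvec \<Rightarrow> 'm"
  assumes "k \<noteq> - 3" and "k \<notin> \<nat>"
    and "x = (of_nat b - of_nat a) / 3"
    and "y = ((of_nat b - of_nat a)^2
               - 3 * (of_nat a + of_nat b) * (2 * (k + 1) - of_nat a - of_nat b)) / (12 * (k + 3))
             - (of_nat b - of_nat a) / 6"
    and "m\<^sub>1 = (of_nat a + 2 * of_nat b) / 3"
    and "universal_BP k vacW YW J Gp Gm L"
    and "BP_irreducible_hw_module vacW YW J Gp Gm L YL v x y"
    and "beta_gamma_algebra vacS YS \<beta> \<gamma>"
    and "Pi0_algebra vacP YP c d e"
    and "Pi0_third vacP YP c d e YQ E"
    and "universal_affine_sl3 k vacV YV \<iota>"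
    and "BP_affine_embedding k vacW YW J Gp Gm vacS YS \<beta> \<gamma> vacP YP c d e vacV YV \<iota> \<phi>"
    and "act = (\<lambda>u. tensor_action YL (tensor_action YS YQ) (\<phi> u))"
    and "is_Lk_sl3 k (of_nat a) (of_nat b) X"
  shows "generated_submodule act (v \<otimes>\<^sub>C vacS \<otimes>\<^sub>C E m\<^sub>1)
           \<subseteq> cvec.span {u \<otimes>\<^sub>C s \<otimes>\<^sub>C q | u s q. q \<in> generated_submodule YQ (E m\<^sub>1)}
       \<and> affine_sl3_iso (\<lambda>A. act (\<iota> A)) (generated_submodule act (v \<otimes>\<^sub>C vacS \<otimes>\<^sub>C E m\<^sub>1)) X
       \<and> affine_sl3_iso (\<lambda>A. act (\<iota> A)) (integrable_part (\<lambda>A. act (\<iota> A))) X"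
  using bp_setting.realization[OF bp_setting.intro[OF assms(1-13)] assms(14)] .

end
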